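(* Let $R(z):=Y_N(z)\begin{pmatrix}1&0\\0&0\end{pmatrix}Y_N^{-1}(z)$ for $z\in\mathbb C\setminus I$. Then, for $z,z_1,z_2,\dots\in\mathbb C\setminus I$ (with the $z_i$ pairwise distinct), the connected cumulant functions of the measure $\mathrm dm_N(X)=\frac1{C_N}\exp\mathrm{tr}\,V(X)\,\mathrm dX$ are given by $$\mathscr C_1^{\sf c}(z)=\left(Y_N^{-1}(z)Y_N'(z)\right)_{1,1},$$ $$\mathscr C_2^{\sf c}(z_1,z_2)=\frac{\mathrm{tr}\left(R(z_1)R(z_2)\right)-1}{(z_1-z_2)^2},$$ $$\mathscr C_\ell^{\sf c}(z_1,\dots,z_\ell)=-\sum_{(i_1,\dots,i_\ell)\in\mathrm{cyc}((\ell))}\frac{\mathrm{tr}\left(R(z_{i_1})\cdots R(z_{i_\ell})\right)}{(z_{i_1}-z_{i_2})(z_{i_2}-z_{i_3})\cdots(z_{i_\ell}-z_{i_1})},\qquad \ell\ge3,$$ where prime denotes $\mathrm d/\mathrm dz$ and $\mathrm{cyc}((\ell))$ is the set of the $(\ell-1)!$ $\ell$-cycles $(i_1,\dots,i_\ell)$ in the symmetric group $\mathfrak S_\ell$.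
   Context: $I\subseteq\mathbb R$ is a closed interval with interior $I^\circ$, $N\ge1$, and $\mathcal H_N(I)$ is the set of $N\times N$ hermitian matrices with eigenvalues in $I$, with Lebesgue measure $\mathrm dX=\prod_i\mathrm dX_{ii}\prod_{i<j}\mathrm d\,\mathrm{Re}X_{ij}\,\mathrm d\,\mathrm{Im}X_{ij}$. $V$ is a smooth function on $I^\circ$ with $\exp V(x)=O(|x-x_0|^{-1+\varepsilon})$ for some $\varepsilon>0$ as $x\in I^\circ$ approaches any finite endpoint $x_0$ of $I$; if $I$ is unbounded, $V(x)\to-\infty$ as $x\to\pm\infty$ fast enough that the measure $\mathrm dm_N(X)=\frac1{C_N}\exp\mathrm{tr}\,V(X)\,\mathrm dX$, $C_N=\int_{\mathcal H_N(I)}\exp\mathrm{tr}\,V(X)\,\mathrm dX$, has finite moments of all orders, so that the orthogonal polynomials below exist. Monic orthogonal polynomials $P_\ell(z)=z^\ell+\cdots$ are defined by $\int_IP_\ell(x)P_m(x)\mathrm e^{V(x)}\mathrm dx=h_\ell\delta_{\ell,m}$ (with $h_\ell\neq 0$), and $$Y_N(z)=\begin{pmatrix}P_N(z)&\frac1{2\pi\mathrm i}\int_IP_N(x)\mathrm e^{V(x)}\frac{\mathrm dx}{x-z}\\-\frac{2\pi\mathrm i}{h_{N-1}}P_{N-1}(z)&-\frac1{h_{N-1}}\int_IP_{N-1}(x)\mathrm e^{V(x)}\frac{\mathrm dx}{x-z}\end{pmatrix},\quad z\in\mathbb C\setminus I.$$ Cumulant functions: $\mathscr C_\ell(z_1,\dots,z_\ell)=\int_{\mathcal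 H_N(I)}\prod_{i=1}^\ell\mathrm{tr}[(z_i-X)^{-1}]\,\mathrm dm_N(X)$ for $z_i\in\mathbb C\setminus I$. Connected cumulant functions: $\mathscr C_\ell^{\sf c}(z_1,\dots,z_\ell)=\sum_{\mathcal P}(-1)^{|\mathcal P|-1}(|\mathcal P|-1)!\prod_{A\in\mathcal P}\mathscr C_{|A|}(\{z_a\}_{a\in A})$, the sum running over set partitions $\mathcal P$ of $\{1,\dots,\ell\}$. *)

theory Defs
  imports
    "HOL-Analysis.Analysis"
    "HOL-Library.Landau_Symbols"
    "HOL-Library.Disjoint_Sets"
    "HOL-Combinatorics.Cycles"
    "Jordan_Normal_Form.Schur_Decomposition"
    "Jordan_Normal_Form.Gauss_Jordan_Elimination"
    "Jordan_Normal_Form.Spectral_Radius"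
begin

definition mat_trace :: "complex mat \<Rightarrow> complex" where
  "mat_trace A = (\<Sum>i<dim_row A. A $$ (i, i))"

definition mat_inv :: "complex mat \<Rightarrow> complex mat" where
  "mat_inv A = the (mat_inverse A)"

definition mat_prod_list :: "nat \<Rightarrow> complex mat list \<Rightarrow> complex mat" where
  "mat_prod_list n As = foldr (*) As (1\<^sub>m n)"

definition hermitian_mats :: "nat \<Rightarrow> real set \<Rightarrow> complex mat set" where
  "hermitian_mats N I =
     {X \<in> carrier_mat N N. mat_adjoint X = X \<and> spectrum X \<subseteq> complex_of_real ` I}"

text \<open>
  The hermitian matrix with real coordinates \<open>x\<close>: on the diagonal \<open>x (i, i) = X\<^sub>i\<^sub>i\<close>, and for
  \<open>i < j\<close> the entries \<open>x (i, j)\<close> and \<open>x (j, i)\<close> are the real and imaginary parts of \<open>X\<^sub>i\<^sub>j\<close>.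
\<close>

definition herm_of_coords :: "nat \<Rightarrow> (nat \<times> nat \<Rightarrow> real) \<Rightarrow> complex mat" where
  "herm_of_coords N x = Matrix.mat N N (\<lambda>(i, j).
     if i = j then complex_of_real (x (i, i))
     else if i < j then Complex (x (i, j)) (x (j, i))
     else Complex (x (j, i)) (- x (i, j)))"

text \<open>
  The map \<open>herm_of_coords N\<close> is a bijection from the space of the product measure onto the
  hermitian \<open>N \<times> N\<close> matrices, so the measure embedding transports both the Borel sets and
  the Lebesgue measure.
\<close>

definition herm_lebesgue :: "nat \<Rightarrow> complex mat measure" where
  "herm_lebesgue N =
     embed_measure (Pi\<^sub>M ({..<N} \<times> {..<N}) (\<lambda>_. lborel)) (herm_of_coords N)"

definition herm_lebesgue_on :: "nat \<Rightarrow> real set \<Rightarrow> complex mat measure" where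
  "herm_lebesgue_on N I = restrict_space (herm_lebesgue N) (hermitian_mats N I)"

text \<open>
  Functional calculus: \<open>V (U diag(d) U\<^sup>*) = U diag(V d) U\<^sup>*\<close> for unitary \<open>U\<close> and real \<open>d\<close>.
  The result does not depend on the diagonalisation.
\<close>

definition herm_fun :: "(real \<Rightarrow> real) \<Rightarrow> complex mat \<Rightarrow> complex mat" where
  "herm_fun V X = (THE Y. \<exists>U (d :: nat \<Rightarrow> real). let n = dim_row X in
     U \<in> carrier_mat n n \<and> U * mat_adjoint U = 1\<^sub>m n \<and> mat_adjoint U * U = 1\<^sub>m n \<and>
     X = U * mat_diag n (\<lambda>i. complex_of_real (d i)) * mat_adjoint U \<and>
     Y = U * mat_diag n (\<lambda>i. complex_of_real (V (d i))) * mat_adjoint U)"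

text \<open>The trace of the hermitian matrix \<open>V X\<close> is real, so nothing is lost by taking \<open>Re\<close>.\<close>

definition exp_tr :: "(real \<Rightarrow> real) \<Rightarrow> complex mat \<Rightarrow> real" where
  "exp_tr V X = exp (Re (mat_trace (herm_fun V X)))"

definition partition_const :: "nat \<Rightarrow> real set \<Rightarrow> (real \<Rightarrow> real) \<Rightarrow> real" where
  "partition_const N I V = (LINT X|herm_lebesgue_on N I. exp_tr V X)"

definition matrix_measure :: "nat \<Rightarrow> real set \<Rightarrow> (real \<Rightarrow> real) \<Rightarrow> complex mat measure" where
  "matrix_measure N I V =
     density (herm_lebesgue_on N I) (\<lambda>X. ennreal (exp_tr V X / partition_const N I V))"

text \<open>
  Finiteness of all moments, i.e. integrability of all monomials in the matrix entries. It is
  stated for the unnormalised measure, since \<open>partition_const\<close> has the default value \<open>0\<close> when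
  the integral diverges; the empty monomial gives the finiteness of the normalisation.
\<close>

definition finite_moments :: "nat \<Rightarrow> real set \<Rightarrow> (real \<Rightarrow> real) \<Rightarrow> bool" where
  "finite_moments N I V \<longleftrightarrow> (\<forall>ps. set ps \<subseteq> {..<N} \<times> {..<N} \<longrightarrow>
     integrable (herm_lebesgue_on N I)
       (\<lambda>X. (\<Prod>ij\<leftarrow>ps. X $$ ij) * complex_of_real (exp_tr V X)))"

text \<open>
  Only the values of \<open>V\<close> on \<open>interior I\<close> matter. For a closed interval with nonempty interior,
  \<open>frontier I\<close> is the set of its finite endpoints.
\<close>

definition admissible_potential :: "nat \<Rightarrow> real set \<Rightarrow> (real \<Rightarrow> real) \<Rightarrow> bool" where
  "admissible_potential N I V \<longleftrightarrow>
     (\<forall>k. ((deriv ^^ k) V) differentiable_on interior I) \<and>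
     (\<exists>\<epsilon>>0. \<forall>x0\<in>frontier I.
        (\<lambda>x. exp (V x)) \<in> O[at x0 within interior I](\<lambda>x. \<bar>x - x0\<bar> powr (- 1 + \<epsilon>))) \<and>
     (\<not> bdd_above I \<longrightarrow> filterlim V at_bot at_top) \<and>
     (\<not> bdd_below I \<longrightarrow> filterlim V at_bot at_bot) \<and>
     (\<not> bounded I \<longrightarrow> finite_moments N I V)"

definition monic_orthogonal_polys ::
  "real set \<Rightarrow> (real \<Rightarrow> real) \<Rightarrow> (nat \<Rightarrow> complex poly) \<Rightarrow> (nat \<Rightarrow> complex) \<Rightarrow> bool" where
  "monic_orthogonal_polys I V P h \<longleftrightarrow>
     (\<forall>l. degree (P l) = l \<and> lead_coeff (P l) = 1 \<and> h l \<noteq> 0) \<and>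
     (\<forall>l m. let f = (\<lambda>x. poly (P l) (of_real x) * poly (P m) (of_real x) * of_real (exp (V x))) in
        set_integrable lborel I f \<and> (LINT x:I|lborel. f x) = (if l = m then h l else 0))"

definition Ymat :: "nat \<Rightarrow> real set \<Rightarrow> (real \<Rightarrow> real) \<Rightarrow> (nat \<Rightarrow> complex poly) \<Rightarrow> (nat \<Rightarrow> complex)
    \<Rightarrow> complex \<Rightarrow> complex mat" where
  "Ymat N I V P h z = mat_of_rows_list 2
     [[poly (P N) z,
       1 / (2 * of_real pi * \<i>) *
         (LINT x:I|lborel. poly (P N) (of_real x) * of_real (exp (V x)) / (of_real x - z))],
      [- (2 * of_real pi * \<i>) / h (N - 1) * poly (P (N - 1)) z,
       - 1 / h (N - 1) *
         (LINT x:I|lborel. poly (P (N - 1)) (of_real x) * of_real (exp (V x)) / (of_real x - z))]]"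

definition mat_deriv :: "(complex \<Rightarrow> complex mat) \<Rightarrow> complex \<Rightarrow> complex mat" where
  "mat_deriv F z =
     Matrix.mat (dim_row (F z)) (dim_col (F z)) (\<lambda>ij. deriv (\<lambda>w. F w $$ ij) z)"

definition Rmat :: "nat \<Rightarrow> real set \<Rightarrow> (real \<Rightarrow> real) \<Rightarrow> (nat \<Rightarrow> complex poly) \<Rightarrow> (nat \<Rightarrow> complex)
    \<Rightarrow> complex \<Rightarrow> complex mat" where
  "Rmat N I V P h z =
     Ymat N I V P h z * mat_of_rows_list 2 [[1, 0], [0, 0]] * mat_inv (Ymat N I V P h z)"

definition cumulant :: "nat \<Rightarrow> real set \<Rightarrow> (real \<Rightarrow> real) \<Rightarrow> complex list \<Rightarrow> complex" where
  "cumulant N I V zs =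
     (LINT X|matrix_measure N I V. (\<Prod>z\<leftarrow>zs. mat_trace (mat_inv (z \<cdot>\<^sub>m 1\<^sub>m N - X))))"

text \<open>Positions in lists are counted from \<open>0\<close>; \<open>nths zs A\<close> is the sublist \<open>{z\<^sub>a}\<close>, \<open>a \<in> A\<close>.\<close>

definition connected_cumulant :: "nat \<Rightarrow> real set \<Rightarrow> (real \<Rightarrow> real) \<Rightarrow> complex list \<Rightarrow> complex" where
  "connected_cumulant N I V zs =
     (\<Sum>\<P> | partition_on {..<length zs} \<P>.
        (- 1) ^ (card \<P> - 1) * fact (card \<P> - 1) * (\<Prod>A\<in>\<P>. cumulant N I V (nths zs A)))"

text \<open>
  The \<open>l\<close>-cycles in the symmetric group on \<open>{0, \<dots>, l - 1}\<close>, as permutations: lists differing by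
  a rotation give the same cycle. A cycle \<open>\<sigma>\<close> is written as \<open>(i\<^sub>0, \<dots>, i\<^sub>l\<^sub>-\<^sub>1)\<close> with
  \<open>i\<^sub>k = \<sigma>\<^sup>k(0)\<close>; the summand in the theorem is invariant under rotation.
\<close>

definition full_cycles :: "nat \<Rightarrow> (nat \<Rightarrow> nat) set" where
  "full_cycles l = cycle_of_list ` {cs. distinct cs \<and> set cs = {..<l}}"

definition cycle_seq :: "nat \<Rightarrow> (nat \<Rightarrow> nat) \<Rightarrow> nat list" where
  "cycle_seq l \<sigma> = map (\<lambda>k. (\<sigma> ^^ k) 0) [0..<l]"

end

theory Submission
  imports Defs "HOL-Probability.Levy" "HOL-Probability.Distributions"
begin

text \<open>
  For eigenvalues \<open>x\<close> and \<open>\<tau>\<^sub>j = \<Sum>\<^sub>i 1 / (z\<^sub>j - x\<^sub>i)\<close>, the determinant of the matrix with diagonal \<open>\<tau>\<^sub>j\<close> and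
  off-diagonal entries \<open>1 / (z\<^sub>i - z\<^sub>j)\<close>, times a Vandermonde determinant, is a block determinant by partial
  fractions. Its average against the eigenvalue density is the determinant of \<open>W (z\<^sub>i, z\<^sub>j) / (z\<^sub>i - z\<^sub>j)\<close>,
  where, by Christoffel-Darboux, \<open>W (u, z)\<close> is the \<open>(1, 1)\<close> entry of \<open>Y\<^sup>-\<^sup>1(z) Y(u)\<close>. Expanding the
  determinants over all subsets of the points exhibits the generating function of the moments as a quotient,
  whose logarithm turns determinants into sums over cycles; the cycles of the Cauchy matrix
  \<open>1 / (z\<^sub>i - z\<^sub>j)\<close> cancel beyond length two.

  The reduction to eigenvalues avoids the Jacobian of the diagonalisation. Under a Gaussian weight, the joint
  moments of the traces of powers on the matrix side and on the eigenvalue side (with squared Vandermonde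
  factor) satisfy the same loop equations, which determine them; moment determinacy then identifies the
  symmetrised laws of the eigenvalues, and dividing by the Gaussian weight gives Weyl's integration formula.
\<close>

section \<open>Cumulants of set functions\<close>

text \<open>The product of the resolvent traces is never integrated directly. Completed by
  off-diagonal Cauchy entries it becomes, up to a diagonal conjugation and a Vandermonde factor, a
  Schur complement in a matrix whose upper rows depend on one eigenvalue each. Such a determinant is
  integrated row by row, and orthogonality makes the upper left block diagonal. The completion costs
  a known factor: in square-zero variables, one for each point, the generating function of the
  moments is multiplied by that of the minors of the bare Cauchy matrix. Its cycles of length two
  are the origin of the \<open>- 1\<close> in the second formula.

  Weyl's formula is needed only up to a constant, since the same constant occurs in
  \<open>partition_const\<close>. The Gaussian weight enters because moments determine a measure
  that has exponential moments, which the density \<open>exp (V x)\<close> need not have. Traces of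
  powers see only symmetric functions of the eigenvalues, hence the laws that are compared are sums
  over all orderings.\<close>

lemma sum_pairs_containing:
  fixes F :: "'a set \<Rightarrow> 'a set \<Rightarrow> 'b::comm_monoid_add"
  assumes "finite S"
  shows "(\<Sum>A | s \<in> A \<and> A \<subseteq> S. \<Sum>T\<in>Pow (S - A). F A T)
       = (\<Sum>U | s \<in> U \<and> U \<subseteq> S. \<Sum>A | s \<in> A \<and> A \<subseteq> U. F A (U - A))"
proof -
  have f1: "finite {A. s \<in> A \<and> A \<subseteq> S}" if "finite S" for S
    using that by (auto intro: finite_subset[of _ "Pow S"])
  have f2: "finite {A. s \<in> A \<and> A \<subseteq> U}" if "U \<subseteq> S" for U
    using that assms f1 finite_subset by blast
  show ?thesis
    using assms f1 f2
    apply (subst sum.Sigma, simp, simp)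
    apply (subst sum.Sigma, simp, simp)
    apply (rule sum.reindex_bij_witness[where i="\<lambda>(U,A). (A, U - A)" and j="\<lambda>(A,T). (A \<union> T, A)"])
    by (auto simp: Diff_Diff_Int Un_Diff) (metis DiffD2 UnE Un_Diff Diff_triv disjoint_iff Diff_iff subsetD Pow_iff)+
qed

text \<open>A partition with a marked block amounts to that block together with a partition of its
  complement. The predicate \<open>Q\<close> restricts the marked block: it is trivial when all
  blocks are counted and \<open>s \<in> U\<close> when the block through a given point is
  wanted.\<close>

lemma sum_partition_pointed:
  fixes F :: "'a set \<Rightarrow> 'a set set \<Rightarrow> 'b::comm_monoid_add"
  assumes "finite S"
  shows "(\<Sum>P | partition_on S P. \<Sum>U | U \<in> P \<and> Q U. F U (P - {U}))
       = (\<Sum>U | U \<noteq> {} \<and> U \<subseteq> S \<and> Q U. \<Sum>P | partition_on (S - U) P. F U P)"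
proof -
  have f1: "finite {P. partition_on T P}" if "T \<subseteq> S" for T
    using finitely_many_partition_on finite_subset[OF that assms] by blast
  have f2: "finite {U. U \<in> P \<and> Q U}" if "partition_on S P" for P
    using finite_elements[OF assms that] by auto
  have f3: "finite {U. U \<noteq> {} \<and> U \<subseteq> S \<and> Q U}"
    using assms by (auto intro: finite_subset[of _ "Pow S"])
  have rem: "partition_on (S - U) (P - {U})" if "partition_on S P" "U \<in> P" for P U
  proof -
    have "disjnt U (\<Union>(P - {U}))"
      using that by (auto simp: partition_on_def disjoint_def disjnt_def)
    moreover have "insert U (P - {U}) = P" using that by auto
    ultimately show ?thesis
      using partition_on_insert[of U "P - {U}" S] that by simp
  qed
  have ins: "partition_on S (insert U P)" if "partition_on (S - U) P" "U \<subseteq> S" "U \<noteq> {}" for P U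
  proof -
    have "disjnt U (\<Union>P)" using that by (auto simp: partition_on_def disjnt_def)
    then show ?thesis using partition_on_insert[of U P S] that by auto
  qed
  have nin: "U \<notin> P" if "partition_on (S - U) P" "U \<noteq> {}" for P U
    using that by (auto simp: partition_on_def)
  show ?thesis
    using f1 f2 f3
    apply (subst sum.Sigma, simp, simp)
    apply (subst sum.Sigma, simp, simp)
    apply (rule sum.reindex_bij_witness[where i="\<lambda>(U,P). (insert U P, U)" and j="\<lambda>(P,U). (U, P - {U})"])
    using nin by (auto intro: rem ins dest: partition_onD1 partition_onD3)
qed

text \<open>The coefficients of the reciprocal of the generating function of \<open>M\<close> in
  square-zero variables, when \<open>M {} = 1\<close>: the geometric series, in which
  \<open>fact (card P)\<close> counts the orderings of the blocks.\<close>

definition inverse_moments :: "('a set \<Rightarrow> 'b::{comm_ring_1,semiring_char_0}) \<Rightarrow> 'a set \<Rightarrow> 'b" where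
  "inverse_moments M T = (\<Sum>P | partition_on T P. (-1) ^ card P * fact (card P) * (\<Prod>A\<in>P. M A))"

text \<open>The coefficients of the logarithm of the same generating function; the series of the
  logarithm divides the \<open>fact (card P)\<close> orderings by \<open>card P\<close>.\<close>

definition set_cumulant :: "('a set \<Rightarrow> 'b::{comm_ring_1,semiring_char_0}) \<Rightarrow> 'a set \<Rightarrow> 'b" where
  "set_cumulant M S = (\<Sum>P | partition_on S P. (-1) ^ (card P - 1) * fact (card P - 1) * (\<Prod>A\<in>P. M A))"

lemma inverse_moments_empty: "inverse_moments M {} = 1"
  by (simp add: inverse_moments_def partition_on_empty)

lemma prod_partition_remove:
  fixes M :: "'a set \<Rightarrow> 'b::comm_ring_1"
  assumes "finite S" "partition_on S P" "U \<in> P"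
  shows "(\<Prod>A\<in>P. M A) = M U * (\<Prod>A\<in>P - {U}. M A)" "card (P - {U}) = card P - 1" "card P > 0"
  using assms finite_elements[OF assms(1,2)] by (auto simp: prod.remove card_gt_0_iff)

text \<open>A generating function times its reciprocal is \<open>1\<close>. Each partition is met
  once for each of its blocks, and \<open>card P\<close> times \<open>fact (card P - 1)\<close>
  restores the factorial with the opposite sign, which the term \<open>U = {}\<close>
  cancels.\<close>

lemma moments_inverse_moments:
  assumes "finite T" "T \<noteq> {}" "M {} = 1"
  shows "(\<Sum>U\<in>Pow T. M U * inverse_moments M (T - U)) = 0"
proof -
  have "(\<Sum>U\<in>Pow T - {{}}. M U * inverse_moments M (T - U)) =
      (\<Sum>U | U \<noteq> {} \<and> U \<subseteq> T \<and> True. \<Sum>P | partition_on (T - U) P. M U * ((-1) ^ card P * fact (card P) * (\<Prod>A\<in>P. M A)))"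
    by (intro sum.cong) (auto simp: inverse_moments_def sum_distrib_left)
  also have "\<dots> = (\<Sum>P | partition_on T P. \<Sum>U | U \<in> P \<and> True. M U * ((-1) ^ card (P - {U}) * fact (card (P - {U})) * (\<Prod>A\<in>P - {U}. M A)))"
    by (rule sum_partition_pointed[symmetric]) fact
  also have "\<dots> = (\<Sum>P | partition_on T P. - ((-1) ^ card P * fact (card P) * (\<Prod>A\<in>P. M A)))"
  proof (intro sum.cong refl)
    fix P assume "P \<in> {P. partition_on T P}"
    then have P: "partition_on T P" by simp
    have "P \<noteq> {}" using P assms(2) by (auto simp: partition_on_def)
    then have c: "card P > 0" using finite_elements[OF assms(1) P] by (simp add: card_gt_0_iff)
    have "(\<Sum>U | U \<in> P \<and> True. M U * ((-1) ^ card (P - {U}) * fact (card (P - {U})) * (\<Prod>A\<in>P - {U}. M A)))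
      = (\<Sum>U\<in>P. (-1) ^ (card P - 1) * fact (card P - 1) * (\<Prod>A\<in>P. M A))"
      by (intro sum.cong) (auto simp: prod_partition_remove[OF assms(1) P] mult_ac)
    also have "\<dots> = - ((-1) ^ card P * fact (card P) * (\<Prod>A\<in>P. M A))"
      using c by (cases "card P") (auto simp: algebra_simps)
    finally show "(\<Sum>U | U \<in> P \<and> True. M U * ((-1) ^ card (P - {U}) * fact (card (P - {U})) * (\<Prod>A\<in>P - {U}. M A))) = - ((-1) ^ card P * fact (card P) * (\<Prod>A\<in>P. M A))" .
  qed
  also have "\<dots> = - inverse_moments M T" by (simp add: inverse_moments_def sum_negf)
  finally show ?thesis
    using assms by (subst sum.remove[of _ "{}"]) auto
qed

text \<open>The derivative of a logarithm is the derivative divided by the function. The derivative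
  in the variable of \<open>s\<close> keeps the sets containing \<open>s\<close>, and exactly one
  block of each partition contains it.\<close>

lemma set_cumulant_pointed:
  assumes "finite S" "s \<in> S"
  shows "set_cumulant M S = (\<Sum>A | s \<in> A \<and> A \<subseteq> S. M A * inverse_moments M (S - A))"
proof -
  have "(\<Sum>A | s \<in> A \<and> A \<subseteq> S. M A * inverse_moments M (S - A)) =
      (\<Sum>U | U \<noteq> {} \<and> U \<subseteq> S \<and> s \<in> U. \<Sum>P | partition_on (S - U) P. M U * ((-1) ^ card P * fact (card P) * (\<Prod>A\<in>P. M A)))"
    by (intro sum.cong) (auto simp: inverse_moments_def sum_distrib_left)
  also have "\<dots> = (\<Sum>P | partition_on S P. \<Sum>U | U \<in> P \<and> s \<in> U. M U * ((-1) ^ card (P - {U}) * fact (card (P - {U})) * (\<Prod>A\<in>P - {U}. M A)))"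
    by (rule sum_partition_pointed[symmetric]) fact
  also have "\<dots> = set_cumulant M S" unfolding set_cumulant_def
  proof (intro sum.cong refl)
    fix P assume "P \<in> {P. partition_on S P}"
    then have P: "partition_on S P" by simp
    obtain U where U: "U \<in> P" "s \<in> U" using P assms by (auto simp: partition_on_def)
    have "{U. U \<in> P \<and> s \<in> U} = {U}" using P U by (auto simp: partition_on_def disjoint_def)
    then show "(\<Sum>U | U \<in> P \<and> s \<in> U. M U * ((-1) ^ card (P - {U}) * fact (card (P - {U})) * (\<Prod>A\<in>P - {U}. M A)))
      = (-1) ^ (card P - 1) * fact (card P - 1) * (\<Prod>A\<in>P. M A)"
      by (simp add: prod_partition_remove[OF assms(1) P U(1)])
  qed
  finally show ?thesis ..
qed

text \<open>The recursion says that the derivative of the generating function of \<open>M\<close> in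
  the variable of \<open>s\<close> is this function times the derivative of that of
  \<open>c\<close>; multiplication by the reciprocal isolates \<open>c S\<close>.\<close>

lemma set_cumulant_eqI:
  assumes "finite S" "s \<in> S" "M {} = 1"
    and rec: "\<And>U. s \<in> U \<Longrightarrow> U \<subseteq> S \<Longrightarrow> M U = (\<Sum>A | s \<in> A \<and> A \<subseteq> U. c A * M (U - A))"
  shows "set_cumulant M S = c S"
proof -
  have "set_cumulant M S = (\<Sum>U | s \<in> U \<and> U \<subseteq> S. \<Sum>A | s \<in> A \<and> A \<subseteq> U. c A * (M (U - A) * inverse_moments M (S - A - (U - A))))"
    unfolding set_cumulant_pointed[OF assms(1,2)]
  proof (intro sum.cong refl)
    fix U assume "U \<in> {U. s \<in> U \<and> U \<subseteq> S}"
    then have U: "s \<in> U" "U \<subseteq> S" by auto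
    have "S - A - (U - A) = S - U" if "A \<subseteq> U" for A using that by auto
    then show "M U * inverse_moments M (S - U) = (\<Sum>A | s \<in> A \<and> A \<subseteq> U. c A * (M (U - A) * inverse_moments M (S - A - (U - A))))"
      unfolding rec[OF U] sum_distrib_right by (intro sum.cong) (auto simp: mult_ac)
  qed
  \<comment> \<open>Grouped by \<open>A\<close>, the inner sums are coefficients of the product of
    the function with its reciprocal, so only \<open>A = S\<close> remains.\<close>
  also have "\<dots> = (\<Sum>A | s \<in> A \<and> A \<subseteq> S. \<Sum>T\<in>Pow (S - A). c A * (M T * inverse_moments M (S - A - T)))"
    by (rule sum_pairs_containing[symmetric]) fact
  also have "\<dots> = (\<Sum>A | s \<in> A \<and> A \<subseteq> S. c A * (if A = S then 1 else 0))"
  proof (intro sum.cong refl)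
    fix A assume "A \<in> {A. s \<in> A \<and> A \<subseteq> S}"
    then have A: "A \<subseteq> S" by auto
    show "(\<Sum>T\<in>Pow (S - A). c A * (M T * inverse_moments M (S - A - T))) = c A * (if A = S then 1 else 0)"
    proof (cases "A = S")
      case True then show ?thesis by (simp add: inverse_moments_empty assms(3))
    next
      case False
      then have "S - A \<noteq> {}" "finite (S - A)" using A assms(1) by auto
      then show ?thesis using False moments_inverse_moments[of "S - A" M] assms(3)
        by (simp flip: sum_distrib_left)
    qed
  qed
  also have "\<dots> = (\<Sum>A\<in>{S}. c A * (if A = S then 1 else 0))"
    using assms by (intro sum.mono_neutral_right) auto
  finally show ?thesis by simp
qed

text \<open>In terms of generating functions in nilpotent variables, \<open>M D\<^sub>0 = D\<close> with logarithmic derivatives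
  \<open>\<kappa>\<^sub>0\<close> and \<open>\<kappa>\<close> of \<open>D\<^sub>0\<close> and \<open>D\<close>, so that \<open>M\<close> has logarithmic derivative \<open>\<kappa> - \<kappa>\<^sub>0\<close>.\<close>

lemma quotient_recursion:
  fixes M :: "'a set \<Rightarrow> 'b::comm_ring_1"
  assumes "finite S" "s \<in> S" and D0e: "D0 {} = 1"
    and prod: "\<And>U. U \<subseteq> S \<Longrightarrow> D U = (\<Sum>T\<in>Pow U. M T * D0 (U - T))"
    and D: "\<And>U. s \<in> U \<Longrightarrow> U \<subseteq> S \<Longrightarrow> D U = (\<Sum>A | s \<in> A \<and> A \<subseteq> U. \<kappa> A * D (U - A))"
    and D0: "\<And>U. s \<in> U \<Longrightarrow> U \<subseteq> S \<Longrightarrow> D0 U = (\<Sum>A | s \<in> A \<and> A \<subseteq> U. \<kappa>0 A * D0 (U - A))"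
  shows "M S = (\<Sum>A | s \<in> A \<and> A \<subseteq> S. (\<kappa> A - \<kappa>0 A) * M (S - A))"
  using assms
proof (induction "card S" arbitrary: S rule: less_induct)
  case less
  define X where "X U = (\<Sum>A | s \<in> A \<and> A \<subseteq> U. (\<kappa> A - \<kappa>0 A) * M (U - A))" for U
  have fin: "finite {A. s \<in> A \<and> A \<subseteq> S}" 
    using less.prems(1) by (auto intro: finite_subset[of _ "Pow S"])
  have IH: "M U = X U" if "s \<in> U" "U \<subset> S" for U
  proof -
    have "finite U" using that less.prems(1) finite_subset by blast
    then show ?thesis unfolding X_def
      using less.prems that psubset_card_mono[of S U]
      by (intro less.hyps) auto
  qed
  \<comment> \<open>Stated for a general coefficient \<open>g\<close>, as it serves both for
    \<open>\<kappa>\<close> and for \<open>\<kappa>0\<close>.\<close>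
  have k: "(\<Sum>A | s \<in> A \<and> A \<subseteq> S. g A * (\<Sum>T\<in>Pow (S - A). M T * D0 (S - A - T)))
      = (\<Sum>U | s \<in> U \<and> U \<subseteq> S. (\<Sum>A | s \<in> A \<and> A \<subseteq> U. g A * M (U - A)) * D0 (S - U))" for g
  proof -
    have "(\<Sum>A | s \<in> A \<and> A \<subseteq> S. g A * (\<Sum>T\<in>Pow (S - A). M T * D0 (S - A - T)))
       = (\<Sum>A | s \<in> A \<and> A \<subseteq> S. \<Sum>T\<in>Pow (S - A). g A * (M T * D0 (S - A - T)))"
      by (simp add: sum_distrib_left)
    also have "\<dots> = (\<Sum>U | s \<in> U \<and> U \<subseteq> S. \<Sum>A | s \<in> A \<and> A \<subseteq> U. g A * (M (U - A) * D0 (S - A - (U - A))))"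
      by (rule sum_pairs_containing) fact
    also have "\<dots> = (\<Sum>U | s \<in> U \<and> U \<subseteq> S. (\<Sum>A | s \<in> A \<and> A \<subseteq> U. g A * M (U - A)) * D0 (S - U))"
    proof (intro sum.cong refl)
      fix U
      have "S - A - (U - A) = S - U" if "A \<subseteq> U" for A using that by auto
      then show "(\<Sum>A | s \<in> A \<and> A \<subseteq> U. g A * (M (U - A) * D0 (S - A - (U - A)))) = (\<Sum>A | s \<in> A \<and> A \<subseteq> U. g A * M (U - A)) * D0 (S - U)"
        unfolding sum_distrib_right by (intro sum.cong) (auto simp: mult_ac)
    qed
    finally show ?thesis .
  qed
  have "D S = (\<Sum>A | s \<in> A \<and> A \<subseteq> S. \<kappa> A * (\<Sum>T\<in>Pow (S - A). M T * D0 (S - A - T)))"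
    unfolding less.prems(5)[OF less.prems(2) order_refl]
    by (intro sum.cong refl, subst less.prems(4)) auto
  also note k[of \<kappa>]
  finally have 1: "D S = (\<Sum>U | s \<in> U \<and> U \<subseteq> S. (\<Sum>A | s \<in> A \<and> A \<subseteq> U. \<kappa> A * M (U - A)) * D0 (S - U))" .
  have "D S = (\<Sum>T\<in>{T. s \<in> T \<and> T \<subseteq> S} \<union> {T. s \<notin> T \<and> T \<subseteq> S}. M T * D0 (S - T))"
    unfolding less.prems(4)[OF order_refl] by (intro sum.cong) auto
  also have "\<dots> = (\<Sum>T | s \<in> T \<and> T \<subseteq> S. M T * D0 (S - T)) + (\<Sum>T | s \<notin> T \<and> T \<subseteq> S. M T * D0 (S - T))"
    using less.prems(1) by (intro sum.union_disjoint) (auto intro: finite_subset[of _ "Pow S"])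
  \<comment> \<open>The complement of a set without \<open>s\<close> contains \<open>s\<close>, so
    the recursion of \<open>D0\<close> applies to it.\<close>
  also have "(\<Sum>T | s \<notin> T \<and> T \<subseteq> S. M T * D0 (S - T)) =
      (\<Sum>T | s \<notin> T \<and> T \<subseteq> S. \<Sum>A | s \<in> A \<and> A \<subseteq> S - T. \<kappa>0 A * (M T * D0 (S - A - T)))"
  proof (intro sum.cong refl)
    fix T assume "T \<in> {T. s \<notin> T \<and> T \<subseteq> S}"
    then have "D0 (S - T) = (\<Sum>A | s \<in> A \<and> A \<subseteq> S - T. \<kappa>0 A * D0 (S - T - A))"
      using less.prems(2) by (intro less.prems(6)) auto
    moreover have "S - T - A = S - A - T" for A by auto
    ultimately show "M T * D0 (S - T) = (\<Sum>A | s \<in> A \<and> A \<subseteq> S - T. \<kappa>0 A * (M T * D0 (S - A - T)))"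
      by (simp add: sum_distrib_left mult_ac)
  qed
  also have "\<dots> = (\<Sum>A | s \<in> A \<and> A \<subseteq> S. \<Sum>T\<in>Pow (S - A). \<kappa>0 A * (M T * D0 (S - A - T)))"
  proof -
    have fin2: "finite {T. s \<notin> T \<and> T \<subseteq> S}" "\<And>T. finite {A. s \<in> A \<and> A \<subseteq> S - T}"
      using less.prems(1) by (auto intro: finite_subset[of _ "Pow S"])
    show ?thesis
      using fin fin2 less.prems(1)
      apply (subst sum.Sigma, simp, simp)
      apply (subst sum.Sigma, simp, simp)
      apply (rule sum.reindex_bij_witness[where i="\<lambda>(T,A). (A, T)" and j="\<lambda>(A,T). (T, A)"])
      by auto
  qed
  also have "\<dots> = (\<Sum>U | s \<in> U \<and> U \<subseteq> S. (\<Sum>A | s \<in> A \<and> A \<subseteq> U. \<kappa>0 A * M (U - A)) * D0 (S - U))"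
    using k[of \<kappa>0] by (simp add: sum_distrib_left)
  finally have 2: "D S = (\<Sum>U | s \<in> U \<and> U \<subseteq> S. M U * D0 (S - U)) + \<dots>" .
  \<comment> \<open>The two expansions of \<open>D S\<close> are compared: by induction the
    differences vanish on proper subsets, and the remaining one carries the factor
    \<open>D0 {} = 1\<close>.\<close>
  have "(\<Sum>U | s \<in> U \<and> U \<subseteq> S. (M U - X U) * D0 (S - U)) = 0"
    using 1 2 by (simp add: X_def left_diff_distrib sum_subtractf eq_diff_eq)
  moreover have "(\<Sum>U | s \<in> U \<and> U \<subseteq> S. (M U - X U) * D0 (S - U)) = (\<Sum>U\<in>{S}. (M U - X U) * D0 (S - U))"
    using fin less.prems(2) IH by (intro sum.mono_neutral_right) (auto simp: psubset_eq)
  ultimately show ?case by (simp add: X_def less.prems(3))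
qed

section \<open>Determinants and cycles\<close>
text \<open>Indexed by a set rather than by an initial segment of the naturals, so that all
  principal minors of one matrix are instances and can be summed over subsets.\<close>

definition set_det :: "('a \<Rightarrow> 'a \<Rightarrow> 'b::comm_ring_1) \<Rightarrow> 'a set \<Rightarrow> 'b" where
  "set_det f S = (\<Sum>\<pi> | \<pi> permutes S. of_int (sign \<pi>) * (\<Prod>i\<in>S. f i (\<pi> i)))"

definition set_cycles :: "'a set \<Rightarrow> ('a \<Rightarrow> 'a) set" where
  "set_cycles S = cycle_of_list ` {cs. distinct cs \<and> set cs = S}"

text \<open>The part of the determinant that comes from permutations with a single cycle, with the
  sign of such a cycle. For nonempty \<open>S\<close> these are the coefficients of the logarithm of
  the generating function of the principal minors.\<close>

definition cycle_det :: "('a \<Rightarrow> 'a \<Rightarrow> 'b::comm_ring_1) \<Rightarrow> 'a set \<Rightarrow> 'b" where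
  "cycle_det f S = (- 1) ^ (card S - 1) * (\<Sum>\<sigma>\<in>set_cycles S. \<Prod>i\<in>S. f i (\<sigma> i))"

lemma set_det_empty [simp]: "set_det f {} = 1"
  by (simp add: set_det_def)

lemma set_cycles_permutes: "\<sigma> \<in> set_cycles A \<Longrightarrow> \<sigma> permutes A"
  by (auto simp: set_cycles_def cycle_permutes)

lemma sign_cycle_of_list: "distinct cs \<Longrightarrow> cs \<noteq> [] \<Longrightarrow> sign (cycle_of_list cs) = (-1) ^ (length cs - 1)"
proof (induction cs rule: cycle_of_list.induct)
  case (1 i j cs)
  then have "sign (cycle_of_list (i # j # cs)) = sign (Transposition.transpose i j) * sign (cycle_of_list (j # cs))"
    unfolding cycle_of_list.simps by (intro sign_compose permutation_swap_id permutation_of_cycle)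
  then show ?case using 1 by (simp add: sign_swap_id comp_def)
qed auto

lemma sign_set_cycles:
  assumes "\<sigma> \<in> set_cycles A" "A \<noteq> {}" shows "sign \<sigma> = (-1) ^ (card A - 1)"
  using assms sign_cycle_of_list by (fastforce simp: set_cycles_def distinct_card)

text \<open>Rotating a list does not change the cycle that it describes.\<close>

lemma set_cycles_starting:
  assumes "\<sigma> \<in> set_cycles A" "s \<in> A"
  obtains cs where "distinct (s # cs)" "set (s # cs) = A" "\<sigma> = cycle_of_list (s # cs)"
proof -
  obtain ds where ds: "distinct ds" "set ds = A" "\<sigma> = cycle_of_list ds"
    using assms by (auto simp: set_cycles_def)
  obtain k where k: "k < length ds" "ds ! k = s"
    using ds assms by (metis in_set_conv_nth)
  have "hd (rotate k ds) = s" using k by (subst hd_rotate_conv_nth) auto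
  moreover have "rotate k ds \<noteq> []" using k by auto
  ultimately obtain cs where "rotate k ds = s # cs" by (cases "rotate k ds") auto
  moreover have "distinct (rotate k ds)" "set (rotate k ds) = A" "\<sigma> = cycle_of_list (rotate k ds)"
    using ds cycle_of_list_rotate_independent[OF ds(1)] by auto
  ultimately show ?thesis using that by metis
qed

text \<open>Applying the cycle to the members of its list rotates the list; the heads are
  compared.\<close>

lemma funpow_cycle_of_list:
  assumes "distinct cs" "n < length cs"
  shows "(cycle_of_list cs ^^ n) (hd cs) = cs ! n"
proof -
  have "cs \<noteq> []" using assms by auto
  have "hd (map (cycle_of_list cs ^^ n) cs) = hd (rotate n cs)"
    by (simp add: cyclic_rotation[OF assms(1)])
  then show ?thesis
    using assms \<open>cs \<noteq> []\<close> by (simp add: hd_map hd_rotate_conv_nth)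
qed

lemma funpow_set_cycles_image:
  assumes "\<sigma> \<in> set_cycles A" "s \<in> A"
  shows "bij_betw (\<lambda>k. (\<sigma> ^^ k) s) {..<card A} A" "(\<sigma> ^^ card A) s = s"
proof -
  obtain cs where cs: "distinct (s # cs)" "set (s # cs) = A" "\<sigma> = cycle_of_list (s # cs)"
    using set_cycles_starting[OF assms] .
  have len: "length (s # cs) = card A" using distinct_card[OF cs(1)] cs(2) by simp
  have "bij_betw (\<lambda>k. (s # cs) ! k) {..<card A} A"
    using bij_betw_nth[OF cs(1), of "{..<card A}" A] len cs(2) by metis
  moreover have "(s # cs) ! k = (\<sigma> ^^ k) s" if "k < card A" for k
    using funpow_cycle_of_list[OF cs(1), of k] that len cs(3) by simp
  ultimately show "bij_betw (\<lambda>k. (\<sigma> ^^ k) s) {..<card A} A"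
    using bij_betw_cong[of "{..<card A}" "\<lambda>k. (s # cs) ! k" "\<lambda>k. (\<sigma> ^^ k) s" A] by simp
  show "(\<sigma> ^^ card A) s = s"
    using cycle_is_id_root[OF cs(1)] unfolding len cs(3)[symmetric] by simp
qed

lemma set_cycles_orbit:
  assumes "\<sigma> \<in> set_cycles A" "s \<in> A"
  shows "range (\<lambda>i. (\<sigma> ^^ i) s) = A"
proof
  show "range (\<lambda>i. (\<sigma> ^^ i) s) \<subseteq> A"
    using permutes_in_image[OF permutes_funpow[OF set_cycles_permutes[OF assms(1)]]] assms(2) by auto
  show "A \<subseteq> range (\<lambda>i. (\<sigma> ^^ i) s)"
    using funpow_set_cycles_image(1)[OF assms] by (auto simp: bij_betw_def)
qed

text \<open>The orbit of \<open>s\<close> is invariant in both directions, so the permutation splits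
  into a cycle on the orbit and a permutation of the rest.\<close>

lemma permutation_first_cycle:
  assumes "\<pi> permutes S" "finite S" "s \<in> S"
  defines "A \<equiv> range (\<lambda>i. (\<pi> ^^ i) s)"
  shows "s \<in> A" "A \<subseteq> S" "(\<lambda>x. if x \<in> A then \<pi> x else x) \<in> set_cycles A"
    "(\<lambda>x. if x \<in> A then x else \<pi> x) permutes (S - A)"
proof -
  have p: "permutation \<pi>" using assms permutation_permutes by blast
  have A: "set (support \<pi> s) = A" unfolding A_def by (rule support_set[OF p])
  show sA: "s \<in> A" unfolding A_def by (rule range_eqI[of _ _ 0]) simp
  show AS: "A \<subseteq> S" using assms permutes_in_image[OF permutes_funpow[OF assms(1)]] by auto
  have inA: "\<pi> x \<in> A \<longleftrightarrow> x \<in> A" for x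
  proof
    assume "x \<in> A" then obtain i where "x = (\<pi> ^^ i) s" by (auto simp: A_def)
    then have "\<pi> x = (\<pi> ^^ Suc i) s" by simp
    then show "\<pi> x \<in> A" unfolding A_def by (rule range_eqI)
  next
    assume "\<pi> x \<in> A" then obtain i where i: "\<pi> x = (\<pi> ^^ i) s" by (auto simp: A_def)
    \<comment> \<open>The permutation has finite order, so its inverse is one of its powers and the
      orbit is closed under the inverse.\<close>
    obtain n where n: "\<pi> ^^ n = id" "n > 0" using permutation_is_nilpotent[OF p] .
    have "\<pi> ((\<pi> ^^ (n - 1 + i)) s) = (\<pi> ^^ Suc (n - 1 + i)) s" by simp
    also have "Suc (n - 1 + i) = n + i" using n by simp
    also have "(\<pi> ^^ (n + i)) s = \<pi> x" by (simp only: funpow_add n(1) o_apply id_apply i)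
    finally have "\<pi> x = \<pi> ((\<pi> ^^ (n - 1 + i)) s)" ..
    then have "x = (\<pi> ^^ (n - 1 + i)) s" using permutes_inj[OF assms(1)] by (simp add: inj_eq)
    then show "x \<in> A" unfolding A_def by blast
  qed
  have "(\<lambda>x. if x \<in> A then \<pi> x else x) = cycle_of_list (support \<pi> s)"
  proof
    fix x show "(if x \<in> A then \<pi> x else x) = cycle_of_list (support \<pi> s) x"
      using cycle_restrict[OF p, of x s] id_outside_supp[of x "support \<pi> s"] A by auto
  qed
  then show "(\<lambda>x. if x \<in> A then \<pi> x else x) \<in> set_cycles A"
    unfolding set_cycles_def using cycle_of_permutation[OF p, of s] A by blast
  have b: "bij (\<lambda>x. if x \<in> A then x else \<pi> x)"
    unfolding bij_def
  proof
    show "inj (\<lambda>x. if x \<in> A then x else \<pi> x)"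
    proof (rule injI)
      fix x y assume "(if x \<in> A then x else \<pi> x) = (if y \<in> A then y else \<pi> y)"
      then show "x = y"
        using inA[of x] inA[of y] injD[OF permutes_inj[OF assms(1)], of x y] by metis
    qed
    show "surj (\<lambda>x. if x \<in> A then x else \<pi> x)"
      unfolding surj_def
    proof
      fix y show "\<exists>x. y = (if x \<in> A then x else \<pi> x)"
      proof (cases "y \<in> A")
        case False
        obtain x where "y = \<pi> x" using surjD[OF permutes_surj[OF assms(1)]] by blast
        then show ?thesis using False inA[of x] by (intro exI[of _ x]) simp
      next
        case True
        then show ?thesis by (intro exI[of _ y]) simp
      qed
    qed
  qed
  show "(\<lambda>x. if x \<in> A then x else \<pi> x) permutes (S - A)"
    using b assms(1) unfolding permutes_def[of "\<lambda>x. if x \<in> A then x else \<pi> x"] bij_iff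
    by (simp add: permutes_not_in)
qed

text \<open>Splitting off the cycle through \<open>s\<close> factors both the sign and the product.
  The result has the form of a logarithmic derivative, as \<open>quotient_recursion\<close> demands
  it of \<open>D\<close> and \<open>D0\<close>.\<close>

lemma set_det_cycle_expansion:
  fixes f :: "'a \<Rightarrow> 'a \<Rightarrow> 'b::comm_ring_1"
  assumes "finite S" "s \<in> S"
  shows "set_det f S = (\<Sum>A | s \<in> A \<and> A \<subseteq> S. cycle_det f A * set_det f (S - A))"
proof -
  define X where "X = (SIGMA A:{A. s \<in> A \<and> A \<subseteq> S}. set_cycles A \<times> {\<rho>. \<rho> permutes (S - A)})"
  define orb where "orb \<pi> = range (\<lambda>i. (\<pi> ^^ i) s)" for \<pi> :: "'a \<Rightarrow> 'a"
  have fin1: "finite {A. s \<in> A \<and> A \<subseteq> S}"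
    using assms by (auto intro: finite_subset[of _ "Pow S"])
  have finS: "finite A" if "A \<subseteq> S" for A using that assms finite_subset by blast
  have fin2: "finite (set_cycles A)" if "A \<subseteq> S" for A
    using finite_permutations[OF finS[OF that]] set_cycles_permutes
    by (metis (mono_tags, lifting) finite_subset mem_Collect_eq subsetI)
  have fin3: "finite {\<rho>. \<rho> permutes (S - A)}" for A
    using assms by (simp add: finite_permutations)
  have comp: "\<sigma> (\<rho> x) = (if x \<in> A then \<sigma> x else \<rho> x)"
    if "\<sigma> permutes A" "\<rho> permutes (S - A)" for \<sigma> \<rho> A x
  proof (cases "x \<in> A")
    case True
    then show ?thesis using permutes_not_in[OF that(2), of x] by simp
  next
    case False
    then have "\<rho> x \<notin> A"
      using permutes_not_in[OF that(2), of x] permutes_in_image[OF that(2), of x] by (cases "x \<in> S") auto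
    then show ?thesis using False permutes_not_in[OF that(1)] by simp
  qed
  \<comment> \<open>The bijection between permutations and triples: the orbit of \<open>s\<close>,
    the cycle on it, and the permutation of the rest.\<close>
  define cut where "cut \<pi> = (orb \<pi>, \<lambda>x. if x \<in> orb \<pi> then \<pi> x else x, \<lambda>x. if x \<in> orb \<pi> then x else \<pi> x)"
    for \<pi> :: "'a \<Rightarrow> 'a"
  define glue where "glue b = (case b of (A, \<sigma>, \<rho>) \<Rightarrow> \<sigma> \<circ> \<rho>)"
    for b :: "'a set \<times> ('a \<Rightarrow> 'a) \<times> ('a \<Rightarrow> 'a)"
  have "set_det f S = (\<Sum>(A, \<sigma>, \<rho>)\<in>X. of_int (sign (\<sigma> \<circ> \<rho>)) * (\<Prod>i\<in>S. f i ((\<sigma> \<circ> \<rho>) i)))"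
    unfolding set_det_def
  proof (rule sum.reindex_bij_witness[where i=glue and j=cut])
    fix \<pi> assume "\<pi> \<in> {\<pi>. \<pi> permutes S}"
    then have \<pi>: "\<pi> permutes S" by simp
    note pf = permutation_first_cycle[OF \<pi> assms, folded orb_def]
    show "cut \<pi> \<in> X"
      unfolding X_def cut_def using pf by auto
    have eq: "(\<lambda>x. if x \<in> orb \<pi> then \<pi> x else x) \<circ> (\<lambda>x. if x \<in> orb \<pi> then x else \<pi> x) = \<pi>"
    proof
      fix x
      show "((\<lambda>x. if x \<in> orb \<pi> then \<pi> x else x) \<circ> (\<lambda>x. if x \<in> orb \<pi> then x else \<pi> x)) x = \<pi> x"
        using comp[OF set_cycles_permutes[OF pf(3)] pf(4), of x] by auto
    qed
    then show "glue (cut \<pi>) = \<pi>" by (simp add: glue_def cut_def)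
    show "(case cut \<pi> of (A, \<sigma>, \<rho>) \<Rightarrow> of_int (sign (\<sigma> \<circ> \<rho>)) * (\<Prod>i\<in>S. f i ((\<sigma> \<circ> \<rho>) i)))
         = of_int (sign \<pi>) * (\<Prod>i\<in>S. f i (\<pi> i))" unfolding cut_def prod.case eq ..
  next
    fix b assume b: "b \<in> X"
    obtain A \<sigma> \<rho> where b': "b = (A, \<sigma>, \<rho>)" by (cases b)
    have A: "s \<in> A" "A \<subseteq> S" and \<sigma>: "\<sigma> \<in> set_cycles A" and \<rho>: "\<rho> permutes (S - A)"
      using b by (auto simp: b' X_def)
    note \<sigma>' = set_cycles_permutes[OF \<sigma>]
    have "\<rho> permutes S" "\<sigma> permutes S" using \<rho> \<sigma>' A permutes_subset by blast+
    then show "glue b \<in> {\<pi>. \<pi> permutes S}"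
      by (simp add: b' glue_def permutes_compose)
    have "((\<sigma> \<circ> \<rho>) ^^ i) s = (\<sigma> ^^ i) s \<and> (\<sigma> ^^ i) s \<in> A" for i
      by (induction i) (use A comp[OF \<sigma>' \<rho>] permutes_in_image[OF \<sigma>'] in auto)
    then have orb: "orb (\<sigma> \<circ> \<rho>) = A"
      unfolding orb_def using set_cycles_orbit[OF \<sigma> A(1)] by simp
    have "(\<lambda>x. if x \<in> A then (\<sigma> \<circ> \<rho>) x else x) = \<sigma>"
      using comp[OF \<sigma>' \<rho>] permutes_not_in[OF \<sigma>'] by fastforce
    moreover have "(\<lambda>x. if x \<in> A then x else (\<sigma> \<circ> \<rho>) x) = \<rho>"
      using comp[OF \<sigma>' \<rho>] permutes_not_in[OF \<rho>] by fastforce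
    ultimately show "cut (glue b) = b"
      unfolding b' cut_def glue_def prod.case orb by simp
  qed
  also have "\<dots> = (\<Sum>(A, \<sigma>, \<rho>)\<in>X. ((-1) ^ (card A - 1) * (\<Prod>i\<in>A. f i (\<sigma> i))) * (of_int (sign \<rho>) * (\<Prod>i\<in>S - A. f i (\<rho> i))))"
  proof (intro sum.cong refl, clarify)
    fix A \<sigma> \<rho> assume b: "(A, \<sigma>, \<rho>) \<in> X"
    have A: "s \<in> A" "A \<subseteq> S" and \<sigma>: "\<sigma> \<in> set_cycles A" and \<rho>: "\<rho> permutes (S - A)"
      using b by (auto simp: X_def)
    note \<sigma>' = set_cycles_permutes[OF \<sigma>]
    have "permutation \<sigma>" "permutation \<rho>"
      using \<sigma>' \<rho> finS[OF A(2)] assms permutation_permutes by blast+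
    then have "sign (\<sigma> \<circ> \<rho>) = (-1) ^ (card A - 1) * sign \<rho>"
      using sign_set_cycles[OF \<sigma>] A by (subst sign_compose) auto
    moreover have "(\<Prod>i\<in>S. f i ((\<sigma> \<circ> \<rho>) i)) = (\<Prod>i\<in>S - A. f i ((\<sigma> \<circ> \<rho>) i)) * (\<Prod>i\<in>A. f i ((\<sigma> \<circ> \<rho>) i))"
      by (rule prod.subset_diff[OF A(2) assms(1)])
    moreover have "(\<Prod>i\<in>S - A. f i ((\<sigma> \<circ> \<rho>) i)) = (\<Prod>i\<in>S - A. f i (\<rho> i))"
      "(\<Prod>i\<in>A. f i ((\<sigma> \<circ> \<rho>) i)) = (\<Prod>i\<in>A. f i (\<sigma> i))"
      by (intro prod.cong; simp add: comp[OF \<sigma>' \<rho>])+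
    ultimately show "of_int (sign (\<sigma> \<circ> \<rho>)) * (\<Prod>i\<in>S. f i ((\<sigma> \<circ> \<rho>) i)) =
      ((-1) ^ (card A - 1) * (\<Prod>i\<in>A. f i (\<sigma> i))) * (of_int (sign \<rho>) * (\<Prod>i\<in>S - A. f i (\<rho> i)))"
      by (simp add: mult_ac)
  qed
  also have "\<dots> = (\<Sum>A | s \<in> A \<and> A \<subseteq> S. \<Sum>(\<sigma>, \<rho>)\<in>set_cycles A \<times> {\<rho>. \<rho> permutes (S - A)}.
      ((-1) ^ (card A - 1) * (\<Prod>i\<in>A. f i (\<sigma> i))) * (of_int (sign \<rho>) * (\<Prod>i\<in>S - A. f i (\<rho> i))))"
    unfolding X_def using fin1 fin2 fin3 by (subst sum.Sigma) auto
  also have "\<dots> = (\<Sum>A | s \<in> A \<and> A \<subseteq> S. cycle_det f A * set_det f (S - A))"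
    by (intro sum.cong refl)
      (simp only: cycle_det_def set_det_def sum_distrib_left[of "(- 1) ^ _" _ "set_cycles _"] sum_product sum.cartesian_product)
  finally show ?thesis .
qed

text \<open>Multilinearity, with \<open>T\<close> collecting the indices at which the diagonal
  summand is chosen. A permutation contributes only if it fixes \<open>T\<close> pointwise, and it
  is then a permutation of \<open>S - T\<close>.\<close>

lemma set_det_diag_add:
  fixes f :: "'a \<Rightarrow> 'a \<Rightarrow> 'b::comm_ring_1"
  assumes "finite S"
  shows "set_det (\<lambda>i j. (if i = j then t i else 0) + f i j) S = (\<Sum>T\<in>Pow S. (\<Prod>i\<in>T. t i) * set_det f (S - T))"
proof -
  have "set_det (\<lambda>i j. (if i = j then t i else 0) + f i j) S =
    (\<Sum>\<pi> | \<pi> permutes S. \<Sum>T\<in>Pow S. of_int (sign \<pi>) * ((\<Prod>i\<in>T. if i = \<pi> i then t i else 0) * (\<Prod>i\<in>S - T. f i (\<pi> i))))"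
    unfolding set_det_def by (simp add: prod_add[OF assms] sum_distrib_left)
  also have "\<dots> = (\<Sum>T\<in>Pow S. \<Sum>\<pi> | \<pi> permutes S. of_int (sign \<pi>) * ((\<Prod>i\<in>T. if i = \<pi> i then t i else 0) * (\<Prod>i\<in>S - T. f i (\<pi> i))))"
    by (rule sum.swap)
  also have "\<dots> = (\<Sum>T\<in>Pow S. (\<Prod>i\<in>T. t i) * set_det f (S - T))"
  proof (intro sum.cong refl)
    fix T assume "T \<in> Pow S"
    then have T: "T \<subseteq> S" "finite T" using assms finite_subset by auto
    have fixT: "\<pi> permutes (S - T)" if "\<pi> permutes S" "\<forall>i\<in>T. i = \<pi> i" for \<pi>
    proof (rule permutes_superset[OF that(1)])
      fix x assume "x \<in> S - (S - T)"
      then have "x = \<pi> x" using that(2) by blast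
      then show "\<pi> x = x" by (rule sym)
    qed
    have "(\<Sum>\<pi> | \<pi> permutes S. of_int (sign \<pi>) * ((\<Prod>i\<in>T. if i = \<pi> i then t i else 0) * (\<Prod>i\<in>S - T. f i (\<pi> i))))
      = (\<Sum>\<pi> | \<pi> permutes (S - T). of_int (sign \<pi>) * ((\<Prod>i\<in>T. if i = \<pi> i then t i else 0) * (\<Prod>i\<in>S - T. f i (\<pi> i))))"
    proof (rule sum.mono_neutral_right)
      show "finite {\<pi>. \<pi> permutes S}" using assms by (simp add: finite_permutations)
      show "{\<pi>. \<pi> permutes S - T} \<subseteq> {\<pi>. \<pi> permutes S}"
        using permutes_subset[of _ "S - T" S] by auto
      show "\<forall>\<pi>\<in>{\<pi>. \<pi> permutes S} - {\<pi>. \<pi> permutes S - T}.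
        of_int (sign \<pi>) * ((\<Prod>i\<in>T. if i = \<pi> i then t i else 0) * (\<Prod>i\<in>S - T. f i (\<pi> i))) = 0"
      proof
        fix \<pi> assume "\<pi> \<in> {\<pi>. \<pi> permutes S} - {\<pi>. \<pi> permutes S - T}"
        then obtain i where "i \<in> T" "i \<noteq> \<pi> i" using fixT by blast
        then have "(\<Prod>i\<in>T. if i = \<pi> i then t i else 0) = 0"
          using T(2) by (intro prod_zero) auto
        then show "of_int (sign \<pi>) * ((\<Prod>i\<in>T. if i = \<pi> i then t i else 0) * (\<Prod>i\<in>S - T. f i (\<pi> i))) = 0" by simp
      qed
    qed
    also have "\<dots> = (\<Prod>i\<in>T. t i) * set_det f (S - T)"
      unfolding set_det_def sum_distrib_left
    proof (intro sum.cong refl)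
      fix \<pi> assume "\<pi> \<in> {\<pi>. \<pi> permutes (S - T)}"
      then have "(\<Prod>i\<in>T. if i = \<pi> i then t i else 0) = (\<Prod>i\<in>T. t i)"
        by (intro prod.cong) (auto simp: permutes_not_in)
      then show "of_int (sign \<pi>) * ((\<Prod>i\<in>T. if i = \<pi> i then t i else 0) * (\<Prod>i\<in>S - T. f i (\<pi> i))) =
        (\<Prod>i\<in>T. t i) * (of_int (sign \<pi>) * (\<Prod>i\<in>S - T. f i (\<pi> i)))" by (simp add: mult_ac)
    qed
    finally show "(\<Sum>\<pi> | \<pi> permutes S. of_int (sign \<pi>) * ((\<Prod>i\<in>T. if i = \<pi> i then t i else 0) * (\<Prod>i\<in>S - T. f i (\<pi> i)))) = (\<Prod>i\<in>T. t i) * set_det f (S - T)" .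
  qed
  finally show ?thesis .
qed

lemma set_det_reindex:
  fixes f :: "'a \<Rightarrow> 'a \<Rightarrow> 'b::comm_ring_1"
  assumes "bij_betw g A B" "finite A"
  shows "set_det (\<lambda>i j. f (g i) (g j)) A = set_det f B"
proof -
  note h = bij_betw_inv_into_left[OF assms(1)]
  have mp: "map_permutation A g \<pi> = (\<lambda>x. if x \<in> B then g (\<pi> (inv_into A g x)) else x)" for \<pi>
    using assms(1) by (auto simp: map_permutation_def restrict_id_def bij_betw_def)
  have "set_det f B = (\<Sum>\<pi> | \<pi> permutes A. of_int (sign (map_permutation A g \<pi>)) * (\<Prod>i\<in>B. f i (map_permutation A g \<pi> i)))"
    unfolding set_det_def mp by (rule sum.reindex_bij_betw[OF bij_betw_permutations[OF assms(1)], symmetric])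
  also have "\<dots> = (\<Sum>\<pi> | \<pi> permutes A. of_int (sign \<pi>) * (\<Prod>i\<in>A. f (g i) (g (\<pi> i))))"
  proof (intro sum.cong refl arg_cong2[where f="(*)"])
    fix \<pi> assume "\<pi> \<in> {\<pi>. \<pi> permutes A}"
    then have \<pi>: "\<pi> permutes A" by simp
    show "(of_int (sign (map_permutation A g \<pi>)) :: 'b) = of_int (sign \<pi>)"
      using sign_map_permutation[OF bij_betw_imp_inj_on[OF assms(1)] \<pi> assms(2)] by simp
    have "(\<Prod>i\<in>B. f i (map_permutation A g \<pi> i)) = (\<Prod>i\<in>A. f (g i) (map_permutation A g \<pi> (g i)))"
      by (rule prod.reindex_bij_betw[OF assms(1), symmetric])
    also have "\<dots> = (\<Prod>i\<in>A. f (g i) (g (\<pi> i)))"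
      using h bij_betw_apply[OF assms(1)] by (intro prod.cong) (auto simp: mp)
    finally show "(\<Prod>i\<in>B. f i (map_permutation A g \<pi> i)) = (\<Prod>i\<in>A. f (g i) (g (\<pi> i)))" .
  qed
  finally show ?thesis by (simp add: set_det_def)
qed

section \<open>Vanishing of the cycle sums of the Cauchy matrix\<close>

lemma set_cycles_no_fixpoint:
  assumes "\<sigma> \<in> set_cycles A" "finite A" "x \<in> A" "card A \<ge> 2"
  shows "\<sigma> x \<noteq> x"
proof
  assume x: "\<sigma> x = x"
  have "(\<sigma> ^^ i) x = x" for i by (induction i) (use x in auto)
  then have "A = {x}" using set_cycles_orbit[OF assms(1,3)] by auto
  then show False using assms by simp
qed

text \<open>The composition inserts \<open>s\<close> immediately before \<open>a\<close>: if the
  cycle is written as a list starting with \<open>a\<close>, then \<open>s\<close> is put in front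
  of that list.\<close>

lemma set_cycles_insert:
  assumes "s \<notin> A" "finite A" "A \<noteq> {}"
  shows "bij_betw (\<lambda>(\<sigma>, a). Transposition.transpose s a \<circ> \<sigma>) (set_cycles A \<times> A) (set_cycles (insert s A))"
proof (rule bij_betwI')
  have s: "\<sigma> s = s" if "\<sigma> \<in> set_cycles A" for \<sigma>
    using permutes_not_in[OF set_cycles_permutes[OF that] assms(1)] .
  fix p q assume pq: "p \<in> set_cycles A \<times> A" "q \<in> set_cycles A \<times> A"
  obtain \<sigma> a \<tau> b where e: "p = (\<sigma>, a)" "q = (\<tau>, b)" by (cases p, cases q)
  show "((case p of (\<sigma>, a) \<Rightarrow> Transposition.transpose s a \<circ> \<sigma>) = (case q of (\<sigma>, a) \<Rightarrow> Transposition.transpose s a \<circ> \<sigma>)) \<longleftrightarrow> p = q"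
  proof
    assume "(case p of (\<sigma>, a) \<Rightarrow> Transposition.transpose s a \<circ> \<sigma>) = (case q of (\<sigma>, a) \<Rightarrow> Transposition.transpose s a \<circ> \<sigma>)"
    then have eq: "Transposition.transpose s a \<circ> \<sigma> = Transposition.transpose s b \<circ> \<tau>" by (simp add: e)
    from fun_cong[OF this, of s] have ab: "a = b" using s[of \<sigma>] s[of \<tau>] pq e by simp
    have "\<sigma> = Transposition.transpose s a \<circ> (Transposition.transpose s a \<circ> \<sigma>)"
      by (auto simp: fun_eq_iff)
    also have "\<dots> = Transposition.transpose s a \<circ> (Transposition.transpose s b \<circ> \<tau>)" by (simp only: eq)
    also have "\<dots> = \<tau>" by (auto simp: ab fun_eq_iff)
    finally show "p = q" using e ab by simp
  qed simp
next
  fix p assume "p \<in> set_cycles A \<times> A"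
  then obtain \<sigma> a where e: "p = (\<sigma>, a)" "\<sigma> \<in> set_cycles A" "a \<in> A" by auto
  obtain cs where cs: "distinct (a # cs)" "set (a # cs) = A" "\<sigma> = cycle_of_list (a # cs)"
    using set_cycles_starting[OF e(2,3)] .
  have "Transposition.transpose s a \<circ> \<sigma> = cycle_of_list (s # a # cs)" unfolding cs by simp
  moreover have "distinct (s # a # cs)" "set (s # a # cs) = insert s A" using cs assms(1) by auto
  ultimately show "(case p of (\<sigma>, a) \<Rightarrow> Transposition.transpose s a \<circ> \<sigma>) \<in> set_cycles (insert s A)"
    unfolding e set_cycles_def by (metis (mono_tags, lifting) image_eqI mem_Collect_eq prod.case)
next
  fix \<tau> assume t: "\<tau> \<in> set_cycles (insert s A)"
  obtain cs where cs: "distinct (s # cs)" "set (s # cs) = insert s A" "\<tau> = cycle_of_list (s # cs)"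
    using set_cycles_starting[OF t] by blast
  have csA: "set cs = A" using cs assms(1) by auto
  then obtain a ds where a: "cs = a # ds" using assms(3) by (cases cs) auto
  have "cycle_of_list cs \<in> set_cycles A" "a \<in> A" using cs csA a by (auto simp: set_cycles_def)
  moreover have "\<tau> = Transposition.transpose s a \<circ> cycle_of_list cs" unfolding cs(3) a by simp
  ultimately show "\<exists>p\<in>set_cycles A \<times> A. \<tau> = (case p of (\<sigma>, a) \<Rightarrow> Transposition.transpose s a \<circ> \<sigma>)"
    by (intro bexI[of _ "(cycle_of_list cs, a)"]) auto
qed

text \<open>Inserting \<open>s\<close> before \<open>a\<close> into a cycle replaces the factor \<open>1 / (z a - z b)\<close> of the edge from \<open>b\<close> to \<open>a\<close>
  by a product of two factors; by partial fractions the sum over all places of insertion telescopes.\<close>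

lemma partial_fraction_insertion:
  fixes b p q s :: "'b::field"
  assumes "p \<noteq> b" "p \<noteq> s" "s \<noteq> b"
  shows "1 / (p - s) * (1 / (s - b) * q) = 1 / (p - b) * q * (1 / (s - b) - 1 / (s - p))"
proof -
  have "1 / (s - b) - 1 / (s - p) = (b - p) / ((s - b) * (s - p))"
    using assms by (simp add: diff_frac_eq)
  then show ?thesis using assms by (simp add: divide_simps) (simp add: algebra_simps)
qed

lemma sum_set_cycles_cauchy_eq_0:
  fixes z :: "'a \<Rightarrow> 'b::field"
  assumes "finite S" "card S \<ge> 3" "inj_on z S"
  shows "(\<Sum>\<sigma>\<in>set_cycles S. \<Prod>i\<in>S. 1 / (z (\<sigma> i) - z i)) = 0"
proof -
  obtain s where "s \<in> S" using assms(2) by fastforce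
  define A where "A = S - {s}"
  have S: "S = insert s A" "s \<notin> A" "finite A" using \<open>s \<in> S\<close> assms by (auto simp: A_def)
  \<comment> \<open>With at least two points left, a cycle on \<open>A\<close> has no fixed points,
    so the edge from \<open>b\<close> to \<open>\<sigma> b\<close> has a nonzero
    denominator.\<close>
  have cA: "card A \<ge> 2" using assms(2) S by simp
  then have A0: "A \<noteq> {}" by auto
  have "(\<Sum>\<sigma>\<in>set_cycles S. \<Prod>i\<in>S. 1 / (z (\<sigma> i) - z i)) =
    (\<Sum>(\<sigma>, a)\<in>set_cycles A \<times> A. \<Prod>i\<in>S. 1 / (z ((Transposition.transpose s a \<circ> \<sigma>) i) - z i))"
    unfolding S(1) by (subst sum.reindex_bij_betw[OF set_cycles_insert[OF S(2,3) A0], symmetric]) (simp add: case_prod_unfold)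
  also have "\<dots> = (\<Sum>\<sigma>\<in>set_cycles A. \<Sum>a\<in>A. \<Prod>i\<in>S. 1 / (z ((Transposition.transpose s a \<circ> \<sigma>) i) - z i))"
    by (simp add: sum.cartesian_product)
  also have "\<dots> = 0"
  proof (rule sum.neutral, rule ballI)
    fix \<sigma> assume \<sigma>: "\<sigma> \<in> set_cycles A"
    note p = set_cycles_permutes[OF \<sigma>]
    define P where "P = (\<Prod>i\<in>A. 1 / (z (\<sigma> i) - z i))"
    have step: "(\<Prod>i\<in>S. 1 / (z ((Transposition.transpose s (\<sigma> b) \<circ> \<sigma>) i) - z i)) =
        P * (1 / (z s - z b) - 1 / (z s - z (\<sigma> b)))" if b: "b \<in> A" for b
    proof -
      have \<sigma>b: "\<sigma> b \<in> A" "\<sigma> b \<noteq> b" using b permutes_in_image[OF p] set_cycles_no_fixpoint[OF \<sigma> S(3) b cA] by auto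
      have ss: "\<sigma> s = s" using permutes_not_in[OF p S(2)] .
      have oth: "Transposition.transpose s (\<sigma> b) (\<sigma> i) = \<sigma> i" if "i \<in> A - {b}" for i
      proof (rule transpose_apply_other)
        show "\<sigma> i \<noteq> s" using that permutes_in_image[OF p, of i] S(2) by auto
        show "\<sigma> i \<noteq> \<sigma> b" using that permutes_inj[OF p] by (auto simp: inj_eq)
      qed
      have ne: "z (\<sigma> b) - z b \<noteq> 0" "z (\<sigma> b) - z s \<noteq> 0" "z s - z b \<noteq> 0" "z s - z (\<sigma> b) \<noteq> 0"
        using assms(3) \<sigma>b b S by (auto simp: inj_on_def)
      define Q where "Q = (\<Prod>i\<in>A - {b}. 1 / (z (\<sigma> i) - z i))"
      have P: "P = 1 / (z (\<sigma> b) - z b) * Q" unfolding P_def Q_def by (rule prod.remove) (use S b in auto)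
      have "(\<Prod>i\<in>S. 1 / (z ((Transposition.transpose s (\<sigma> b) \<circ> \<sigma>) i) - z i)) =
         1 / (z (\<sigma> b) - z s) * (\<Prod>i\<in>A. 1 / (z ((Transposition.transpose s (\<sigma> b) \<circ> \<sigma>) i) - z i))"
        unfolding S(1) using S ss by simp
      also have "(\<Prod>i\<in>A. 1 / (z ((Transposition.transpose s (\<sigma> b) \<circ> \<sigma>) i) - z i)) =
        1 / (z s - z b) * (\<Prod>i\<in>A - {b}. 1 / (z ((Transposition.transpose s (\<sigma> b) \<circ> \<sigma>) i) - z i))"
        using S(3) b by (subst prod.remove[of _ b]) auto
      also have "(\<Prod>i\<in>A - {b}. 1 / (z ((Transposition.transpose s (\<sigma> b) \<circ> \<sigma>) i) - z i)) = Q"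
        unfolding Q_def by (intro prod.cong) (auto simp: oth)
      also have "1 / (z (\<sigma> b) - z s) * (1 / (z s - z b) * Q) = P * (1 / (z s - z b) - 1 / (z s - z (\<sigma> b)))"
        unfolding P by (rule partial_fraction_insertion) (use ne in auto)
      finally show ?thesis .
    qed
    \<comment> \<open>The place of insertion is reindexed by its predecessor \<open>b\<close>. The
      two halves of the difference are then the same sum, since \<open>\<sigma>\<close> permutes
      \<open>A\<close>.\<close>
    have "(\<Sum>a\<in>A. \<Prod>i\<in>S. 1 / (z ((Transposition.transpose s a \<circ> \<sigma>) i) - z i)) =
      (\<Sum>b\<in>A. \<Prod>i\<in>S. 1 / (z ((Transposition.transpose s (\<sigma> b) \<circ> \<sigma>) i) - z i))"
      by (rule sum.reindex_bij_betw[OF permutes_imp_bij[OF p], symmetric])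
    also have "\<dots> = P * ((\<Sum>b\<in>A. 1 / (z s - z b)) - (\<Sum>b\<in>A. 1 / (z s - z (\<sigma> b))))"
      using step by (simp add: sum_subtractf sum_distrib_left right_diff_distrib del: o_apply)
    also have "(\<Sum>b\<in>A. 1 / (z s - z (\<sigma> b))) = (\<Sum>b\<in>A. 1 / (z s - z b))"
      by (rule sum.reindex_bij_betw[OF permutes_imp_bij[OF p]])
    finally show "(\<Sum>a\<in>A. \<Prod>i\<in>S. 1 / (z ((Transposition.transpose s a \<circ> \<sigma>) i) - z i)) = 0" by simp
  qed
  finally show ?thesis .
qed

section \<open>Interpolation identities\<close>
hide_const (open) Finite_Cartesian_Product.mat Determinants.det Finite_Cartesian_Product.vec
no_notation Finite_Cartesian_Product.vec_nth (infixl "$" 90)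

text \<open>Adding \<open>L\<close> times the upper rows to the lower ones has determinant
  \<open>1\<close> and clears the lower left block, because \<open>L\<close> solves
  \<open>L D = P\<close>. It is used twice with the same lower rows: pointwise, where
  \<open>L\<close> is Lagrange interpolation, and after integration, where \<open>D\<close> is
  diagonal.\<close>

lemma det_block_elimination:
  fixes D F P B L :: "nat \<Rightarrow> nat \<Rightarrow> 'a::idom"
  assumes L: "\<And>j a. j < l \<Longrightarrow> a < n \<Longrightarrow> (\<Sum>i<n. L j i * D i a) = P j a"
  shows "Determinant.det (Matrix.mat (n + l) (n + l) (\<lambda>(k, c). if k < n then (if c < n then D k c else F k (c - n))
      else (if c < n then - P (k - n) c else B (k - n) (c - n)))) =
    Determinant.det (Matrix.mat n n (\<lambda>(i, a). D i a)) *
    Determinant.det (Matrix.mat l l (\<lambda>(j, c). B j c + (\<Sum>i<n. L j i * F i c)))"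
    (is "Determinant.det ?M = _ * Determinant.det ?S")
proof -
  let ?D = "Matrix.mat n n (\<lambda>(i, a). D i a)" and ?F = "Matrix.mat n l (\<lambda>(i, c). F i c)"
  let ?P = "Matrix.mat l n (\<lambda>(j, a). - P j a)" and ?B = "Matrix.mat l l (\<lambda>(j, c). B j c)"
  let ?L = "Matrix.mat l n (\<lambda>(j, i). L j i)"
  have M: "?M = four_block_mat ?D ?F ?P ?B"
    by (rule eq_matI) auto
  have 1: "?L * ?D + 1\<^sub>m l * ?P = 0\<^sub>m l n"
    by (rule eq_matI) (auto simp: scalar_prod_def L atLeast0LessThan)
  have 2: "?L * ?F + 1\<^sub>m l * ?B = ?S"
    by (rule eq_matI) (auto simp: scalar_prod_def atLeast0LessThan add.commute)
  have "four_block_mat (1\<^sub>m n) (0\<^sub>m n l) ?L (1\<^sub>m l) * four_block_mat ?D ?F ?P ?B =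
     four_block_mat (1\<^sub>m n * ?D + 0\<^sub>m n l * ?P) (1\<^sub>m n * ?F + 0\<^sub>m n l * ?B) (?L * ?D + 1\<^sub>m l * ?P) (?L * ?F + 1\<^sub>m l * ?B)"
    by (rule mult_four_block_mat) auto
  also have "\<dots> = four_block_mat ?D ?F (0\<^sub>m l n) ?S"
    unfolding 1 2 by simp
  finally have "Determinant.det (four_block_mat (1\<^sub>m n) (0\<^sub>m n l) ?L (1\<^sub>m l)) * Determinant.det (four_block_mat ?D ?F ?P ?B)
     = Determinant.det (four_block_mat ?D ?F (0\<^sub>m l n) ?S)"
    by (metis (no_types, lifting) det_mult four_block_carrier_mat mat_carrier one_carrier_mat)
  also have "Determinant.det (four_block_mat (1\<^sub>m n) (0\<^sub>m n l) ?L (1\<^sub>m l)) = 1"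
    by (subst det_four_block_mat_upper_right_zero[of _ n _ l]) auto
  also have "Determinant.det (four_block_mat ?D ?F (0\<^sub>m l n) ?S) = Determinant.det ?D * Determinant.det ?S"
    by (rule det_four_block_mat_lower_left_zero) auto
  finally show ?thesis unfolding M by simp
qed

lemma lagrange_interpolation:
  fixes x :: "nat \<Rightarrow> 'a::{field,ring_char_0}"
  assumes "inj_on x {..<n}" "degree q < n"
  shows "(\<Sum>i<n. (\<Prod>k\<in>{..<n} - {i}. (z - x k) / (x i - x k)) * poly q (x i)) = poly q z"
proof -
  define r where "r = (\<Sum>i<n. Polynomial.smult (poly q (x i)) (\<Prod>k\<in>{..<n} - {i}. Polynomial.smult (1 / (x i - x k)) [:- x k, 1:]))"
  have pr: "poly r y = (\<Sum>i<n. (\<Prod>k\<in>{..<n} - {i}. (y - x k) / (x i - x k)) * poly q (x i))" for y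
    by (simp add: r_def poly_sum poly_prod mult_ac diff_divide_distrib)
  have "degree r < n"
  proof -
    have "degree (Polynomial.smult (poly q (x i)) (\<Prod>k\<in>{..<n} - {i}. Polynomial.smult (1 / (x i - x k)) [:- x k, 1:])) \<le> n - 1" if "i < n" for i
    proof -
      have "degree (Polynomial.smult (poly q (x i)) (\<Prod>k\<in>{..<n} - {i}. Polynomial.smult (1 / (x i - x k)) [:- x k, 1:])) \<le>
         degree (\<Prod>k\<in>{..<n} - {i}. Polynomial.smult (1 / (x i - x k)) [:- x k, 1:])"
        by (rule degree_smult_le)
      also have "\<dots> \<le> (\<Sum>k\<in>{..<n} - {i}. degree (Polynomial.smult (1 / (x i - x k)) [:- x k, 1:]))"
        by (rule degree_prod_sum_le[unfolded o_def]) simp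
      also have "\<dots> \<le> (\<Sum>k\<in>{..<n} - {i}. 1)" by (intro sum_mono) auto
      also have "\<dots> = n - 1" using that by simp
      finally show ?thesis .
    qed
    then have "degree r \<le> n - 1" unfolding r_def by (intro degree_sum_le) auto
    then show ?thesis using assms(2) by linarith
  qed
  have "poly r (x j) = poly q (x j)" if "j < n" for j
  proof -
    have "(\<Prod>k\<in>{..<n} - {i}. (x j - x k) / (x i - x k)) = (if i = j then 1 else 0)" if "i < n" for i
    proof (cases "i = j")
      case True
      have "(x j - x k) / (x i - x k) = 1" if "k \<in> {..<n} - {i}" for k
      proof -
        have "x j \<noteq> x k" using inj_onD[OF assms(1), of j k] that True \<open>j < n\<close> by auto
        then show ?thesis by (simp add: True)
      qed
      then show ?thesis using True by (simp add: prod.neutral)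
    next
      case False
      then show ?thesis using \<open>j < n\<close> by (auto intro!: prod_zero)
    qed
    then have "poly r (x j) = (\<Sum>i<n. (if i = j then 1 else 0) * poly q (x i))"
      unfolding pr by (intro sum.cong) auto
    also have "\<dots> = poly q (x j)" using that by (simp add: if_distrib[of "\<lambda>a. a * _"] cong: if_cong)
    finally show ?thesis .
  qed
  then have "poly (r - q) (x j) = 0" if "j < n" for j using that by simp
  then have "x ` {..<n} \<subseteq> {y. poly (r - q) y = 0}" by auto
  moreover have "card (x ` {..<n}) = n" using assms(1) by (simp add: card_image)
  moreover have "degree (r - q) < n" using \<open>degree r < n\<close> assms(2) degree_diff_le_max[of r q] by linarith
  ultimately have "r - q = 0"
    using card_poly_roots_bound[of "r - q"] poly_roots_finite[of "r - q"] card_mono[of "{y. poly (r - q) y = 0}" "x ` {..<n}"]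
    by fastforce
  then show ?thesis using pr[of z] by simp
qed

text \<open>\<open>synthetic_div q c\<close> is the difference quotient of \<open>q\<close> at
  \<open>c\<close>, a polynomial whose value at \<open>c\<close> itself is the derivative.\<close>

lemma poly_synthetic_div_self:
  fixes c :: "'a::idom"
  shows "poly (synthetic_div q c) c = poly (pderiv q) c"
proof -
  have "pderiv q = pderiv ([:- c, 1:] * synthetic_div q c + [:poly q c:])"
    using synthetic_div_correct'[of c q] by simp
  also have "poly \<dots> c = poly (synthetic_div q c) c"
    by (simp add: pderiv_add pderiv_diff pderiv_smult pderiv_pCons)
  finally show ?thesis ..
qed

lemma poly_synthetic_div:
  fixes c :: "'a::comm_ring_1"
  shows "(x - c) * poly (synthetic_div q c) x = poly q x - poly q c"
proof -
  have "poly q x = poly ([:- c, 1:] * synthetic_div q c + [:poly q c:]) x"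
    using synthetic_div_correct'[of c q] by simp
  then show ?thesis by (simp add: algebra_simps)
qed

text \<open>Interpolation of a simple pole. The function \<open>1 / (z - x)\<close> is no
  polynomial, but \<open>d z / (z - x i)\<close>, with \<open>d\<close> the nodal polynomial, is the
  value at \<open>x i\<close> of the difference quotient of \<open>d\<close> at \<open>z\<close>,
  which has degree below \<open>n\<close>. At \<open>y = z\<close> this quotient becomes the
  derivative of \<open>d\<close>, which yields the first case.\<close>

lemma lagrange_cauchy_sum:
  fixes x :: "nat \<Rightarrow> 'a::{field,field_char_0}"
  assumes inj: "inj_on x {..<n}" and z: "\<And>i. i < n \<Longrightarrow> z \<noteq> x i" and y: "\<And>i. i < n \<Longrightarrow> y \<noteq> x i"
  shows "(\<Sum>i<n. (\<Prod>k\<in>{..<n} - {i}. (y - x k) / (x i - x k)) * (1 / (z - x i))) =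
    (if y = z then \<Sum>i<n. 1 / (z - x i)
     else (1 - (\<Prod>i<n. y - x i) / (\<Prod>i<n. z - x i)) / (z - y))"
proof (cases "n = 0")
  case False
  define d where "d = (\<Prod>i<n. [:- x i, 1:])"
  define q where "q = synthetic_div d z"
  have d: "poly d u = (\<Prod>i<n. u - x i)" for u by (simp add: d_def poly_prod)
  have dz: "poly d z \<noteq> 0" using z by (simp add: d)
  have "degree d = n" unfolding d_def by (subst degree_prod_eq_sum_degree) auto
  then have "degree q < n" using False by (simp add: q_def degree_synthetic_div)
  then have int: "(\<Sum>i<n. (\<Prod>k\<in>{..<n} - {i}. (y - x k) / (x i - x k)) * poly q (x i)) = poly q y"
    by (rule lagrange_interpolation[OF inj])
  have "poly q (x i) = poly d z * (1 / (z - x i))" if "i < n" for i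
  proof -
    have "(x i - z) * poly q (x i) = - poly d z"
      unfolding q_def poly_synthetic_div using that by (auto simp: d prod_zero_iff intro!: prod_zero)
    then show ?thesis using z[OF that] by (simp add: field_simps)
  qed
  then have "poly d z * (\<Sum>i<n. (\<Prod>k\<in>{..<n} - {i}. (y - x k) / (x i - x k)) * (1 / (z - x i))) = poly q y"
    unfolding int[symmetric] sum_distrib_left by (intro sum.cong) auto
  then have *: "(\<Sum>i<n. (\<Prod>k\<in>{..<n} - {i}. (y - x k) / (x i - x k)) * (1 / (z - x i))) = poly q y / poly d z"
    using dz by (simp add: field_simps)
  show ?thesis
  proof (cases "y = z")
    case True
    have "poly q z = poly (pderiv d) z" unfolding q_def by (rule poly_synthetic_div_self)
    also have "\<dots> = (\<Sum>i<n. \<Prod>k\<in>{..<n} - {i}. z - x k)"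
      by (simp add: d_def pderiv_prod poly_sum poly_prod pderiv_pCons)
    also have "\<dots> = poly d z * (\<Sum>i<n. 1 / (z - x i))"
      unfolding sum_distrib_left
    proof (intro sum.cong refl)
      fix i assume i: "i \<in> {..<n}"
      have "poly d z = (z - x i) * (\<Prod>k\<in>{..<n} - {i}. z - x k)"
        unfolding d by (rule prod.remove) (use i in auto)
      then show "(\<Prod>k\<in>{..<n} - {i}. z - x k) = poly d z * (1 / (z - x i))"
        using z i by (simp add: field_simps)
    qed
    finally show ?thesis using True dz * by simp
  next
    case yz: False
    have "(y - z) * poly q y = poly d y - poly d z" unfolding q_def by (rule poly_synthetic_div)
    then have "poly q y = (poly d z - poly d y) / (z - y)" using yz by (simp add: field_simps)
    then show ?thesis using yz dz unfolding * by (simp add: d[symmetric] divide_simps)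
  qed
qed auto

section \<open>Orthogonal polynomials\<close>
text \<open>The weight lives on the whole line and vanishes outside \<open>I\<close>, so that
  integrals over \<open>I\<close> become integrals over \<open>lborel\<close> and product measures
  can be used directly.\<close>

locale orthogonal_polys =
  fixes w :: "real \<Rightarrow> real" and I :: "real set" and p :: "nat \<Rightarrow> complex poly" and h :: "nat \<Rightarrow> complex"
  assumes deg: "degree (p l) = l" and monic: "lead_coeff (p l) = 1" and h_nz: "h l \<noteq> 0"
    and integrable_pp: "integrable lborel (\<lambda>x. poly (p l) (of_real x) * poly (p m) (of_real x) * of_real (w x))"
    and integral_pp: "(LINT x|lborel. poly (p l) (of_real x) * poly (p m) (of_real x) * of_real (w x)) = (if l = m then h l else 0)"
    and closed_I: "closed I" and support: "\<And>x. x \<notin> I \<Longrightarrow> w x = 0"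
begin

definition moment :: "complex poly \<Rightarrow> complex" where
  "moment q = (LINT x|lborel. poly q (of_real x) * of_real (w x))"

text \<open>The Cauchy transform with denominator \<open>z - x\<close>, opposite in sign to the
  integrals in \<open>Ymat\<close>.\<close>

definition second_kind :: "nat \<Rightarrow> complex \<Rightarrow> complex" where
  "second_kind a z = (LINT x|lborel. poly (p a) (of_real x) * of_real (w x) / (z - of_real x))"

definition cd_kernel :: "nat \<Rightarrow> complex \<Rightarrow> complex \<Rightarrow> complex" where
  "cd_kernel n u x = (\<Sum>a<n. poly (p a) u * poly (p a) x / h a)"

lemma p_0: "p 0 = 1"
proof -
  obtain c where "p 0 = [:c:]" using deg[of 0] by (auto elim: degree_eq_zeroE)
  then show ?thesis using monic[of 0] by (simp add: one_pCons)
qed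

lemma expand: "degree q \<le> n \<Longrightarrow> \<exists>c. q = (\<Sum>a\<le>n. Polynomial.smult (c a) (p a))"
proof (induction n arbitrary: q)
  case 0
  then obtain c where "q = [:c:]" by (auto elim: degree_eq_zeroE)
  then show ?case by (intro exI[of _ "\<lambda>_. c"]) (simp add: p_0)
next
  case (Suc n)
  define r where "r = q - Polynomial.smult (coeff q (Suc n)) (p (Suc n))"
  have "coeff r k = 0" if "k > n" for k
  proof (cases "k = Suc n")
    case True
    then show ?thesis using monic[of "Suc n"] deg[of "Suc n"] by (simp add: r_def)
  next
    case False
    then have "k > Suc n" using that by simp
    then show ?thesis using Suc.prems deg[of "Suc n"] by (simp add: r_def coeff_eq_0)
  qed
  then have "degree r \<le> n" by (intro degree_le) auto
  from Suc.IH[OF this] obtain c where c: "r = (\<Sum>a\<le>n. Polynomial.smult (c a) (p a))" by blast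
  have "q = r + Polynomial.smult (coeff q (Suc n)) (p (Suc n))" by (simp add: r_def)
  also have "\<dots> = (\<Sum>a\<le>Suc n. Polynomial.smult ((c(Suc n := coeff q (Suc n))) a) (p a))"
    unfolding c by simp
  finally show ?case by blast
qed

lemma integrable_poly:
  fixes q :: "complex poly"
  shows "integrable lborel (\<lambda>x. poly q (of_real x) * of_real (w x))"
proof -
  obtain c where c: "q = (\<Sum>a\<le>degree q. Polynomial.smult (c a) (p a))" using expand[of q] by blast
  have "integrable lborel (\<lambda>x. \<Sum>a\<le>degree q. c a * (poly (p a) (of_real x) * poly (p 0) (of_real x) * of_real (w x)))"
    by (intro Bochner_Integration.integrable_sum integrable_mult_right integrable_pp)
  also have "(\<lambda>x. \<Sum>a\<le>degree q. c a * (poly (p a) (of_real x) * poly (p 0) (of_real x) * of_real (w x)))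
     = (\<lambda>x. poly (\<Sum>a\<le>degree q. Polynomial.smult (c a) (p a)) (of_real x) * of_real (w x))"
    by (simp add: p_0 poly_sum sum_distrib_left mult_ac)
  finally show ?thesis unfolding c[symmetric] .
qed

lemma moment_add: "moment (q + r) = moment q + moment r"
  and moment_diff: "moment (q - r) = moment q - moment r"
  and moment_smult: "moment (Polynomial.smult c q) = c * moment q"
  unfolding moment_def
  by (simp_all add: distrib_right left_diff_distrib integrable_poly mult.assoc)

lemma moment_0 [simp]: "moment 0 = 0" by (simp add: moment_def)

lemma moment_sum: "moment (\<Sum>a\<in>A. f a) = (\<Sum>a\<in>A. moment (f a))"
  by (induction A rule: infinite_finite_induct) (simp_all add: moment_add)

lemma moment_pp: "moment (p l * p m) = (if l = m then h l else 0)"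
  using integral_pp[of l m] by (simp add: moment_def)

lemma moment_low: "degree q < m \<Longrightarrow> moment (q * p m) = 0"
proof -
  assume q: "degree q < m"
  obtain c where c: "q = (\<Sum>a\<le>degree q. Polynomial.smult (c a) (p a))" using expand[of q] by blast
  have "moment ((\<Sum>a\<le>degree q. Polynomial.smult (c a) (p a)) * p m) = 0"
    unfolding sum_distrib_right moment_sum mult_smult_left moment_smult moment_pp
    using q by (intro sum.neutral) auto
  then show ?thesis using c by simp
qed

text \<open>A monic polynomial of degree \<open>m\<close> differs from \<open>p m\<close> by a
  polynomial of lower degree, which is orthogonal to \<open>p m\<close>.\<close>

lemma moment_monic:
  assumes "degree q = m" "lead_coeff q = 1" shows "moment (q * p m) = h m"
proof -
  have "moment (q * p m) = moment ((q - p m) * p m) + moment (p m * p m)"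
    by (simp add: moment_add[symmetric] algebra_simps)
  moreover have "moment ((q - p m) * p m) = 0"
  proof (cases "q - p m = 0")
    case False
    have "coeff (q - p m) k = 0" if "k \<ge> m" for k
      using that assms deg[of m] monic[of m] by (cases "k = m") (auto simp: coeff_eq_0)
    then have "degree (q - p m) < m"
      using False by (metis leading_coeff_neq_0 not_le_imp_less)
    then show ?thesis by (rule moment_low)
  qed simp
  ultimately show ?thesis by (simp add: moment_pp)
qed

text \<open>The coefficient of \<open>p m\<close> in \<open>x * p n\<close> is the moment of
  \<open>x * p m * p n\<close> divided by \<open>h m\<close>. For \<open>m + 1 < n\<close> it
  vanishes by orthogonality; for \<open>m + 1 = n\<close> it is \<open>h n / h m\<close>, because
  \<open>x * p m\<close> is monic of degree \<open>n\<close>.\<close>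

lemma three_term:
  "\<exists>b. [:0, 1:] * p (Suc n) = p (Suc (Suc n)) + Polynomial.smult b (p (Suc n)) + Polynomial.smult (h (Suc n) / h n) (p n)"
  "\<exists>b. [:0, 1:] * p 0 = p (Suc 0) + Polynomial.smult b (p 0)"
proof -
  have degx: "degree ([:0, 1:] * p n) = Suc n" "lead_coeff ([:0, 1:] * p n) = 1" for n
    using deg[of n] monic[of n] by (auto simp: degree_mult_eq degree_pCons_eq_if)
  have low: "degree ([:0, 1:] * p n - p (Suc n)) \<le> n" for n
  proof (rule degree_le, intro allI impI)
    fix k assume "n < k"
    then show "coeff ([:0, 1:] * p n - p (Suc n)) k = 0"
      using degx[of n] deg[of "Suc n"] monic[of "Suc n"]
      by (cases "k = Suc n") (auto simp: coeff_eq_0)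
  qed
  have coef: "\<exists>c. [:0, 1:] * p n = p (Suc n) + (\<Sum>a\<le>n. Polynomial.smult (c a) (p a)) \<and>
     (\<forall>m\<le>n. c m * h m = moment ([:0, 1:] * p m * p n))" for n
  proof -
    obtain c where c: "[:0, 1:] * p n - p (Suc n) = (\<Sum>a\<le>n. Polynomial.smult (c a) (p a))"
      using expand[OF low] by blast
    have "c m * h m = moment ([:0, 1:] * p m * p n)" if "m \<le> n" for m
    proof -
      have "moment (([:0, 1:] * p n - p (Suc n)) * p m) = (\<Sum>a\<le>n. c a * (if a = m then h a else 0))"
        unfolding c sum_distrib_right moment_sum mult_smult_left moment_smult moment_pp ..
      also have "\<dots> = c m * h m" using that by (simp add: if_distrib cong: if_cong)
      also have "moment (([:0, 1:] * p n - p (Suc n)) * p m) = moment ([:0, 1:] * p m * p n)"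
        using that by (simp only: left_diff_distrib moment_diff moment_pp) (simp add: mult_ac)
      finally show ?thesis ..
    qed
    then show ?thesis using c by (metis add.commute diff_add_cancel)
  qed
  show "\<exists>b. [:0, 1:] * p 0 = p (Suc 0) + Polynomial.smult b (p 0)"
    using coef[of 0] by auto
  obtain c where c: "[:0, 1:] * p (Suc n) = p (Suc (Suc n)) + (\<Sum>a\<le>Suc n. Polynomial.smult (c a) (p a))"
     "\<forall>m\<le>Suc n. c m * h m = moment ([:0, 1:] * p m * p (Suc n))" using coef[of "Suc n"] by blast
  have "c n * h n = h (Suc n)" using c(2) moment_monic[OF degx] by simp
  then have cn: "c n = h (Suc n) / h n" using h_nz[of n] by (simp add: field_simps)
  have "c m = 0" if "m < n" for m
  proof -
    have "c m * h m = 0" using c(2) that moment_low[of "[:0, 1:] * p m" "Suc n"] degx[of m] by simp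
    then show ?thesis using h_nz[of m] by simp
  qed
  then have "(\<Sum>a<n. Polynomial.smult (c a) (p a)) = 0" by (intro sum.neutral) auto
  moreover have "(\<Sum>a\<le>n. Polynomial.smult (c a) (p a)) = (\<Sum>a<n. Polynomial.smult (c a) (p a)) + Polynomial.smult (c n) (p n)"
    unfolding lessThan_Suc_atMost[symmetric] by (rule sum.lessThan_Suc)
  ultimately have "(\<Sum>a\<le>Suc n. Polynomial.smult (c a) (p a)) = Polynomial.smult (c (Suc n)) (p (Suc n)) + Polynomial.smult (c n) (p n)"
    by simp
  then show "\<exists>b. [:0, 1:] * p (Suc n) = p (Suc (Suc n)) + Polynomial.smult b (p (Suc n)) + Polynomial.smult (h (Suc n) / h n) (p n)"
    using c(1) cn by (metis add.assoc)
qed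

lemma christoffel_darboux:
  "(u - x) * cd_kernel (Suc n) u x = (poly (p (Suc n)) u * poly (p n) x - poly (p n) u * poly (p (Suc n)) x) / h n"
proof (induction n)
  case 0
  obtain b where "[:0, 1:] * p 0 = p (Suc 0) + Polynomial.smult b (p 0)" using three_term(2) by blast
  then have "poly ([:0, 1:] * p 0) y = poly (p (Suc 0) + Polynomial.smult b (p 0)) y" for y by simp
  then have "poly (p (Suc 0)) y = y - b" for y by (simp add: p_0 algebra_simps)
  then show ?case using h_nz[of 0] by (simp add: cd_kernel_def p_0)
next
  case (Suc n)
  obtain b where "[:0, 1:] * p (Suc n) = p (Suc (Suc n)) + Polynomial.smult b (p (Suc n)) + Polynomial.smult (h (Suc n) / h n) (p n)"
    using three_term(1) by blast
  then have "poly ([:0, 1:] * p (Suc n)) y = poly (p (Suc (Suc n)) + Polynomial.smult b (p (Suc n)) + Polynomial.smult (h (Suc n) / h n) (p n)) y" for y by simp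
  then have r: "poly (p (Suc (Suc n))) y = (y - b) * poly (p (Suc n)) y - h (Suc n) / h n * poly (p n) y" for y
    by (simp add: algebra_simps)
  have "(u - x) * cd_kernel (Suc (Suc n)) u x = (u - x) * cd_kernel (Suc n) u x + (u - x) * (poly (p (Suc n)) u * poly (p (Suc n)) x / h (Suc n))"
    by (simp add: cd_kernel_def distrib_left)
  also have "\<dots> = (poly (p (Suc (Suc n))) u * poly (p (Suc n)) x - poly (p (Suc n)) u * poly (p (Suc (Suc n))) x) / h (Suc n)"
    unfolding Suc.IH r using h_nz[of n] h_nz[of "Suc n"] by (simp add: field_simps)
  finally show ?case .
qed

text \<open>On the closed set \<open>I\<close> the denominator is bounded away from zero, and off
  \<open>I\<close> the integrand vanishes.\<close>

lemma integrable_w_cauchy: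
  assumes "z \<notin> complex_of_real ` I"
  shows "integrable lborel (\<lambda>x. poly q (of_real x) * of_real (w x) / (z - of_real x))"
proof -
  have "closed (complex_of_real ` I)" using closed_I
    by (intro closed_injective_linear_image) (auto simp: linear_of_real inj_def)
  then obtain e where e: "e > 0" "\<And>y. y \<in> complex_of_real ` I \<Longrightarrow> e \<le> dist z y"
    using separate_point_closed[OF _ assms] by blast
  have m: "(\<lambda>x. poly q (of_real x) * complex_of_real (w x)) \<in> borel_measurable lborel"
    by (rule borel_measurable_integrable[OF integrable_poly])
  show ?thesis
  proof (rule Bochner_Integration.integrable_bound)
    show "integrable lborel (\<lambda>x. inverse e *\<^sub>R norm (poly q (of_real x) * complex_of_real (w x)))"
      by (intro integrable_scaleR_right integrable_norm integrable_poly)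
    show "(\<lambda>x. poly q (of_real x) * complex_of_real (w x) / (z - of_real x)) \<in> borel_measurable lborel"
      by (intro borel_measurable_divide m borel_measurable_diff borel_measurable_const) simp
    show "AE x in lborel. norm (poly q (of_real x) * complex_of_real (w x) / (z - of_real x)) \<le> norm (inverse e *\<^sub>R norm (poly q (of_real x) * complex_of_real (w x)))"
    proof (rule AE_I2)
      fix x
      show "norm (poly q (of_real x) * complex_of_real (w x) / (z - of_real x)) \<le> norm (inverse e *\<^sub>R norm (poly q (of_real x) * complex_of_real (w x)))"
      proof (cases "x \<in> I")
        case True
        then have "e \<le> norm (z - of_real x)" using e(2) by (auto simp: dist_norm)
        then have "norm (poly q (of_real x) * complex_of_real (w x)) / norm (z - of_real x) \<le> norm (poly q (of_real x) * complex_of_real (w x)) / e"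
          using e(1) by (intro divide_left_mono mult_pos_pos) auto
        then show ?thesis using e(1) by (simp add: norm_divide norm_mult norm_inverse divide_inverse mult_ac)
      qed (simp add: support)
    qed
  qed
qed

text \<open>The Christoffel-Darboux identity integrated against \<open>w x / (z - x)\<close>.
  Writing \<open>u - z\<close> as \<open>(u - x) - (z - x)\<close> leaves over the integral of the
  kernel alone, which is the \<open>1\<close> on the left.\<close>

lemma second_kind_christoffel_darboux:
  assumes z: "z \<notin> complex_of_real ` I"
  shows "(u - z) * (\<Sum>a<Suc n. poly (p a) u * second_kind a z / h a) + 1 =
    (poly (p (Suc n)) u * second_kind n z - poly (p n) u * second_kind (Suc n) z) / h n"
proof -
  have zx: "z \<noteq> of_real x" if "x \<in> I" for x using z that by blast
  \<comment> \<open>The kernel reproduces constants: only the term \<open>a = 0\<close> survives,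
    since \<open>p 0 = 1\<close>.\<close>
  have K1: "(LINT x|lborel. cd_kernel (Suc n) u (of_real x) * of_real (w x)) = 1"
  proof -
    have "(LINT x|lborel. cd_kernel (Suc n) u (of_real x) * of_real (w x)) =
        moment (\<Sum>a<Suc n. Polynomial.smult (poly (p a) u / h a) (p a * p 0))"
      by (simp only: moment_def cd_kernel_def poly_sum) (simp add: p_0 mult_ac)
    also have "\<dots> = (\<Sum>a<Suc n. poly (p a) u / h a * (if a = 0 then h a else 0))"
      unfolding moment_sum moment_smult moment_pp ..
    also have "\<dots> = 1" by (subst sum.lessThan_Suc_shift) (simp add: p_0 h_nz)
    finally show ?thesis .
  qed
  have iK: "integrable lborel (\<lambda>x. cd_kernel (Suc n) u (of_real x) * of_real (w x))"
    using integrable_poly[of "\<Sum>a<Suc n. Polynomial.smult (poly (p a) u / h a) (p a)"]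
    by (simp only: poly_sum cd_kernel_def) (simp add: mult_ac)
  have int: "integrable lborel (\<lambda>x. poly (p a) u * (poly (p a) (of_real x) * of_real (w x) / (z - of_real x)) / h a)" for a
    by (intro integrable_divide integrable_mult_right integrable_w_cauchy z)
  have i1: "integrable lborel (\<lambda>x. c * (poly (p a) (of_real x) * of_real (w x) / (z - of_real x)))" for c a
    by (intro integrable_mult_right integrable_w_cauchy z)
  have term_int: "(LINT x|lborel. poly (p a) u * (poly (p a) (of_real x) * of_real (w x) / (z - of_real x)) / h a) = poly (p a) u * second_kind a z / h a" for a
    unfolding second_kind_def by (simp only: integral_divide_zero integral_mult_right_zero)
  have "(u - z) * (\<Sum>a<Suc n. poly (p a) u * second_kind a z / h a) =
     (LINT x|lborel. (u - z) * (\<Sum>a<Suc n. poly (p a) u * (poly (p a) (of_real x) * of_real (w x) / (z - of_real x)) / h a))"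
    by (simp only: integral_mult_right_zero Bochner_Integration.integral_sum[OF int] term_int)
  also have "\<dots> = (LINT x|lborel. (poly (p (Suc n)) u * (poly (p n) (of_real x) * of_real (w x) / (z - of_real x)) -
       poly (p n) u * (poly (p (Suc n)) (of_real x) * of_real (w x) / (z - of_real x))) / h n - cd_kernel (Suc n) u (of_real x) * of_real (w x))"
  proof (rule Bochner_Integration.integral_cong[OF refl])
    fix x :: real
    have s: "(\<Sum>a<Suc n. poly (p a) u * (poly (p a) (of_real x) * of_real (w x) / (z - of_real x)) / h a) =
        cd_kernel (Suc n) u (of_real x) * (of_real (w x) / (z - of_real x))"
      by (simp only: cd_kernel_def sum_distrib_right) (simp add: mult_ac)
    show "(u - z) * (\<Sum>a<Suc n. poly (p a) u * (poly (p a) (of_real x) * of_real (w x) / (z - of_real x)) / h a) =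
      (poly (p (Suc n)) u * (poly (p n) (of_real x) * of_real (w x) / (z - of_real x)) -
       poly (p n) u * (poly (p (Suc n)) (of_real x) * of_real (w x) / (z - of_real x))) / h n - cd_kernel (Suc n) u (of_real x) * of_real (w x)"
    proof (cases "x \<in> I")
      case True
      define K where "K = cd_kernel (Suc n) u (of_real x)"
      define t where "t = of_real (w x) / (z - of_real x)"
      have w: "of_real (w x) = (z - of_real x) * t" using zx[OF True] by (simp add: t_def)
      have "(poly (p (Suc n)) u * (poly (p n) (of_real x) * t) - poly (p n) u * (poly (p (Suc n)) (of_real x) * t)) / h n
        = (u - of_real x) * K * t" unfolding K_def christoffel_darboux by (simp add: algebra_simps diff_divide_distrib)
      moreover have "a * of_real (w x) / (z - of_real x) = a * t" for a by (simp add: t_def)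
      moreover have "(u - z) * (K * t) = (u - of_real x) * K * t - K * ((z - of_real x) * t)"
        by (simp add: algebra_simps)
      ultimately show ?thesis unfolding s K_def[symmetric] t_def[symmetric] by (simp only: w)
    qed (simp add: support)
  qed
  also have "\<dots> = (poly (p (Suc n)) u * second_kind n z - poly (p n) u * second_kind (Suc n) z) / h n - 1"
    by (simp only: Bochner_Integration.integral_diff[OF integrable_divide[OF Bochner_Integration.integrable_diff[OF i1 i1]] iK]
        integral_divide_zero Bochner_Integration.integral_diff[OF i1 i1] integral_mult_right_zero K1 second_kind_def)
  finally show ?thesis by simp
qed

end

section \<open>Averages of resolvent determinants\<close>
lemma det_eq_set_det:
  "Determinant.det (Matrix.mat n n (\<lambda>(i, j). f i j)) = set_det f {..<n}"
  by (subst det_def'[of _ n]) (auto simp: set_det_def atLeast0LessThan permutes_in_image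
      intro!: sum.cong prod.cong)

text \<open>The coefficients of monic polynomials form a unitriangular matrix.\<close>

lemma det_monic_powers:
  fixes x :: "nat \<Rightarrow> 'a::idom"
  assumes "\<And>a. degree (p a) = a" "\<And>a. lead_coeff (p a) = 1"
  shows "Determinant.det (Matrix.mat n n (\<lambda>(i, a). poly (p a) (x i))) = Determinant.det (Matrix.mat n n (\<lambda>(i, a). x i ^ a))"
proof -
  let ?X = "Matrix.mat n n (\<lambda>(i, a). x i ^ a)" and ?C = "Matrix.mat n n (\<lambda>(b, a). coeff (p a) b)"
  have "Matrix.mat n n (\<lambda>(i, a). poly (p a) (x i)) = ?X * ?C"
  proof (rule eq_matI)
    fix i a assume ia: "i < dim_row (?X * ?C)" "a < dim_col (?X * ?C)"
    have "poly (p a) (x i) = (\<Sum>b\<le>a. coeff (p a) b * x i ^ b)"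
      using assms(1)[of a] by (simp add: poly_altdef)
    also have "\<dots> = (\<Sum>b<n. coeff (p a) b * x i ^ b)"
      using ia assms(1)[of a] by (intro sum.mono_neutral_left) (auto simp: coeff_eq_0)
    finally show "Matrix.mat n n (\<lambda>(i, a). poly (p a) (x i)) $$ (i, a) = (?X * ?C) $$ (i, a)"
      using ia by (simp add: scalar_prod_def atLeast0LessThan mult.commute)
  qed auto
  moreover have "Determinant.det ?C = 1"
  proof -
    have "coeff (p a) a = 1" for a using assms[of a] by simp
    then have "prod_list (diag_mat ?C) = 1"
      by (simp add: prod_list_diag_prod)
    moreover have "upper_triangular ?C"
      using assms(1) by (auto intro!: upper_triangularI simp: coeff_eq_0)
    ultimately show ?thesis using det_upper_triangular[of ?C n] by simp
  qed
  ultimately show ?thesis using det_mult[of ?X n ?C] by simp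
qed

text \<open>By \<open>det_monic_powers\<close> any monic family gives the same determinant. For
  Newton's family \<open>q\<close>, whose zeros are the points themselves, the matrix is
  triangular.\<close>

lemma det_monic_eq_vandermonde:
  fixes x :: "nat \<Rightarrow> 'a::idom"
  assumes "\<And>a. degree (p a) = a" "\<And>a. lead_coeff (p a) = 1"
  shows "Determinant.det (Matrix.mat n n (\<lambda>(i, a). poly (p a) (x i))) = (\<Prod>i<n. \<Prod>k<i. x i - x k)"
proof -
  define q where "q a = (\<Prod>k<a. [:- x k, 1:])" for a
  let ?Q = "Matrix.mat n n (\<lambda>(i, a). poly (q a) (x i))"
  have q: "degree (q a) = a" "lead_coeff (q a) = 1" for a
    unfolding q_def by (subst degree_prod_eq_sum_degree; simp) (simp add: lead_coeff_prod)
  have "Determinant.det ?Q = prod_list (diag_mat ?Q)"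
  proof (rule det_lower_triangular)
    fix i j assume "i < j" "j < n"
    then show "?Q $$ (i, j) = 0" by (auto simp: q_def poly_prod intro!: prod_zero)
  qed simp
  also have "\<dots> = (\<Prod>i<n. \<Prod>k<i. x i - x k)"
    by (simp add: prod_list_diag_prod atLeast0LessThan q_def poly_prod)
  finally show ?thesis
    using det_monic_powers[of p n x, OF assms] det_monic_powers[of q n x, OF q] by simp
qed

text \<open>Each of the first \<open>n\<close> rows depends on one variable only, so every term of
  the Leibniz expansion is a product over the variables and Fubini's theorem integrates the rows
  separately. The last \<open>l\<close> rows are constant.\<close>

lemma integral_det_rows:
  fixes g r :: "nat \<Rightarrow> real \<Rightarrow> complex" and R :: "nat \<Rightarrow> nat \<Rightarrow> complex"
  assumes int: "\<And>i c. i < n \<Longrightarrow> c < n + l \<Longrightarrow> integrable lborel (\<lambda>t. g i t * r c t)"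
  shows "has_bochner_integral (Pi\<^sub>M {..<n} (\<lambda>_. lborel))
     (\<lambda>x. (\<Prod>i<n. g i (x i)) * Determinant.det (Matrix.mat (n + l) (n + l) (\<lambda>(k, c). if k < n then r c (x k) else R k c)))
     (Determinant.det (Matrix.mat (n + l) (n + l) (\<lambda>(k, c). if k < n then LINT t|lborel. g k t * r c t else R k c)))"
proof -
  interpret product_sigma_finite "\<lambda>_::nat. lborel :: real measure" by standard
  have split: "(\<Prod>k<n + l. if k < n then f k else e k) = (\<Prod>k<n. f k) * (\<Prod>k\<in>{n..<n + l}. e k)"
    for f e :: "nat \<Rightarrow> complex"
  proof -
    have "{..<n + l} = {..<n} \<union> {n..<n + l}" by auto
    then have "(\<Prod>k<n + l. if k < n then f k else e k) = (\<Prod>k\<in>{..<n} \<union> {n..<n + l}. if k < n then f k else e k)" by simp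
    also have "\<dots> = (\<Prod>k<n. if k < n then f k else e k) * (\<Prod>k\<in>{n..<n + l}. if k < n then f k else e k)"
      by (rule prod.union_disjoint) auto
    also have "\<dots> = (\<Prod>k<n. f k) * (\<Prod>k\<in>{n..<n + l}. e k)"
      by (intro arg_cong2[where f="(*)"] prod.cong) auto
    finally show ?thesis .
  qed
  let ?P = "{\<pi>. \<pi> permutes {..<n + l}}"
  let ?t = "\<lambda>\<pi>. of_int (sign \<pi>) * (\<Prod>k\<in>{n..<n + l}. R k (\<pi> k))"
  have "has_bochner_integral (Pi\<^sub>M {..<n} (\<lambda>_. lborel))
     (\<lambda>x. \<Sum>\<pi>\<in>?P. ?t \<pi> * (\<Prod>k<n. g k (x k) * r (\<pi> k) (x k)))
     (\<Sum>\<pi>\<in>?P. ?t \<pi> * (\<Prod>k<n. LINT t|lborel. g k t * r (\<pi> k) t))"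
  proof (intro has_bochner_integral_sum has_bochner_integral_mult_right)
    fix \<pi> assume "\<pi> \<in> ?P"
    then have "\<pi> k < n + l" if "k < n" for k
      using permutes_in_image[of \<pi> "{..<n + l}" k] that by auto
    then have i: "integrable lborel (\<lambda>t. g k t * r (\<pi> k) t)" if "k \<in> {..<n}" for k using int that by auto
    show "has_bochner_integral (Pi\<^sub>M {..<n} (\<lambda>_. lborel)) (\<lambda>x. \<Prod>k<n. g k (x k) * r (\<pi> k) (x k)) (\<Prod>k<n. LINT t|lborel. g k t * r (\<pi> k) t)"
      using product_integrable_prod[OF finite_lessThan i] product_integral_prod[OF finite_lessThan i]
      by (simp add: has_bochner_integral_iff)
  qed
  also have "(\<lambda>x. \<Sum>\<pi>\<in>?P. ?t \<pi> * (\<Prod>k<n. g k (x k) * r (\<pi> k) (x k))) =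
    (\<lambda>x. (\<Prod>i<n. g i (x i)) * Determinant.det (Matrix.mat (n + l) (n + l) (\<lambda>(k, c). if k < n then r c (x k) else R k c)))"
    unfolding det_eq_set_det set_det_def split prod.distrib sum_distrib_left by (simp add: mult_ac)
  also have "(\<Sum>\<pi>\<in>?P. ?t \<pi> * (\<Prod>k<n. LINT t|lborel. g k t * r (\<pi> k) t)) =
     Determinant.det (Matrix.mat (n + l) (n + l) (\<lambda>(k, c). if k < n then LINT t|lborel. g k t * r c t else R k c))"
    unfolding det_eq_set_det set_det_def split by (simp add: mult_ac)
  finally show ?thesis .
qed

text \<open>A permutation meets every row and every column once, so the diagonal factors cancel in
  each term.\<close>

lemma set_det_conjugate:
  fixes f :: "'a \<Rightarrow> 'a \<Rightarrow> 'b::field"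
  assumes "finite S" "\<And>i. i \<in> S \<Longrightarrow> d i \<noteq> 0"
  shows "set_det (\<lambda>i j. d i / d j * f i j) S = set_det f S"
  unfolding set_det_def
proof (intro sum.cong refl arg_cong2[where f="(*)"])
  fix \<pi> assume "\<pi> \<in> {\<pi>. \<pi> permutes S}"
  then have "\<pi> permutes S" by simp
  then have "(\<Prod>i\<in>S. d (\<pi> i)) = (\<Prod>i\<in>S. d i)"
    by (rule prod.reindex_bij_betw[OF permutes_imp_bij])
  then show "(\<Prod>i\<in>S. d i / d (\<pi> i) * f i (\<pi> i)) = (\<Prod>i\<in>S. f i (\<pi> i))"
    using assms by (simp add: prod.distrib prod_dividef)
qed

lemma set_det_cong:
  assumes "\<And>i j. i \<in> S \<Longrightarrow> j \<in> S \<Longrightarrow> f i j = g i j" shows "set_det f S = set_det g S"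
  unfolding set_det_def using assms
  by (intro sum.cong refl arg_cong2[where f="(*)"] prod.cong) (auto simp: permutes_in_image)

definition cauchy_off :: "('i \<Rightarrow> complex) \<Rightarrow> 'i \<Rightarrow> 'i \<Rightarrow> complex" where
  "cauchy_off \<zeta> i j = (if i = j then 0 else 1 / (\<zeta> i - \<zeta> j))"

section \<open>The block determinant, pointwise and on average\<close>

context orthogonal_polys
begin

definition weight_prod :: "nat \<Rightarrow> (nat \<Rightarrow> real) \<Rightarrow> complex" where
  "weight_prod n x = (\<Prod>i<n. of_real (w (x i)))"

text \<open>The upper rows evaluate polynomials and simple poles at one eigenvalue each. The lower
  rows, given by \<open>source_row\<close>, are chosen such that block elimination leaves the Cauchy
  matrix plus the interpolated poles.\<close>

definition ensemble_row :: "nat \<Rightarrow> (nat \<Rightarrow> complex) \<Rightarrow> nat \<Rightarrow> real \<Rightarrow> complex" where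
  "ensemble_row n \<zeta> c t = (if c < n then poly (p c) (of_real t) else 1 / (\<zeta> (c - n) - of_real t))"

definition source_row :: "nat \<Rightarrow> (nat \<Rightarrow> complex) \<Rightarrow> nat \<Rightarrow> nat \<Rightarrow> complex" where
  "source_row n \<zeta> k c = (if c < n then - poly (p c) (\<zeta> (k - n)) else cauchy_off \<zeta> (k - n) (c - n))"

definition ensemble_det :: "nat \<Rightarrow> nat \<Rightarrow> (nat \<Rightarrow> complex) \<Rightarrow> (nat \<Rightarrow> real) \<Rightarrow> complex" where
  "ensemble_det n l \<zeta> x = Determinant.det (Matrix.mat (n + l) (n + l)
     (\<lambda>(k, c). if k < n then ensemble_row n \<zeta> c (x k) else source_row n \<zeta> k c))"

definition resolvent_sum :: "nat \<Rightarrow> (nat \<Rightarrow> real) \<Rightarrow> complex \<Rightarrow> complex" where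
  "resolvent_sum n x z = (\<Sum>i<n. 1 / (z - of_real (x i)))"

lemma vandermonde_set_det:
  "Determinant.det (Matrix.mat n n (\<lambda>(i, a). poly (p a) (x i))) = (\<Prod>i<n. \<Prod>k<i. x i - x k)"
  by (rule det_monic_eq_vandermonde) (simp_all add: deg monic[unfolded deg])

text \<open>Block elimination with the Lagrange coefficients \<open>L\<close>. By
  \<open>lagrange_cauchy_sum\<close> the Schur complement is the matrix of resolvent sums and Cauchy
  entries, conjugated by the diagonal matrix of the values \<open>d j\<close> of the characteristic
  polynomial.\<close>

lemma ensemble_det_eq:
  assumes inj: "inj_on \<zeta> {..<l}" and z: "\<And>i j. i < n \<Longrightarrow> j < l \<Longrightarrow> \<zeta> j \<noteq> of_real (x i)"
  shows "ensemble_det n l \<zeta> x = (\<Prod>i<n. \<Prod>k<i. of_real (x i) - of_real (x k)) *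
    set_det (\<lambda>i j. (if i = j then resolvent_sum n x (\<zeta> i) else 0) + cauchy_off \<zeta> i j) {..<l}"
proof (cases "inj_on (\<lambda>i. complex_of_real (x i)) {..<n}")
  case True
  let ?y = "\<lambda>i. complex_of_real (x i)"
  define L where "L j i = (\<Prod>k\<in>{..<n} - {i}. (\<zeta> j - ?y k) / (?y i - ?y k))" for j i
  define d where "d j = (\<Prod>i<n. \<zeta> j - ?y i)" for j
  have d0: "d j \<noteq> 0" if "j < l" for j using z that by (auto simp: d_def)
  have "ensemble_det n l \<zeta> x = Determinant.det (Matrix.mat (n + l) (n + l) (\<lambda>(k, c).
     if k < n then (if c < n then poly (p c) (?y k) else 1 / (\<zeta> (c - n) - ?y k))
      else (if c < n then - poly (p c) (\<zeta> (k - n)) else cauchy_off \<zeta> (k - n) (c - n))))"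
    unfolding ensemble_det_def ensemble_row_def source_row_def ..
  also have "\<dots> = Determinant.det (Matrix.mat n n (\<lambda>(i, a). poly (p a) (?y i))) *
      Determinant.det (Matrix.mat l l (\<lambda>(j, c). cauchy_off \<zeta> j c + (\<Sum>i<n. L j i * (1 / (\<zeta> c - ?y i)))))"
    by (rule det_block_elimination) (unfold L_def, rule lagrange_interpolation, rule True, simp add: deg)
  also have "Determinant.det (Matrix.mat l l (\<lambda>(j, c). cauchy_off \<zeta> j c + (\<Sum>i<n. L j i * (1 / (\<zeta> c - ?y i))))) =
     set_det (\<lambda>i j. d i / d j * ((if i = j then resolvent_sum n x (\<zeta> i) else 0) + cauchy_off \<zeta> i j)) {..<l}"
    unfolding det_eq_set_det
  proof (rule set_det_cong)
    fix j c assume jc: "j \<in> {..<l}" "c \<in> {..<l}"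
    have s: "(\<Sum>i<n. L j i * (1 / (\<zeta> c - ?y i))) = (if \<zeta> j = \<zeta> c then \<Sum>i<n. 1 / (\<zeta> c - ?y i)
        else (1 - d j / d c) / (\<zeta> c - \<zeta> j))"
      unfolding L_def d_def by (rule lagrange_cauchy_sum[OF True]) (use z jc in auto)
    show "cauchy_off \<zeta> j c + (\<Sum>i<n. L j i * (1 / (\<zeta> c - ?y i))) =
       d j / d c * ((if j = c then resolvent_sum n x (\<zeta> j) else 0) + cauchy_off \<zeta> j c)"
    proof (cases "j = c")
      case True
      then show ?thesis unfolding s using d0 jc by (simp add: cauchy_off_def resolvent_sum_def)
    next
      case False
      then have "\<zeta> j - \<zeta> c \<noteq> 0" using inj jc by (auto simp: inj_on_def)
      then have "1 / (\<zeta> j - \<zeta> c) + (1 - d j / d c) / (\<zeta> c - \<zeta> j) = d j / d c * (1 / (\<zeta> j - \<zeta> c))"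
        using d0 jc by (simp add: divide_simps) (simp add: algebra_simps)
      then show ?thesis unfolding s using False \<open>\<zeta> j - \<zeta> c \<noteq> 0\<close> by (simp add: cauchy_off_def)
    qed
  qed
  also have "\<dots> = set_det (\<lambda>i j. (if i = j then resolvent_sum n x (\<zeta> i) else 0) + cauchy_off \<zeta> i j) {..<l}"
    by (rule set_det_conjugate) (use d0 in auto)
  also note vandermonde_set_det
  finally show ?thesis .
next
  case False
  \<comment> \<open>Interpolation breaks down at coinciding eigenvalues, but there both sides
    vanish: two rows on the left are equal, and a Vandermonde factor on the right is zero.\<close>
  then obtain i k where ik: "i < n" "k < n" "i \<noteq> k" "x i = x k" by (auto simp: inj_on_def)
  have "ensemble_det n l \<zeta> x = 0"
    unfolding ensemble_det_def
    by (rule det_identical_rows[of _ "n + l" i k]) (use ik in \<open>auto simp: row_def\<close>)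
  moreover have "(\<Prod>i<n. \<Prod>k<i. complex_of_real (x i) - of_real (x k)) = 0"
  proof (cases "i < k")
    case True then show ?thesis using ik by (intro prod_zero[OF _ bexI[of _ k]] prod_zero[OF _ bexI[of _ i]]) auto
  next
    case False then show ?thesis using ik by (intro prod_zero[OF _ bexI[of _ i]] prod_zero[OF _ bexI[of _ k]]) auto
  qed
  ultimately show ?thesis by simp
qed

text \<open>The Cauchy transform of the Christoffel-Darboux kernel in its second variable; on
  average it takes the place of the resolvent sums.\<close>

definition cd_cauchy :: "nat \<Rightarrow> complex \<Rightarrow> complex \<Rightarrow> complex" where
  "cd_cauchy n u z = (\<Sum>a<n. poly (p a) u * second_kind a z / h a)"

text \<open>The Vandermonde factor in front is itself a determinant of the orthogonal polynomials.
  Expanded and multiplied into the rows, it turns the upper left block of the integrated matrix into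
  the diagonal of the \<open>h a\<close>, and elimination produces the kernel sum
  \<open>cd_cauchy\<close>.\<close>

lemma has_bochner_integral_ensemble_det:
  assumes \<zeta>: "\<And>j. j < l \<Longrightarrow> \<zeta> j \<notin> complex_of_real ` I"
  shows "has_bochner_integral (Pi\<^sub>M {..<n} (\<lambda>_. lborel))
     (\<lambda>x. weight_prod n x * (\<Prod>i<n. \<Prod>k<i. of_real (x i) - of_real (x k)) * ensemble_det n l \<zeta> x)
     (fact n * (\<Prod>a<n. h a) * set_det (\<lambda>i j. cauchy_off \<zeta> i j + cd_cauchy n (\<zeta> i) (\<zeta> j)) {..<l})"
proof -
  define G where "G a c = (if c < n then if a = c then h a else 0 else second_kind a (\<zeta> (c - n)))" for a c
  define M where "M = Matrix.mat (n + l) (n + l) (\<lambda>(k, c). if k < n then G k c else source_row n \<zeta> k c)"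
  have detM: "Determinant.det M = (\<Prod>a<n. h a) * set_det (\<lambda>i j. cauchy_off \<zeta> i j + cd_cauchy n (\<zeta> i) (\<zeta> j)) {..<l}"
  proof -
    have "Determinant.det M = Determinant.det (Matrix.mat (n + l) (n + l) (\<lambda>(k, c).
     if k < n then (if c < n then if k = c then h k else 0 else second_kind k (\<zeta> (c - n)))
      else (if c < n then - poly (p c) (\<zeta> (k - n)) else cauchy_off \<zeta> (k - n) (c - n))))"
      unfolding M_def G_def source_row_def ..
    also have "\<dots> = Determinant.det (Matrix.mat n n (\<lambda>(i, a). if i = a then h i else 0)) *
      Determinant.det (Matrix.mat l l (\<lambda>(j, c). cauchy_off \<zeta> j c + (\<Sum>i<n. poly (p i) (\<zeta> j) / h i * second_kind i (\<zeta> c))))"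
      by (rule det_block_elimination) (simp add: if_distrib h_nz cong: if_cong)
    also have "Determinant.det (Matrix.mat n n (\<lambda>(i, a). if i = a then h i else 0)) = (\<Prod>a<n. h a)"
      by (subst det_upper_triangular[of _ n]) (auto simp: prod_list_diag_prod atLeast0LessThan)
    finally show ?thesis by (simp add: det_eq_set_det cd_cauchy_def)
  qed
  \<comment> \<open>A permutation from the expanded factor merely permutes the upper rows of
    \<open>M\<close>. The two signs cancel, so the \<open>fact n\<close> terms agree.\<close>
  let ?P = "{\<sigma>. \<sigma> permutes {..<n}}"
  have "has_bochner_integral (Pi\<^sub>M {..<n} (\<lambda>_. lborel))
     (\<lambda>x. \<Sum>\<sigma>\<in>?P. of_int (sign \<sigma>) * ((\<Prod>i<n. of_real (w (x i)) * poly (p (\<sigma> i)) (of_real (x i))) * ensemble_det n l \<zeta> x))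
     (\<Sum>\<sigma>\<in>?P. of_int (sign \<sigma>) * (of_int (sign \<sigma>) * Determinant.det M))"
  proof (intro has_bochner_integral_sum has_bochner_integral_mult_right)
    fix \<sigma> assume "\<sigma> \<in> ?P"
    then have \<sigma>: "\<sigma> permutes {..<n}" by simp
    have val: "(LINT t|lborel. (of_real (w t) * poly (p a) (of_real t)) * ensemble_row n \<zeta> c t) = G a c"
      and int: "c < n + l \<Longrightarrow> integrable lborel (\<lambda>t. (of_real (w t) * poly (p a) (of_real t)) * ensemble_row n \<zeta> c t)" for a c
    proof -
      show "(LINT t|lborel. (of_real (w t) * poly (p a) (of_real t)) * ensemble_row n \<zeta> c t) = G a c"
      proof (cases "c < n")
        case True
        then show ?thesis using integral_pp[of a c] by (simp add: ensemble_row_def G_def mult_ac)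
      qed (simp add: ensemble_row_def G_def second_kind_def mult_ac)
      assume c: "c < n + l"
      show "integrable lborel (\<lambda>t. (of_real (w t) * poly (p a) (of_real t)) * ensemble_row n \<zeta> c t)"
      proof (cases "c < n")
        case True
        then show ?thesis using integrable_pp[of a c] by (simp add: ensemble_row_def mult_ac)
      next
        case False
        then have "\<zeta> (c - n) \<notin> complex_of_real ` I" using c \<zeta>[of "c - n"] by auto
        then show ?thesis using integrable_w_cauchy[of "\<zeta> (c - n)" "p a"] False by (simp add: ensemble_row_def mult_ac)
      qed
    qed
    have "has_bochner_integral (Pi\<^sub>M {..<n} (\<lambda>_. lborel))
      (\<lambda>x. (\<Prod>i<n. of_real (w (x i)) * poly (p (\<sigma> i)) (of_real (x i))) * ensemble_det n l \<zeta> x)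
      (Determinant.det (Matrix.mat (n + l) (n + l) (\<lambda>(k, c). if k < n then LINT t|lborel. (of_real (w t) * poly (p (\<sigma> k)) (of_real t)) * ensemble_row n \<zeta> c t else source_row n \<zeta> k c)))"
      unfolding ensemble_det_def by (rule integral_det_rows) (rule int)
    also have "Matrix.mat (n + l) (n + l) (\<lambda>(k, c). if k < n then LINT t|lborel. (of_real (w t) * poly (p (\<sigma> k)) (of_real t)) * ensemble_row n \<zeta> c t else source_row n \<zeta> k c)
       = Matrix.mat (n + l) (n + l) (\<lambda>(k, c). M $$ (\<sigma> k, c))"
    proof (rule eq_matI)
      fix k c assume kc: "k < dim_row (Matrix.mat (n + l) (n + l) (\<lambda>(k, c). M $$ (\<sigma> k, c)))"
        "c < dim_col (Matrix.mat (n + l) (n + l) (\<lambda>(k, c). M $$ (\<sigma> k, c)))"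
      have "\<sigma> k < n \<longleftrightarrow> k < n" using permutes_in_image[OF \<sigma>, of k] by simp
      moreover have "\<sigma> k = k" if "\<not> k < n" using permutes_not_in[OF \<sigma>, of k] that by simp
      ultimately show "Matrix.mat (n + l) (n + l) (\<lambda>(k, c). if k < n then LINT t|lborel. (of_real (w t) * poly (p (\<sigma> k)) (of_real t)) * ensemble_row n \<zeta> c t else source_row n \<zeta> k c) $$ (k, c) =
         Matrix.mat (n + l) (n + l) (\<lambda>(k, c). M $$ (\<sigma> k, c)) $$ (k, c)"
        using kc by (cases "k < n") (simp_all add: val M_def)
    qed auto
    also have "Determinant.det (Matrix.mat (n + l) (n + l) (\<lambda>(k, c). M $$ (\<sigma> k, c))) = of_int (sign \<sigma>) * Determinant.det M"
    proof (rule det_permute_rows)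
      show "M \<in> carrier_mat (n + l) (n + l)" by (simp add: M_def)
      show "\<sigma> permutes {0..<n + l}" by (rule permutes_subset[OF \<sigma>]) auto
    qed
    finally show "has_bochner_integral (Pi\<^sub>M {..<n} (\<lambda>_. lborel))
      (\<lambda>x. (\<Prod>i<n. of_real (w (x i)) * poly (p (\<sigma> i)) (of_real (x i))) * ensemble_det n l \<zeta> x)
      (of_int (sign \<sigma>) * Determinant.det M)" .
  qed
  also have "(\<Sum>\<sigma>\<in>?P. of_int (sign \<sigma>) * (of_int (sign \<sigma>) * Determinant.det M)) = fact n * Determinant.det M"
    by (simp add: mult.assoc[symmetric] sign_idempotent of_int_mult[symmetric] card_permutations[of _ n] del: of_int_mult)
  also have "(\<lambda>x. \<Sum>\<sigma>\<in>?P. of_int (sign \<sigma>) * ((\<Prod>i<n. of_real (w (x i)) * poly (p (\<sigma> i)) (of_real (x i))) * ensemble_det n l \<zeta> x)) =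
    (\<lambda>x. weight_prod n x * (\<Prod>i<n. \<Prod>k<i. of_real (x i) - of_real (x k)) * ensemble_det n l \<zeta> x)"
    unfolding vandermonde_set_det[symmetric] det_eq_set_det set_det_def weight_prod_def prod.distrib
    by (simp add: sum_distrib_left sum_distrib_right mult_ac)
  finally show ?thesis unfolding detM by (simp add: mult_ac)
qed

text \<open>The pointwise evaluation requires the points \<open>\<zeta> j\<close> to differ from the
  eigenvalues. They do if all eigenvalues lie in \<open>I\<close>; otherwise the weight is
  zero.\<close>

lemma has_bochner_integral_resolvent_det:
  fixes l n :: nat
  assumes inj: "inj_on \<zeta> {..<l}" and \<zeta>: "\<And>j. j < l \<Longrightarrow> \<zeta> j \<notin> complex_of_real ` I"
  shows "has_bochner_integral (Pi\<^sub>M {..<n} (\<lambda>_. lborel))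
     (\<lambda>x. weight_prod n x * (\<Prod>i<n. \<Prod>k<i. of_real (x i) - of_real (x k))\<^sup>2 *
       set_det (\<lambda>i j. (if i = j then resolvent_sum n x (\<zeta> i) else 0) + cauchy_off \<zeta> i j) {..<l})
     (fact n * (\<Prod>a<n. h a) * set_det (\<lambda>i j. cauchy_off \<zeta> i j + cd_cauchy n (\<zeta> i) (\<zeta> j)) {..<l})"
proof -
  have eq: "weight_prod n x * (\<Prod>i<n. \<Prod>k<i. of_real (x i) - of_real (x k)) * ensemble_det n l \<zeta> x =
    weight_prod n x * (\<Prod>i<n. \<Prod>k<i. of_real (x i) - of_real (x k))\<^sup>2 *
       set_det (\<lambda>i j. (if i = j then resolvent_sum n x (\<zeta> i) else 0) + cauchy_off \<zeta> i j) {..<l}" for x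
  proof (cases "\<forall>i<n. x i \<in> I")
    case True
    then have "\<zeta> j \<noteq> of_real (x i)" if "i < n" "j < l" for i j using \<zeta>[OF that(2)] that by auto
    then show ?thesis by (subst ensemble_det_eq[OF inj]) (simp_all add: power2_eq_square mult_ac)
  next
    case False
    then obtain i where "i < n" "x i \<notin> I" by blast
    then have "weight_prod n x = 0" unfolding weight_prod_def
      using support by (intro prod_zero) auto
    then show ?thesis by simp
  qed
  from has_bochner_integral_ensemble_det[of l \<zeta> n, OF \<zeta>] show ?thesis unfolding eq .
qed

end

section \<open>Gaussian integrals\<close>
abbreviation nd :: "real \<Rightarrow> real \<Rightarrow> real" where "nd s \<equiv> normal_density 0 s"

lemma integrable_monomial_normal:
  assumes "0 < s" shows "integrable lborel (\<lambda>t. of_real (t ^ k * nd s t) :: complex)"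
proof -
  have "integrable lborel (\<lambda>t. t ^ k * nd s t)"
    using integrable_normal_moment[of s 0 k] assms by (simp add: mult.commute)
  then show ?thesis by (rule integrable_of_real)
qed

text \<open>Stein's identity for monomials, read off from the explicit moments. At
  \<open>k = 0\<close> the truncated exponent \<open>k - 1\<close> is harmless because of the factor
  \<open>k\<close>.\<close>

lemma integral_monomial_normal_rec:
  assumes "0 < s"
  shows "(LINT t|lborel. t ^ Suc k * nd s t) = s\<^sup>2 * k * (LINT t|lborel. t ^ (k - 1) * nd s t)"
proof (cases "even k")
  case True
  then obtain j where j: "k = 2 * j" by auto
  have odd0: "(LINT t|lborel. t ^ (2 * i + 1) * nd s t) = 0" for i
    using integral_normal_moment_odd[of s 0 i] assms by (simp add: mult.commute)
  show ?thesis
  proof (cases j)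
    case 0 then show ?thesis using odd0[of 0] j by simp
  next
    case (Suc i)
    have "k - 1 = 2 * i + 1" "Suc k = 2 * j + 1" using j Suc by auto
    then show ?thesis using odd0[of j] odd0[of i] by simp
  qed
next
  case False
  then obtain j where j: "k = 2 * j + 1" by (auto elim: oddE)
  have ev: "(LINT t|lborel. t ^ (2 * i) * nd s t) = fact (2 * i) / ((2 / s\<^sup>2) ^ i * fact i)" for i
    using integral_normal_moment_even[OF assms, of 0 i] by (simp add: mult.commute)
  have "Suc k = 2 * Suc j" "k - 1 = 2 * j" using j by auto
  moreover have "fact (2 * Suc j) / ((2 / s\<^sup>2) ^ Suc j * fact (Suc j)) =
     s\<^sup>2 * (2 * real j + 1) * (fact (2 * j) / ((2 / s\<^sup>2) ^ j * fact j))"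
  proof -
    define c d f where "c = (2 / s\<^sup>2) ^ j" and "d = (fact j :: real)" and "f = (fact (2 * j) :: real)"
    have "c \<noteq> 0" "d \<noteq> 0" "s \<noteq> 0" "real j + 1 \<noteq> 0" using assms by (auto simp: c_def d_def)
    moreover have "(fact (2 * Suc j) :: real) = 2 * (real j + 1) * (2 * real j + 1) * f"
      by (simp add: f_def algebra_simps)
    moreover have "(fact (Suc j) :: real) = (real j + 1) * d" by (simp add: d_def algebra_simps)
    ultimately show ?thesis unfolding power_Suc c_def[symmetric] d_def[symmetric] f_def[symmetric]
      by (simp add: divide_simps power2_eq_square)
  qed
  ultimately show ?thesis using ev[of "Suc j"] ev[of j] j by simp
qed

lemma integral_normal_poly:
  fixes q :: "complex poly"
  assumes "0 < s"
  shows "integrable lborel (\<lambda>t. poly q (of_real t) * of_real (nd s t))" (is ?int)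
    and "(LINT t|lborel. of_real t * poly q (of_real t) * of_real (nd s t)) =
      of_real (s\<^sup>2) * (LINT t|lborel. poly (pderiv q) (of_real t) * of_real (nd s t))" (is ?stein)
proof -
  have int: "integrable lborel (\<lambda>t. poly q (of_real t) * of_real (nd s t))" for q :: "complex poly"
  proof -
    have "integrable lborel (\<lambda>t. \<Sum>k\<le>degree q. coeff q k * of_real (t ^ k * nd s t))"
      by (intro Bochner_Integration.integrable_sum integrable_mult_right integrable_monomial_normal assms)
    then show ?thesis by (simp add: poly_altdef sum_distrib_left mult_ac)
  qed
  show ?int by (rule int)
  define A where "A q = (LINT t|lborel. of_real t * poly q (of_real t) * of_real (nd s t))" for q :: "complex poly"
  define B where "B q = (LINT t|lborel. poly q (of_real t) * of_real (nd s t))" for q :: "complex poly"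
  have A: "A q = B ([:0, 1:] * q)" for q by (simp add: A_def B_def mult_ac)
  have add: "B (q + r) = B q + B r" for q r
    unfolding B_def by (simp add: distrib_right int)
  have smult: "B (Polynomial.smult c q) = c * B q" for c q
    unfolding B_def by (simp add: mult.assoc)
  have mon: "B (monom 1 k) = of_real (LINT t|lborel. t ^ k * nd s t)" for k
  proof -
    have "B (monom 1 k) = (LINT t|lborel. of_real (t ^ k * nd s t))" by (simp add: B_def poly_monom)
    also have "\<dots> = of_real (LINT t|lborel. t ^ k * nd s t)"
      by (rule integral_complex_of_real)
    finally show ?thesis .
  qed
  have "A q = of_real (s\<^sup>2) * B (pderiv q)"
  proof -
    have q: "q = (\<Sum>k\<le>degree q. Polynomial.smult (coeff q k) (monom 1 k))"
      using poly_as_sum_of_monoms[of q] by (simp add: smult_monom)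
    have S: "B (\<Sum>k\<in>K. f k) = (\<Sum>k\<in>K. B (f k))" for K :: "nat set" and f
      by (induction K rule: infinite_finite_induct) (simp_all add: add, simp_all add: B_def)
    have "A (monom 1 k) = of_real (s\<^sup>2) * B (pderiv (monom 1 k))" for k
    proof -
      have "A (monom 1 k) = B (monom 1 (Suc k))" unfolding A by (simp add: monom_Suc)
      also have "\<dots> = of_real (s\<^sup>2) * (of_nat k * B (monom 1 (k - 1)))"
        unfolding mon integral_monomial_normal_rec[OF assms] by simp
      also have "of_nat k * B (monom 1 (k - 1)) = B (pderiv (monom 1 k))"
        by (simp add: pderiv_monom smult_monom smult[symmetric])
      finally show ?thesis .
    qed
    then have "A (\<Sum>k\<le>degree q. Polynomial.smult (coeff q k) (monom 1 k)) =
       of_real (s\<^sup>2) * B (pderiv (\<Sum>k\<le>degree q. Polynomial.smult (coeff q k) (monom 1 k)))"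
      unfolding A sum_distrib_left[of "[:0, 1:]"] pderiv_sum S mult_smult_right pderiv_smult smult
      by (simp add: sum_distrib_left mult_ac)
    then show ?thesis unfolding q[symmetric] .
  qed
  then show ?stein by (simp add: A_def B_def)
qed

section \<open>Polynomial functions of the coordinates under a Gaussian weight\<close>

inductive poly_fun :: "'e set \<Rightarrow> (('e \<Rightarrow> real) \<Rightarrow> complex) \<Rightarrow> bool" for J where
  const: "poly_fun J (\<lambda>x. c)"
| coord: "e \<in> J \<Longrightarrow> poly_fun J (\<lambda>x. of_real (x e))"
| add: "poly_fun J F \<Longrightarrow> poly_fun J G \<Longrightarrow> poly_fun J (\<lambda>x. F x + G x)"
| mult: "poly_fun J F \<Longrightarrow> poly_fun J G \<Longrightarrow> poly_fun J (\<lambda>x. F x * G x)"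

lemma poly_fun_uminus: "poly_fun J F \<Longrightarrow> poly_fun J (\<lambda>x. - F x)"
  using poly_fun.mult[OF poly_fun.const[of J "-1"], of F] by simp

lemma poly_fun_diff: "poly_fun J F \<Longrightarrow> poly_fun J G \<Longrightarrow> poly_fun J (\<lambda>x. F x - G x)"
  using poly_fun.add[OF _ poly_fun_uminus, of J F G] by simp

lemma poly_fun_sum: "(\<And>i. i \<in> A \<Longrightarrow> poly_fun J (F i)) \<Longrightarrow> poly_fun J (\<lambda>x. \<Sum>i\<in>A. F i x)"
  by (induction A rule: infinite_finite_induct) (auto intro: poly_fun.intros)

lemma poly_fun_prod: "(\<And>i. i \<in> A \<Longrightarrow> poly_fun J (F i)) \<Longrightarrow> poly_fun J (\<lambda>x. \<Prod>i\<in>A. F i x)"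
  by (induction A rule: infinite_finite_induct) (auto intro: poly_fun.intros)

lemma poly_fun_power: "poly_fun J F \<Longrightarrow> poly_fun J (\<lambda>x. F x ^ k)"
  by (induction k) (auto intro: poly_fun.intros)

lemma poly_fun_measurable:
  "poly_fun J F \<Longrightarrow> F \<in> borel_measurable (Pi\<^sub>M J (\<lambda>_. lborel))"
proof (induction rule: poly_fun.induct)
  case (coord e)
  have "(\<lambda>x. x e) \<in> measurable (Pi\<^sub>M J (\<lambda>_. lborel)) lborel"
    by (rule measurable_component_singleton) fact
  then show ?case by (rule measurable_compose) simp
qed auto

lemma prod_exp_add:
  fixes m k :: real
  shows "(\<Prod>e\<in>J. exp ((m + k) * f e)) = (\<Prod>e\<in>J. exp (m * f e)) * (\<Prod>e\<in>J. exp (k * f e))"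
  by (simp add: distrib_right exp_add prod.distrib)

text \<open>Bounds by products of exponentials survive sums and products by adding the exponents,
  and they factor over the coordinates, which suits integration against the product weight.\<close>

lemma poly_fun_bound:
  assumes "finite J"
  shows "poly_fun J F \<Longrightarrow> \<exists>C m. 0 \<le> C \<and> 0 \<le> m \<and> (\<forall>x. norm (F x) \<le> C * (\<Prod>e\<in>J. exp (m * \<bar>x e\<bar>)))"
proof (induction rule: poly_fun.induct)
  case (const c)
  show ?case by (intro exI[of _ "norm c"] exI[of _ 0]) simp
next
  case (coord e)
  have "\<bar>x e\<bar> \<le> (\<Prod>e\<in>J. exp (1 * \<bar>x e\<bar>))" for x :: "'a \<Rightarrow> real"
  proof -
    have "\<bar>x e\<bar> \<le> exp (\<bar>x e\<bar>)" using exp_ge_add_one_self[of "\<bar>x e\<bar>"] by linarith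
    also have "\<dots> = exp \<bar>x e\<bar> * 1" by simp
    also have "\<dots> \<le> exp \<bar>x e\<bar> * (\<Prod>e\<in>J - {e}. exp \<bar>x e\<bar>)"
      by (intro mult_left_mono prod_ge_1) auto
    also have "\<dots> = (\<Prod>e\<in>J. exp (1 * \<bar>x e\<bar>))" using coord assms by (simp add: prod.remove)
    finally show ?thesis .
  qed
  then show ?case by (intro exI[of _ 1]) simp
next
  case (add F G)
  then obtain C m D k where *: "0 \<le> C" "0 \<le> m" "\<And>x. norm (F x) \<le> C * (\<Prod>e\<in>J. exp (m * \<bar>x e\<bar>))"
     "0 \<le> D" "0 \<le> k" "\<And>x. norm (G x) \<le> D * (\<Prod>e\<in>J. exp (k * \<bar>x e\<bar>))" by metis
  have "norm (F x + G x) \<le> (C + D) * (\<Prod>e\<in>J. exp ((m + k) * \<bar>x e\<bar>))" for x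
  proof -
    have "norm (F x + G x) \<le> C * (\<Prod>e\<in>J. exp (m * \<bar>x e\<bar>)) + D * (\<Prod>e\<in>J. exp (k * \<bar>x e\<bar>))"
      using norm_triangle_ineq[of "F x" "G x"] *(3)[of x] *(6)[of x] by linarith
    also have "\<dots> \<le> C * (\<Prod>e\<in>J. exp ((m + k) * \<bar>x e\<bar>)) + D * (\<Prod>e\<in>J. exp ((m + k) * \<bar>x e\<bar>))"
      using * by (intro add_mono mult_left_mono prod_mono) (auto intro!: mult_right_mono)
    finally show ?thesis by (simp add: distrib_right)
  qed
  then show ?case using * by (intro exI[of _ "C + D"] exI[of _ "m + k"]) auto
next
  case (mult F G)
  then obtain C m D k where *: "0 \<le> C" "0 \<le> m" "\<And>x. norm (F x) \<le> C * (\<Prod>e\<in>J. exp (m * \<bar>x e\<bar>))"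
     "0 \<le> D" "0 \<le> k" "\<And>x. norm (G x) \<le> D * (\<Prod>e\<in>J. exp (k * \<bar>x e\<bar>))" by metis
  have "norm (F x * G x) \<le> (C * D) * (\<Prod>e\<in>J. exp ((m + k) * \<bar>x e\<bar>))" for x
  proof -
    have "norm (F x * G x) \<le> (C * (\<Prod>e\<in>J. exp (m * \<bar>x e\<bar>))) * (D * (\<Prod>e\<in>J. exp (k * \<bar>x e\<bar>)))"
      unfolding norm_mult using * by (intro mult_mono) (auto intro!: mult_nonneg_nonneg prod_nonneg)
    also have "\<dots> = (C * D) * (\<Prod>e\<in>J. exp ((m + k) * \<bar>x e\<bar>))"
      unfolding prod_exp_add by (simp only: mult_ac)
    finally show ?thesis .
  qed
  then show ?case using * by (intro exI[of _ "C * D"] exI[of _ "m + k"]) auto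
qed

definition gauss_weight :: "'e set \<Rightarrow> ('e \<Rightarrow> real) \<Rightarrow> ('e \<Rightarrow> real) \<Rightarrow> real" where
  "gauss_weight J s x = (\<Prod>e\<in>J. nd (s e) (x e))"

text \<open>Completing the square turns \<open>exp (c * t)\<close> times the density into a constant
  times a shifted density; the absolute value is handled by adding the cases \<open>c = m\<close>
  and \<open>c = - m\<close>.\<close>

lemma integrable_exp_abs_normal:
  assumes "0 < s" shows "integrable lborel (\<lambda>t. exp (m * \<bar>t\<bar>) * nd s t)"
proof -
  have shift: "exp (c * t) * nd s t = exp (c\<^sup>2 * s\<^sup>2 / 2) * normal_density (c * s\<^sup>2) s t" for c t
    using assms by (simp add: normal_density_def exp_add[symmetric] power2_eq_square field_simps)
  have "integrable lborel (\<lambda>t. exp (c * t) * nd s t)" for c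
    unfolding shift using assms by (intro integrable_mult_right integrable_normal_density) auto
  from this[of m] this[of "- m"]
  have "integrable lborel (\<lambda>t. exp (m * t) * nd s t + exp (- m * t) * nd s t)" by (rule Bochner_Integration.integrable_add)
  then show ?thesis
  proof (rule Bochner_Integration.integrable_bound)
    show "(\<lambda>t. exp (m * \<bar>t\<bar>) * nd s t) \<in> borel_measurable lborel" by simp
    show "AE t in lborel. norm (exp (m * \<bar>t\<bar>) * nd s t) \<le> norm (exp (m * t) * nd s t + exp (- m * t) * nd s t)"
    proof (rule AE_I2)
      fix t
      have "0 \<le> exp (c * t) * nd s t" for c by (simp add: normal_density_nonneg)
      from this[of m] this[of "- m"]
      show "norm (exp (m * \<bar>t\<bar>) * nd s t) \<le> norm (exp (m * t) * nd s t + exp (- m * t) * nd s t)"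
        by (cases "t \<ge> 0") auto
    qed
  qed
qed

lemma gauss_weight_measurable: "gauss_weight J s \<in> borel_measurable (Pi\<^sub>M J (\<lambda>_. lborel))"
  unfolding gauss_weight_def
proof (intro borel_measurable_prod)
  fix e assume "e \<in> J"
  then have "(\<lambda>x. x e) \<in> measurable (Pi\<^sub>M J (\<lambda>_. lborel)) lborel"
    by (rule measurable_component_singleton)
  then show "(\<lambda>x. nd (s e) (x e)) \<in> borel_measurable (Pi\<^sub>M J (\<lambda>_. lborel))"
    by (rule measurable_compose) simp
qed

lemma gauss_weight_nonneg: "0 \<le> gauss_weight J s x"
  by (simp add: gauss_weight_def prod_nonneg normal_density_nonneg)

lemma integrable_exp_gauss:
  assumes "finite J" "\<And>e. e \<in> J \<Longrightarrow> 0 < s e"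
  shows "integrable (Pi\<^sub>M J (\<lambda>_. lborel)) (\<lambda>x. (\<Prod>e\<in>J. exp (m * \<bar>x e\<bar>)) * gauss_weight J s x)"
proof -
  interpret product_sigma_finite "\<lambda>_::'a. lborel :: real measure" by standard
  have "integrable (Pi\<^sub>M J (\<lambda>_. lborel)) (\<lambda>x. \<Prod>e\<in>J. exp (m * \<bar>x e\<bar>) * nd (s e) (x e))"
    by (intro product_integrable_prod integrable_exp_abs_normal assms)
  then show ?thesis by (simp add: gauss_weight_def prod.distrib)
qed

lemma poly_fun_exp_integrable:
  assumes "finite J" "\<And>e. e \<in> J \<Longrightarrow> 0 < s e" "poly_fun J F"
    and G: "G \<in> borel_measurable (Pi\<^sub>M J (\<lambda>_. lborel))"
    and bd: "\<And>x. norm (G x) \<le> D * (\<Prod>e\<in>J. exp (k * \<bar>x e\<bar>))"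
  shows "integrable (Pi\<^sub>M J (\<lambda>_. lborel)) (\<lambda>x. F x * G x * of_real (gauss_weight J s x) :: complex)"
proof -
  obtain C m where *: "0 \<le> C" "0 \<le> m" "\<And>x. norm (F x) \<le> C * (\<Prod>e\<in>J. exp (m * \<bar>x e\<bar>))"
    using poly_fun_bound[OF assms(1,3)] by blast
  show ?thesis
  proof (rule Bochner_Integration.integrable_bound)
    show "integrable (Pi\<^sub>M J (\<lambda>_. lborel)) (\<lambda>x. (C * D) * ((\<Prod>e\<in>J. exp ((m + k) * \<bar>x e\<bar>)) * gauss_weight J s x))"
      by (intro integrable_mult_right integrable_exp_gauss assms)
    show "(\<lambda>x. F x * G x * of_real (gauss_weight J s x)) \<in> borel_measurable (Pi\<^sub>M J (\<lambda>_. lborel))"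
      using poly_fun_measurable[OF assms(3)] G gauss_weight_measurable[of J s] by simp
    show "AE x in Pi\<^sub>M J (\<lambda>_. lborel). norm (F x * G x * of_real (gauss_weight J s x)) \<le>
       norm ((C * D) * ((\<Prod>e\<in>J. exp ((m + k) * \<bar>x e\<bar>)) * gauss_weight J s x))"
    proof (rule AE_I2)
      fix x
      have "norm (F x * G x) \<le> (C * (\<Prod>e\<in>J. exp (m * \<bar>x e\<bar>))) * (D * (\<Prod>e\<in>J. exp (k * \<bar>x e\<bar>)))"
        unfolding norm_mult using * bd by (intro mult_mono) (auto intro!: mult_nonneg_nonneg prod_nonneg)
      also have "\<dots> = (C * D) * (\<Prod>e\<in>J. exp ((m + k) * \<bar>x e\<bar>))"
        unfolding prod_exp_add by (simp only: mult_ac)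
      finally have "norm (F x * G x) * gauss_weight J s x \<le> (C * D) * (\<Prod>e\<in>J. exp ((m + k) * \<bar>x e\<bar>)) * gauss_weight J s x"
        by (rule mult_right_mono) (rule gauss_weight_nonneg)
      then show "norm (F x * G x * of_real (gauss_weight J s x)) \<le>
       norm ((C * D) * ((\<Prod>e\<in>J. exp ((m + k) * \<bar>x e\<bar>)) * gauss_weight J s x))"
        using gauss_weight_nonneg[of J s x] by (simp add: norm_mult mult.assoc)
    qed
  qed
qed

lemma poly_fun_integrable:
  assumes "finite J" "\<And>e. e \<in> J \<Longrightarrow> 0 < s e" "poly_fun J F"
  shows "integrable (Pi\<^sub>M J (\<lambda>_. lborel)) (\<lambda>x. F x * of_real (gauss_weight J s x))"
  using poly_fun_exp_integrable[OF assms, where G="\<lambda>_. 1" and D=1 and k=0] by simp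

text \<open>A partial derivative without limits: on every line in direction \<open>e\<close> the two
  functions are one polynomial and its formal derivative. In this form the one-variable identity for
  polynomials applies to each line.\<close>

definition has_pd :: "'e \<Rightarrow> (('e \<Rightarrow> real) \<Rightarrow> complex) \<Rightarrow> (('e \<Rightarrow> real) \<Rightarrow> complex) \<Rightarrow> bool" where
  "has_pd e F F' \<longleftrightarrow> (\<forall>x. \<exists>q. \<forall>t. F (x(e := t)) = poly q (of_real t) \<and> F' (x(e := t)) = poly (pderiv q) (of_real t))"

lemma has_pd_const: "has_pd e (\<lambda>x. c) (\<lambda>x. 0)"
  unfolding has_pd_def by (intro allI exI[of _ "[:c:]"]) (simp add: pderiv_pCons)

lemma has_pd_coord: "has_pd e (\<lambda>x. of_real (x e')) (\<lambda>x. if e = e' then 1 else 0)"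
  unfolding has_pd_def
proof
  fix x :: "'a \<Rightarrow> real"
  show "\<exists>q. \<forall>t. complex_of_real ((x(e := t)) e') = poly q (of_real t) \<and> (if e = e' then 1 else 0) = poly (pderiv q) (of_real t)"
  proof (cases "e = e'")
    case True
    then show ?thesis by (intro exI[of _ "[:0, 1:]"]) (simp add: pderiv_pCons)
  next
    case False
    then show ?thesis by (intro exI[of _ "[:of_real (x e'):]"]) (simp add: pderiv_pCons)
  qed
qed

lemma has_pd_add: "has_pd e F F' \<Longrightarrow> has_pd e G G' \<Longrightarrow> has_pd e (\<lambda>x. F x + G x) (\<lambda>x. F' x + G' x)"
  unfolding has_pd_def by (metis poly_add pderiv_add)

lemma has_pd_mult: "has_pd e F F' \<Longrightarrow> has_pd e G G' \<Longrightarrow> has_pd e (\<lambda>x. F x * G x) (\<lambda>x. F' x * G x + F x * G' x)"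
  unfolding has_pd_def
proof (intro allI)
  fix x assume "\<forall>x. \<exists>q. \<forall>t. F (x(e := t)) = poly q (of_real t) \<and> F' (x(e := t)) = poly (pderiv q) (of_real t)"
    "\<forall>x. \<exists>q. \<forall>t. G (x(e := t)) = poly q (of_real t) \<and> G' (x(e := t)) = poly (pderiv q) (of_real t)"
  then obtain q r where "\<forall>t. F (x(e := t)) = poly q (of_real t) \<and> F' (x(e := t)) = poly (pderiv q) (of_real t)"
    "\<forall>t. G (x(e := t)) = poly r (of_real t) \<and> G' (x(e := t)) = poly (pderiv r) (of_real t)" by metis
  then show "\<exists>q. \<forall>t. F (x(e := t)) * G (x(e := t)) = poly q (of_real t) \<and>
     F' (x(e := t)) * G (x(e := t)) + F (x(e := t)) * G' (x(e := t)) = poly (pderiv q) (of_real t)"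
    by (intro exI[of _ "q * r"]) (auto simp: pderiv_mult algebra_simps)
qed

lemma has_pd_sum: "(\<And>i. i \<in> A \<Longrightarrow> has_pd e (F i) (F' i)) \<Longrightarrow> has_pd e (\<lambda>x. \<Sum>i\<in>A. F i x) (\<lambda>x. \<Sum>i\<in>A. F' i x)"
  by (induction A rule: infinite_finite_induct) (auto intro: has_pd_const has_pd_add)

lemma has_pd_cmult: "has_pd e F F' \<Longrightarrow> has_pd e (\<lambda>x. c * F x) (\<lambda>x. c * F' x)"
  using has_pd_mult[OF has_pd_const[of e c], of F F'] by simp

text \<open>Fubini's theorem isolates the coordinate \<open>e\<close>; on each line Stein's identity
  holds with the variance of that coordinate.\<close>

lemma gauss_integration_by_parts:
  assumes J: "finite J" "\<And>e. e \<in> J \<Longrightarrow> 0 < s e" and e: "e \<in> J"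
    and F: "poly_fun J F" and F': "poly_fun J F'" and pd: "has_pd e F F'"
  shows "(LINT x|Pi\<^sub>M J (\<lambda>_. lborel). of_real (x e) * F x * of_real (gauss_weight J s x)) =
    of_real ((s e)\<^sup>2) * (LINT x|Pi\<^sub>M J (\<lambda>_. lborel). F' x * of_real (gauss_weight J s x))"
proof -
  interpret product_sigma_finite "\<lambda>_::'a. lborel :: real measure" by standard
  define K where "K = J - {e}"
  have K: "finite K" "e \<notin> K" "J = insert e K" using J e by (auto simp: K_def)
  have gw: "gauss_weight J s (x(e := t)) = nd (s e) t * gauss_weight K s x" for x t
  proof -
    have "(\<Prod>i\<in>K. nd (s i) ((x(e := t)) i)) = (\<Prod>i\<in>K. nd (s i) (x i))"
      by (intro prod.cong refl) (use K in auto)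
    then show ?thesis unfolding gauss_weight_def K(3) using K(1,2) by simp
  qed
  have se: "0 < s e" using J e by simp
  have i1: "integrable (Pi\<^sub>M J (\<lambda>_. lborel)) (\<lambda>x. of_real (x e) * F x * of_real (gauss_weight J s x))"
    by (intro poly_fun_integrable J poly_fun.intros F e)
  have i2: "integrable (Pi\<^sub>M J (\<lambda>_. lborel)) (\<lambda>x. F' x * of_real (gauss_weight J s x))"
    by (intro poly_fun_integrable J F')
  have "(LINT x|Pi\<^sub>M J (\<lambda>_. lborel). of_real (x e) * F x * of_real (gauss_weight J s x)) =
     (LINT x|Pi\<^sub>M K (\<lambda>_. lborel). (LINT t|lborel. of_real ((x(e := t)) e) * F (x(e := t)) * of_real (gauss_weight J s (x(e := t)))))"
    using product_integral_insert[OF K(1,2) i1[unfolded K(3)]] by (simp only: K(3))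
  also have "\<dots> = (LINT x|Pi\<^sub>M K (\<lambda>_. lborel). of_real ((s e)\<^sup>2) * (LINT t|lborel. F' (x(e := t)) * of_real (gauss_weight J s (x(e := t)))))"
  proof (rule Bochner_Integration.integral_cong[OF refl])
    fix x
    obtain q where q: "\<And>t. F (x(e := t)) = poly q (of_real t)" "\<And>t. F' (x(e := t)) = poly (pderiv q) (of_real t)"
      using pd unfolding has_pd_def by metis
    have "(LINT t|lborel. of_real ((x(e := t)) e) * F (x(e := t)) * of_real (gauss_weight J s (x(e := t)))) =
       (LINT t|lborel. (of_real t * poly q (of_real t) * of_real (nd (s e) t)) * of_real (gauss_weight K s x))"
      by (simp add: q gw mult_ac)
    also have "\<dots> = (LINT t|lborel. of_real t * poly q (of_real t) * of_real (nd (s e) t)) * of_real (gauss_weight K s x)"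
      by (rule integral_mult_left_zero)
    also have "\<dots> = of_real ((s e)\<^sup>2) * ((LINT t|lborel. poly (pderiv q) (of_real t) * of_real (nd (s e) t)) * of_real (gauss_weight K s x))"
      unfolding integral_normal_poly(2)[OF se] by (simp only: mult.assoc)
    also have "(LINT t|lborel. poly (pderiv q) (of_real t) * of_real (nd (s e) t)) * of_real (gauss_weight K s x) =
       (LINT t|lborel. F' (x(e := t)) * of_real (gauss_weight J s (x(e := t))))"
      unfolding q gw by (subst integral_mult_left_zero[symmetric]) (simp add: mult_ac)
    finally show "(LINT t|lborel. of_real ((x(e := t)) e) * F (x(e := t)) * of_real (gauss_weight J s (x(e := t)))) =
      of_real ((s e)\<^sup>2) * (LINT t|lborel. F' (x(e := t)) * of_real (gauss_weight J s (x(e := t))))" .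
  qed
  also have "\<dots> = of_real ((s e)\<^sup>2) * (LINT x|Pi\<^sub>M K (\<lambda>_. lborel). (LINT t|lborel. F' (x(e := t)) * of_real (gauss_weight J s (x(e := t)))))"
    by (rule integral_mult_right_zero)
  also have "(LINT x|Pi\<^sub>M K (\<lambda>_. lborel). (LINT t|lborel. F' (x(e := t)) * of_real (gauss_weight J s (x(e := t))))) = (LINT x|Pi\<^sub>M J (\<lambda>_. lborel). F' x * of_real (gauss_weight J s x))"
    using product_integral_insert[OF K(1,2) i2[unfolded K(3)]] by (simp only: K(3))
  finally show ?thesis .
qed

section \<open>Loop equations\<close>
text \<open>The terms, with coefficients, of the derivative of a product of traces of powers in the
  direction of the \<open>k\<close>-th power: a factor with exponent \<open>m\<close> becomes
  \<open>m\<close> times the factor with exponent \<open>k + m - 1\<close>. For \<open>m = 0\<close>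
  the zero coefficient makes the exponent irrelevant.\<close>

fun merge_trace :: "nat \<Rightarrow> nat list \<Rightarrow> (nat \<times> nat list) list" where
  "merge_trace k [] = []"
| "merge_trace k (m # ks) = (m, (k + m - 1) # ks) # map (\<lambda>(c, l). (c, m # l)) (merge_trace k ks)"

lemma sum_list_merge_trace: "(c, l) \<in> set (merge_trace k ks) \<Longrightarrow> sum_list l \<le> k + sum_list ks"
proof (induction ks arbitrary: c l)
  case (Cons m ks)
  then show ?case by fastforce
qed simp

text \<open>The loop (Schwinger-Dyson) equations determine all mixed moments of the power sums, since the total
  degree drops.\<close>

definition loop_equations :: "nat \<Rightarrow> (nat list \<Rightarrow> 'a::comm_semiring_1) \<Rightarrow> bool" where
  "loop_equations n m \<longleftrightarrow> (\<forall>ks. m (0 # ks) = of_nat n * m ks) \<and>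
     (\<forall>k ks. m (Suc k # ks) = (\<Sum>i<k. m (i # (k - 1 - i) # ks)) + (\<Sum>(c, l)\<leftarrow>merge_trace k ks. of_nat c * m l))"

lemma loop_equations_unique:
  assumes "loop_equations n m" "loop_equations n m'" "m [] = m' []"
  shows "m ks = m' ks"
\<comment> \<open>A leading exponent \<open>0\<close> keeps the total degree but shortens the list,
  hence the lexicographic measure.\<close>
proof (induction ks rule: wf_induct[of "measures [sum_list, length]"])
  case 1 show ?case by simp
next
  case (2 ks)
  then have IH: "sum_list l < sum_list ks \<or> sum_list l = sum_list ks \<and> length l < length ks \<Longrightarrow> m l = m' l" for l
    by auto
  show ?case
  proof (cases ks)
    case Nil then show ?thesis using assms by simp
  next
    case (Cons a l)
    show ?thesis
    proof (cases a)
      case 0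
      then show ?thesis using assms IH[of l] by (simp add: Cons loop_equations_def)
    next
      case (Suc k)
      have "m (i # (k - 1 - i) # l) = m' (i # (k - 1 - i) # l)" if "i < k" for i
        using that by (intro IH) (simp add: Cons Suc)
      moreover have "m q = m' q" if "(c, q) \<in> set (merge_trace k l)" for c q
        using sum_list_merge_trace[OF that] by (intro IH) (simp add: Cons Suc)
      then have "(\<Sum>(c, q)\<leftarrow>merge_trace k l. of_nat c * m q) = (\<Sum>(c, q)\<leftarrow>merge_trace k l. of_nat c * m' q)"
        by (intro arg_cong[where f=sum_list] map_cong) auto
      ultimately show ?thesis using assms by (simp add: Cons Suc loop_equations_def)
    qed
  qed
qed

lemma has_pd_power:
  "has_pd e F F' \<Longrightarrow> has_pd e (\<lambda>x. F x ^ k) (\<lambda>x. of_nat k * F x ^ (k - 1) * F' x)"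
proof (induction k)
  case 0 then show ?case using has_pd_const[of e 1] by simp
next
  case (Suc k)
  have "has_pd e (\<lambda>x. F x * F x ^ k) (\<lambda>x. F' x * F x ^ k + F x * (of_nat k * F x ^ (k - 1) * F' x))"
    by (intro has_pd_mult Suc)
  moreover have "F' x * F x ^ k + F x * (of_nat k * F x ^ (k - 1) * F' x) = of_nat (Suc k) * F x ^ (Suc k - 1) * F' x" for x
    by (cases k) (simp_all add: algebra_simps)
  ultimately show ?case by simp
qed

lemma has_pd_prod:
  "finite A \<Longrightarrow> (\<And>a. a \<in> A \<Longrightarrow> has_pd e (F a) (F' a)) \<Longrightarrow>
    has_pd e (\<lambda>x. \<Prod>a\<in>A. F a x) (\<lambda>x. \<Sum>a\<in>A. F' a x * (\<Prod>b\<in>A - {a}. F b x))"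
proof (induction A rule: finite_induct)
  case empty then show ?case using has_pd_const[of e 1] by simp
next
  case (insert a A)
  have "has_pd e (\<lambda>x. F a x * (\<Prod>a\<in>A. F a x)) (\<lambda>x. F' a x * (\<Prod>a\<in>A. F a x) + F a x * (\<Sum>a\<in>A. F' a x * (\<Prod>b\<in>A - {a}. F b x)))"
    using insert by (intro has_pd_mult) auto
  moreover have "F a x * (\<Sum>c\<in>A. F' c x * (\<Prod>b\<in>A - {c}. F b x)) = (\<Sum>c\<in>A. F' c x * (\<Prod>b\<in>insert a A - {c}. F b x))" for x
    unfolding sum_distrib_left
  proof (intro sum.cong refl)
    fix c assume "c \<in> A"
    then have "insert a A - {c} = insert a (A - {c})" using insert by auto
    then show "F a x * (F' c x * (\<Prod>b\<in>A - {c}. F b x)) = F' c x * (\<Prod>b\<in>insert a A - {c}. F b x)"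
      using insert by simp
  qed
  ultimately show ?case using insert by simp
qed

lemma has_pd_minus: "has_pd e F F' \<Longrightarrow> has_pd e G G' \<Longrightarrow> has_pd e (\<lambda>x. F x - G x) (\<lambda>x. F' x - G' x)"
  using has_pd_add[OF _ has_pd_cmult[of e G G' "-1"], of F F'] by simp

section \<open>Loop equations on the eigenvalue side\<close>

definition psum :: "nat \<Rightarrow> nat \<Rightarrow> (nat \<Rightarrow> real) \<Rightarrow> complex" where
  "psum n k x = (\<Sum>i<n. of_real (x i) ^ k)"

definition psums :: "nat \<Rightarrow> nat list \<Rightarrow> (nat \<Rightarrow> real) \<Rightarrow> complex" where
  "psums n ks x = (\<Prod>k\<leftarrow>ks. psum n k x)"

lemma psums_simps [simp]: "psums n [] x = 1" "psums n (k # ks) x = psum n k x * psums n ks x"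
  by (simp_all add: psums_def)

lemma poly_fun_psum: "poly_fun {..<n} (psum n k)"
  unfolding psum_def[abs_def] by (intro poly_fun_sum poly_fun_power poly_fun.coord)

lemma poly_fun_psums: "poly_fun {..<n} (psums n ks)"
proof (induction ks)
  case Nil then show ?case using poly_fun.const[of _ 1] by (simp add: psums_def[abs_def])
next
  case (Cons k ks)
  then show ?case using poly_fun.mult[OF poly_fun_psum Cons] by (simp add: psums_def[abs_def])
qed

fun dpsums :: "nat \<Rightarrow> nat \<Rightarrow> nat list \<Rightarrow> (nat \<Rightarrow> real) \<Rightarrow> complex" where
  "dpsums n i [] x = 0"
| "dpsums n i (k # ks) x = of_nat k * of_real (x i) ^ (k - 1) * psums n ks x + psum n k x * dpsums n i ks x"

lemma dpsums_fun:
  "dpsums n i [] = (\<lambda>x. 0)"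
  "dpsums n i (k # ks) = (\<lambda>x. of_nat k * of_real (x i) ^ (k - 1) * psums n ks x + psum n k x * dpsums n i ks x)"
  by (rule ext, simp)+

lemma psums_fun: "psums n [] = (\<lambda>x. 1)" "psums n (k # ks) = (\<lambda>x. psum n k x * psums n ks x)"
  by (rule ext, simp)+

lemma poly_fun_dpsums: "i < n \<Longrightarrow> poly_fun {..<n} (dpsums n i ks)"
proof (induction ks)
  case Nil then show ?case unfolding dpsums_fun by (intro poly_fun.const)
next
  case (Cons k ks)
  have "poly_fun {..<n} (\<lambda>x. of_nat k * of_real (x i) ^ (k - 1) * psums n ks x + psum n k x * dpsums n i ks x)"
    using Cons by (intro poly_fun.intros poly_fun_power poly_fun_psum poly_fun_psums) auto
  then show ?case unfolding dpsums_fun .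
qed

lemma has_pd_psum: "i < n \<Longrightarrow> has_pd i (psum n k) (\<lambda>x. of_nat k * of_real (x i) ^ (k - 1))"
proof -
  assume i: "i < n"
  have "has_pd i (\<lambda>x. \<Sum>j<n. of_real (x j) ^ k) (\<lambda>x. \<Sum>j<n. of_nat k * of_real (x j) ^ (k - 1) * (if i = j then 1 else 0))"
    by (intro has_pd_sum has_pd_power has_pd_coord)
  moreover have "(\<Sum>j<n. of_nat k * of_real (x j) ^ (k - 1) * (if i = j then 1 else 0)) = of_nat k * complex_of_real (x i) ^ (k - 1)" for x
    using i by (simp add: if_distrib cong: if_cong)
  ultimately show ?thesis by (simp add: psum_def[abs_def])
qed

lemma has_pd_psums: "i < n \<Longrightarrow> has_pd i (psums n ks) (dpsums n i ks)"
proof (induction ks)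
  case Nil then show ?case unfolding dpsums_fun psums_fun by (intro has_pd_const)
next
  case (Cons k ks)
  have "has_pd i (\<lambda>x. psum n k x * psums n ks x) (\<lambda>x. of_nat k * of_real (x i) ^ (k - 1) * psums n ks x + psum n k x * dpsums n i ks x)"
    using Cons by (intro has_pd_mult has_pd_psum) auto
  then show ?case unfolding dpsums_fun psums_fun .
qed

text \<open>The vector field with components \<open>x i ^ k\<close> sends the power sum of exponent
  \<open>m\<close> to \<open>m\<close> times that of exponent \<open>k + m - 1\<close>, one factor
  of the product at a time.\<close>

lemma sum_power_dpsums:
  "(\<Sum>i<n. of_real (x i) ^ k * dpsums n i ks x) = (\<Sum>(c, l)\<leftarrow>merge_trace k ks. of_nat c * psums n l x)"
proof (induction ks)
  case (Cons m ks)
  have "(\<Sum>i<n. of_real (x i) ^ k * dpsums n i (m # ks) x) =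
     (\<Sum>i<n. of_nat m * (of_real (x i) ^ k * of_real (x i) ^ (m - 1))) * psums n ks x + psum n m x * (\<Sum>i<n. of_real (x i) ^ k * dpsums n i ks x)"
    by (simp add: distrib_left sum.distrib sum_distrib_left sum_distrib_right mult_ac)
  also have "(\<Sum>i<n. of_nat m * (of_real (x i) ^ k * complex_of_real (x i) ^ (m - 1))) = of_nat m * psum n (k + m - 1) x"
    by (cases m) (simp_all add: psum_def sum_distrib_left power_add)
  finally show ?case
    unfolding Cons.IH
    by (simp add: o_def case_prod_unfold sum_list_const_mult[symmetric] mult_ac del: sum_list_const_mult)
qed simp

section \<open>The squared Vandermonde factor\<close>

definition pairs :: "nat \<Rightarrow> (nat \<times> nat) set" where "pairs n = Sigma {..<n} (\<lambda>j. {..<j})"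

definition vsq :: "nat \<Rightarrow> (nat \<Rightarrow> real) \<Rightarrow> complex" where
  "vsq n x = (\<Prod>q\<in>pairs n. (of_real (x (fst q)) - of_real (x (snd q)))\<^sup>2)"

text \<open>Kept in the exact shape that the rules for products, powers and differences produce,
  including \<open>of_nat 2\<close> and \<open>2 - 1\<close>.\<close>

definition dvsq :: "nat \<Rightarrow> nat \<Rightarrow> (nat \<Rightarrow> real) \<Rightarrow> complex" where
  "dvsq n i x = (\<Sum>q\<in>pairs n. (of_nat 2 * (of_real (x (fst q)) - of_real (x (snd q))) ^ (2 - 1) *
     ((if i = fst q then 1 else 0) - (if i = snd q then 1 else 0))) *
     (\<Prod>r\<in>pairs n - {q}. (of_real (x (fst r)) - of_real (x (snd r)))\<^sup>2))"

lemma finite_pairs [simp]: "finite (pairs n)" by (simp add: pairs_def)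

lemma pairs_less: "q \<in> pairs n \<Longrightarrow> fst q < n \<and> snd q < n" by (auto simp: pairs_def)

lemma poly_fun_vsq: "poly_fun {..<n} (vsq n)"
  unfolding vsq_def[abs_def] using pairs_less
  by (intro poly_fun_prod poly_fun_power poly_fun_diff poly_fun.coord) auto

lemma poly_fun_dvsq: "poly_fun {..<n} (dvsq n i)"
  unfolding dvsq_def[abs_def] using pairs_less
  by (intro poly_fun_sum poly_fun.mult poly_fun_prod poly_fun_power poly_fun_diff poly_fun.coord poly_fun.const) auto

lemma has_pd_vsq: "has_pd i (vsq n) (dvsq n i)"
  unfolding vsq_def[abs_def] dvsq_def[abs_def]
  by (intro has_pd_prod has_pd_power has_pd_minus has_pd_coord) simp

text \<open>Along the vector field \<open>x i ^ k\<close>, the logarithmic derivative of the squared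
  Vandermonde factor is the sum over pairs of \<open>2 * (x a ^ k - x b ^ k) / (x a - x b)\<close>.
  The quotient is the symmetric polynomial \<open>g\<close>, so the pairs add up to the full double
  sum without its diagonal.\<close>

lemma sum_power_dvsq:
  "(\<Sum>i<n. of_real (x i) ^ k * dvsq n i x) =
     vsq n x * ((\<Sum>r<k. psum n r x * psum n (k - 1 - r) x) - of_nat k * psum n (k - 1) x)"
proof -
  define y where "y i = complex_of_real (x i)" for i
  define g where "g a b = (\<Sum>r<k. y a ^ r * y b ^ (k - 1 - r))" for a b
  define W where "W q = (\<Prod>r\<in>pairs n - {q}. (y (fst r) - y (snd r))\<^sup>2)" for q
  have gsym: "g a b = g b a" for a b
    unfolding g_def by (rule sum.reindex_bij_witness[of _ "\<lambda>r. k - 1 - r" "\<lambda>r. k - 1 - r"]) auto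
  have pw: "y a ^ k - y b ^ k = (y a - y b) * g a b" for a b
    unfolding g_def by (subst power_diff_sumr2) (simp add: mult_ac)
  have VW: "vsq n x = (y (fst q) - y (snd q))\<^sup>2 * W q" if "q \<in> pairs n" for q
    unfolding vsq_def W_def y_def by (rule prod.remove) (use that in auto)
  have "(\<Sum>i<n. y i ^ k * dvsq n i x) =
     (\<Sum>q\<in>pairs n. 2 * (y (fst q) - y (snd q)) * W q * (\<Sum>i<n. y i ^ k * ((if i = fst q then 1 else 0) - (if i = snd q then 1 else 0))))"
    unfolding dvsq_def y_def[symmetric] W_def[symmetric] sum_distrib_left
    by (subst sum.swap) (simp add: mult_ac)
  also have "\<dots> = (\<Sum>q\<in>pairs n. 2 * g (fst q) (snd q) * vsq n x)"
  proof (intro sum.cong refl)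
    fix q assume q: "q \<in> pairs n"
    have "(\<Sum>i<n. y i ^ k * ((if i = fst q then 1 else 0) - (if i = snd q then 1 else 0))) = y (fst q) ^ k - y (snd q) ^ k"
    proof -
      have "(\<Sum>i<n. y i ^ k * (if i = a then 1 else 0)) = y a ^ k" if "a < n" for a
        using that by (simp add: if_distrib cong: if_cong)
      then show ?thesis using pairs_less[OF q] by (simp only: right_diff_distrib sum_subtractf)
    qed
    then show "2 * (y (fst q) - y (snd q)) * W q * (\<Sum>i<n. y i ^ k * ((if i = fst q then 1 else 0) - (if i = snd q then 1 else 0))) = 2 * g (fst q) (snd q) * vsq n x"
      unfolding VW[OF q] pw by (simp add: power2_eq_square mult_ac)
  qed
  also have "\<dots> = vsq n x * (\<Sum>q\<in>pairs n. 2 * g (fst q) (snd q))"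
    by (simp add: sum_distrib_left mult_ac)
  also have "(\<Sum>q\<in>pairs n. 2 * g (fst q) (snd q)) = (\<Sum>a<n. \<Sum>b<n. g a b) - (\<Sum>a<n. g a a)"
  proof -
    have "(\<Sum>q\<in>{..<n} \<times> {..<n}. g (fst q) (snd q)) = (\<Sum>q\<in>pairs n \<union> prod.swap ` pairs n \<union> (\<lambda>a. (a, a)) ` {..<n}. g (fst q) (snd q))"
      by (intro sum.cong) (auto simp: pairs_def image_iff)
    also have "\<dots> = (\<Sum>q\<in>pairs n. g (fst q) (snd q)) + (\<Sum>q\<in>prod.swap ` pairs n. g (fst q) (snd q)) + (\<Sum>q\<in>(\<lambda>a. (a, a)) ` {..<n}. g (fst q) (snd q))"
      by (subst sum.union_disjoint, (auto simp: pairs_def)[3], subst sum.union_disjoint) (auto simp: pairs_def)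
    also have "(\<Sum>q\<in>prod.swap ` pairs n. g (fst q) (snd q)) = (\<Sum>q\<in>pairs n. g (fst q) (snd q))"
      by (subst sum.reindex) (auto simp: gsym)
    also have "(\<Sum>q\<in>(\<lambda>a. (a, a)) ` {..<n}. g (fst q) (snd q)) = (\<Sum>a<n. g a a)"
      by (subst sum.reindex) (auto simp: inj_on_def)
    finally show ?thesis by (simp add: sum.cartesian_product case_prod_unfold sum_distrib_left[symmetric])
  qed
  also have "(\<Sum>a<n. \<Sum>b<n. g a b) = (\<Sum>r<k. psum n r x * psum n (k - 1 - r) x)"
    unfolding g_def psum_def y_def sum_product
  proof -
    have "(\<Sum>a<n. \<Sum>b<n. \<Sum>r<k. h a b r) = (\<Sum>r<k. \<Sum>a<n. \<Sum>b<n. h a b r)" for h :: "nat \<Rightarrow> nat \<Rightarrow> nat \<Rightarrow> complex"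
    proof -
      have "(\<Sum>a<n. \<Sum>b<n. \<Sum>r<k. h a b r) = (\<Sum>a<n. \<Sum>r<k. \<Sum>b<n. h a b r)"
        by (intro sum.cong refl sum.swap)
      also have "\<dots> = (\<Sum>r<k. \<Sum>a<n. \<Sum>b<n. h a b r)" by (rule sum.swap)
      finally show ?thesis .
    qed
    then show "(\<Sum>a<n. \<Sum>b<n. \<Sum>r<k. complex_of_real (x a) ^ r * complex_of_real (x b) ^ (k - 1 - r)) =
      (\<Sum>r<k. \<Sum>a<n. \<Sum>b<n. complex_of_real (x a) ^ r * complex_of_real (x b) ^ (k - 1 - r))" .
  qed
  also have "(\<Sum>a<n. g a a) = of_nat k * psum n (k - 1) x"
  proof -
    have "g a a = of_nat k * y a ^ (k - 1)" for a
      unfolding g_def by (simp flip: power_add)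
    then show ?thesis by (simp add: psum_def y_def sum_distrib_left)
  qed
  finally show ?thesis unfolding y_def .
qed

section \<open>Linearity of Gaussian integrals and the loop equations\<close>

abbreviation gint :: "'e set \<Rightarrow> ('e \<Rightarrow> real) \<Rightarrow> (('e \<Rightarrow> real) \<Rightarrow> complex) \<Rightarrow> complex" where
  "gint J s F \<equiv> (LINT x|Pi\<^sub>M J (\<lambda>_. lborel). F x * of_real (gauss_weight J s x))"

lemma gint_sum:
  assumes "finite J" "\<And>e. e \<in> J \<Longrightarrow> 0 < s e" "\<And>i. i \<in> A \<Longrightarrow> poly_fun J (F i)"
  shows "gint J s (\<lambda>x. \<Sum>i\<in>A. F i x) = (\<Sum>i\<in>A. gint J s (F i))"
  unfolding sum_distrib_right using assms by (intro Bochner_Integration.integral_sum poly_fun_integrable)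

lemma gint_add:
  assumes "finite J" "\<And>e. e \<in> J \<Longrightarrow> 0 < s e" "poly_fun J F" "poly_fun J G"
  shows "gint J s (\<lambda>x. F x + G x) = gint J s F + gint J s G"
  unfolding distrib_right using assms by (intro Bochner_Integration.integral_add poly_fun_integrable)

lemma gint_cmult: "gint J s (\<lambda>x. c * F x) = c * gint J s F"
  by (simp add: mult.assoc)

lemma poly_fun_merge:
  assumes "\<And>l. poly_fun J (F l)"
  shows "poly_fun J (\<lambda>x. \<Sum>(c, l)\<leftarrow>L. of_nat c * F l x)"
proof (induction L)
  case Nil then show ?case using poly_fun.const[of J 0] by simp
next
  case (Cons a L)
  obtain c l where a: "a = (c, l)" by (cases a)
  have "poly_fun J (\<lambda>x. of_nat c * F l x + (\<Sum>(c, l)\<leftarrow>L. of_nat c * F l x))"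
    by (intro poly_fun.intros assms Cons)
  then show ?case by (simp add: a)
qed

lemma gint_merge:
  assumes "finite J" "\<And>e. e \<in> J \<Longrightarrow> 0 < s e" "\<And>l. poly_fun J (F l)"
  shows "gint J s (\<lambda>x. \<Sum>(c, l)\<leftarrow>L. of_nat c * F l x) = (\<Sum>(c, l)\<leftarrow>L. of_nat c * gint J s (F l))"
proof (induction L)
  case (Cons a L)
  obtain c l where a: "a = (c, l)" by (cases a)
  have "gint J s (\<lambda>x. of_nat c * F l x + (\<Sum>(c, l)\<leftarrow>L. of_nat c * F l x)) =
      gint J s (\<lambda>x. of_nat c * F l x) + gint J s (\<lambda>x. \<Sum>(c, l)\<leftarrow>L. of_nat c * F l x)"
    by (intro gint_add assms poly_fun_merge poly_fun.intros)
  then show ?case using Cons by (simp add: a mult.assoc)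
qed simp

text \<open>Integration by parts along the vector field \<open>x i ^ k\<close>. The derivative of
  the Vandermonde factor supplies the terms with one power sum split into two, that of the other
  power sums supplies the merged ones.\<close>

lemma loop_equations_eigenvalues:
  "loop_equations n (\<lambda>ks. gint {..<n} (\<lambda>_. 1) (\<lambda>x. psums n ks x * vsq n x))"
  unfolding loop_equations_def
proof (intro conjI allI)
  fix ks
  show "gint {..<n} (\<lambda>_. 1) (\<lambda>x. psums n (0 # ks) x * vsq n x) = of_nat n * gint {..<n} (\<lambda>_. 1) (\<lambda>x. psums n ks x * vsq n x)"
    by (simp add: psum_def mult.assoc)
next
  fix k ks
  let ?E = "gint {..<n} (\<lambda>_. 1)"
  note pf = poly_fun.intros poly_fun_power poly_fun_psum poly_fun_psums poly_fun_dpsums poly_fun_vsq poly_fun_dvsq poly_fun_sum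
  have "?E (\<lambda>x. psums n (Suc k # ks) x * vsq n x) = ?E (\<lambda>x. \<Sum>i<n. of_real (x i) * (of_real (x i) ^ k * psums n ks x * vsq n x))"
    by (simp add: psum_def sum_distrib_right sum_distrib_left mult_ac)
  also have "\<dots> = (\<Sum>i<n. ?E (\<lambda>x. of_real (x i) * (of_real (x i) ^ k * psums n ks x * vsq n x)))"
    by (intro gint_sum pf) auto
  also have "\<dots> = (\<Sum>i<n. ?E (\<lambda>x. (of_nat k * of_real (x i) ^ (k - 1) * 1 * psums n ks x + of_real (x i) ^ k * dpsums n i ks x) * vsq n x
      + of_real (x i) ^ k * psums n ks x * dvsq n i x))"
  proof (intro sum.cong refl)
    fix i assume "i \<in> {..<n}"
    then have i: "i < n" by simp
    have hc: "has_pd i (\<lambda>x. complex_of_real (x i)) (\<lambda>x. 1)" using has_pd_coord[of i i] by simp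
    have pd: "has_pd i (\<lambda>x. of_real (x i) ^ k * psums n ks x * vsq n x)
      (\<lambda>x. (of_nat k * of_real (x i) ^ (k - 1) * 1 * psums n ks x + of_real (x i) ^ k * dpsums n i ks x) * vsq n x
      + of_real (x i) ^ k * psums n ks x * dvsq n i x)"
      by (intro has_pd_mult has_pd_power has_pd_psums has_pd_vsq hc i)
    show "?E (\<lambda>x. of_real (x i) * (of_real (x i) ^ k * psums n ks x * vsq n x)) =
       ?E (\<lambda>x. (of_nat k * of_real (x i) ^ (k - 1) * 1 * psums n ks x + of_real (x i) ^ k * dpsums n i ks x) * vsq n x
      + of_real (x i) ^ k * psums n ks x * dvsq n i x)"
      using i by (subst gauss_integration_by_parts[OF _ _ _ _ _ pd]) (auto intro!: pf)
  qed
  also have "\<dots> = ?E (\<lambda>x. \<Sum>i<n. (of_nat k * of_real (x i) ^ (k - 1) * 1 * psums n ks x + of_real (x i) ^ k * dpsums n i ks x) * vsq n x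
      + of_real (x i) ^ k * psums n ks x * dvsq n i x)"
    by (intro gint_sum[symmetric] pf) auto
  also have "\<dots> = ?E (\<lambda>x. (\<Sum>r<k. psums n (r # (k - 1 - r) # ks) x * vsq n x) + (\<Sum>(c, l)\<leftarrow>merge_trace k ks. of_nat c * (psums n l x * vsq n x)))"
  proof (intro Bochner_Integration.integral_cong refl arg_cong2[where f="(*)"])
    fix x
    have "(\<Sum>i<n. (of_nat k * of_real (x i) ^ (k - 1) * 1 * psums n ks x + of_real (x i) ^ k * dpsums n i ks x) * vsq n x
      + of_real (x i) ^ k * psums n ks x * dvsq n i x) =
      of_nat k * psum n (k - 1) x * psums n ks x * vsq n x + (\<Sum>i<n. of_real (x i) ^ k * dpsums n i ks x) * vsq n x +
      psums n ks x * (\<Sum>i<n. of_real (x i) ^ k * dvsq n i x)"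
      by (simp add: psum_def sum.distrib sum_distrib_left sum_distrib_right algebra_simps)
    \<comment> \<open>Differentiating \<open>x i ^ k\<close> itself gives
      \<open>k * psum n (k - 1)\<close>, which cancels the diagonal term of
      \<open>sum_power_dvsq\<close>.\<close>
    also have "\<dots> = (\<Sum>r<k. psums n (r # (k - 1 - r) # ks) x * vsq n x) + (\<Sum>(c, l)\<leftarrow>merge_trace k ks. of_nat c * psums n l x) * vsq n x"
      unfolding sum_power_dvsq sum_power_dpsums
      by (simp add: algebra_simps sum_distrib_left sum_distrib_right)
    also have "(\<Sum>(c, l)\<leftarrow>merge_trace k ks. of_nat c * psums n l x) * vsq n x = (\<Sum>(c, l)\<leftarrow>merge_trace k ks. of_nat c * (psums n l x * vsq n x))"
      unfolding sum_list_mult_const[symmetric] by (simp add: case_prod_unfold mult.assoc)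
    finally show "(\<Sum>i<n. (of_nat k * of_real (x i) ^ (k - 1) * 1 * psums n ks x + of_real (x i) ^ k * dpsums n i ks x) * vsq n x
      + of_real (x i) ^ k * psums n ks x * dvsq n i x) =
      (\<Sum>r<k. psums n (r # (k - 1 - r) # ks) x * vsq n x) + (\<Sum>(c, l)\<leftarrow>merge_trace k ks. of_nat c * (psums n l x * vsq n x))" .
  qed
  also have "\<dots> = (\<Sum>r<k. ?E (\<lambda>x. psums n (r # (k - 1 - r) # ks) x * vsq n x)) + (\<Sum>(c, l)\<leftarrow>merge_trace k ks. of_nat c * ?E (\<lambda>x. psums n l x * vsq n x))"
  proof -
    have "?E (\<lambda>x. (\<Sum>r<k. psums n (r # (k - 1 - r) # ks) x * vsq n x) + (\<Sum>(c, l)\<leftarrow>merge_trace k ks. of_nat c * (psums n l x * vsq n x))) =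
      ?E (\<lambda>x. \<Sum>r<k. psums n (r # (k - 1 - r) # ks) x * vsq n x) + ?E (\<lambda>x. \<Sum>(c, l)\<leftarrow>merge_trace k ks. of_nat c * (psums n l x * vsq n x))"
      by (intro gint_add pf poly_fun_merge) auto
    also have "?E (\<lambda>x. \<Sum>r<k. psums n (r # (k - 1 - r) # ks) x * vsq n x) = (\<Sum>r<k. ?E (\<lambda>x. psums n (r # (k - 1 - r) # ks) x * vsq n x))"
      by (intro gint_sum pf) auto
    also have "?E (\<lambda>x. \<Sum>(c, l)\<leftarrow>merge_trace k ks. of_nat c * (psums n l x * vsq n x)) =
       (\<Sum>(c, l)\<leftarrow>merge_trace k ks. of_nat c * ?E (\<lambda>x. psums n l x * vsq n x))"
      by (intro gint_merge pf) auto
    finally show ?thesis .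
  qed
  finally show "?E (\<lambda>x. psums n (Suc k # ks) x * vsq n x) =
     (\<Sum>r<k. ?E (\<lambda>x. psums n (r # (k - 1 - r) # ks) x * vsq n x)) + (\<Sum>(c, l)\<leftarrow>merge_trace k ks. of_nat c * ?E (\<lambda>x. psums n l x * vsq n x))" .
qed

section \<open>Loop equations on the matrix side\<close>

text \<open>The entries of \<open>herm_of_coords\<close>, in a form that is visibly polynomial in
  the coordinates.\<close>

definition ment :: "nat \<Rightarrow> nat \<Rightarrow> (nat \<times> nat \<Rightarrow> real) \<Rightarrow> complex" where
  "ment a b x = (if a = b then of_real (x (a, a)) else if a < b then of_real (x (a, b)) + \<i> * of_real (x (b, a))
     else of_real (x (b, a)) - \<i> * of_real (x (a, b)))"

fun mpow :: "nat \<Rightarrow> nat \<Rightarrow> nat \<Rightarrow> nat \<Rightarrow> (nat \<times> nat \<Rightarrow> real) \<Rightarrow> complex" where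
  "mpow n 0 a b x = (if a = b then 1 else 0)"
| "mpow n (Suc k) a b x = (\<Sum>m<n. ment a m x * mpow n k m b x)"

lemma mpow_fun:
  "mpow n 0 a b = (\<lambda>x. if a = b then 1 else 0)"
  "mpow n (Suc k) a b = (\<lambda>x. \<Sum>m<n. ment a m x * mpow n k m b x)"
  by (rule ext, simp)+

lemma mpow_add:
  assumes "a < n"
  shows "mpow n (i + j) a b x = (\<Sum>m<n. mpow n i a m x * mpow n j m b x)"
  using assms
proof (induction i arbitrary: a)
  case 0
  then show ?case by (simp add: if_distrib[of "\<lambda>c. c * _"] cong: if_cong)
next
  case (Suc i)
  have "mpow n (Suc i + j) a b x = (\<Sum>l<n. ment a l x * (\<Sum>m<n. mpow n i l m x * mpow n j m b x))"
    using Suc.IH by simp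
  also have "\<dots> = (\<Sum>m<n. \<Sum>l<n. ment a l x * mpow n i l m x * mpow n j m b x)"
    unfolding sum_distrib_left by (subst sum.swap) (simp add: mult.assoc)
  finally show ?case by (simp add: sum_distrib_right)
qed

definition mtr :: "nat \<Rightarrow> nat \<Rightarrow> (nat \<times> nat \<Rightarrow> real) \<Rightarrow> complex" where
  "mtr n k x = (\<Sum>a<n. mpow n k a a x)"

definition mtrs :: "nat \<Rightarrow> nat list \<Rightarrow> (nat \<times> nat \<Rightarrow> real) \<Rightarrow> complex" where
  "mtrs n ks x = (\<Prod>k\<leftarrow>ks. mtr n k x)"

lemma mtrs_simps [simp]: "mtrs n [] x = 1" "mtrs n (k # ks) x = mtr n k x * mtrs n ks x"
  by (simp_all add: mtrs_def)

lemma mtrs_fun: "mtrs n [] = (\<lambda>x. 1)" "mtrs n (k # ks) = (\<lambda>x. mtr n k x * mtrs n ks x)"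
  by (rule ext, simp)+

abbreviation sq :: "nat \<Rightarrow> (nat \<times> nat) set" where "sq n \<equiv> {..<n} \<times> {..<n}"

lemma poly_fun_ment: "a < n \<Longrightarrow> b < n \<Longrightarrow> poly_fun (sq n) (ment a b)"
  unfolding ment_def[abs_def]
  by (cases "a = b"; cases "a < b") (auto intro!: poly_fun.intros poly_fun_diff)

lemma poly_fun_mpow: "a < n \<Longrightarrow> b < n \<Longrightarrow> poly_fun (sq n) (mpow n k a b)"
proof (induction k arbitrary: a)
  case 0 then show ?case unfolding mpow_fun by (intro poly_fun.const)
next
  case (Suc k) then show ?case unfolding mpow_fun by (intro poly_fun_sum poly_fun.mult poly_fun_ment) auto
qed

lemma poly_fun_mtr: "poly_fun (sq n) (mtr n k)"
  unfolding mtr_def[abs_def] by (intro poly_fun_sum poly_fun_mpow) auto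

lemma poly_fun_mtrs: "poly_fun (sq n) (mtrs n ks)"
  by (induction ks) (auto simp: mtrs_fun intro!: poly_fun.intros poly_fun_mtr)

text \<open>The deviations for which the Gaussian density is proportional to the exponential of
  \<open>- tr (X * X) / 2\<close>. Each off-diagonal real or imaginary part enters this trace twice,
  a diagonal entry once.\<close>

definition std_dev :: "nat \<times> nat \<Rightarrow> real" where
  "std_dev e = (if fst e = snd e then 1 else sqrt (1 / 2))"

lemma std_dev_pos: "0 < std_dev e" by (simp add: std_dev_def)

text \<open>The coefficients of the Wirtinger derivative with respect to the entry
  \<open>(b, a)\<close>: half of the derivative in the real part and half of \<plusminus>\<i> times
  that in the imaginary part. A diagonal entry has a real coordinate only.\<close>

definition lead_coef :: "nat \<Rightarrow> nat \<Rightarrow> complex" where "lead_coef a b = (if a = b then 1 else 1 / 2)"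
definition im_coef :: "nat \<Rightarrow> nat \<Rightarrow> complex" where
  "im_coef a b = (if a = b then 0 else if a < b then \<i> / 2 else - \<i> / 2)"

text \<open>The derivation dual to the entry \<open>(a, b)\<close> under the Gaussian measure: it sends the entry \<open>(b, a)\<close> to \<open>1\<close>
  and all other entries to \<open>0\<close>.\<close>

definition entry_derivation :: "nat \<Rightarrow> nat \<Rightarrow> nat \<Rightarrow> ((nat \<times> nat \<Rightarrow> real) \<Rightarrow> complex) \<Rightarrow> ((nat \<times> nat \<Rightarrow> real) \<Rightarrow> complex) \<Rightarrow> bool" where
  "entry_derivation n a b F G \<longleftrightarrow> (\<exists>F1 F2. poly_fun (sq n) F \<and> poly_fun (sq n) F1 \<and> poly_fun (sq n) F2 \<and>
     has_pd (min a b, max a b) F F1 \<and> has_pd (max a b, min a b) F F2 \<and>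
     G = (\<lambda>x. lead_coef a b * F1 x + im_coef a b * F2 x))"

lemma entry_derivation_poly_fun: "entry_derivation n a b F G \<Longrightarrow> poly_fun (sq n) F \<and> poly_fun (sq n) G"
  unfolding entry_derivation_def by (auto intro!: poly_fun.intros)

lemma entry_derivation_mult:
  assumes "entry_derivation n a b F G" "entry_derivation n a b F' G'"
  shows "entry_derivation n a b (\<lambda>x. F x * F' x) (\<lambda>x. G x * F' x + F x * G' x)"
proof -
  obtain F1 F2 where *: "poly_fun (sq n) F" "poly_fun (sq n) F1" "poly_fun (sq n) F2"
     "has_pd (min a b, max a b) F F1" "has_pd (max a b, min a b) F F2"
     and G: "G = (\<lambda>x. lead_coef a b * F1 x + im_coef a b * F2 x)"
    using assms(1) unfolding entry_derivation_def by blast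
  obtain F1' F2' where **: "poly_fun (sq n) F'" "poly_fun (sq n) F1'" "poly_fun (sq n) F2'"
     "has_pd (min a b, max a b) F' F1'" "has_pd (max a b, min a b) F' F2'"
     and G': "G' = (\<lambda>x. lead_coef a b * F1' x + im_coef a b * F2' x)"
    using assms(2) unfolding entry_derivation_def by blast
  show ?thesis unfolding entry_derivation_def
  proof (rule exI[of _ "\<lambda>x. F1 x * F' x + F x * F1' x"], rule exI[of _ "\<lambda>x. F2 x * F' x + F x * F2' x"], intro conjI)
    show "(\<lambda>x. G x * F' x + F x * G' x) = (\<lambda>x. lead_coef a b * (F1 x * F' x + F x * F1' x) + im_coef a b * (F2 x * F' x + F x * F2' x))"
      unfolding G G' by (simp add: algebra_simps)
  qed (intro poly_fun.intros has_pd_mult * **)+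
qed

lemma entry_derivation_const: "entry_derivation n a b (\<lambda>x. c) (\<lambda>x. 0)"
  unfolding entry_derivation_def
  by (rule exI[of _ "\<lambda>x. 0"], rule exI[of _ "\<lambda>x. 0"]) (auto intro!: poly_fun.intros has_pd_const)

lemma entry_derivation_add:
  assumes "entry_derivation n a b F G" "entry_derivation n a b F' G'"
  shows "entry_derivation n a b (\<lambda>x. F x + F' x) (\<lambda>x. G x + G' x)"
proof -
  obtain F1 F2 where *: "poly_fun (sq n) F" "poly_fun (sq n) F1" "poly_fun (sq n) F2"
     "has_pd (min a b, max a b) F F1" "has_pd (max a b, min a b) F F2"
     and G: "G = (\<lambda>x. lead_coef a b * F1 x + im_coef a b * F2 x)"
    using assms(1) unfolding entry_derivation_def by blast
  obtain F1' F2' where **: "poly_fun (sq n) F'" "poly_fun (sq n) F1'" "poly_fun (sq n) F2'"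
     "has_pd (min a b, max a b) F' F1'" "has_pd (max a b, min a b) F' F2'"
     and G': "G' = (\<lambda>x. lead_coef a b * F1' x + im_coef a b * F2' x)"
    using assms(2) unfolding entry_derivation_def by blast
  show ?thesis unfolding entry_derivation_def
  proof (rule exI[of _ "\<lambda>x. F1 x + F1' x"], rule exI[of _ "\<lambda>x. F2 x + F2' x"], intro conjI)
    show "(\<lambda>x. G x + G' x) = (\<lambda>x. lead_coef a b * (F1 x + F1' x) + im_coef a b * (F2 x + F2' x))"
      unfolding G G' by (simp add: algebra_simps)
  qed (intro poly_fun.intros has_pd_add * **)+
qed

lemma entry_derivation_sum:
  "(\<And>i. i \<in> A \<Longrightarrow> entry_derivation n a b (F i) (G i)) \<Longrightarrow>
    entry_derivation n a b (\<lambda>x. \<Sum>i\<in>A. F i x) (\<lambda>x. \<Sum>i\<in>A. G i x)"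
  by (induction A rule: infinite_finite_induct) (auto intro: entry_derivation_const entry_derivation_add)

definition dment :: "nat \<times> nat \<Rightarrow> nat \<Rightarrow> nat \<Rightarrow> complex" where
  "dment e c d = (if c = d then (if e = (c, c) then 1 else 0)
    else if c < d then (if e = (c, d) then 1 else 0) + \<i> * (if e = (d, c) then 1 else 0)
    else (if e = (d, c) then 1 else 0) - \<i> * (if e = (c, d) then 1 else 0))"

lemma has_pd_ment: "has_pd e (ment c d) (\<lambda>x. dment e c d)"
proof -
  consider "c = d" | "c < d" | "d < c" by linarith
  then show ?thesis
  proof cases
    case 1
    have "has_pd e (\<lambda>x. complex_of_real (x (c, c))) (\<lambda>x. if e = (c, c) then 1 else 0)" by (rule has_pd_coord)
    then show ?thesis using 1 by (simp add: ment_def[abs_def] dment_def)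
  next
    case 2
    have "has_pd e (\<lambda>x. of_real (x (c, d)) + \<i> * of_real (x (d, c)))
      (\<lambda>x. (if e = (c, d) then 1 else 0) + \<i> * (if e = (d, c) then 1 else 0))"
      by (intro has_pd_add has_pd_cmult has_pd_coord)
    moreover have "ment c d = (\<lambda>x. of_real (x (c, d)) + \<i> * of_real (x (d, c)))" using 2 by (auto simp: ment_def)
    moreover have "dment e c d = (if e = (c, d) then 1 else 0) + \<i> * (if e = (d, c) then 1 else 0)"
      using 2 by (auto simp: dment_def)
    ultimately show ?thesis by simp
  next
    case 3
    have "has_pd e (\<lambda>x. of_real (x (d, c)) - \<i> * of_real (x (c, d)))
      (\<lambda>x. (if e = (d, c) then 1 else 0) - \<i> * (if e = (c, d) then 1 else 0))"
      by (intro has_pd_minus has_pd_cmult has_pd_coord)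
    moreover have "ment c d = (\<lambda>x. of_real (x (d, c)) - \<i> * of_real (x (c, d)))" using 3 by (auto simp: ment_def)
    moreover have "dment e c d = (if e = (d, c) then 1 else 0) - \<i> * (if e = (c, d) then 1 else 0)"
      using 3 by (auto simp: dment_def)
    ultimately show ?thesis by simp
  qed
qed

lemma entry_derivation_ment:
  assumes "a < n" "b < n" "c < n" "d < n"
  shows "entry_derivation n a b (ment c d) (\<lambda>x. if c = b \<and> d = a then 1 else 0)"
proof -
  have *: "(if c = b \<and> d = a then 1 else 0) =
      lead_coef a b * dment (min a b, max a b) c d + im_coef a b * dment (max a b, min a b) c d"
  proof -
    consider "a = b" | "a < b" | "b < a" by linarith
    then show ?thesis
    proof cases
      case 1 then show ?thesis by (auto simp: lead_coef_def im_coef_def dment_def)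
    next
      case 2
      then have "min a b = a" "max a b = b" by auto
      then show ?thesis using 2 by (auto simp: lead_coef_def im_coef_def dment_def)
    next
      case 3
      then have "min a b = b" "max a b = a" by auto
      then show ?thesis using 3 by (auto simp: lead_coef_def im_coef_def dment_def)
    qed
  qed
  show ?thesis unfolding entry_derivation_def *
    by (rule exI[of _ "\<lambda>x. dment (min a b, max a b) c d"], rule exI[of _ "\<lambda>x. dment (max a b, min a b) c d"],
        intro conjI has_pd_ment poly_fun_ment assms poly_fun.const refl)
qed

text \<open>The factor \<open>1 / 2\<close> in the coefficients of the derivation equals the
  variance of the off-diagonal coordinates, so integration by parts in the real and in the imaginary
  part combine to a single complex derivation.\<close>

lemma entry_integration_by_parts:
  assumes "a < n" "b < n" "entry_derivation n a b F G"
  shows "gint (sq n) std_dev (\<lambda>x. ment a b x * F x) = gint (sq n) std_dev G"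
proof -
  let ?E = "gint (sq n) std_dev"
  obtain F1 F2 where *: "poly_fun (sq n) F" "poly_fun (sq n) F1" "poly_fun (sq n) F2"
     "has_pd (min a b, max a b) F F1" "has_pd (max a b, min a b) F F2"
     "G = (\<lambda>x. lead_coef a b * F1 x + im_coef a b * F2 x)"
    using assms(3) unfolding entry_derivation_def by blast
  have ibp: "?E (\<lambda>x. of_real (x (a, b)) * F x) = of_real ((std_dev (a, b))\<^sup>2) * ?E F'"
    if "a < n" "b < n" "has_pd (a, b) F F'" "poly_fun (sq n) F'" for a b F'
    using that *(1) std_dev_pos by (intro gauss_integration_by_parts) auto
  have G: "?E G = lead_coef a b * ?E F1 + im_coef a b * ?E F2"
  proof -
    have "?E G = ?E (\<lambda>x. lead_coef a b * F1 x) + ?E (\<lambda>x. im_coef a b * F2 x)"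
      unfolding *(6) using std_dev_pos * by (intro gint_add poly_fun.intros) auto
    then show ?thesis by (simp only: gint_cmult)
  qed
  have half: "(std_dev (c, d))\<^sup>2 = 1 / 2" if "c \<noteq> d" for c d using that by (simp add: std_dev_def)
  consider "a = b" | "a < b" | "b < a" by linarith
  then show ?thesis
  proof cases
    case 1
    then have "?E (\<lambda>x. ment a b x * F x) = ?E (\<lambda>x. of_real (x (a, b)) * F x)" by (simp add: ment_def)
    also have "\<dots> = of_real ((std_dev (a, b))\<^sup>2) * ?E F1"
      using assms * 1 by (intro ibp) auto
    finally show ?thesis using G 1 by (simp add: std_dev_def lead_coef_def im_coef_def)
  next
    case 2
    have "?E (\<lambda>x. ment a b x * F x) = ?E (\<lambda>x. of_real (x (a, b)) * F x + \<i> * (of_real (x (b, a)) * F x))"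
      using 2 by (intro Bochner_Integration.integral_cong) (auto simp: ment_def algebra_simps)
    also have "\<dots> = ?E (\<lambda>x. of_real (x (a, b)) * F x) + ?E (\<lambda>x. \<i> * (of_real (x (b, a)) * F x))"
      using assms * std_dev_pos by (intro gint_add poly_fun.intros) auto
    also have "?E (\<lambda>x. \<i> * (of_real (x (b, a)) * F x)) = \<i> * ?E (\<lambda>x. of_real (x (b, a)) * F x)" by (rule gint_cmult)
    also have "?E (\<lambda>x. of_real (x (a, b)) * F x) = of_real ((std_dev (a, b))\<^sup>2) * ?E F1"
      using assms * 2 by (intro ibp) auto
    also have "?E (\<lambda>x. of_real (x (b, a)) * F x) = of_real ((std_dev (b, a))\<^sup>2) * ?E F2"
      using assms * 2 by (intro ibp) auto
    finally show ?thesis using G 2 by (simp add: half lead_coef_def im_coef_def)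
  next
    case 3
    have "?E (\<lambda>x. ment a b x * F x) = ?E (\<lambda>x. of_real (x (b, a)) * F x + (- \<i>) * (of_real (x (a, b)) * F x))"
      using 3 by (intro Bochner_Integration.integral_cong) (auto simp: ment_def algebra_simps)
    also have "\<dots> = ?E (\<lambda>x. of_real (x (b, a)) * F x) + ?E (\<lambda>x. (- \<i>) * (of_real (x (a, b)) * F x))"
      using assms * std_dev_pos by (intro gint_add poly_fun.intros) auto
    also have "?E (\<lambda>x. (- \<i>) * (of_real (x (a, b)) * F x)) = (- \<i>) * ?E (\<lambda>x. of_real (x (a, b)) * F x)" by (rule gint_cmult)
    also have "?E (\<lambda>x. of_real (x (b, a)) * F x) = of_real ((std_dev (b, a))\<^sup>2) * ?E F1"
      using assms * 3 by (intro ibp) (auto simp: min_def max_def)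
    also have "?E (\<lambda>x. of_real (x (a, b)) * F x) = of_real ((std_dev (a, b))\<^sup>2) * ?E F2"
      using assms * 3 by (intro ibp) (auto simp: min_def max_def)
    finally show ?thesis using G 3 by (simp add: half lead_coef_def im_coef_def)
  qed
qed

text \<open>Leibniz' rule: one factor of the power is replaced by the matrix unit at
  \<open>(b, a)\<close>, which cuts the power into two.\<close>

lemma entry_derivation_mpow:
  assumes "a < n" "b < n" "c < n" "d < n"
  shows "entry_derivation n a b (mpow n k c d) (\<lambda>x. \<Sum>i<k. mpow n i c b x * mpow n (k - 1 - i) a d x)"
  using assms(3)
proof (induction k arbitrary: c)
  case 0
  then show ?case unfolding mpow_fun by (simp add: entry_derivation_const)
next
  case (Suc k)
  have "entry_derivation n a b (\<lambda>x. \<Sum>m<n. ment c m x * mpow n k m d x)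
    (\<lambda>x. \<Sum>m<n. (if c = b \<and> m = a then 1 else 0) * mpow n k m d x +
       ment c m x * (\<Sum>i<k. mpow n i m b x * mpow n (k - 1 - i) a d x))"
    by (intro entry_derivation_sum entry_derivation_mult entry_derivation_ment assms Suc) auto
  moreover have "(\<Sum>m<n. (if c = b \<and> m = a then 1 else 0) * mpow n k m d x +
       ment c m x * (\<Sum>i<k. mpow n i m b x * mpow n (k - 1 - i) a d x)) =
     (\<Sum>i<Suc k. mpow n i c b x * mpow n (Suc k - 1 - i) a d x)" for x
  proof -
    have "(\<Sum>m<n. (if c = b \<and> m = a then 1 else 0) * mpow n k m d x) = mpow n 0 c b x * mpow n k a d x"
      using assms(1) by (cases "c = b") (auto simp: if_distrib[of "\<lambda>c. c * _"] cong: if_cong)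
    moreover have "(\<Sum>m<n. ment c m x * (\<Sum>i<k. mpow n i m b x * mpow n (k - 1 - i) a d x)) =
       (\<Sum>i<k. mpow n (Suc i) c b x * mpow n (k - Suc i) a d x)"
      unfolding sum_distrib_left by (subst sum.swap) (simp add: sum_distrib_right mult.assoc)
    ultimately show ?thesis
      by (simp only: sum.distrib sum.lessThan_Suc_shift diff_Suc_1 diff_zero)
  qed
  ultimately show ?case unfolding mpow_fun by simp
qed

lemma entry_derivation_mtr:
  assumes "a < n" "b < n"
  shows "entry_derivation n a b (mtr n k) (\<lambda>x. of_nat k * mpow n (k - 1) a b x)"
proof -
  have "entry_derivation n a b (\<lambda>x. \<Sum>c<n. mpow n k c c x) (\<lambda>x. \<Sum>c<n. \<Sum>i<k. mpow n i c b x * mpow n (k - 1 - i) a c x)"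
    by (intro entry_derivation_sum entry_derivation_mpow assms) auto
  moreover have "(\<Sum>c<n. \<Sum>i<k. mpow n i c b x * mpow n (k - 1 - i) a c x) = of_nat k * mpow n (k - 1) a b x" for x
  proof -
    have "(\<Sum>c<n. \<Sum>i<k. mpow n i c b x * mpow n (k - 1 - i) a c x) = (\<Sum>i<k. \<Sum>c<n. mpow n (k - 1 - i) a c x * mpow n i c b x)"
      by (subst sum.swap) (simp add: mult.commute)
    also have "\<dots> = (\<Sum>i<k. mpow n (k - 1 - i + i) a b x)" by (simp only: mpow_add[OF assms(1)])
    finally show ?thesis by simp
  qed
  ultimately show ?thesis unfolding mtr_def[abs_def] by simp
qed

fun dmtrs :: "nat \<Rightarrow> nat \<Rightarrow> nat \<Rightarrow> nat list \<Rightarrow> (nat \<times> nat \<Rightarrow> real) \<Rightarrow> complex" where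
  "dmtrs n a b [] x = 0"
| "dmtrs n a b (k # ks) x = of_nat k * mpow n (k - 1) a b x * mtrs n ks x + mtr n k x * dmtrs n a b ks x"

lemma dmtrs_fun: "dmtrs n a b [] = (\<lambda>x. 0)"
  "dmtrs n a b (k # ks) = (\<lambda>x. of_nat k * mpow n (k - 1) a b x * mtrs n ks x + mtr n k x * dmtrs n a b ks x)"
  by (rule ext, simp)+

lemma entry_derivation_mtrs:
  "a < n \<Longrightarrow> b < n \<Longrightarrow> entry_derivation n a b (mtrs n ks) (dmtrs n a b ks)"
proof (induction ks)
  case Nil then show ?case unfolding mtrs_fun dmtrs_fun by (intro entry_derivation_const)
next
  case (Cons k ks)
  then show ?case unfolding mtrs_fun dmtrs_fun by (intro entry_derivation_mult entry_derivation_mtr)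
qed

text \<open>A differentiated trace is open at the indices \<open>a\<close> and \<open>b\<close>.
  Contraction with the \<open>k\<close>-th power closes it again, so the same list
  \<open>merge_trace\<close> appears as for power sums.\<close>

lemma sum_mpow_dmtrs:
  "(\<Sum>a<n. \<Sum>b<n. mpow n k b a x * dmtrs n a b ks x) = (\<Sum>(c, l)\<leftarrow>merge_trace k ks. of_nat c * mtrs n l x)"
proof (induction ks)
  case (Cons m ks)
  have "(\<Sum>a<n. \<Sum>b<n. mpow n k b a x * dmtrs n a b (m # ks) x) =
     (of_nat m * (\<Sum>b<n. \<Sum>a<n. mpow n k b a x * mpow n (m - 1) a b x)) * mtrs n ks x + mtr n m x * (\<Sum>a<n. \<Sum>b<n. mpow n k b a x * dmtrs n a b ks x)"
    by (subst sum.swap[of _ "{..<n}" "{..<n}"]) (simp add: distrib_left sum.distrib sum_distrib_left sum_distrib_right mult_ac, subst sum.swap, simp)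
  also have "of_nat m * (\<Sum>b<n. \<Sum>a<n. mpow n k b a x * mpow n (m - 1) a b x) = of_nat m * mtr n (k + m - 1) x"
    by (cases m) (simp_all add: mtr_def mpow_add)
  finally show ?case
    unfolding Cons.IH
    by (simp add: o_def case_prod_unfold sum_list_const_mult[symmetric] mult_ac del: sum_list_const_mult)
qed simp

text \<open>One factor of the power under the first trace is integrated by parts, entry by entry.
  Differentiating the remaining power splits this trace in two; differentiating the other traces
  merges them with it.\<close>

lemma loop_equations_matrix:
  "loop_equations n (\<lambda>ks. gint (sq n) std_dev (mtrs n ks))"
  unfolding loop_equations_def
proof (intro conjI allI)
  fix ks
  show "gint (sq n) std_dev (mtrs n (0 # ks)) = of_nat n * gint (sq n) std_dev (mtrs n ks)"
    by (simp add: mtr_def mult.assoc)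
next
  fix k ks
  let ?E = "gint (sq n) std_dev"
  note pf = poly_fun.intros poly_fun_ment poly_fun_mpow poly_fun_mtr poly_fun_mtrs poly_fun_sum std_dev_pos
  let ?G = "\<lambda>a b x. (\<Sum>i<k. mpow n i b b x * mpow n (k - 1 - i) a a x) * mtrs n ks x + mpow n k b a x * dmtrs n a b ks x"
  have der: "entry_derivation n a b (\<lambda>x. mpow n k b a x * mtrs n ks x) (?G a b)" if "a < n" "b < n" for a b
    by (intro entry_derivation_mult entry_derivation_mpow entry_derivation_mtrs that)
  have pfd: "poly_fun (sq n) (dmtrs n a b ks)" if "a < n" "b < n" for a b
    using entry_derivation_poly_fun[OF entry_derivation_mtrs[OF that]] by blast
  have pG: "poly_fun (sq n) (?G a b)" if "a < n" "b < n" for a b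
    using entry_derivation_poly_fun[OF der[OF that]] by blast
  have "?E (mtrs n (Suc k # ks)) = ?E (\<lambda>x. \<Sum>a<n. \<Sum>b<n. ment a b x * (mpow n k b a x * mtrs n ks x))"
    by (simp add: mtr_def sum_distrib_right sum_distrib_left mult_ac)
  also have "\<dots> = (\<Sum>a<n. ?E (\<lambda>x. \<Sum>b<n. ment a b x * (mpow n k b a x * mtrs n ks x)))"
    by (intro gint_sum pf) auto
  also have "\<dots> = (\<Sum>a<n. \<Sum>b<n. ?E (\<lambda>x. ment a b x * (mpow n k b a x * mtrs n ks x)))"
    by (intro sum.cong refl gint_sum pf) auto
  also have "\<dots> = (\<Sum>a<n. \<Sum>b<n. ?E (?G a b))"
    by (intro sum.cong refl entry_integration_by_parts der) auto
  also have "\<dots> = (\<Sum>a<n. ?E (\<lambda>x. \<Sum>b<n. ?G a b x))"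
    by (intro sum.cong refl gint_sum[symmetric] pG std_dev_pos) auto
  also have "\<dots> = ?E (\<lambda>x. \<Sum>a<n. \<Sum>b<n. ?G a b x)"
    by (intro gint_sum[symmetric] poly_fun_sum pG std_dev_pos) auto
  also have "\<dots> = ?E (\<lambda>x. (\<Sum>r<k. mtrs n (r # (k - 1 - r) # ks) x) + (\<Sum>(c, l)\<leftarrow>merge_trace k ks. of_nat c * mtrs n l x))"
  proof (intro Bochner_Integration.integral_cong refl arg_cong2[where f="(*)"])
    fix x
    have "(\<Sum>a<n. \<Sum>b<n. ?G a b x) = (\<Sum>a<n. \<Sum>b<n. \<Sum>i<k. mpow n i b b x * mpow n (k - 1 - i) a a x) * mtrs n ks x
       + (\<Sum>a<n. \<Sum>b<n. mpow n k b a x * dmtrs n a b ks x)"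
      by (simp add: sum.distrib sum_distrib_right)
    also have "(\<Sum>a<n. \<Sum>b<n. \<Sum>i<k. mpow n i b b x * mpow n (k - 1 - i) a a x) = (\<Sum>i<k. mtr n i x * mtr n (k - 1 - i) x)"
    proof -
      have "(\<Sum>b<n. \<Sum>i<k. mpow n i b b x * mpow n (k - 1 - i) a a x) = (\<Sum>i<k. mtr n i x * mpow n (k - 1 - i) a a x)" for a
        by (subst sum.swap) (simp only: mtr_def sum_distrib_right)
      then have "(\<Sum>a<n. \<Sum>b<n. \<Sum>i<k. mpow n i b b x * mpow n (k - 1 - i) a a x) = (\<Sum>a<n. \<Sum>i<k. mtr n i x * mpow n (k - 1 - i) a a x)"
        by simp
      also have "\<dots> = (\<Sum>i<k. mtr n i x * mtr n (k - 1 - i) x)"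
        by (subst sum.swap) (simp only: sum_distrib_left[symmetric] mtr_def[symmetric])
      finally show ?thesis .
    qed
    finally show "(\<Sum>a<n. \<Sum>b<n. ?G a b x) = (\<Sum>r<k. mtrs n (r # (k - 1 - r) # ks) x) + (\<Sum>(c, l)\<leftarrow>merge_trace k ks. of_nat c * mtrs n l x)"
      unfolding sum_mpow_dmtrs by (simp add: sum_distrib_right mult.assoc)
  qed
  also have "\<dots> = (\<Sum>r<k. ?E (mtrs n (r # (k - 1 - r) # ks))) + (\<Sum>(c, l)\<leftarrow>merge_trace k ks. of_nat c * ?E (mtrs n l))"
  proof -
    have "?E (\<lambda>x. (\<Sum>r<k. mtrs n (r # (k - 1 - r) # ks) x) + (\<Sum>(c, l)\<leftarrow>merge_trace k ks. of_nat c * mtrs n l x)) =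
      ?E (\<lambda>x. \<Sum>r<k. mtrs n (r # (k - 1 - r) # ks) x) + ?E (\<lambda>x. \<Sum>(c, l)\<leftarrow>merge_trace k ks. of_nat c * mtrs n l x)"
      by (intro gint_add poly_fun_sum poly_fun_mtrs poly_fun_merge std_dev_pos) auto
    also have "?E (\<lambda>x. \<Sum>r<k. mtrs n (r # (k - 1 - r) # ks) x) = (\<Sum>r<k. ?E (mtrs n (r # (k - 1 - r) # ks)))"
      by (intro gint_sum poly_fun_mtrs std_dev_pos) auto
    also have "?E (\<lambda>x. \<Sum>(c, l)\<leftarrow>merge_trace k ks. of_nat c * mtrs n l x) = (\<Sum>(c, l)\<leftarrow>merge_trace k ks. of_nat c * ?E (mtrs n l))"
      by (intro gint_merge poly_fun_mtrs std_dev_pos) auto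
    finally show ?thesis .
  qed
  finally show "?E (mtrs n (Suc k # ks)) =
     (\<Sum>r<k. ?E (mtrs n (r # (k - 1 - r) # ks))) + (\<Sum>(c, l)\<leftarrow>merge_trace k ks. of_nat c * ?E (mtrs n l))" .
qed

section \<open>Moment determinacy\<close>

lemma norm_exp_partial_sum: "norm (\<Sum>k<n. (z::complex) ^ k / fact k) \<le> exp (norm z)"
proof -
  have "norm (\<Sum>k<n. z ^ k / fact k) \<le> (\<Sum>k<n. norm z ^ k / fact k)"
    by (rule order_trans[OF norm_sum]) (simp add: norm_divide norm_power)
  also have "\<dots> \<le> (\<Sum>k. norm z ^ k / fact k)"
    using summable_exp[of "norm z"] by (intro sum_le_suminf) (auto simp: divide_inverse mult.commute)
  also have "\<dots> = exp (norm z)" by (simp add: exp_def divide_inverse mult.commute)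
  finally show ?thesis .
qed

lemma integrable_power_if_exp:
  assumes "sets M = sets borel" "integrable M (\<lambda>x::real. exp \<bar>x\<bar>)"
  shows "integrable M (\<lambda>x. x ^ k)"
proof (rule Bochner_Integration.integrable_bound)
  show "integrable M (\<lambda>x. fact k * exp \<bar>x\<bar>)" using assms by simp
  show "(\<lambda>x. x ^ k) \<in> borel_measurable M" using assms(1) by (simp cong: measurable_cong_sets)
  show "AE x in M. norm (x ^ k) \<le> norm (fact k * exp \<bar>x\<bar>)"
  proof (rule AE_I2)
    fix x :: real
    have "\<bar>x\<bar> ^ k / fact k \<le> (\<Sum>j\<in>{k}. \<bar>x\<bar> ^ j / fact j)" by simp
    also have "\<dots> \<le> (\<Sum>j. \<bar>x\<bar> ^ j / fact j)"
      using summable_exp[of "\<bar>x\<bar>"] by (intro sum_le_suminf) (auto simp: divide_inverse mult.commute)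
    also have "\<dots> = exp \<bar>x\<bar>" by (simp add: exp_def divide_inverse mult.commute)
    finally show "norm (x ^ k) \<le> norm (fact k * exp \<bar>x\<bar>)" by (simp add: field_simps power_abs)
  qed
qed

text \<open>The partial sums of the exponential series are dominated by
  \<open>exp (\<bar>t\<bar> * \<bar>x\<bar>)\<close>, which is integrable, so the characteristic
  function is the sum of the moment series.\<close>

lemma char_moment_limit:
  assumes M: "finite_measure M" "sets M = sets borel" and ex: "\<And>c. integrable M (\<lambda>x::real. exp (c * \<bar>x\<bar>))"
  shows "(\<lambda>n. \<Sum>k<n. (\<i> * of_real t) ^ k / fact k * of_real (LINT x|M. x ^ k)) \<longlonglongrightarrow> (CLINT x|M. iexp (t * x))"
proof -
  have ip: "integrable M (\<lambda>x. x ^ k)" for k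
    using integrable_power_if_exp[OF M(2)] ex[of 1] by simp
  have ipc: "integrable M (\<lambda>x. (\<i> * of_real t) ^ k / fact k * complex_of_real (x ^ k))" for k
    by (intro integrable_mult_right integrable_of_real ip)
  have "(\<lambda>n. CLINT x|M. (\<Sum>k<n. (\<i> * of_real t) ^ k / fact k * of_real (x ^ k))) \<longlonglongrightarrow> (CLINT x|M. iexp (t * x))"
  proof (rule integral_dominated_convergence)
    show "integrable M (\<lambda>x. exp (\<bar>t\<bar> * \<bar>x\<bar>))" by (rule ex)
    show "(\<lambda>x. iexp (t * x)) \<in> borel_measurable M"
      using M(2) by (simp cong: measurable_cong_sets)
    show "(\<lambda>x. \<Sum>k<n. (\<i> * of_real t) ^ k / fact k * complex_of_real (x ^ k)) \<in> borel_measurable M" for n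
      using M(2) by (simp cong: measurable_cong_sets)
    have eq: "(\<Sum>k<n. (\<i> * of_real t) ^ k / fact k * complex_of_real (x ^ k)) = (\<Sum>k<n. (\<i> * of_real (t * x)) ^ k / fact k)" for n x
      by (simp add: power_mult_distrib mult_ac)
    show "AE x in M. (\<lambda>n. \<Sum>k<n. (\<i> * of_real t) ^ k / fact k * complex_of_real (x ^ k)) \<longlonglongrightarrow> iexp (t * x)"
    proof (rule AE_I2)
      fix x
      have "(\<lambda>k. (\<i> * of_real (t * x)) ^ k / fact k) sums exp (\<i> * complex_of_real (t * x))"
        using exp_converges[of "\<i> * complex_of_real (t * x)"] by (simp add: scaleR_conv_of_real divide_inverse mult.commute)
      then show "(\<lambda>n. \<Sum>k<n. (\<i> * of_real t) ^ k / fact k * complex_of_real (x ^ k)) \<longlonglongrightarrow> iexp (t * x)"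
        unfolding eq sums_def .
    qed
    show "AE x in M. norm (\<Sum>k<n. (\<i> * of_real t) ^ k / fact k * complex_of_real (x ^ k)) \<le> exp (\<bar>t\<bar> * \<bar>x\<bar>)" for n
      unfolding eq by (rule AE_I2, rule order_trans[OF norm_exp_partial_sum]) (simp add: norm_mult abs_mult)
  qed
  also have "(\<lambda>n. CLINT x|M. (\<Sum>k<n. (\<i> * of_real t) ^ k / fact k * of_real (x ^ k))) =
     (\<lambda>n. \<Sum>k<n. (\<i> * of_real t) ^ k / fact k * of_real (LINT x|M. x ^ k))"
    by (rule ext, subst Bochner_Integration.integral_sum[OF ipc])
      (simp only: integral_mult_right_zero integral_complex_of_real)
  finally show ?thesis .
qed

text \<open>The moments determine the characteristic function, and the zeroth one the total mass.
  After normalisation Levy's uniqueness theorem applies; the zero measure cannot be normalised and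
  is treated apart.\<close>

lemma moment_determinacy_real:
  assumes M1: "finite_measure M1" "sets M1 = sets borel" "\<And>c. integrable M1 (\<lambda>x::real. exp (c * \<bar>x\<bar>))"
    and M2: "finite_measure M2" "sets M2 = sets borel" "\<And>c. integrable M2 (\<lambda>x::real. exp (c * \<bar>x\<bar>))"
    and eq: "\<And>k. (LINT x|M1. x ^ k) = (LINT x|M2. x ^ k)"
  shows "M1 = M2"
proof -
  interpret M1: finite_measure M1 by fact
  interpret M2: finite_measure M2 by fact
  have sp: "space M1 = UNIV" "space M2 = UNIV" using sets_eq_imp_space_eq[OF M1(2)] sets_eq_imp_space_eq[OF M2(2)] by auto
  define m where "m = measure M1 UNIV"
  have m: "m = measure M1 UNIV" "m = measure M2 UNIV"
    using eq[of 0] by (simp_all add: m_def sp)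
  show ?thesis
  proof (cases "m = 0")
    case True
    have "emeasure M1 A = emeasure M2 A" if "A \<in> sets M1" for A
    proof -
      have "measure M1 A \<le> measure M1 UNIV" "measure M2 A \<le> measure M2 UNIV"
        using M1.bounded_measure[of A] M2.bounded_measure[of A] by (auto simp: sp)
      then have "measure M1 A = 0" "measure M2 A = 0"
        using m True by (auto intro: antisym simp: measure_le_0_iff)
      then show ?thesis by (simp add: M1.emeasure_eq_measure M2.emeasure_eq_measure)
    qed
    then show ?thesis using M1(2) M2(2) by (intro measure_eqI) auto
  next
    case False
    then have m0: "m > 0" using m by (simp add: less_le)
    define N where "N M = density M (\<lambda>_::real. ennreal (1 / m))" for M
    have rd: "real_distribution (N M)" if "sets M = sets borel" "finite_measure M" "measure M UNIV = m" for M
    proof -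
      interpret finite_measure M by fact
      have spM: "space M = UNIV" using sets_eq_imp_space_eq[OF that(1)] by simp
      have "emeasure (N M) (space (N M)) = ennreal (1 / m) * emeasure M UNIV"
        by (simp add: N_def spM emeasure_density_const that(1))
      also have "\<dots> = 1" using m0 that(3) by (simp add: emeasure_eq_measure flip: ennreal_mult)
      finally have "prob_space (N M)" by (rule prob_spaceI)
      then show ?thesis using that(1) by (simp add: real_distribution_def real_distribution_axioms_def N_def)
    qed
    have ch: "char (N M) t = (1 / m) *\<^sub>R (CLINT x|M. iexp (t * x))" if "sets M = sets borel" for M t
      unfolding char_def N_def using that m0
      by (subst integral_density) (auto cong: measurable_cong_sets)
    have "(CLINT x|M1. iexp (t * x)) = (CLINT x|M2. iexp (t * x))" for t
      using char_moment_limit[OF M1, of t] char_moment_limit[OF M2, of t] unfolding eq by (rule LIMSEQ_unique)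
    then have "char (N M1) = char (N M2)" using ch M1(2) M2(2) by (intro ext) simp
    then have N: "N M1 = N M2"
      using rd[OF M1(2,1)] rd[OF M2(2,1)] m by (intro Levy_uniqueness) auto
    have dens: "M = density (N M) (\<lambda>_. ennreal m)" if "sets M = sets borel" for M
    proof (rule measure_eqI)
      fix A assume "A \<in> sets M"
      then show "emeasure M A = emeasure (density (N M) (\<lambda>_. ennreal m)) A"
        using m0 by (simp add: N_def emeasure_density nn_integral_density nn_integral_cmult mult.assoc[symmetric] flip: ennreal_mult)
    qed (simp add: N_def)
    show ?thesis using dens[OF M1(2)] dens[OF M2(2)] N by metis
  qed
qed

section \<open>Determinacy in several variables\<close>

lemma poly_exp_bound: "\<exists>C m. 0 \<le> C \<and> 0 \<le> m \<and> (\<forall>y::real. \<bar>poly q y\<bar> \<le> C * exp (m * \<bar>y\<bar>))"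
proof (induction q rule: pCons_induct)
  case 0 then show ?case by (intro exI[of _ 0]) simp
next
  case (pCons a q)
  then obtain C m where *: "0 \<le> C" "0 \<le> m" "\<And>y. \<bar>poly q y\<bar> \<le> C * exp (m * \<bar>y\<bar>)" by auto
  have "\<bar>poly (pCons a q) y\<bar> \<le> (\<bar>a\<bar> + C) * exp ((m + 1) * \<bar>y\<bar>)" for y
  proof -
    have "\<bar>y\<bar> \<le> exp \<bar>y\<bar>" using exp_ge_add_one_self[of "\<bar>y\<bar>"] by linarith
    then have "\<bar>y * poly q y\<bar> \<le> exp \<bar>y\<bar> * (C * exp (m * \<bar>y\<bar>))"
      unfolding abs_mult using * by (intro mult_mono) auto
    also have "\<dots> = C * exp ((m + 1) * \<bar>y\<bar>)" by (simp add: distrib_right exp_add)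
    finally have "\<bar>y * poly q y\<bar> \<le> C * exp ((m + 1) * \<bar>y\<bar>)" .
    moreover have "\<bar>a\<bar> \<le> \<bar>a\<bar> * exp ((m + 1) * \<bar>y\<bar>)"
      using *(2) by (intro mult_le_cancel_left1[THEN iffD2]) auto
    ultimately show ?thesis using abs_triangle_ineq[of a "y * poly q y"] by (simp add: distrib_right)
  qed
  then show ?case using * by (intro exI[of _ "\<bar>a\<bar> + C"] exI[of _ "m + 1"]) auto
qed

locale exp_moments = finite_measure M for M :: "(nat \<Rightarrow> real) measure" and n :: nat +
  assumes sets_M: "sets M = sets (Pi\<^sub>M {..<n} (\<lambda>_. borel))"
    and exp_int: "\<And>c. integrable M (\<lambda>x. \<Prod>i<n. exp (c * \<bar>x i\<bar>))"
begin

lemma coord_measurable: "i < n \<Longrightarrow> (\<lambda>x. x i) \<in> borel_measurable M"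
  unfolding measurable_cong_sets[OF sets_M refl] by (rule measurable_component_singleton) simp

lemma exp_bounded_integrable:
  assumes f: "\<And>i. i < n \<Longrightarrow> f i \<in> borel_measurable borel"
    and bd: "\<And>i. i < n \<Longrightarrow> \<exists>C m. 0 \<le> C \<and> 0 \<le> m \<and> (\<forall>y. \<bar>f i y\<bar> \<le> C * exp (m * \<bar>y\<bar>))"
  shows "integrable M (\<lambda>x. \<Prod>i<n. f i (x i) :: real)"
proof -
  have "\<forall>i. \<exists>C m. i < n \<longrightarrow> 0 \<le> C \<and> 0 \<le> m \<and> (\<forall>y. \<bar>f i y\<bar> \<le> C * exp (m * \<bar>y\<bar>))" using bd by blast
  then obtain C m where Cm: "\<And>i. i < n \<Longrightarrow> 0 \<le> C i \<and> 0 \<le> m i \<and> (\<forall>y. \<bar>f i y\<bar> \<le> C i * exp (m i * \<bar>y\<bar>))" by metis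
  \<comment> \<open>One exponent for all coordinates, as the exponential moments of the locale have
    a common constant.\<close>
  define k where "k = (\<Sum>i<n. m i)"
  have mk: "m i \<le> k" if "i < n" for i
    unfolding k_def using that Cm by (intro member_le_sum) auto
  show ?thesis
  proof (rule Bochner_Integration.integrable_bound)
    show "integrable M (\<lambda>x. (\<Prod>i<n. C i) * (\<Prod>i<n. exp (k * \<bar>x i\<bar>)))"
      by (intro integrable_mult_right exp_int)
    show "(\<lambda>x. \<Prod>i<n. f i (x i)) \<in> borel_measurable M"
      by (intro borel_measurable_prod measurable_compose[OF coord_measurable f]) auto
    show "AE x in M. norm (\<Prod>i<n. f i (x i)) \<le> norm ((\<Prod>i<n. C i) * (\<Prod>i<n. exp (k * \<bar>x i\<bar>)))"
    proof (rule AE_I2)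
      fix x
      have "norm (\<Prod>i<n. f i (x i)) = (\<Prod>i<n. \<bar>f i (x i)\<bar>)" by (simp add: abs_prod)
      also have "\<dots> \<le> (\<Prod>i<n. C i * exp (k * \<bar>x i\<bar>))"
      proof (intro prod_mono conjI)
        fix i assume "i \<in> {..<n}"
        then have i: "i < n" by simp
        have "\<bar>f i (x i)\<bar> \<le> C i * exp (m i * \<bar>x i\<bar>)" using Cm[OF i] by blast
        also have "\<dots> \<le> C i * exp (k * \<bar>x i\<bar>)"
          using Cm[OF i] mk[OF i] by (intro mult_left_mono) (auto intro: mult_right_mono)
        finally show "\<bar>f i (x i)\<bar> \<le> C i * exp (k * \<bar>x i\<bar>)" .
      qed simp
      also have "\<dots> = (\<Prod>i<n. C i) * (\<Prod>i<n. exp (k * \<bar>x i\<bar>))" by (rule prod.distrib)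
      also have "\<dots> \<le> norm \<dots>" by simp
      finally show "norm (\<Prod>i<n. f i (x i)) \<le> norm ((\<Prod>i<n. C i) * (\<Prod>i<n. exp (k * \<bar>x i\<bar>)))" .
    qed
  qed
qed

lemma poly_expansion:
  "(LINT x|M. (\<Prod>i<n. poly (q i) (x i))) =
     (\<Sum>g\<in>Pi\<^sub>E {..<n} (\<lambda>i. {..degree (q i)}). (\<Prod>i<n. coeff (q i) (g i)) * (LINT x|M. (\<Prod>i<n. x i ^ g i)))"
proof -
  have "(\<Prod>i<n. poly (q i) (x i)) = (\<Sum>g\<in>Pi\<^sub>E {..<n} (\<lambda>i. {..degree (q i)}). (\<Prod>i<n. coeff (q i) (g i)) * (\<Prod>i<n. x i ^ g i))" for x
    unfolding poly_altdef by (subst prod_sum_PiE) (auto simp: prod.distrib)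
  moreover have "integrable M (\<lambda>x. \<Prod>i<n. x i ^ g i)" for g
  proof (rule exp_bounded_integrable)
    fix i show "\<exists>C m. 0 \<le> C \<and> 0 \<le> m \<and> (\<forall>y::real. \<bar>y ^ g i\<bar> \<le> C * exp (m * \<bar>y\<bar>))"
      using poly_exp_bound[of "monom 1 (g i)"] by (simp add: poly_monom)
  qed simp
  ultimately show ?thesis by simp
qed

end

text \<open>Polynomial factors are replaced by indicators one coordinate at a time, which reduces
  the claim to the real line: all factors but that of coordinate \<open>k\<close> form a density
  \<open>W\<close> for the law of this coordinate. A density must be nonnegative, hence the
  restriction to nonnegative polynomials in \<open>stage\<close>.\<close>

lemma moment_determinacy:
  assumes M1: "exp_moments M1 n" and M2: "exp_moments M2 n"
    and eq: "\<And>g. (LINT x|M1. (\<Prod>i<n. x i ^ g i)) = (LINT x|M2. (\<Prod>i<n. x i ^ g i))"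
  shows "M1 = M2"
proof -
  interpret M1: exp_moments M1 n by fact
  interpret M2: exp_moments M2 n by fact
  define F where "F k B q i y = (if i < k then indicator (B i) y else poly (q i) y)"
    for k :: nat and B :: "nat \<Rightarrow> real set" and q :: "nat \<Rightarrow> real poly" and i and y :: real
  have poly_meas: "poly r \<in> borel_measurable borel" for r :: "real poly"
    by (intro borel_measurable_continuous_onI continuous_intros)
  have F_meas: "F k B q i \<in> borel_measurable borel" if "\<And>i. B i \<in> sets borel" for k B q i
    using that by (cases "i < k") (simp_all add: F_def[abs_def] poly_meas)
  have F_bd: "\<exists>C m. 0 \<le> C \<and> 0 \<le> m \<and> (\<forall>y. \<bar>F k B q i y\<bar> \<le> C * exp (m * \<bar>y\<bar>))" for k B q i
  proof (cases "i < k")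
    case True
    then show ?thesis by (intro exI[of _ 1] exI[of _ 0]) (simp add: F_def indicator_def)
  next
    case False
    then show ?thesis using poly_exp_bound[of "q i"] by (simp add: F_def)
  qed
  have stage: "\<lbrakk>\<And>i. B i \<in> sets borel; \<And>i y. 0 \<le> poly (q i) y; k \<le> n\<rbrakk> \<Longrightarrow>
    (LINT x|M1. (\<Prod>i<n. F k B q i (x i))) = (LINT x|M2. (\<Prod>i<n. F k B q i (x i)))" for k B q
  proof (induction k arbitrary: B q)
    case 0
    then show ?case unfolding F_def by (simp add: M1.poly_expansion M2.poly_expansion eq)
  next
    case (Suc k)
    then have kn: "k < n" by simp
    define W where "W x = (\<Prod>i\<in>{..<n} - {k}. F k B q i (x i))" for x
    define D where "D M = distr (density M (\<lambda>x. ennreal (W x))) borel (\<lambda>x. x k)" for M :: "(nat \<Rightarrow> real) measure"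
    have W0: "0 \<le> W x" for x unfolding W_def F_def using Suc.prems by (intro prod_nonneg) auto
    have Wm: "W \<in> borel_measurable M" if "exp_moments M n" for M
    proof -
      interpret exp_moments M n by fact
      show ?thesis unfolding W_def
        by (intro borel_measurable_prod measurable_compose[OF coord_measurable F_meas]) (use Suc.prems in auto)
    qed
    have split: "f (x k) * W x = (\<Prod>i<n. (if i = k then f else F k B q i) (x i))" for f x
      unfolding W_def using kn by (subst prod.remove[of "{..<n}" k]) (auto intro!: prod.cong)
    have Wint: "integrable M (\<lambda>x. f (x k) * W x)" if "exp_moments M n" "f \<in> borel_measurable borel"
      "\<exists>C m. 0 \<le> C \<and> 0 \<le> m \<and> (\<forall>y. \<bar>f y\<bar> \<le> C * exp (m * \<bar>y\<bar>))" for M f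
    proof -
      interpret exp_moments M n by fact
      show ?thesis unfolding split
        by (rule exp_bounded_integrable) (use that F_meas[OF Suc.prems(1)] F_bd in auto)
    qed
    have Dint: "(LINT y|D M. f y) = (LINT x|M. f (x k) * W x)" "integrable (D M) f = integrable M (\<lambda>x. f (x k) * W x)"
      if "exp_moments M n" "f \<in> borel_measurable borel" for M and f :: "real \<Rightarrow> real"
    proof -
      interpret exp_moments M n by fact
      have m: "(\<lambda>x. x k) \<in> measurable (density M (\<lambda>x. ennreal (W x))) borel"
        using coord_measurable[OF kn] by simp
      have fm: "(\<lambda>x. f (x k)) \<in> borel_measurable M" by (rule measurable_compose[OF coord_measurable[OF kn] that(2)])
      show "(LINT y|D M. f y) = (LINT x|M. f (x k) * W x)"
        unfolding D_def using integral_distr[OF m that(2)] integral_real_density[OF Wm[OF that(1)] _ fm] W0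
        by (simp add: mult.commute)
      show "integrable (D M) f = integrable M (\<lambda>x. f (x k) * W x)"
        unfolding D_def using integrable_distr_eq[OF m that(2)] integrable_real_density[OF Wm[OF that(1)] _ fm] W0
        by (simp add: mult.commute)
    qed
    have Dfin: "finite_measure (D M)" "sets (D M) = sets borel" "integrable (D M) (\<lambda>y. exp (c * \<bar>y\<bar>))"
      if "exp_moments M n" for M c
    proof -
      interpret exp_moments M n by fact
      show "sets (D M) = sets borel" by (simp add: D_def)
      have ex: "integrable (D M) (\<lambda>y. exp (c * \<bar>y\<bar>))" for c
      proof -
        have "exp (c * \<bar>y\<bar>) \<le> exp (\<bar>c\<bar> * \<bar>y\<bar>)" for y :: real
          using mult_right_mono[of c "\<bar>c\<bar>" "\<bar>y\<bar>"] by simp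
        then have "\<exists>C m. 0 \<le> C \<and> 0 \<le> m \<and> (\<forall>y::real. \<bar>exp (c * \<bar>y\<bar>)\<bar> \<le> C * exp (m * \<bar>y\<bar>))"
          by (intro exI[of _ 1] exI[of _ "\<bar>c\<bar>"]) simp
        then have "integrable M (\<lambda>x. exp (c * \<bar>x k\<bar>) * W x)" by (intro Wint[OF that]) auto
        then show ?thesis by (subst Dint(2)[OF that]) auto
      qed
      then show "integrable (D M) (\<lambda>y. exp (c * \<bar>y\<bar>))" .
      have "integrable (D M) (\<lambda>y. 1 :: real)" using ex[of 0] by simp
      then show "finite_measure (D M)"
        by (intro finite_measureI) (auto simp: integrable_iff_bounded less_top)
    qed
    have pol: "(LINT x|M1. poly r (x k) * W x) = (LINT x|M2. poly r (x k) * W x)" if "\<And>y. 0 \<le> poly r y" for r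
    proof -
      have "(\<Prod>i<n. (if i = k then poly r else F k B q i) (x i)) = (\<Prod>i<n. F k B (q(k := r)) i (x i))" for x
        by (intro prod.cong) (auto simp: F_def)
      moreover have "(LINT x|M1. (\<Prod>i<n. F k B (q(k := r)) i (x i))) = (LINT x|M2. (\<Prod>i<n. F k B (q(k := r)) i (x i)))"
        by (rule Suc.IH) (use Suc.prems that in auto)
      ultimately show ?thesis unfolding split by simp
    qed
    have ipol: "integrable M (\<lambda>x. poly r (x k) * W x)" if "exp_moments M n" for M r
      by (rule Wint[OF that poly_meas poly_exp_bound])
    have mom: "(LINT x|M1. x k ^ j * W x) = (LINT x|M2. x k ^ j * W x)" for j
    proof -
      \<comment> \<open>A monomial \<open>a\<close> is half of
        \<open>(a + 1) * (a + 1) - a * a - 1\<close>, a combination of nonnegative polynomials, to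
        which the induction hypothesis applies.\<close>
      define a where "a = monom (1::real) j"
      define p1 p2 where "p1 = (a + 1) * (a + 1)" and "p2 = a * a"
      have e: "x k ^ j * W x = (poly p1 (x k) * W x - poly p2 (x k) * W x - poly 1 (x k) * W x) / 2" for x
        by (simp add: p1_def p2_def a_def poly_monom algebra_simps)
      have av: "(LINT x|M. x k ^ j * W x) = ((LINT x|M. poly p1 (x k) * W x) - (LINT x|M. poly p2 (x k) * W x) - (LINT x|M. poly 1 (x k) * W x)) / 2"
        if "exp_moments M n" for M
        unfolding e integral_divide_zero
        by (simp only: Bochner_Integration.integral_diff Bochner_Integration.integrable_diff ipol[OF that])
      have nn: "0 \<le> poly p1 y" "0 \<le> poly p2 y" "0 \<le> poly (1 :: real poly) y" for y
        by (simp_all add: p1_def p2_def)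
      show ?thesis by (simp only: av[OF M1] av[OF M2] pol[OF nn(1)] pol[OF nn(2)] pol[OF nn(3)])
    qed
    have "D M1 = D M2"
    proof (rule moment_determinacy_real)
      show "(LINT x|D M1. x ^ j) = (LINT x|D M2. x ^ j)" for j
        using mom[of j] by (simp add: Dint(1)[OF M1] Dint(1)[OF M2])
    qed (use Dfin[OF M1] Dfin[OF M2] in auto)
    then have "(LINT x|M1. indicator (B k) (x k) * W x) = (LINT x|M2. indicator (B k) (x k) * W x)"
      using Dint(1)[OF M1, of "indicator (B k)"] Dint(1)[OF M2, of "indicator (B k)"] Suc.prems(1) by simp
    moreover have "indicator (B k) (x k) * W x = (\<Prod>i<n. F (Suc k) B q i (x i))" for x
      unfolding split by (intro prod.cong) (auto simp: F_def)
    ultimately show ?case by simp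
  qed
  show ?thesis
  proof (rule measure_eqI_PiM_finite[of "{..<n}" _ "\<lambda>_. borel" _ "\<lambda>_. Pi\<^sub>E {..<n} (\<lambda>_. UNIV)"])
    fix A :: "nat \<Rightarrow> real set" assume A: "\<And>i. i \<in> {..<n} \<Longrightarrow> A i \<in> sets borel"
    define B where "B i = (if i < n then A i else {})" for i
    have B: "B i \<in> sets borel" for i using A by (simp add: B_def)
    have AB: "Pi\<^sub>E {..<n} A = Pi\<^sub>E {..<n} B" by (intro PiE_cong) (simp add: B_def)
    have "measure M (Pi\<^sub>E {..<n} B) = (LINT x|M. (\<Prod>i<n. F n B (\<lambda>_. 0) i (x i)))" if "exp_moments M n" for M
    proof -
      interpret exp_moments M n by fact
      have sp: "space M = space (Pi\<^sub>M {..<n} (\<lambda>_. borel :: real measure))" by (rule sets_eq_imp_space_eq[OF sets_M])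
      have "measure M (Pi\<^sub>E {..<n} B) = (LINT x|M. indicator (Pi\<^sub>E {..<n} B) x)"
        by (simp add: sp space_PiM Int_absorb2 PiE_mono)
      also have "\<dots> = (LINT x|M. (\<Prod>i<n. F n B (\<lambda>_. 0) i (x i)))"
      proof (rule Bochner_Integration.integral_cong[OF refl])
        fix x assume "x \<in> space M"
        then have x: "x \<in> extensional {..<n}" by (simp add: sp space_PiM PiE_def)
        show "indicator (Pi\<^sub>E {..<n} B) x = (\<Prod>i<n. F n B (\<lambda>_. 0) i (x i))"
        proof (cases "\<forall>i<n. x i \<in> B i")
          case True
          then show ?thesis using x by (simp add: F_def PiE_def Pi_def)
        next
          case False
          then obtain i where i: "i < n" "x i \<notin> B i" by blast
          then have "x \<notin> Pi\<^sub>E {..<n} B" by auto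
          moreover have "(\<Prod>i<n. F n B (\<lambda>_. 0) i (x i)) = 0"
            using i by (intro prod_zero bexI[of _ i]) (auto simp: F_def)
          ultimately show ?thesis by simp
        qed
      qed
      finally show ?thesis .
    qed
    then have "measure M1 (Pi\<^sub>E {..<n} B) = measure M2 (Pi\<^sub>E {..<n} B)"
      using stage[of B "\<lambda>_. 0" n] B M1 M2 by simp
    then show "emeasure M1 (Pi\<^sub>E {..<n} A) = emeasure M2 (Pi\<^sub>E {..<n} A)"
      by (simp add: AB M1.emeasure_eq_measure M2.emeasure_eq_measure)
  next
    have "Pi\<^sub>E {..<n} (\<lambda>_. UNIV) \<in> prod_algebra {..<n} (\<lambda>_. borel :: real measure)"
      by (rule prod_algebraI_finite) auto
    then show "range (\<lambda>_::nat. Pi\<^sub>E {..<n} (\<lambda>_. UNIV)) \<subseteq> prod_algebra {..<n} (\<lambda>_. borel :: real measure)"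
      by auto
  qed (auto simp: M1.sets_M M2.sets_M space_PiM)
qed

section \<open>Spectral theorem for Hermitian matrices\<close>

lemma mat_adjoint_index [simp]:
  "i < dim_col A \<Longrightarrow> j < dim_row A \<Longrightarrow> mat_adjoint A $$ (i, j) = conjugate (A $$ (j, i))"
  by (simp add: mat_adjoint_def mat_of_rows_index)

lemma mat_adjoint_dim [simp]: "dim_row (mat_adjoint A) = dim_col A" "dim_col (mat_adjoint A) = dim_row A"
  by (simp_all add: mat_adjoint_def)

lemma mat_adjoint_carrier [simp]: "A \<in> carrier_mat n m \<Longrightarrow> mat_adjoint A \<in> carrier_mat m n"
  by (intro carrier_matI) auto

lemma mat_adjoint_mult:
  fixes A B :: "complex mat"
  assumes "A \<in> carrier_mat n m" "B \<in> carrier_mat m k"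
  shows "mat_adjoint (A * B) = mat_adjoint B * mat_adjoint A"
  using assms by (intro eq_matI) (auto simp: scalar_prod_def mult.commute intro!: sum.cong)

lemma mat_adjoint_adjoint [simp]: "mat_adjoint (mat_adjoint (A :: complex mat)) = A"
  by (rule eq_matI) auto

text \<open>The reflection that exchanges the first unit vector and \<open>v\<close>; its axis is
  their difference \<open>u\<close>. For a unit vector \<open>v\<close> with real \<open>v 0\<close>
  the squared norm of \<open>u\<close> is \<open>2 * (1 - v 0)\<close>, which explains the
  denominator.\<close>

definition householder :: "nat \<Rightarrow> (nat \<Rightarrow> complex) \<Rightarrow> complex mat" where
  "householder n v = Matrix.mat n n (\<lambda>(i, j).
     let u = (\<lambda>k. (if k = 0 then 1 else 0) - v k) in (if i = j then 1 else 0) - u i * cnj (u j) / (1 - v 0))"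

lemma householder:
  assumes n: "0 < n" and norm: "(\<Sum>k<n. v k * cnj (v k)) = 1" and v0: "v 0 = of_real r" "r \<le> 0"
  shows "householder n v \<in> carrier_mat n n" "mat_adjoint (householder n v) = householder n v"
    "householder n v * householder n v = 1\<^sub>m n" "i < n \<Longrightarrow> householder n v $$ (i, 0) = v i"
proof -
  define u where "u k = (if k = 0 then 1 else 0) - v k" for k
  define W where "W i j = (if i = j then 1 else 0) - u i * cnj (u j) / (1 - v 0)" for i j
  have H: "householder n v = Matrix.mat n n (\<lambda>(i, j). W i j)"
    by (simp add: householder_def W_def u_def Let_def)
  \<comment> \<open>The sign condition on \<open>v 0\<close> keeps the denominator away from
    zero.\<close>
  have c: "cnj (1 - v 0) = 1 - v 0" "1 - v 0 \<noteq> 0"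
    using v0 by (auto simp: complex_eq_iff)
  show "householder n v \<in> carrier_mat n n" by (simp add: H)
  show "mat_adjoint (householder n v) = householder n v"
    using v0 by (intro eq_matI) (auto simp: H W_def mult.commute)
  have s: "(\<Sum>k<n. cnj (u k) * u k) = 2 * (1 - v 0)"
  proof -
    have "cnj (u k) * u k = (if k = 0 then 1 - v 0 - cnj (v 0) else 0) + v k * cnj (v k)" for k
      by (simp add: u_def algebra_simps)
    then have "(\<Sum>k<n. cnj (u k) * u k) = (\<Sum>k<n. if k = 0 then 1 - v 0 - cnj (v 0) else 0) + 1"
      by (simp add: sum.distrib norm)
    then show ?thesis using n v0 by simp
  qed
  show "householder n v * householder n v = 1\<^sub>m n"
  proof (rule eq_matI)
    fix i k assume ik: "i < dim_row (1\<^sub>m n :: complex mat)" "k < dim_col (1\<^sub>m n :: complex mat)"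
    have delta: "(\<Sum>j<n. (if i = j then 1 else 0) * f j) = f i" "(\<Sum>j<n. (if j = k then 1 else 0) * f j) = f k" for f :: "nat \<Rightarrow> complex"
      using ik by (simp_all add: if_distrib[of "\<lambda>c. c * _"] cong: if_cong)
    have "(\<Sum>j<n. W i j * W j k) = (\<Sum>j<n. (if i = j then 1 else 0) * (if j = k then 1 else 0)) - (\<Sum>j<n. (if i = j then 1 else 0) * (u j * cnj (u k) / (1 - v 0)))
       - (\<Sum>j<n. (if j = k then 1 else 0) * (u i * cnj (u j) / (1 - v 0))) + u i * cnj (u k) / (1 - v 0)\<^sup>2 * (\<Sum>j<n. cnj (u j) * u j)"
    proof -
      have gen: "(a - p / c) * (b - q / c) = a * b - a * (q / c) - b * (p / c) + p * q / c\<^sup>2" for a b p q c :: complex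
        by (simp add: algebra_simps power2_eq_square)
      have "W i j * W j k = (if i = j then 1 else 0) * (if j = k then 1 else 0) - (if i = j then 1 else 0) * (u j * cnj (u k) / (1 - v 0))
        - (if j = k then 1 else 0) * (u i * cnj (u j) / (1 - v 0)) + u i * cnj (u k) / (1 - v 0)\<^sup>2 * (cnj (u j) * u j)" for j
        unfolding W_def gen by (simp add: mult_ac)
      then show ?thesis by (simp only: sum.distrib sum_subtractf sum_distrib_left)
    qed
    also have "(\<Sum>j<n. (if i = j then 1 else 0) * (if j = k then 1 else 0)) = (if i = k then 1 else 0 :: complex)"
      by (simp only: delta)
    also have "(\<Sum>j<n. (if i = j then 1 else 0) * (u j * cnj (u k) / (1 - v 0))) = u i * cnj (u k) / (1 - v 0)"
      by (simp only: delta)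
    also have "(\<Sum>j<n. (if j = k then 1 else 0) * (u i * cnj (u j) / (1 - v 0))) = u i * cnj (u k) / (1 - v 0)"
      by (simp only: delta)
    also have "u i * cnj (u k) / (1 - v 0)\<^sup>2 * (\<Sum>j<n. cnj (u j) * u j) = 2 * (u i * cnj (u k) / (1 - v 0))"
    proof -
      have "x / c\<^sup>2 * (2 * c) = 2 * (x / c)" if "c \<noteq> 0" for x c :: complex
        using that by (simp add: field_simps power2_eq_square)
      then show ?thesis unfolding s using c(2) by blast
    qed
    finally show "(householder n v * householder n v) $$ (i, k) = 1\<^sub>m n $$ (i, k)"
      using ik by (simp add: H scalar_prod_def atLeast0LessThan)
  qed (auto simp: H)
  show "householder n v $$ (i, 0) = v i" if "i < n"
  proof -
    have "cnj (u 0) = 1 - v 0" using v0 by (simp add: u_def)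
    then have "W i 0 = v i" using c(2) by (simp add: W_def) (simp add: u_def)
    then show ?thesis using that n by (simp add: H)
  qed
qed

lemma hermitian_eigenvector:
  fixes A :: "complex mat"
  assumes A: "A \<in> carrier_mat n n" "mat_adjoint A = A" and n: "0 < n"
  obtains v e r where "(\<Sum>k<n. v k * cnj (v k)) = 1" "v 0 = of_real r" "r \<le> 0"
    "\<And>i. i < n \<Longrightarrow> (\<Sum>k<n. A $$ (i, k) * v k) = of_real e * v i"
proof -
  obtain k where "eigenvalue A k" using spectrum_non_empty[OF A(1) n] by (auto simp: spectrum_def)
  then obtain w where w: "w \<in> carrier_vec n" "w \<noteq> 0\<^sub>v n" "A *\<^sub>v w = k \<cdot>\<^sub>v w"
    using A(1) by (auto simp: eigenvalue_def eigenvector_def)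
  have Aw: "(\<Sum>j<n. A $$ (i, j) * w $ j) = k * w $ i" if "i < n" for i
  proof -
    have "(A *\<^sub>v w) $ i = (k \<cdot>\<^sub>v w) $ i" using w(3) by simp
    then show ?thesis using that A(1) w(1) by (simp add: scalar_prod_def atLeast0LessThan)
  qed
  define S where "S = (\<Sum>i<n. (cmod (w $ i))\<^sup>2)"
  have "\<exists>i<n. w $ i \<noteq> 0" using w(1,2) by (auto simp: vec_eq_iff)
  then have S: "S > 0" unfolding S_def by (auto intro!: sum_pos2)
  have SS: "(\<Sum>i<n. w $ i * cnj (w $ i)) = of_real S"
    by (simp add: S_def complex_norm_square del: of_real_power)
  have hA: "A $$ (i, j) = cnj (A $$ (j, i))" if "i < n" "j < n" for i j
  proof -
    have "mat_adjoint A $$ (i, j) = conjugate (A $$ (j, i))" using A(1) that by (intro mat_adjoint_index) auto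
    then show ?thesis using A(2) by simp
  qed
  \<comment> \<open>The quadratic form of a hermitian matrix is real; at an eigenvector it is the
    eigenvalue times the squared norm.\<close>
  define Q where "Q = (\<Sum>i<n. cnj (w $ i) * (\<Sum>j<n. A $$ (i, j) * w $ j))"
  have Q: "Q = k * of_real S"
  proof -
    have "Q = (\<Sum>i<n. k * (w $ i * cnj (w $ i)))"
      unfolding Q_def by (intro sum.cong refl, subst Aw) (auto simp: mult_ac)
    then show ?thesis by (simp only: SS flip: sum_distrib_left)
  qed
  have "cnj Q = (\<Sum>i<n. \<Sum>j<n. w $ i * (A $$ (j, i) * cnj (w $ j)))"
    unfolding Q_def by (simp add: sum_distrib_left) (intro sum.cong refl, simp add: hA[symmetric])
  also have "\<dots> = Q"
    unfolding Q_def sum_distrib_left by (subst sum.swap) (simp add: mult_ac)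
  finally have "cnj k = k" using Q S by simp
  then have k: "k = of_real (Re k)" by (simp add: complex_eq_iff)
  \<comment> \<open>A phase that makes the first component real and nonpositive, as the reflection
    requires.\<close>
  define ph where "ph = (if w $ 0 = 0 then 1 else - cnj (w $ 0) / of_real (cmod (w $ 0)))"
  have ph: "ph * cnj ph = 1" "ph * w $ 0 = - of_real (cmod (w $ 0))"
  proof -
    have "w $ 0 * cnj (w $ 0) = of_real (cmod (w $ 0)) * of_real (cmod (w $ 0))"
      by (metis complex_norm_square of_real_power power2_eq_square)
    then show "ph * cnj ph = 1" "ph * w $ 0 = - of_real (cmod (w $ 0))"
      by (auto simp: ph_def field_simps)
  qed
  define v where "v i = ph * w $ i / of_real (sqrt S)" for i
  show ?thesis
  proof (rule that[of v "- cmod (w $ 0) / sqrt S" "Re k"])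
    have "v i * cnj (v i) = (ph * cnj ph) * (w $ i * cnj (w $ i)) / of_real S" for i
      using S by (simp add: v_def power2_eq_square[symmetric] flip: of_real_power of_real_mult)
    then have "(\<Sum>i<n. v i * cnj (v i)) = of_real S / of_real S"
      by (simp add: ph(1) flip: SS sum_divide_distrib)
    then show "(\<Sum>i<n. v i * cnj (v i)) = 1" using S by simp
    show "v 0 = of_real (- cmod (w $ 0) / sqrt S)" by (simp add: v_def ph(2))
    show "- cmod (w $ 0) / sqrt S \<le> 0" using S by simp
    show "(\<Sum>j<n. A $$ (i, j) * v j) = of_real (Re k) * v i" if "i < n" for i
    proof -
      have "(\<Sum>j<n. A $$ (i, j) * v j) = ph / of_real (sqrt S) * (\<Sum>j<n. A $$ (i, j) * w $ j)"
        by (simp add: v_def sum_distrib_left mult_ac)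
      then show ?thesis unfolding Aw[OF that] using k by (simp add: v_def)
    qed
  qed
qed

text \<open>Induction on the dimension. The reflection \<open>W\<close> takes the first unit vector
  to an eigenvector, so the first column of \<open>W A W\<close> is a multiple of that unit vector;
  being hermitian, \<open>W A W\<close> is then block diagonal.\<close>

lemma hermitian_spectral:
  fixes A :: "complex mat"
  assumes "A \<in> carrier_mat n n" "mat_adjoint A = A"
  shows "\<exists>U (d :: nat \<Rightarrow> real). U \<in> carrier_mat n n \<and> mat_adjoint U * U = 1\<^sub>m n \<and> A * U = U * mat_diag n (\<lambda>i. of_real (d i))"
  using assms
proof (induction n arbitrary: A)
  case 0
  then show ?case by (intro exI[of _ "1\<^sub>m 0"] exI[of _ "\<lambda>_. 0"]) (auto intro!: eq_matI simp: mat_diag_def)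
next
  case (Suc n)
  note A = Suc.prems
  obtain v e r where v: "(\<Sum>k<Suc n. v k * cnj (v k)) = 1" "v 0 = of_real r" "r \<le> 0"
    "\<And>i. i < Suc n \<Longrightarrow> (\<Sum>k<Suc n. A $$ (i, k) * v k) = of_real e * v i"
    using hermitian_eigenvector[OF A zero_less_Suc] by metis
  define W where "W = householder (Suc n) v"
  note H = householder[OF _ v(1-3), folded W_def, simplified]
  have W: "W \<in> carrier_mat (Suc n) (Suc n)" "mat_adjoint W = W" "W * W = 1\<^sub>m (Suc n)"
    "\<And>i. i < Suc n \<Longrightarrow> W $$ (i, 0) = v i" using H by auto
  define B where "B = W * (A * W)"
  have B: "B \<in> carrier_mat (Suc n) (Suc n)" using W A by (simp add: B_def)
  have AW: "A * W = W * B"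
  proof -
    have "W * B = (W * W) * (A * W)" unfolding B_def by (rule assoc_mult_mat[symmetric]) (use W A in auto)
    also have "\<dots> = A * W" unfolding W(3) by (rule left_mult_one_mat) (use W A in auto)
    finally show ?thesis ..
  qed
  have Bh: "mat_adjoint B = B"
  proof -
    have "mat_adjoint B = mat_adjoint (A * W) * mat_adjoint W" unfolding B_def by (rule mat_adjoint_mult) (use W A in auto)
    also have "mat_adjoint (A * W) = mat_adjoint W * mat_adjoint A" by (rule mat_adjoint_mult) (use W A in auto)
    also have "mat_adjoint W * mat_adjoint A * mat_adjoint W = W * A * W" by (simp only: W(2) A(2))
    also have "\<dots> = B" unfolding B_def by (rule assoc_mult_mat) (use W A in auto)
    finally show ?thesis .
  qed
  have B0: "B $$ (i, 0) = (if i = 0 then of_real e else 0)" if i: "i < Suc n" for i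
  proof -
    have "(A * W) $$ (j, 0) = of_real e * W $$ (j, 0)" if "j < Suc n" for j
      using v(4)[OF that] W(1,4) A that by (simp add: scalar_prod_def atLeast0LessThan del: sum.lessThan_Suc)
    then have "B $$ (i, 0) = (\<Sum>j<Suc n. W $$ (i, j) * (of_real e * W $$ (j, 0)))"
      using W(1) A i by (simp add: B_def scalar_prod_def atLeast0LessThan del: sum.lessThan_Suc)
    also have "\<dots> = of_real e * (W * W) $$ (i, 0)"
      using W(1) i by (simp add: scalar_prod_def atLeast0LessThan sum_distrib_left mult_ac del: sum.lessThan_Suc)
    finally show ?thesis using i by (simp add: W(3))
  qed
  have Bij: "B $$ (i, j) = cnj (B $$ (j, i))" if "i < Suc n" "j < Suc n" for i j
  proof -
    have "mat_adjoint B $$ (i, j) = conjugate (B $$ (j, i))" using B that by (intro mat_adjoint_index) auto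
    then show ?thesis using Bh by simp
  qed
  define A' where "A' = Matrix.mat n n (\<lambda>(i, j). B $$ (Suc i, Suc j))"
  have A': "A' \<in> carrier_mat n n" "mat_adjoint A' = A'"
    by (simp add: A'_def, rule eq_matI) (auto simp: A'_def Bij[symmetric])
  obtain U' d' where U': "U' \<in> carrier_mat n n" "mat_adjoint U' * U' = 1\<^sub>m n"
      "A' * U' = U' * mat_diag n (\<lambda>i. of_real (d' i))"
    using Suc.IH[OF A'] by blast
  let ?E = "Matrix.mat 1 1 (\<lambda>_. complex_of_real e)"
  have Bblock: "B = four_block_mat ?E (0\<^sub>m 1 n) (0\<^sub>m n 1) A'"
  proof (rule eq_matI)
    fix i j assume ij: "i < dim_row (four_block_mat ?E (0\<^sub>m 1 n) (0\<^sub>m n 1) A')" "j < dim_col (four_block_mat ?E (0\<^sub>m 1 n) (0\<^sub>m n 1) A')"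
    then have "i < Suc n" "j < Suc n" by (auto simp: A'_def)
    then show "B $$ (i, j) = four_block_mat ?E (0\<^sub>m 1 n) (0\<^sub>m n 1) A' $$ (i, j)"
      using B0[of i] B0[of j] Bij[of i j] by (cases "i = 0"; cases "j = 0") (auto simp: A'_def)
  qed (use B in \<open>auto simp: A'_def\<close>)
  define X where "X = four_block_mat (1\<^sub>m 1) (0\<^sub>m 1 n) (0\<^sub>m n 1) U'"
  have X: "X \<in> carrier_mat (Suc n) (Suc n)" using U'(1) by (intro carrier_matI) (auto simp: X_def)
  define d where "d i = (case i of 0 \<Rightarrow> e | Suc j \<Rightarrow> d' j)" for i
  let ?D' = "mat_diag n (\<lambda>i. complex_of_real (d' i))"
  have D: "mat_diag (Suc n) (\<lambda>i. complex_of_real (d i)) = four_block_mat ?E (0\<^sub>m 1 n) (0\<^sub>m n 1) ?D'"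
    by (rule eq_matI) (auto simp: mat_diag_def d_def split: nat.splits)
  have Xadj: "mat_adjoint X = four_block_mat (1\<^sub>m 1) (0\<^sub>m 1 n) (0\<^sub>m n 1) (mat_adjoint U')"
    using U' by (intro eq_matI) (auto simp: X_def)
  have XX: "mat_adjoint X * X = 1\<^sub>m (Suc n)"
  proof -
    have "mat_adjoint X * X = four_block_mat (1\<^sub>m 1 * 1\<^sub>m 1 + 0\<^sub>m 1 n * 0\<^sub>m n 1) (1\<^sub>m 1 * 0\<^sub>m 1 n + 0\<^sub>m 1 n * U')
       (0\<^sub>m n 1 * 1\<^sub>m 1 + mat_adjoint U' * 0\<^sub>m n 1) (0\<^sub>m n 1 * 0\<^sub>m 1 n + mat_adjoint U' * U')"
      unfolding Xadj unfolding X_def by (rule mult_four_block_mat) (use U' in auto)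
    also have "\<dots> = four_block_mat (1\<^sub>m 1) (0\<^sub>m 1 n) (0\<^sub>m n 1) (1\<^sub>m n)"
      unfolding U'(2) using U'(1) by (intro arg_cong4[where f=four_block_mat] eq_matI) (auto simp: scalar_prod_def)
    also have "\<dots> = 1\<^sub>m (Suc n)" by (rule eq_matI) auto
    finally show ?thesis .
  qed
  have BX: "B * X = X * mat_diag (Suc n) (\<lambda>i. complex_of_real (d i))"
  proof -
    have "B * X = four_block_mat (?E * 1\<^sub>m 1 + 0\<^sub>m 1 n * 0\<^sub>m n 1) (?E * 0\<^sub>m 1 n + 0\<^sub>m 1 n * U')
       (0\<^sub>m n 1 * 1\<^sub>m 1 + A' * 0\<^sub>m n 1) (0\<^sub>m n 1 * 0\<^sub>m 1 n + A' * U')"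
      unfolding Bblock X_def by (rule mult_four_block_mat) (use U' A' in auto)
    also have "\<dots> = four_block_mat (1\<^sub>m 1 * ?E + 0\<^sub>m 1 n * 0\<^sub>m n 1) (1\<^sub>m 1 * 0\<^sub>m 1 n + 0\<^sub>m 1 n * ?D')
       (0\<^sub>m n 1 * ?E + U' * 0\<^sub>m n 1) (0\<^sub>m n 1 * 0\<^sub>m 1 n + U' * ?D')"
      unfolding U'(3) using U'(1) A'(1)
      by (intro arg_cong4[where f=four_block_mat] eq_matI) (auto simp: scalar_prod_def mat_diag_def)
    also have "\<dots> = X * mat_diag (Suc n) (\<lambda>i. complex_of_real (d i))"
      unfolding D X_def by (rule mult_four_block_mat[symmetric]) (use U' in auto)
    finally show ?thesis .
  qed
  define U where "U = W * X"
  have U: "U \<in> carrier_mat (Suc n) (Suc n)" using W X by (simp add: U_def)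
  have "mat_adjoint U * U = (mat_adjoint X * W) * (W * X)"
    unfolding U_def using mat_adjoint_mult[OF W(1) X] W(2) by simp
  also have "\<dots> = mat_adjoint X * (W * (W * X))" by (rule assoc_mult_mat) (use W X in auto)
  also have "W * (W * X) = (W * W) * X" by (rule assoc_mult_mat[symmetric]) (use W X in auto)
  also have "(W * W) * X = X" unfolding W(3) by (rule left_mult_one_mat) (rule X)
  finally have 1: "mat_adjoint U * U = 1\<^sub>m (Suc n)" using XX by simp
  have "A * U = A * W * X" unfolding U_def by (rule assoc_mult_mat[symmetric]) (use W X A in auto)
  also have "\<dots> = W * (B * X)" unfolding AW by (rule assoc_mult_mat) (use W X B in auto)
  also have "\<dots> = U * mat_diag (Suc n) (\<lambda>i. complex_of_real (d i))"
    unfolding BX U_def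
    by (rule assoc_mult_mat[symmetric, of _ "Suc n" "Suc n" _ "Suc n" _ "Suc n"]) (use W X in \<open>auto simp: mat_diag_def\<close>)
  finally show ?case using U 1 by blast
qed

section \<open>Unitary diagonalisation\<close>

definition unitary_diag :: "nat \<Rightarrow> complex mat \<Rightarrow> complex mat \<Rightarrow> (nat \<Rightarrow> real) \<Rightarrow> bool" where
  "unitary_diag n A U d \<longleftrightarrow> U \<in> carrier_mat n n \<and> U * mat_adjoint U = 1\<^sub>m n \<and> mat_adjoint U * U = 1\<^sub>m n \<and>
     A = U * mat_diag n (\<lambda>i. complex_of_real (d i)) * mat_adjoint U"

lemma hermitian_unitary_diag:
  assumes "A \<in> carrier_mat n n" "mat_adjoint A = A"
  shows "\<exists>U d. unitary_diag n A U d"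
proof -
  obtain U d where U: "U \<in> carrier_mat n n" "mat_adjoint U * U = 1\<^sub>m n" "A * U = U * mat_diag n (\<lambda>i. complex_of_real (d i))"
    using hermitian_spectral[OF assms] by blast
  have UU: "U * mat_adjoint U = 1\<^sub>m n"
    using mat_mult_left_right_inverse[of "mat_adjoint U" n U] U by simp
  have "A = A * (U * mat_adjoint U)" using UU assms by simp
  also have "\<dots> = A * U * mat_adjoint U" by (rule assoc_mult_mat[symmetric]) (use U assms in auto)
  finally have "A = U * mat_diag n (\<lambda>i. complex_of_real (d i)) * mat_adjoint U" unfolding U(3) .
  then show ?thesis using U UU unfolding unitary_diag_def by blast
qed

section \<open>Eigenvalues of the coordinate matrix\<close>

lemma unitary_diagD:
  assumes "unitary_diag n A U d"
  shows "U \<in> carrier_mat n n" "A \<in> carrier_mat n n"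
    "\<And>a b. a < n \<Longrightarrow> b < n \<Longrightarrow> (\<Sum>j<n. U $$ (a, j) * cnj (U $$ (b, j))) = (if a = b then 1 else 0)"
    "\<And>j k. j < n \<Longrightarrow> k < n \<Longrightarrow> (\<Sum>m<n. cnj (U $$ (m, j)) * U $$ (m, k)) = (if j = k then 1 else 0)"
    "\<And>a b. a < n \<Longrightarrow> b < n \<Longrightarrow> A $$ (a, b) = (\<Sum>j<n. U $$ (a, j) * of_real (d j) * cnj (U $$ (b, j)))"
proof -
  have U: "U \<in> carrier_mat n n" "U * mat_adjoint U = 1\<^sub>m n" "mat_adjoint U * U = 1\<^sub>m n"
    "A = U * mat_diag n (\<lambda>i. complex_of_real (d i)) * mat_adjoint U"
    using assms by (auto simp: unitary_diag_def)
  show "U \<in> carrier_mat n n" by fact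
  show "A \<in> carrier_mat n n" unfolding U(4) using U(1) by (intro mult_carrier_mat) (auto simp: mat_diag_def)
  show "(\<Sum>j<n. U $$ (a, j) * cnj (U $$ (b, j))) = (if a = b then 1 else 0)" if "a < n" "b < n" for a b
  proof -
    have "(U * mat_adjoint U) $$ (a, b) = (\<Sum>j<n. U $$ (a, j) * cnj (U $$ (b, j)))"
      using U(1) that by (simp add: scalar_prod_def atLeast0LessThan)
    then show ?thesis using that by (simp add: U(2))
  qed
  show "(\<Sum>m<n. cnj (U $$ (m, j)) * U $$ (m, k)) = (if j = k then 1 else 0)" if "j < n" "k < n" for j k
  proof -
    have "(mat_adjoint U * U) $$ (j, k) = (\<Sum>m<n. cnj (U $$ (m, j)) * U $$ (m, k))"
      using U(1) that by (simp add: scalar_prod_def atLeast0LessThan)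
    then show ?thesis using that by (simp add: U(3))
  qed
  show "A $$ (a, b) = (\<Sum>j<n. U $$ (a, j) * of_real (d j) * cnj (U $$ (b, j)))" if "a < n" "b < n" for a b
  proof -
    have "U * mat_diag n (\<lambda>i. complex_of_real (d i)) = Matrix.mat n n (\<lambda>(i, j). U $$ (i, j) * complex_of_real (d j))"
      using mat_diag_mult_right[OF U(1)] by (simp add: mult.commute)
    then show ?thesis unfolding U(4) using U(1) that by (simp add: scalar_prod_def atLeast0LessThan)
  qed
qed

text \<open>\<open>U diag(f) U\<^sup>*\<close>\<close>

definition conj_diag :: "nat \<Rightarrow> complex mat \<Rightarrow> (nat \<Rightarrow> complex) \<Rightarrow> complex mat" where
  "conj_diag n U f = Matrix.mat n n (\<lambda>(a, b). \<Sum>j<n. U $$ (a, j) * f j * cnj (U $$ (b, j)))"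

lemma conj_diag_carrier [simp]: "conj_diag n U f \<in> carrier_mat n n"
  by (simp add: conj_diag_def)

lemma conj_diag_eq:
  assumes "U \<in> carrier_mat n n"
  shows "U * mat_diag n f * mat_adjoint U = conj_diag n U f"
proof -
  have "U * mat_diag n f = Matrix.mat n n (\<lambda>(i, j). U $$ (i, j) * f j)"
    using mat_diag_mult_right[OF assms] by (simp add: mult.commute)
  then show ?thesis using assms
    by (intro eq_matI) (auto simp: conj_diag_def scalar_prod_def atLeast0LessThan)
qed

section \<open>Trace, resolvent, spectrum and functional calculus in a given diagonalisation\<close>

context
  fixes n :: nat and A U :: "complex mat" and d :: "nat \<Rightarrow> real"
  assumes ud: "unitary_diag n A U d"
begin

lemma unitary_diag_eq: "A = conj_diag n U (\<lambda>i. of_real (d i))"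
  using ud conj_diag_eq[of U n "\<lambda>i. complex_of_real (d i)"] by (auto simp: unitary_diag_def)

lemma mat_trace_conj_diag: "mat_trace (conj_diag n U f) = (\<Sum>j<n. f j)"
proof -
  have "mat_trace (conj_diag n U f) = (\<Sum>a<n. \<Sum>j<n. U $$ (a, j) * f j * cnj (U $$ (a, j)))"
    by (simp add: mat_trace_def conj_diag_def)
  also have "\<dots> = (\<Sum>j<n. f j * (\<Sum>a<n. cnj (U $$ (a, j)) * U $$ (a, j)))"
    by (subst sum.swap) (simp add: sum_distrib_left mult_ac)
  finally show ?thesis by (simp add: unitary_diagD(4)[OF ud])
qed

lemma conj_diag_mult: "conj_diag n U f * conj_diag n U g = conj_diag n U (\<lambda>j. f j * g j)"
proof (rule eq_matI)
  fix a b assume "a < dim_row (conj_diag n U (\<lambda>j. f j * g j))" "b < dim_col (conj_diag n U (\<lambda>j. f j * g j))"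
  then have ab: "a < n" "b < n" by (auto simp: conj_diag_def)
  have "(conj_diag n U f * conj_diag n U g) $$ (a, b) =
     (\<Sum>m<n. (\<Sum>j<n. U $$ (a, j) * f j * cnj (U $$ (m, j))) * (\<Sum>k<n. U $$ (m, k) * g k * cnj (U $$ (b, k))))"
    using ab by (simp add: conj_diag_def scalar_prod_def atLeast0LessThan)
  also have "\<dots> = (\<Sum>m<n. \<Sum>j<n. \<Sum>k<n. U $$ (a, j) * f j * g k * cnj (U $$ (b, k)) * (cnj (U $$ (m, j)) * U $$ (m, k)))"
    unfolding sum_product by (intro sum.cong refl) (simp add: mult_ac)
  also have "\<dots> = (\<Sum>j<n. \<Sum>k<n. U $$ (a, j) * f j * g k * cnj (U $$ (b, k)) * (\<Sum>m<n. cnj (U $$ (m, j)) * U $$ (m, k)))"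
  proof -
    have "(\<Sum>m<n. \<Sum>j<n. \<Sum>k<n. h m j k) = (\<Sum>j<n. \<Sum>k<n. \<Sum>m<n. h m j k)" for h :: "nat \<Rightarrow> nat \<Rightarrow> nat \<Rightarrow> complex"
    proof -
      have "(\<Sum>m<n. \<Sum>j<n. \<Sum>k<n. h m j k) = (\<Sum>j<n. \<Sum>m<n. \<Sum>k<n. h m j k)" by (rule sum.swap)
      also have "\<dots> = (\<Sum>j<n. \<Sum>k<n. \<Sum>m<n. h m j k)" by (rule sum.cong[OF refl]) (rule sum.swap)
      finally show ?thesis .
    qed
    then show ?thesis unfolding sum_distrib_left .
  qed
  also have "\<dots> = (\<Sum>j<n. \<Sum>k<n. U $$ (a, j) * f j * g k * cnj (U $$ (b, k)) * (if j = k then 1 else 0))"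
    by (intro sum.cong refl) (simp add: unitary_diagD(4)[OF ud])
  also have "\<dots> = (\<Sum>j<n. U $$ (a, j) * (f j * g j) * cnj (U $$ (b, j)))"
    by (intro sum.cong refl) (simp add: if_distrib mult.assoc cong: if_cong)
  finally show "(conj_diag n U f * conj_diag n U g) $$ (a, b) = conj_diag n U (\<lambda>j. f j * g j) $$ (a, b)"
    using ab by (simp add: conj_diag_def)
qed (auto simp: conj_diag_def)

lemma conj_diag_one: "conj_diag n U (\<lambda>_. 1) = 1\<^sub>m n"
  by (rule eq_matI) (auto simp: conj_diag_def unitary_diagD(3)[OF ud])

lemma mat_trace_resolvent:
  assumes z: "\<And>i. i < n \<Longrightarrow> z \<noteq> of_real (d i)"
  shows "mat_trace (mat_inv (z \<cdot>\<^sub>m 1\<^sub>m n - A)) = (\<Sum>i<n. 1 / (z - of_real (d i)))"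
proof -
  let ?B = "z \<cdot>\<^sub>m 1\<^sub>m n - A" and ?C = "conj_diag n U (\<lambda>i. 1 / (z - of_real (d i)))"
  have B: "?B = conj_diag n U (\<lambda>i. z - of_real (d i))"
  proof (rule eq_matI)
    fix a b assume "a < dim_row (conj_diag n U (\<lambda>i. z - of_real (d i)))" "b < dim_col (conj_diag n U (\<lambda>i. z - of_real (d i)))"
    then have ab: "a < n" "b < n" by (auto simp: conj_diag_def)
    have "conj_diag n U (\<lambda>i. z - of_real (d i)) $$ (a, b) = z * (\<Sum>j<n. U $$ (a, j) * cnj (U $$ (b, j))) - A $$ (a, b)"
      using ab unitary_diagD(5)[OF ud ab]
      by (simp add: conj_diag_def algebra_simps sum_subtractf sum_distrib_left)
    then show "?B $$ (a, b) = conj_diag n U (\<lambda>i. z - of_real (d i)) $$ (a, b)"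
      using ab unitary_diagD(2)[OF ud] unitary_diagD(3)[OF ud ab] by simp
  qed (use unitary_diagD(2)[OF ud] in \<open>auto simp: conj_diag_def\<close>)
  have cong: "conj_diag n U f = conj_diag n U g" if "\<And>i. i < n \<Longrightarrow> f i = g i" for f g
    unfolding conj_diag_def using that by (intro eq_matI) auto
  have BC: "?B * ?C = 1\<^sub>m n" "?C * ?B = 1\<^sub>m n"
  proof -
    have "?B * ?C = conj_diag n U (\<lambda>i. (z - of_real (d i)) * (1 / (z - of_real (d i))))"
      by (simp only: B conj_diag_mult)
    also have "\<dots> = conj_diag n U (\<lambda>_. 1)" by (rule cong) (use z in auto)
    finally show "?B * ?C = 1\<^sub>m n" by (simp only: conj_diag_one)
    have "?C * ?B = conj_diag n U (\<lambda>i. 1 / (z - of_real (d i)) * (z - of_real (d i)))"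
      by (simp only: B conj_diag_mult)
    also have "\<dots> = conj_diag n U (\<lambda>_. 1)" by (rule cong) (use z in auto)
    finally show "?C * ?B = 1\<^sub>m n" by (simp only: conj_diag_one)
  qed
  have Bc: "?B \<in> carrier_mat n n" unfolding B by simp
  \<comment> \<open>The explicit inverse shows that \<open>mat_inverse\<close> succeeds; only then
    does \<open>the\<close> in \<open>mat_inv\<close> have a meaning.\<close>
  obtain M where M: "mat_inverse ?B = Some M"
  proof -
    have "?B \<in> Units (ring_mat TYPE(complex) n ())"
      unfolding Units_def ring_mat_simps using Bc BC conj_diag_carrier by blast
    then have "mat_inverse ?B \<noteq> None" using mat_inverse(1)[OF Bc, of "()"] by blast
    then show ?thesis using that by auto
  qed
  have M': "M \<in> carrier_mat n n" "M * ?B = 1\<^sub>m n" using mat_inverse(2)[OF Bc M] by auto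
  have "M = M * (?B * ?C)" using M' BC by simp
  also have "\<dots> = (M * ?B) * ?C" by (rule assoc_mult_mat[symmetric, OF M'(1) Bc conj_diag_carrier])
  also have "\<dots> = ?C" unfolding M'(2) by (rule left_mult_one_mat[OF conj_diag_carrier])
  finally show ?thesis by (simp add: mat_inv_def M mat_trace_conj_diag)
qed

lemma spectrum_unitary_diag: "spectrum A = (\<lambda>i. complex_of_real (d i)) ` {..<n}"
proof
  note A = unitary_diagD(2)[OF ud]
  show "spectrum A \<subseteq> (\<lambda>i. complex_of_real (d i)) ` {..<n}"
  proof
    fix k assume "k \<in> spectrum A"
    then obtain v where v: "v \<in> carrier_vec n" "v \<noteq> 0\<^sub>v n" "A *\<^sub>v v = k \<cdot>\<^sub>v v"
      using A by (auto simp: spectrum_def eigenvalue_def eigenvector_def)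
    show "k \<in> (\<lambda>i. complex_of_real (d i)) ` {..<n}"
    proof (rule ccontr)
      assume k: "k \<notin> (\<lambda>i. complex_of_real (d i)) ` {..<n}"
      \<comment> \<open>The coordinates of the eigenvector in the eigenbasis. Each of them vanishes
        if \<open>k\<close> differs from all \<open>d j\<close>.\<close>
      define w where "w j = (\<Sum>b<n. cnj (U $$ (b, j)) * v $ b)" for j
      have Av: "(\<Sum>b<n. A $$ (a, b) * v $ b) = k * v $ a" if "a < n" for a
      proof -
        have "(A *\<^sub>v v) $ a = (k \<cdot>\<^sub>v v) $ a" using v(3) by simp
        then show ?thesis using that A v(1) by (simp add: scalar_prod_def atLeast0LessThan)
      qed
      have w: "w j = 0" if j: "j < n" for j
      proof -
        have "k * w j = (\<Sum>a<n. cnj (U $$ (a, j)) * (\<Sum>b<n. A $$ (a, b) * v $ b))"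
          unfolding w_def sum_distrib_left[of k] by (intro sum.cong refl, subst Av) (auto simp: mult_ac)
        also have "\<dots> = (\<Sum>a<n. cnj (U $$ (a, j)) * (\<Sum>i<n. U $$ (a, i) * of_real (d i) * w i))"
        proof (rule sum.cong[OF refl])
          fix a assume "a \<in> {..<n}"
          then have a: "a < n" by simp
          have "(\<Sum>b<n. A $$ (a, b) * v $ b) = (\<Sum>b<n. (\<Sum>i<n. U $$ (a, i) * of_real (d i) * cnj (U $$ (b, i))) * v $ b)"
            by (intro sum.cong refl, subst unitary_diagD(5)[OF ud a]) auto
          also have "\<dots> = (\<Sum>i<n. U $$ (a, i) * of_real (d i) * w i)"
            unfolding w_def sum_distrib_right sum_distrib_left by (subst sum.swap) (simp add: mult_ac)
          finally show "cnj (U $$ (a, j)) * (\<Sum>b<n. A $$ (a, b) * v $ b) = cnj (U $$ (a, j)) * (\<Sum>i<n. U $$ (a, i) * of_real (d i) * w i)"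
            by (rule arg_cong)
        qed
        also have "\<dots> = (\<Sum>i<n. of_real (d i) * w i * (\<Sum>a<n. cnj (U $$ (a, j)) * U $$ (a, i)))"
          unfolding sum_distrib_left by (subst sum.swap) (simp add: mult_ac)
        also have "\<dots> = (\<Sum>i<n. of_real (d i) * w i * (if j = i then 1 else 0))"
          by (intro sum.cong refl, subst unitary_diagD(4)[OF ud j]) auto
        also have "\<dots> = of_real (d j) * w j" using j by (simp add: if_distrib cong: if_cong)
        finally show "w j = 0" using k j by (auto simp: image_iff)
      qed
      have "v $ a = 0" if a: "a < n" for a
      proof -
        have "(\<Sum>j<n. U $$ (a, j) * w j) = (\<Sum>b<n. (\<Sum>j<n. U $$ (a, j) * cnj (U $$ (b, j))) * v $ b)"
          unfolding w_def sum_distrib_left sum_distrib_right by (subst sum.swap) (simp add: mult_ac)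
        also have "\<dots> = (\<Sum>b<n. (if a = b then 1 else 0) * v $ b)"
          by (intro sum.cong refl, subst unitary_diagD(3)[OF ud a]) auto
        also have "\<dots> = v $ a" using a by (simp add: if_distrib[of "\<lambda>c. c * _"] cong: if_cong)
        finally show ?thesis using w by simp
      qed
      then have "v = 0\<^sub>v n" using v(1) by (intro eq_vecI) auto
      then show False using v(2) by simp
    qed
  qed
  show "(\<lambda>i. complex_of_real (d i)) ` {..<n} \<subseteq> spectrum A"
  proof (rule image_subsetI)
    fix k assume "k \<in> {..<n}"
    then have k: "k < n" by simp
    define v where "v = Matrix.vec n (\<lambda>a. U $$ (a, k))"
    have "A *\<^sub>v v = of_real (d k) \<cdot>\<^sub>v v"
    proof (rule eq_vecI)
      fix a assume "a < dim_vec (of_real (d k) \<cdot>\<^sub>v v)"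
      then have a: "a < n" by (simp add: v_def)
      have "(A *\<^sub>v v) $ a = (\<Sum>b<n. A $$ (a, b) * U $$ (b, k))"
        using a A by (simp add: v_def scalar_prod_def atLeast0LessThan)
      also have "\<dots> = (\<Sum>b<n. (\<Sum>i<n. U $$ (a, i) * of_real (d i) * cnj (U $$ (b, i))) * U $$ (b, k))"
        by (intro sum.cong refl, subst unitary_diagD(5)[OF ud a]) auto
      also have "\<dots> = (\<Sum>i<n. U $$ (a, i) * of_real (d i) * (\<Sum>b<n. cnj (U $$ (b, i)) * U $$ (b, k)))"
        unfolding sum_distrib_left sum_distrib_right by (subst sum.swap) (simp add: mult_ac)
      also have "\<dots> = (\<Sum>i<n. U $$ (a, i) * of_real (d i) * (if i = k then 1 else 0))"
        using k by (intro sum.cong refl, subst unitary_diagD(4)[OF ud]) auto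
      also have "\<dots> = of_real (d k) * U $$ (a, k)" using k by (simp add: if_distrib cong: if_cong)
      finally show "(A *\<^sub>v v) $ a = (of_real (d k) \<cdot>\<^sub>v v) $ a" using a by (simp add: v_def)
    qed (use A in \<open>auto simp: v_def\<close>)
    moreover have "v \<noteq> 0\<^sub>v n"
    proof
      assume "v = 0\<^sub>v n"
      then have "U $$ (a, k) = 0" if "a < n" for a using that by (auto simp: v_def vec_eq_iff)
      then show False using unitary_diagD(4)[OF ud k k] by simp
    qed
    ultimately show "complex_of_real (d k) \<in> spectrum A"
      using A by (auto simp: spectrum_def eigenvalue_def eigenvector_def v_def intro!: exI[of _ v])
  qed
qed

text \<open>The definite description calls for independence of the diagonalisation. The transition
  matrix \<open>S\<close> intertwines the two diagonal matrices, so \<open>S i j\<close> is nonzero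
  only where \<open>d' i = d j\<close>; there the values of \<open>V\<close> agree as well, and
  \<open>S\<close> intertwines these too.\<close>

lemma herm_fun_unitary_diag: "herm_fun V A = conj_diag n U (\<lambda>i. of_real (V (d i)))"
proof -
  have dim: "dim_row A = n" using unitary_diagD(2)[OF ud] by simp
  have key: "conj_diag n U' (\<lambda>i. of_real (V (d' i))) = conj_diag n U (\<lambda>i. of_real (V (d i)))"
    if ud': "unitary_diag n A U' d'" for U' d'
  proof (rule eq_matI)
    define S where "S i j = (\<Sum>a<n. cnj (U' $$ (a, i)) * U $$ (a, j))" for i j
    have AU: "(\<Sum>b<n. A $$ (a, b) * U $$ (b, j)) = U $$ (a, j) * of_real (d j)" if "a < n" "j < n" for a j
    proof -
      have "(\<Sum>b<n. A $$ (a, b) * U $$ (b, j)) = (\<Sum>b<n. (\<Sum>i<n. U $$ (a, i) * of_real (d i) * cnj (U $$ (b, i))) * U $$ (b, j))"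
        by (intro sum.cong refl, subst unitary_diagD(5)[OF ud that(1)]) auto
      also have "\<dots> = (\<Sum>i<n. U $$ (a, i) * of_real (d i) * (\<Sum>b<n. cnj (U $$ (b, i)) * U $$ (b, j)))"
        unfolding sum_distrib_left sum_distrib_right by (subst sum.swap) (simp add: mult_ac)
      also have "\<dots> = (\<Sum>i<n. U $$ (a, i) * of_real (d i) * (if i = j then 1 else 0))"
        using that by (intro sum.cong refl, subst unitary_diagD(4)[OF ud]) auto
      finally show ?thesis using that by (simp add: if_distrib cong: if_cong)
    qed
    have UA: "(\<Sum>a<n. cnj (U' $$ (a, i)) * A $$ (a, b)) = of_real (d' i) * cnj (U' $$ (b, i))" if "i < n" "b < n" for i b
    proof -
      have "(\<Sum>a<n. cnj (U' $$ (a, i)) * A $$ (a, b)) = (\<Sum>a<n. cnj (U' $$ (a, i)) * (\<Sum>k<n. U' $$ (a, k) * of_real (d' k) * cnj (U' $$ (b, k))))"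
        using that by (intro sum.cong refl, subst unitary_diagD(5)[OF ud']) auto
      also have "\<dots> = (\<Sum>k<n. of_real (d' k) * cnj (U' $$ (b, k)) * (\<Sum>a<n. cnj (U' $$ (a, i)) * U' $$ (a, k)))"
        unfolding sum_distrib_left by (subst sum.swap) (simp add: mult_ac)
      also have "\<dots> = (\<Sum>k<n. of_real (d' k) * cnj (U' $$ (b, k)) * (if i = k then 1 else 0))"
        using that by (intro sum.cong refl, subst unitary_diagD(4)[OF ud']) auto
      finally show ?thesis using that by (simp add: if_distrib cong: if_cong)
    qed
    have dS: "of_real (d' i) * S i j = S i j * of_real (d j)" if "i < n" "j < n" for i j
    proof -
      have "of_real (d' i) * S i j = (\<Sum>b<n. (\<Sum>a<n. cnj (U' $$ (a, i)) * A $$ (a, b)) * U $$ (b, j))"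
        unfolding S_def sum_distrib_left using that by (intro sum.cong refl, subst UA) (auto simp: mult_ac)
      also have "\<dots> = (\<Sum>a<n. cnj (U' $$ (a, i)) * (\<Sum>b<n. A $$ (a, b) * U $$ (b, j)))"
        unfolding sum_distrib_left sum_distrib_right by (subst sum.swap) (simp add: mult_ac)
      also have "\<dots> = S i j * of_real (d j)"
        unfolding S_def sum_distrib_right using that by (intro sum.cong refl, subst AU) (auto simp: mult_ac)
      finally show ?thesis .
    qed
    have VS: "of_real (V (d' i)) * S i j = S i j * of_real (V (d j))" if "i < n" "j < n" for i j
      using dS[OF that] by (cases "S i j = 0") auto
    fix a b assume "a < dim_row (conj_diag n U (\<lambda>i. of_real (V (d i))))" "b < dim_col (conj_diag n U (\<lambda>i. of_real (V (d i))))"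
    then have ab: "a < n" "b < n" by (auto simp: conj_diag_def)
    have SU: "(\<Sum>j<n. S i j * cnj (U $$ (b, j))) = cnj (U' $$ (b, i))" for i
    proof -
      have "(\<Sum>j<n. S i j * cnj (U $$ (b, j))) = (\<Sum>c<n. cnj (U' $$ (c, i)) * (\<Sum>j<n. U $$ (c, j) * cnj (U $$ (b, j))))"
        unfolding S_def sum_distrib_left sum_distrib_right by (subst sum.swap) (simp add: mult_ac)
      also have "\<dots> = (\<Sum>c<n. cnj (U' $$ (c, i)) * (if c = b then 1 else 0))"
        using ab by (intro sum.cong refl, subst unitary_diagD(3)[OF ud]) auto
      finally show ?thesis using ab by (simp add: if_distrib cong: if_cong)
    qed
    have US: "(\<Sum>i<n. U' $$ (a, i) * S i j) = U $$ (a, j)" for j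
    proof -
      have "(\<Sum>i<n. U' $$ (a, i) * S i j) = (\<Sum>c<n. (\<Sum>i<n. U' $$ (a, i) * cnj (U' $$ (c, i))) * U $$ (c, j))"
        unfolding S_def sum_distrib_left sum_distrib_right by (subst sum.swap) (simp add: mult_ac)
      also have "\<dots> = (\<Sum>c<n. (if a = c then 1 else 0) * U $$ (c, j))"
        using ab by (intro sum.cong refl, subst unitary_diagD(3)[OF ud']) auto
      finally show ?thesis using ab by (simp add: if_distrib[of "\<lambda>c. c * _"] cong: if_cong)
    qed
    have "(\<Sum>i<n. U' $$ (a, i) * of_real (V (d' i)) * cnj (U' $$ (b, i))) =
       (\<Sum>i<n. \<Sum>j<n. U' $$ (a, i) * (of_real (V (d' i)) * S i j) * cnj (U $$ (b, j)))"
      unfolding SU[symmetric] sum_distrib_left by (simp add: mult_ac)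
    also have "\<dots> = (\<Sum>i<n. \<Sum>j<n. U' $$ (a, i) * (S i j * of_real (V (d j))) * cnj (U $$ (b, j)))"
      by (intro sum.cong refl, subst VS) auto
    also have "\<dots> = (\<Sum>j<n. (\<Sum>i<n. U' $$ (a, i) * S i j) * of_real (V (d j)) * cnj (U $$ (b, j)))"
      unfolding sum_distrib_right by (subst sum.swap) (simp add: mult_ac)
    finally show "conj_diag n U' (\<lambda>i. of_real (V (d' i))) $$ (a, b) = conj_diag n U (\<lambda>i. of_real (V (d i))) $$ (a, b)"
      using ab by (simp add: US conj_diag_def)
  qed (auto simp: conj_diag_def)
  have P: "(\<exists>U (d :: nat \<Rightarrow> real). let n = dim_row A in
     U \<in> carrier_mat n n \<and> U * mat_adjoint U = 1\<^sub>m n \<and> mat_adjoint U * U = 1\<^sub>m n \<and>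
     A = U * mat_diag n (\<lambda>i. complex_of_real (d i)) * mat_adjoint U \<and>
     Y = U * mat_diag n (\<lambda>i. complex_of_real (V (d i))) * mat_adjoint U) \<longleftrightarrow>
     (\<exists>U d. unitary_diag n A U d \<and> Y = conj_diag n U (\<lambda>i. of_real (V (d i))))" for Y
  proof -
    have "(U \<in> carrier_mat n n \<and> U * mat_adjoint U = 1\<^sub>m n \<and> mat_adjoint U * U = 1\<^sub>m n \<and>
       A = U * mat_diag n (\<lambda>i. complex_of_real (d i)) * mat_adjoint U \<and>
       Y = U * mat_diag n (\<lambda>i. complex_of_real (V (d i))) * mat_adjoint U) \<longleftrightarrow>
       unitary_diag n A U d \<and> Y = conj_diag n U (\<lambda>i. of_real (V (d i)))" for U d
      using conj_diag_eq[of U n "\<lambda>i. complex_of_real (V (d i))"] unfolding unitary_diag_def by metis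
    then show ?thesis unfolding Let_def dim by simp
  qed
  show ?thesis
    unfolding herm_fun_def P
  proof (rule the_equality)
    show "\<exists>U' d'. unitary_diag n A U' d' \<and> conj_diag n U (\<lambda>i. of_real (V (d i))) = conj_diag n U' (\<lambda>i. of_real (V (d' i)))"
      using ud by blast
    fix Y assume "\<exists>U' d'. unitary_diag n A U' d' \<and> Y = conj_diag n U' (\<lambda>i. of_real (V (d' i)))"
    then show "Y = conj_diag n U (\<lambda>i. of_real (V (d i)))" using key by blast
  qed
qed

end

section \<open>The matrix in coordinates and its sorted eigenvalues\<close>

lemma herm_of_coords_index: "a < n \<Longrightarrow> b < n \<Longrightarrow> herm_of_coords n x $$ (a, b) = ment a b x"
  by (auto simp: herm_of_coords_def ment_def complex_eq_iff)

lemma herm_of_coords_carrier [simp]: "herm_of_coords n x \<in> carrier_mat n n"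
  by (simp add: herm_of_coords_def)

lemma cnj_ment: "cnj (ment a b x) = ment b a x"
  by (auto simp: ment_def complex_eq_iff)

lemma mat_adjoint_herm_of_coords: "mat_adjoint (herm_of_coords n x) = herm_of_coords n x"
proof (rule eq_matI)
  fix i j assume "i < dim_row (herm_of_coords n x)" "j < dim_col (herm_of_coords n x)"
  then have "i < n" "j < n" by (auto simp: herm_of_coords_def)
  then show "mat_adjoint (herm_of_coords n x) $$ (i, j) = herm_of_coords n x $$ (i, j)"
    using carrier_matD[OF herm_of_coords_carrier[of n x]]
    by (subst mat_adjoint_index) (simp_all add: herm_of_coords_index cnj_ment)
qed (auto simp: herm_of_coords_def)

lemma sorted_spectrum_exists:
  "\<exists>es. sorted es \<and> length es = n \<and> (\<exists>U d \<pi>. unitary_diag n (herm_of_coords n x) U d \<and> \<pi> permutes {..<n} \<and> (\<forall>i<n. es ! i = d (\<pi> i)))"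
proof -
  obtain U d where ud: "unitary_diag n (herm_of_coords n x) U d"
    using hermitian_unitary_diag[OF herm_of_coords_carrier mat_adjoint_herm_of_coords] by blast
  define ds where "ds = map d [0..<n]"
  have "mset (sort ds) = mset ds" by simp
  then obtain \<pi> where \<pi>: "\<pi> permutes {..<length ds}" "permute_list \<pi> ds = sort ds"
    by (rule mset_eq_permutation)
  have "sort ds ! i = d (\<pi> i)" if "i < n" for i
  proof -
    have "\<pi> i < n" using permutes_in_image[OF \<pi>(1), of i] that by (simp add: ds_def)
    then show ?thesis unfolding \<pi>(2)[symmetric] using permute_list_nth[OF \<pi>(1), of i] that by (simp add: ds_def)
  qed
  then show ?thesis using ud \<pi>(1) by (intro exI[of _ "sort ds"]) (auto simp: ds_def)
qed

text \<open>The eigenvalues with multiplicity in increasing order. Sorting allows each entry to be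
  recovered from counting functions, which is how measurability is obtained.\<close>

definition sorted_spectrum :: "nat \<Rightarrow> (nat \<times> nat \<Rightarrow> real) \<Rightarrow> real list" where
  "sorted_spectrum n x = (SOME es. sorted es \<and> length es = n \<and>
     (\<exists>U d \<pi>. unitary_diag n (herm_of_coords n x) U d \<and> \<pi> permutes {..<n} \<and> (\<forall>i<n. es ! i = d (\<pi> i))))"

text \<open>Restricted to \<open>{..<n}\<close>, hence a point of the product space.\<close>

definition eigv :: "nat \<Rightarrow> (nat \<times> nat \<Rightarrow> real) \<Rightarrow> nat \<Rightarrow> real" where
  "eigv n x = (\<lambda>i\<in>{..<n}. sorted_spectrum n x ! i)"

lemma sorted_spectrum: "sorted (sorted_spectrum n x)" "length (sorted_spectrum n x) = n"
  "\<exists>U d \<pi>. unitary_diag n (herm_of_coords n x) U d \<and> \<pi> permutes {..<n} \<and> (\<forall>i<n. sorted_spectrum n x ! i = d (\<pi> i))"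
  using someI_ex[OF sorted_spectrum_exists[of n x]] unfolding sorted_spectrum_def by blast+

lemma eigv_unitary_diag:
  obtains U d \<pi> where "unitary_diag n (herm_of_coords n x) U d" "\<pi> permutes {..<n}" "\<And>i. i < n \<Longrightarrow> eigv n x i = d (\<pi> i)"
  using sorted_spectrum(3)[of n x] by (auto simp: eigv_def)

lemma sum_eigv:
  assumes "\<pi> permutes {..<n}" "\<And>i. i < n \<Longrightarrow> eigv n x i = d (\<pi> i)"
  shows "(\<Sum>i<n. g (eigv n x i)) = (\<Sum>i<n. g (d i))"
proof -
  have "(\<Sum>i<n. g (eigv n x i)) = (\<Sum>i<n. g (d (\<pi> i)))" using assms(2) by simp
  also have "\<dots> = (\<Sum>i<n. g (d i))" by (rule sum.reindex_bij_betw[OF permutes_imp_bij[OF assms(1)]])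
  finally show ?thesis .
qed

text \<open>Powers of the matrix are computed in a diagonalisation, and a power sum does not depend
  on the order of the eigenvalues.\<close>

lemma mtr_eq_psum: "mtr n k x = psum n k (eigv n x)"
proof -
  obtain U d \<pi> where ud: "unitary_diag n (herm_of_coords n x) U d" and \<pi>: "\<pi> permutes {..<n}" "\<And>i. i < n \<Longrightarrow> eigv n x i = d (\<pi> i)"
    using eigv_unitary_diag[of n x] by blast
  have "mpow n k a b x = conj_diag n U (\<lambda>j. of_real (d j) ^ k) $$ (a, b)" if "a < n" "b < n" for a b
    using that
  proof (induction k arbitrary: a)
    case 0
    then show ?case using conj_diag_one[OF ud] by simp
  next
    case (Suc k)
    have "conj_diag n U (\<lambda>j. of_real (d j) ^ Suc k) = herm_of_coords n x * conj_diag n U (\<lambda>j. of_real (d j) ^ k)"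
      unfolding unitary_diag_eq[OF ud] conj_diag_mult[OF ud] by simp
    also have "\<dots> $$ (a, b) = (\<Sum>m<n. herm_of_coords n x $$ (a, m) * conj_diag n U (\<lambda>j. of_real (d j) ^ k) $$ (m, b))"
      using Suc.prems by (subst index_mult_mat) (auto simp: scalar_prod_def atLeast0LessThan herm_of_coords_def conj_diag_def)
    also have "\<dots> = mpow n (Suc k) a b x"
      using Suc by (simp add: herm_of_coords_index)
    finally show ?case ..
  qed
  then have "mtr n k x = mat_trace (conj_diag n U (\<lambda>j. of_real (d j) ^ k))"
    by (simp add: mtr_def mat_trace_def conj_diag_def)
  also have "\<dots> = (\<Sum>j<n. of_real (d j) ^ k)" by (rule mat_trace_conj_diag[OF ud])
  finally show ?thesis using sum_eigv[OF \<pi>, of "\<lambda>t. complex_of_real t ^ k"] by (simp add: psum_def)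
qed

lemma mtrs_eq_psums: "mtrs n ks x = psums n ks (eigv n x)"
  by (simp add: mtrs_def psums_def mtr_eq_psum)

lemma mat_trace_herm_fun: "mat_trace (herm_fun V (herm_of_coords n x)) = (\<Sum>i<n. of_real (V (eigv n x i)))"
proof -
  obtain U d \<pi> where ud: "unitary_diag n (herm_of_coords n x) U d" and \<pi>: "\<pi> permutes {..<n}" "\<And>i. i < n \<Longrightarrow> eigv n x i = d (\<pi> i)"
    using eigv_unitary_diag[of n x] by blast
  show ?thesis unfolding herm_fun_unitary_diag[OF ud] mat_trace_conj_diag[OF ud]
    using sum_eigv[OF \<pi>, of "\<lambda>t. complex_of_real (V t)"] by simp
qed

lemma spectrum_herm_of_coords: "spectrum (herm_of_coords n x) \<subseteq> complex_of_real ` I \<longleftrightarrow> (\<forall>i<n. eigv n x i \<in> I)"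
proof -
  obtain U d \<pi> where ud: "unitary_diag n (herm_of_coords n x) U d" and \<pi>: "\<pi> permutes {..<n}" "\<And>i. i < n \<Longrightarrow> eigv n x i = d (\<pi> i)"
    using eigv_unitary_diag[of n x] by blast
  have "spectrum (herm_of_coords n x) = (\<lambda>i. complex_of_real (d i)) ` \<pi> ` {..<n}"
    using spectrum_unitary_diag[OF ud] permutes_image[OF \<pi>(1)] by simp
  also have "\<dots> = (\<lambda>i. complex_of_real (eigv n x i)) ` {..<n}" using \<pi>(2) by (auto simp: image_image)
  finally show ?thesis by auto
qed

lemma mat_trace_resolvent_eigv:
  assumes "\<And>i. i < n \<Longrightarrow> z \<noteq> of_real (eigv n x i)"
  shows "mat_trace (mat_inv (z \<cdot>\<^sub>m 1\<^sub>m n - herm_of_coords n x)) = (\<Sum>i<n. 1 / (z - of_real (eigv n x i)))"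
proof -
  obtain U d \<pi> where ud: "unitary_diag n (herm_of_coords n x) U d" and \<pi>: "\<pi> permutes {..<n}" "\<And>i. i < n \<Longrightarrow> eigv n x i = d (\<pi> i)"
    using eigv_unitary_diag[of n x] by blast
  have "z \<noteq> of_real (d i)" if i: "i < n" for i
  proof -
    obtain j where "j < n" "\<pi> j = i" using permutes_image[OF \<pi>(1)] i by (metis imageE lessThan_iff)
    then show ?thesis using assms[of j] \<pi>(2)[of j] by simp
  qed
  then have "mat_trace (mat_inv (z \<cdot>\<^sub>m 1\<^sub>m n - herm_of_coords n x)) = (\<Sum>i<n. 1 / (z - of_real (d i)))"
    by (rule mat_trace_resolvent[OF ud])
  then show ?thesis using sum_eigv[OF \<pi>, of "\<lambda>t. 1 / (z - complex_of_real t)"] by simp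
qed

section \<open>Measurability and size of the eigenvalues\<close>

abbreviation coords_space :: "nat \<Rightarrow> (nat \<times> nat \<Rightarrow> real) measure" where
  "coords_space n \<equiv> Pi\<^sub>M (sq n) (\<lambda>_. lborel)"

text \<open>Linear statistics of continuous functions are limits of linear statistics of polynomials, which are
  polynomials in the coordinates.\<close>

lemma linear_statistic_limit:
  assumes "\<And>m. (\<lambda>x. \<Sum>i<n. g m (eigv n x i) :: real) \<in> borel_measurable (coords_space n)"
    and "\<And>y. (\<lambda>m. g m y) \<longlonglongrightarrow> h y"
  shows "(\<lambda>x. \<Sum>i<n. h (eigv n x i)) \<in> borel_measurable (coords_space n)"
proof (rule borel_measurable_LIMSEQ_real)
  show "(\<lambda>m. \<Sum>i<n. g m (eigv n x i)) \<longlonglongrightarrow> (\<Sum>i<n. h (eigv n x i))" for x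
    by (rule tendsto_sum) (rule assms(2))
qed (rule assms(1))

lemma linear_statistic_continuous:
  assumes "continuous_on UNIV (g :: real \<Rightarrow> real)"
  shows "(\<lambda>x. \<Sum>i<n. g (eigv n x i)) \<in> borel_measurable (coords_space n)"
proof -
  \<comment> \<open>Approximation within \<open>1 / Suc m\<close> on growing intervals. Every point
    lies in all but finitely many of them, which is enough for pointwise convergence.\<close>
  have "\<exists>p. real_polynomial_function p \<and> (\<forall>y\<in>{- real m..real m}. \<bar>g y - p y\<bar> < 1 / Suc m)" for m
  proof -
    have "compact {- real m..real m}" "continuous_on {- real m..real m} g" "0 < 1 / real (Suc m)"
      using continuous_on_subset[OF assms] by auto
    from Stone_Weierstrass_real_polynomial_function[OF this] show ?thesis by (metis (no_types))
  qed
  then obtain p where p: "\<And>m. real_polynomial_function (p m)" "\<And>m y. y \<in> {- real m..real m} \<Longrightarrow> \<bar>g y - p m y\<bar> < 1 / Suc m"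
    by metis
  show ?thesis
  proof (rule linear_statistic_limit)
    fix m
    obtain a N where pm: "p m = (\<lambda>y. \<Sum>k\<le>N. a k * y ^ k)"
      using p(1)[of m] by (auto simp: real_polynomial_function_iff_sum)
    have "(\<Sum>i<n. p m (eigv n x i)) = (\<Sum>k\<le>N. a k * Re (mtr n k x))" for x
      unfolding pm mtr_eq_psum psum_def by (subst sum.swap) (simp add: sum_distrib_left flip: of_real_power)
    moreover have "(\<lambda>x. \<Sum>k\<le>N. a k * Re (mtr n k x)) \<in> borel_measurable (coords_space n)"
      using poly_fun_measurable[OF poly_fun_mtr] by measurable
    ultimately show "(\<lambda>x. \<Sum>i<n. p m (eigv n x i)) \<in> borel_measurable (coords_space n)" by simp
  next
    fix y
    obtain M where M: "\<bar>y\<bar> \<le> real M" using real_arch_simple by blast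
    have "(\<lambda>m. g y - p m y) \<longlonglongrightarrow> 0"
    proof (rule Lim_null_comparison[OF _ LIMSEQ_inverse_real_of_nat])
      show "\<forall>\<^sub>F m in sequentially. norm (g y - p m y) \<le> inverse (real (Suc m))"
        using eventually_ge_at_top[of M]
      proof eventually_elim
        case (elim m)
        then have "y \<in> {- real m..real m}" using M by auto
        then show ?case using p(2)[of y m] by (simp add: inverse_eq_divide)
      qed
    qed
    from tendsto_diff[OF tendsto_const this, of "g y"] show "(\<lambda>m. p m y) \<longlonglongrightarrow> g y" by simp
  qed
qed

text \<open>The indicator is the pointwise limit of continuous ramps that descend with slope
  \<open>- m\<close> to the right of \<open>c\<close>.\<close>

lemma linear_statistic_indicator:
  "(\<lambda>x. \<Sum>i<n. indicator {..c} (eigv n x i) :: real) \<in> borel_measurable (coords_space n)"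
proof (rule linear_statistic_limit)
  show "(\<lambda>x. \<Sum>i<n. max 0 (min 1 (1 - real m * (eigv n x i - c)))) \<in> borel_measurable (coords_space n)" for m
    by (rule linear_statistic_continuous) (intro continuous_intros)
  fix y
  show "(\<lambda>m. max 0 (min 1 (1 - real m * (y - c)))) \<longlonglongrightarrow> indicator {..c} y"
  proof (cases "y \<le> c")
    case True
    then have "max 0 (min 1 (1 - real m * (y - c))) = 1" for m
      using mult_nonneg_nonpos[of "real m" "y - c"] by (simp add: min_def max_def)
    then show ?thesis using True by simp
  next
    case False
    obtain M where M: "1 / (y - c) \<le> real M" using real_arch_simple by blast
    have "\<forall>\<^sub>F m in sequentially. max 0 (min 1 (1 - real m * (y - c))) = 0"
      using eventually_ge_at_top[of M]
    proof eventually_elim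
      case (elim m)
      then have "1 / (y - c) \<le> real m" using M by linarith
      then have "1 \<le> real m * (y - c)" using False by (simp add: field_simps)
      then show ?case by simp
    qed
    then show ?thesis using False by (simp add: tendsto_eventually)
  qed
qed

text \<open>Turns order statistics into counting functions. Positions count from \<open>0\<close>,
  hence the \<open>+ 1\<close>.\<close>

lemma sorted_nth_le_iff:
  assumes "sorted es" "length es = n" "k < n"
  shows "es ! k \<le> (c::real) \<longleftrightarrow> real k + 1 \<le> (\<Sum>i<n. indicator {..c} (es ! i))"
proof -
  have S: "(\<Sum>i<n. indicator {..c} (es ! i)) = real (card {i\<in>{..<n}. es ! i \<le> c})"
    by (simp add: indicator_def sum.If_cases Int_def)
  show ?thesis
  proof
    assume "es ! k \<le> c"
    then have "{..k} \<subseteq> {i\<in>{..<n}. es ! i \<le> c}"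
      using assms by (auto intro: order_trans[OF sorted_nth_mono])
    then have "card {..k} \<le> card {i\<in>{..<n}. es ! i \<le> c}" by (intro card_mono) auto
    then show "real k + 1 \<le> (\<Sum>i<n. indicator {..c} (es ! i))" unfolding S by simp
  next
    assume r: "real k + 1 \<le> (\<Sum>i<n. indicator {..c} (es ! i))"
    show "es ! k \<le> c"
    proof (rule ccontr)
      assume "\<not> es ! k \<le> c"
      then have "{i\<in>{..<n}. es ! i \<le> c} \<subseteq> {..<k}"
        using assms by (auto simp: not_le) (metis le_less_trans not_le sorted_nth_mono)
      then have "card {i\<in>{..<n}. es ! i \<le> c} \<le> card {..<k}" by (intro card_mono) auto
      then show False using r unfolding S by simp
    qed
  qed
qed

lemma eigv_measurable: "eigv n \<in> measurable (coords_space n) (Pi\<^sub>M {..<n} (\<lambda>_. borel))"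
  unfolding eigv_def[abs_def]
proof (rule measurable_restrict)
  fix k assume "k \<in> {..<n}"
  then have k: "k < n" by simp
  show "(\<lambda>x. sorted_spectrum n x ! k) \<in> borel_measurable (coords_space n)"
    unfolding borel_measurable_iff_le
  proof
    fix c
    have "sorted_spectrum n x ! k \<le> c \<longleftrightarrow> real k + 1 \<le> (\<Sum>i<n. indicator {..c} (eigv n x i))" for x
      using sorted_nth_le_iff[OF sorted_spectrum(1)[of n x] sorted_spectrum(2)[of n x] k, where c=c] by (simp add: eigv_def)
    then show "{x \<in> space (coords_space n). sorted_spectrum n x ! k \<le> c} \<in> sets (coords_space n)"
      using linear_statistic_indicator[of c n] by simp
  qed
qed

lemma sum_eigv_squares: "(\<Sum>i<n. (eigv n x i)\<^sup>2) = (\<Sum>a<n. \<Sum>b<n. (cmod (ment a b x))\<^sup>2)"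
proof -
  have "complex_of_real (\<Sum>i<n. (eigv n x i)\<^sup>2) = mtr n 2 x"
    by (simp add: mtr_eq_psum psum_def)
  also have "\<dots> = (\<Sum>a<n. \<Sum>b<n. ment a b x * ment b a x)"
    unfolding mtr_def numeral_2_eq_2
    by (simp add: if_distrib[of "\<lambda>c. _ * c"] cong: if_cong)
  also have "\<dots> = complex_of_real (\<Sum>a<n. \<Sum>b<n. (cmod (ment a b x))\<^sup>2)"
    by (simp add: complex_norm_square cnj_ment del: of_real_power)
  finally show ?thesis by (simp only: of_real_eq_iff)
qed

text \<open>An eigenvalue is bounded by the Frobenius norm, and this by the sum of the absolute
  values of the entries. The bound is linear in the coordinates, so exponentials of the eigenvalues
  remain integrable under the Gaussian weight.\<close>

lemma eigv_bound:
  assumes "i < n" shows "\<bar>eigv n x i\<bar> \<le> 2 * (\<Sum>e\<in>sq n. \<bar>x e\<bar>)"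
proof -
  have m: "cmod (ment a b x) \<le> \<bar>x (a, b)\<bar> + \<bar>x (b, a)\<bar>" for a b
    unfolding ment_def
    using norm_triangle_ineq[of "complex_of_real (x (a, b))" "\<i> * complex_of_real (x (b, a))"]
      norm_triangle_ineq4[of "complex_of_real (x (b, a))" "\<i> * complex_of_real (x (a, b))"]
    by (auto simp: norm_mult)
  have sq: "sum f (sq n) = (\<Sum>a<n. \<Sum>b<n. f (a, b))" for f :: "nat \<times> nat \<Rightarrow> real"
    by (simp add: sum.cartesian_product)
  have "(eigv n x i)\<^sup>2 \<le> (\<Sum>i<n. (eigv n x i)\<^sup>2)"
    using assms by (intro member_le_sum) auto
  also have "\<dots> = (\<Sum>e\<in>sq n. (cmod (ment (fst e) (snd e) x))\<^sup>2)" by (simp add: sum_eigv_squares sq)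
  finally have "sqrt ((eigv n x i)\<^sup>2) \<le> L2_set (\<lambda>e. cmod (ment (fst e) (snd e) x)) (sq n)"
    unfolding L2_set_def by (rule real_sqrt_le_mono)
  also have "\<dots> \<le> (\<Sum>e\<in>sq n. cmod (ment (fst e) (snd e) x))"
    by (rule L2_set_le_sum) simp
  finally have "\<bar>eigv n x i\<bar> \<le> (\<Sum>e\<in>sq n. cmod (ment (fst e) (snd e) x))" by simp
  also have "\<dots> \<le> (\<Sum>e\<in>sq n. \<bar>x (fst e, snd e)\<bar> + \<bar>x (snd e, fst e)\<bar>)"
    by (intro sum_mono m)
  also have "\<dots> = 2 * (\<Sum>e\<in>sq n. \<bar>x e\<bar>)"
    unfolding sum.distrib sq by (simp, rule sum.swap)
  finally show ?thesis .
qed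

section \<open>Symmetrised laws\<close>

text \<open>For \<open>S = {}\<close> and \<open>m = n\<close> these lists are the orderings of all
  indices; the excluded set \<open>S\<close> serves the recursion over the list.\<close>

definition tuples :: "nat \<Rightarrow> nat set \<Rightarrow> nat \<Rightarrow> nat list set" where
  "tuples n S m = {js. length js = m \<and> distinct js \<and> set js \<subseteq> {..<n} - S}"

lemma finite_tuples [simp]: "finite (tuples n S m)"
  by (rule finite_subset[OF _ finite_lists_length_eq[of "{..<n}" m]]) (auto simp: tuples_def)

lemma tuples_0: "tuples n S 0 = {[]}" by (auto simp: tuples_def)

lemma sum_tuples_Suc:
  "(\<Sum>js\<in>tuples n S (Suc m). f js) = (\<Sum>i\<in>{..<n} - S. \<Sum>js\<in>tuples n (insert i S) m. f (i # js))"
proof -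
  have "(\<Sum>i\<in>{..<n} - S. \<Sum>js\<in>tuples n (insert i S) m. f (i # js)) = (\<Sum>(i, js)\<in>(SIGMA i:{..<n} - S. tuples n (insert i S) m). f (i # js))"
    by (rule sum.Sigma) auto
  also have "\<dots> = (\<Sum>js\<in>tuples n S (Suc m). f js)"
    by (rule sum.reindex_bij_witness[where j="\<lambda>(i, js). i # js" and i="\<lambda>js. (hd js, tl js)"])
      (auto simp: tuples_def length_Suc_conv)
  finally show ?thesis ..
qed

text \<open>For \<open>S = {}\<close> a monomial symmetric function up to a multiplicity, written as
  a sum over distinct indices.\<close>

definition tuple_moment :: "nat \<Rightarrow> nat set \<Rightarrow> nat list \<Rightarrow> (nat \<Rightarrow> real) \<Rightarrow> complex" where
  "tuple_moment n S ks y = (\<Sum>js\<in>tuples n S (length ks). \<Prod>j<length ks. of_real (y (js ! j)) ^ (ks ! j))"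

lemma tuple_moment_Nil [simp]: "tuple_moment n S [] y = 1"
  by (simp add: tuple_moment_def tuples_0)

lemma tuple_moment_Cons:
  "tuple_moment n S (k # ks) y = (\<Sum>i\<in>{..<n} - S. of_real (y i) ^ k * tuple_moment n (insert i S) ks y)"
  unfolding tuple_moment_def list.size(4) add_Suc_right add_0_right 
apply (subst sum_tuples_Suc)
apply (subst prod.lessThan_Suc_shift)
apply (simp only: nth_Cons_0 nth_Cons_Suc)
apply (simp only: sum_distrib_left)
done

fun add_exponent :: "nat \<Rightarrow> nat list \<Rightarrow> nat list list" where
  "add_exponent k [] = []"
| "add_exponent k (m # ks) = ((m + k) # ks) # map ((#) m) (add_exponent k ks)"

lemma length_add_exponent: "l \<in> set (add_exponent k ks) \<Longrightarrow> length l = length ks"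
  by (induction ks arbitrary: l) auto

text \<open>In the product with a power sum the new index is either distinct from those in use,
  which appends an exponent, or equal to one of them, which raises its exponent.\<close>

lemma tuple_moment_mult:
  "tuple_moment n S ks y * (\<Sum>i\<in>{..<n} - S. of_real (y i) ^ k) =
    tuple_moment n S (ks @ [k]) y + (\<Sum>l\<leftarrow>add_exponent k ks. tuple_moment n S l y)"
proof (induction ks arbitrary: S)
  case Nil
  then show ?case by (simp add: tuple_moment_Cons)
next
  case (Cons m ks)
  have "tuple_moment n S (m # ks) y * (\<Sum>i\<in>{..<n} - S. of_real (y i) ^ k) =
     (\<Sum>i\<in>{..<n} - S. of_real (y i) ^ m * (tuple_moment n (insert i S) ks y * (\<Sum>i\<in>{..<n} - S. of_real (y i) ^ k)))"
    by (simp add: tuple_moment_Cons sum_distrib_right mult.assoc)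
  also have "\<dots> = (\<Sum>i\<in>{..<n} - S. of_real (y i) ^ m * (of_real (y i) ^ k * tuple_moment n (insert i S) ks y) +
      of_real (y i) ^ m * (tuple_moment n (insert i S) (ks @ [k]) y + (\<Sum>l\<leftarrow>add_exponent k ks. tuple_moment n (insert i S) l y)))"
  proof (intro sum.cong refl)
    fix i assume i: "i \<in> {..<n} - S"
    \<comment> \<open>The index \<open>i\<close> is split off from the power sum; the remaining
      indices avoid it and fall under the induction hypothesis.\<close>
    have e: "{..<n} - S = insert i ({..<n} - insert i S)" using i by auto
    have "(\<Sum>i\<in>{..<n} - S. complex_of_real (y i) ^ k) = of_real (y i) ^ k + (\<Sum>i\<in>{..<n} - insert i S. of_real (y i) ^ k)"
      by (subst e, subst sum.insert) auto
    then show "of_real (y i) ^ m * (tuple_moment n (insert i S) ks y * (\<Sum>i\<in>{..<n} - S. of_real (y i) ^ k)) =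
       of_real (y i) ^ m * (of_real (y i) ^ k * tuple_moment n (insert i S) ks y) +
      of_real (y i) ^ m * (tuple_moment n (insert i S) (ks @ [k]) y + (\<Sum>l\<leftarrow>add_exponent k ks. tuple_moment n (insert i S) l y))"
      by (simp only: distrib_left Cons.IH mult.commute[of "tuple_moment n (insert i S) ks y" "of_real (y i) ^ k"])
  qed
  also have "\<dots> = tuple_moment n S ((m + k) # ks) y + (tuple_moment n S (m # ks @ [k]) y + (\<Sum>l\<leftarrow>add_exponent k ks. tuple_moment n S (m # l) y))"
  proof -
    have "(\<Sum>i\<in>A. f i * (\<Sum>l\<leftarrow>L. g i l)) = (\<Sum>l\<leftarrow>L. \<Sum>i\<in>A. f i * g i l)" for A :: "nat set" and f :: "nat \<Rightarrow> complex" and g :: "nat \<Rightarrow> nat list \<Rightarrow> complex" and L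
      by (induction L) (simp_all add: distrib_left sum.distrib)
    then show ?thesis by (simp only: tuple_moment_Cons sum.distrib distrib_left power_add mult.assoc)
  qed
  finally show ?case
    by (simp only: append_Cons add_exponent.simps list.map sum_list.Cons map_map o_def
        add.left_commute[of "tuple_moment n S ((m + k) # ks) y"])
qed

lemma tuples_nth: "js \<in> tuples n S m \<Longrightarrow> j < m \<Longrightarrow> js ! j \<in> {..<n}"
  unfolding tuples_def by (auto dest: nth_mem)

lemma poly_fun_tuple_moment: "poly_fun {..<n} (tuple_moment n S ks)"
  unfolding tuple_moment_def[abs_def]
  by (intro poly_fun_sum poly_fun_prod poly_fun_power poly_fun.coord) (rule tuples_nth, assumption, simp)

lemma tuples_full:
  assumes "js \<in> tuples n {} n"
  shows "bij_betw (\<lambda>j. js ! j) {..<n} {..<n}"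
proof -
  have l: "length js = n" "distinct js" "set js \<subseteq> {..<n}" using assms by (auto simp: tuples_def)
  have "card (set js) = n" using distinct_card[OF l(2)] l(1) by simp
  with l(3) have e: "set js = {..<n}" by (intro card_subset_eq) simp_all
  show ?thesis by (rule bij_betw_nth[OF l(2)]) (simp_all only: l(1) e)
qed

lemma upt_in_tuples: "[0..<n] \<in> tuples n {} n"
  by (auto simp: tuples_def)

lemma poly_fun_borel_measurable:
  assumes "poly_fun J F" shows "F \<in> borel_measurable (Pi\<^sub>M J (\<lambda>_. borel))"
proof -
  have "sets (Pi\<^sub>M J (\<lambda>_. lborel)) = sets (Pi\<^sub>M J (\<lambda>_. borel))" by (rule sets_PiM_cong) simp_all
  from measurable_cong_sets[OF this refl] poly_fun_measurable[OF assms] show ?thesis by simp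
qed

section \<open>The symmetrised law of a random vector\<close>

locale random_vector = finite_measure M for M :: "'w measure" and X :: "'w \<Rightarrow> nat \<Rightarrow> real" and n :: nat +
  assumes X_measurable [measurable]: "X \<in> measurable M (Pi\<^sub>M {..<n} (\<lambda>_. borel))"
    and X_exp: "\<And>c. integrable M (\<lambda>\<omega>. \<Prod>i<n. exp (c * \<bar>X \<omega> i\<bar>))"
begin

definition relabel :: "nat list \<times> 'w \<Rightarrow> nat \<Rightarrow> real" where
  "relabel p = (\<lambda>i\<in>{..<n}. X (snd p) (fst p ! i))"

text \<open>The sum, over all orderings of the components, of the laws of the reordered vector.
  Without normalisation the total mass is multiplied by the number of orderings, which depends on
  \<open>n\<close> alone.\<close>

definition sym_law :: "(nat \<Rightarrow> real) measure" where
  "sym_law = distr (count_space (tuples n {} n) \<Otimes>\<^sub>M M) (Pi\<^sub>M {..<n} (\<lambda>_. borel)) relabel"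

lemma relabel_measurable_section:
  assumes "js \<in> tuples n {} n"
  shows "(\<lambda>\<omega>. relabel (js, \<omega>)) \<in> measurable M (Pi\<^sub>M {..<n} (\<lambda>_. borel))"
  unfolding relabel_def
proof (rule measurable_restrict)
  fix i assume "i \<in> {..<n}"
  then have "js ! i \<in> {..<n}" using tuples_full[OF assms] by (auto simp: bij_betw_def)
  then have "(\<lambda>y. y (js ! i)) \<in> measurable (Pi\<^sub>M {..<n} (\<lambda>_. borel)) (borel :: real measure)" by (rule measurable_component_singleton)
  from measurable_compose[OF X_measurable this]
  show "(\<lambda>\<omega>. X (snd (js, \<omega>)) (fst (js, \<omega>) ! i)) \<in> borel_measurable M" by simp
qed

lemma relabel_measurable: "relabel \<in> measurable (count_space (tuples n {} n) \<Otimes>\<^sub>M M) (Pi\<^sub>M {..<n} (\<lambda>_. borel))"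
  by (rule measurable_pair_measure_countable1) (simp_all add: countable_finite relabel_measurable_section)

lemma pair_sigma: "pair_sigma_finite (count_space (tuples n {} n)) M"
proof -
  show ?thesis
    by (intro pair_sigma_finite.intro sigma_finite_measure_count_space_finite finite_tuples sigma_finite_measure_axioms)
qed

lemma integrable_sym_law:
  fixes F :: "(nat \<Rightarrow> real) \<Rightarrow> 'b::{banach, second_countable_topology}"
  assumes F: "F \<in> borel_measurable (Pi\<^sub>M {..<n} (\<lambda>_. borel))"
  shows "integrable sym_law F \<longleftrightarrow> (\<forall>js\<in>tuples n {} n. integrable M (\<lambda>\<omega>. F (relabel (js, \<omega>))))"
    and "integrable sym_law F \<Longrightarrow> (LINT y|sym_law. F y) = (\<Sum>js\<in>tuples n {} n. LINT \<omega>|M. F (relabel (js, \<omega>)))"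
proof -
  let ?C = "count_space (tuples n {} n)"
  interpret pair_sigma_finite ?C M by (rule pair_sigma)
  have m: "(\<lambda>p. F (relabel p)) \<in> borel_measurable (?C \<Otimes>\<^sub>M M)"
    by (rule measurable_compose[OF relabel_measurable F])
  have 1: "integrable sym_law F \<longleftrightarrow> integrable (?C \<Otimes>\<^sub>M M) (\<lambda>p. F (relabel p))"
    unfolding sym_law_def by (rule integrable_distr_eq[OF relabel_measurable F])
  show "integrable sym_law F \<longleftrightarrow> (\<forall>js\<in>tuples n {} n. integrable M (\<lambda>\<omega>. F (relabel (js, \<omega>))))"
    unfolding 1
  proof
    assume "integrable (?C \<Otimes>\<^sub>M M) (\<lambda>p. F (relabel p))"
    from AE_integrable_fst'[OF this] show "\<forall>js\<in>tuples n {} n. integrable M (\<lambda>\<omega>. F (relabel (js, \<omega>)))"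
      by (simp add: AE_count_space)
  next
    assume "\<forall>js\<in>tuples n {} n. integrable M (\<lambda>\<omega>. F (relabel (js, \<omega>)))"
    then show "integrable (?C \<Otimes>\<^sub>M M) (\<lambda>p. F (relabel p))"
      by (intro Fubini_integrable[OF m]) (auto simp: AE_count_space integrable_count_space)
  qed
  show "(LINT y|sym_law. F y) = (\<Sum>js\<in>tuples n {} n. LINT \<omega>|M. F (relabel (js, \<omega>)))" if "integrable sym_law F"
  proof -
    have i: "integrable (?C \<Otimes>\<^sub>M M) (\<lambda>p. F (relabel p))" using that 1 by simp
    have "(LINT y|sym_law. F y) = (LINT p|(?C \<Otimes>\<^sub>M M). F (relabel p))"
      unfolding sym_law_def by (rule integral_distr[OF relabel_measurable F])
    also have "\<dots> = (LINT js|count_space (tuples n {} n). (LINT \<omega>|M. F (relabel (js, \<omega>))))"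
      using integral_fst'[OF i] by simp
    also have "\<dots> = (\<Sum>js\<in>tuples n {} n. LINT \<omega>|M. F (relabel (js, \<omega>)))"
      by (rule lebesgue_integral_count_space_finite) simp
    finally show ?thesis .
  qed
qed

lemma symmetric_sym_law:
  fixes F :: "(nat \<Rightarrow> real) \<Rightarrow> 'b::{banach, second_countable_topology}"
  assumes F: "F \<in> borel_measurable (Pi\<^sub>M {..<n} (\<lambda>_. borel))"
    and sym: "\<And>js y. js \<in> tuples n {} n \<Longrightarrow> y \<in> space (Pi\<^sub>M {..<n} (\<lambda>_. borel)) \<Longrightarrow> F (\<lambda>i\<in>{..<n}. y (js ! i)) = F y"
  shows "integrable sym_law F \<longleftrightarrow> integrable M (\<lambda>\<omega>. F (X \<omega>))"
    and "(LINT y|sym_law. F y) = of_nat (card (tuples n {} n)) *\<^sub>R (LINT \<omega>|M. F (X \<omega>))"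
proof -
  have eq: "F (relabel (js, \<omega>)) = F (X \<omega>)" if "js \<in> tuples n {} n" "\<omega> \<in> space M" for "js" \<omega>
    using sym[OF that(1), of "X \<omega>"] measurable_space[OF X_measurable that(2)] by (simp add: relabel_def)
  have i: "integrable M (\<lambda>\<omega>. F (relabel (js, \<omega>))) \<longleftrightarrow> integrable M (\<lambda>\<omega>. F (X \<omega>))" if "js \<in> tuples n {} n" for "js"
    by (rule Bochner_Integration.integrable_cong) (auto simp: eq that)
  show 1: "integrable sym_law F \<longleftrightarrow> integrable M (\<lambda>\<omega>. F (X \<omega>))"
    unfolding integrable_sym_law(1)[OF F] using i upt_in_tuples by blast
  show "(LINT y|sym_law. F y) = of_nat (card (tuples n {} n)) *\<^sub>R (LINT \<omega>|M. F (X \<omega>))"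
  proof (cases "integrable sym_law F")
    case True
    have "(LINT \<omega>|M. F (relabel (js, \<omega>))) = (LINT \<omega>|M. F (X \<omega>))" if "js \<in> tuples n {} n" for "js"
      by (rule Bochner_Integration.integral_cong) (auto simp: eq that)
    then show ?thesis using integrable_sym_law(2)[OF F True] by (simp add: sum_constant_scaleR)
  next
    \<comment> \<open>If the integral does not exist, both sides have the default value
      \<open>0\<close>.\<close>
    case False
    then show ?thesis using 1 by (simp add: not_integrable_integral_eq)
  qed
qed

lemma exp_moments_sym_law: "exp_moments sym_law n"
proof -
  have m: "(\<lambda>y. \<Prod>i<n. exp (c * \<bar>y i\<bar>)) \<in> borel_measurable (Pi\<^sub>M {..<n} (\<lambda>_. borel :: real measure))" for c
  proof (rule borel_measurable_prod)
    fix i assume "i \<in> {..<n}"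
    then have "(\<lambda>y. y i) \<in> measurable (Pi\<^sub>M {..<n} (\<lambda>_. borel)) (borel :: real measure)"
      by (rule measurable_component_singleton)
    then show "(\<lambda>y. exp (c * \<bar>y i\<bar>)) \<in> borel_measurable (Pi\<^sub>M {..<n} (\<lambda>_. borel))" by measurable
  qed
  have s: "(\<Prod>i<n. exp (c * \<bar>(\<lambda>i\<in>{..<n}. y (js ! i)) i\<bar>)) = (\<Prod>i<n. exp (c * \<bar>y i\<bar>))"
    if "js \<in> tuples n {} n" for "js" y and c :: real
    using prod.reindex_bij_betw[OF tuples_full[OF that], of "\<lambda>i. exp (c * \<bar>y i\<bar>)"] by simp
  have int: "integrable sym_law (\<lambda>y. \<Prod>i<n. exp (c * \<bar>y i\<bar>))" for c
    by (subst symmetric_sym_law(1)[OF m s], assumption, rule X_exp)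
  have one: "integrable sym_law (\<lambda>y. 1 :: real)" using int[of 0] by simp
  have "integrable sym_law (indicat_real (space sym_law))"
    by (rule Bochner_Integration.integrable_bound[OF one]) (simp_all add: indicator_def)
  then have "emeasure sym_law (space sym_law \<inter> space sym_law) < \<infinity>"
    unfolding integrable_indicator_iff by (rule conjunct2)
  then have "emeasure sym_law (space sym_law) \<noteq> \<infinity>" by simp
  then have fin: "finite_measure sym_law" by (rule finite_measureI)
  have sets: "sets sym_law = sets (Pi\<^sub>M {..<n} (\<lambda>_. borel))" unfolding sym_law_def by (rule sets_distr)
  show ?thesis
  proof (rule exp_moments.intro)
    show "exp_moments_axioms sym_law n"
    proof (rule exp_moments_axioms.intro)
      show "integrable sym_law (\<lambda>y. \<Prod>i<n. exp (c * \<bar>y i\<bar>))" for c by (rule int)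
    qed (rule sets)
  qed (rule fin)
qed

lemma poly_fun_X_integrable:
  assumes "poly_fun {..<n} F" shows "integrable M (\<lambda>\<omega>. F (X \<omega>))"
proof -
  have "\<exists>C m. 0 \<le> C \<and> 0 \<le> m \<and> (\<forall>x. norm (F x) \<le> C * (\<Prod>e<n. exp (m * \<bar>x e\<bar>)))"
    by (rule poly_fun_bound) (rule finite_lessThan, rule assms)
  then obtain C m where C: "0 \<le> C" "\<forall>x. norm (F x) \<le> C * (\<Prod>e<n. exp (m * \<bar>x e\<bar>))" by auto
  show ?thesis
  proof (rule Bochner_Integration.integrable_bound)
    show "integrable M (\<lambda>\<omega>. C * (\<Prod>i<n. exp (m * \<bar>X \<omega> i\<bar>)))" by (intro integrable_mult_right X_exp)
    have "F \<in> borel_measurable (Pi\<^sub>M {..<n} (\<lambda>_. borel))"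
      by (rule poly_fun_borel_measurable[OF assms])
    then show "(\<lambda>\<omega>. F (X \<omega>)) \<in> borel_measurable M" by (rule measurable_compose[OF X_measurable])
    show "AE \<omega> in M. norm (F (X \<omega>)) \<le> norm (C * (\<Prod>i<n. exp (m * \<bar>X \<omega> i\<bar>)))"
    proof (rule AE_I2)
      fix \<omega>
      have "norm (F (X \<omega>)) \<le> C * (\<Prod>i<n. exp (m * \<bar>X \<omega> i\<bar>))" using C(2) by (rule spec)
      also have "\<dots> \<le> norm \<dots>" unfolding real_norm_def by (rule abs_ge_self)
      finally show "norm (F (X \<omega>)) \<le> norm (C * (\<Prod>i<n. exp (m * \<bar>X \<omega> i\<bar>)))" .
    qed
  qed
qed

text \<open>Lowers the length of the tuple by moving its last exponent into the power sums; the
  coincidences of indices are subtracted.\<close>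

lemma tuple_moment_expectation:
  "(LINT \<omega>|M. tuple_moment n {} (ks @ [k]) (X \<omega>) * psums n ls (X \<omega>)) =
     (LINT \<omega>|M. tuple_moment n {} ks (X \<omega>) * psums n (k # ls) (X \<omega>)) -
     (\<Sum>l\<leftarrow>add_exponent k ks. LINT \<omega>|M. tuple_moment n {} l (X \<omega>) * psums n ls (X \<omega>))"
proof -
  have i: "integrable M (\<lambda>\<omega>. tuple_moment n {} l (X \<omega>) * psums n ls (X \<omega>))" for l ls
    by (rule poly_fun_X_integrable[OF poly_fun.mult[OF poly_fun_tuple_moment poly_fun_psums]])
  have s: "integrable M (\<lambda>\<omega>. \<Sum>l\<leftarrow>L. tuple_moment n {} l (X \<omega>) * psums n ls (X \<omega>)) \<and>
    (LINT \<omega>|M. (\<Sum>l\<leftarrow>L. tuple_moment n {} l (X \<omega>) * psums n ls (X \<omega>))) = (\<Sum>l\<leftarrow>L. LINT \<omega>|M. tuple_moment n {} l (X \<omega>) * psums n ls (X \<omega>))" for L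
    by (induction L) (simp_all add: i)
  have "tuple_moment n {} (ks @ [k]) y * psums n ls y = tuple_moment n {} ks y * psums n (k # ls) y -
     (\<Sum>l\<leftarrow>add_exponent k ks. tuple_moment n {} l y * psums n ls y)" for y
  proof -
    have "tuple_moment n {} (ks @ [k]) y = tuple_moment n {} ks y * psum n k y - (\<Sum>l\<leftarrow>add_exponent k ks. tuple_moment n {} l y)"
      using tuple_moment_mult[of n "{}" ks y k] by (simp add: psum_def)
    then show ?thesis by (simp only: left_diff_distrib mult.assoc sum_list_mult_const psums_simps)
  qed
  then show ?thesis
    by (simp only: Bochner_Integration.integral_diff[OF i conjunct1[OF s]] conjunct2[OF s])
qed

lemma random_vector_sym_law: "random_vector sym_law (\<lambda>y. y) n"
proof -
  interpret E: exp_moments sym_law n by (rule exp_moments_sym_law)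
  show ?thesis
    by (intro random_vector.intro random_vector_axioms.intro E.exp_int E.finite_measure_axioms)
      (simp add: measurable_ident_sets E.sets_M)
qed

text \<open>Summing a monomial over all orderings of the variables is the same as summing over all
  lists of distinct indices.\<close>

lemma sym_law_moment:
  "complex_of_real (LINT y|sym_law. (\<Prod>i<n. y i ^ g i)) = (LINT \<omega>|M. tuple_moment n {} (map g [0..<n]) (X \<omega>))"
proof -
  let ?F = "\<lambda>y. \<Prod>i<n. complex_of_real (y i) ^ g i"
  have F: "poly_fun {..<n} ?F" by (intro poly_fun_prod poly_fun_power poly_fun.coord)
  have Fm: "?F \<in> borel_measurable (Pi\<^sub>M {..<n} (\<lambda>_. borel))"
    by (rule poly_fun_borel_measurable[OF F])
  have int: "integrable sym_law ?F" by (rule random_vector.poly_fun_X_integrable[OF random_vector_sym_law F])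
  have sec: "integrable M (\<lambda>\<omega>. ?F (relabel (js, \<omega>)))" if "js \<in> tuples n {} n" for "js"
    using integrable_sym_law(1)[OF Fm] int that by blast
  have "complex_of_real (LINT y|sym_law. (\<Prod>i<n. y i ^ g i)) = (LINT y|sym_law. ?F y)"
    by (subst integral_complex_of_real[symmetric]) simp
  also have "\<dots> = (\<Sum>js\<in>tuples n {} n. LINT \<omega>|M. ?F (relabel (js, \<omega>)))"
    by (rule integrable_sym_law(2)[OF Fm int])
  also have "\<dots> = (LINT \<omega>|M. (\<Sum>js\<in>tuples n {} n. ?F (relabel (js, \<omega>))))"
    by (rule Bochner_Integration.integral_sum[symmetric]) (rule sec)
  also have "\<dots> = (LINT \<omega>|M. tuple_moment n {} (map g [0..<n]) (X \<omega>))"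
    by (simp add: tuple_moment_def relabel_def)
  finally show ?thesis .
qed

end

text \<open>Induction on the length of the tuple. The additional power sums \<open>ls\<close> have
  to be arbitrary, because \<open>tuple_moment_expectation\<close> moves the last exponent
  there.\<close>

lemma tuple_moments_eq:
  assumes rv: "random_vector M1 X1 n" "random_vector M2 X2 n"
    and eq: "\<And>ks. (LINT \<omega>|M1. psums n ks (X1 \<omega>)) = (LINT \<omega>|M2. psums n ks (X2 \<omega>))"
  shows "length ks = m \<Longrightarrow> (LINT \<omega>|M1. tuple_moment n {} ks (X1 \<omega>) * psums n ls (X1 \<omega>)) =
      (LINT \<omega>|M2. tuple_moment n {} ks (X2 \<omega>) * psums n ls (X2 \<omega>))"
proof (induction m arbitrary: ks ls)
  case 0
  then have "ks = []" by simp
  then show ?case by (simp only: tuple_moment_Nil mult_1 eq)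
next
  case (Suc m)
  then obtain ks' k where ks: "ks = ks' @ [k]" "length ks' = m"
    using length_Suc_conv_rev[of ks m] by auto
  have "(\<Sum>l\<leftarrow>add_exponent k ks'. LINT \<omega>|M1. tuple_moment n {} l (X1 \<omega>) * psums n ls (X1 \<omega>)) =
     (\<Sum>l\<leftarrow>add_exponent k ks'. LINT \<omega>|M2. tuple_moment n {} l (X2 \<omega>) * psums n ls (X2 \<omega>))"
  proof (intro arg_cong[where f=sum_list] map_cong refl)
    fix l assume "l \<in> set (add_exponent k ks')"
    then show "(LINT \<omega>|M1. tuple_moment n {} l (X1 \<omega>) * psums n ls (X1 \<omega>)) = (LINT \<omega>|M2. tuple_moment n {} l (X2 \<omega>) * psums n ls (X2 \<omega>))"
      by (intro Suc.IH) (simp only: length_add_exponent ks(2))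
  qed
  then show ?case
    unfolding ks(1) random_vector.tuple_moment_expectation[OF rv(1)] random_vector.tuple_moment_expectation[OF rv(2)]
    by (simp only: Suc.IH[OF ks(2)])
qed

text \<open>Equal moments of products of power sums give equal moments of the symmetrised laws.
  These have all exponential moments and hence coincide, and a symmetric function integrates over
  them to a fixed multiple of the original integral.\<close>

lemma symmetric_transfer:
  fixes F :: "(nat \<Rightarrow> real) \<Rightarrow> complex"
  assumes rv: "random_vector M1 X1 n" "random_vector M2 X2 n"
    and eq: "\<And>ks. (LINT \<omega>|M1. psums n ks (X1 \<omega>)) = (LINT \<omega>|M2. psums n ks (X2 \<omega>))"
    and F: "F \<in> borel_measurable (Pi\<^sub>M {..<n} (\<lambda>_. borel))"
    and sym: "\<And>js y. js \<in> tuples n {} n \<Longrightarrow> y \<in> space (Pi\<^sub>M {..<n} (\<lambda>_. borel)) \<Longrightarrow> F (\<lambda>i\<in>{..<n}. y (js ! i)) = F y"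
  shows "integrable M1 (\<lambda>\<omega>. F (X1 \<omega>)) \<longleftrightarrow> integrable M2 (\<lambda>\<omega>. F (X2 \<omega>))"
    and "(LINT \<omega>|M1. F (X1 \<omega>)) = (LINT \<omega>|M2. F (X2 \<omega>))"
proof -
  interpret R1: random_vector M1 X1 n by (rule rv)
  interpret R2: random_vector M2 X2 n by (rule rv)
  have "R1.sym_law = R2.sym_law"
  proof (rule moment_determinacy[OF R1.exp_moments_sym_law R2.exp_moments_sym_law])
    fix g :: "nat \<Rightarrow> nat"
    have "complex_of_real (LINT y|R1.sym_law. (\<Prod>i<n. y i ^ g i)) = of_real (LINT y|R2.sym_law. (\<Prod>i<n. y i ^ g i))"
      unfolding R1.sym_law_moment R2.sym_law_moment
      using tuple_moments_eq[OF rv eq, of "map g [0..<n]" n "[]"] by simp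
    then show "(LINT y|R1.sym_law. (\<Prod>i<n. y i ^ g i)) = (LINT y|R2.sym_law. (\<Prod>i<n. y i ^ g i))" by simp
  qed
  moreover have "card (tuples n {} n) \<noteq> 0" using upt_in_tuples by (auto simp: card_eq_0_iff)
  ultimately show "integrable M1 (\<lambda>\<omega>. F (X1 \<omega>)) \<longleftrightarrow> integrable M2 (\<lambda>\<omega>. F (X2 \<omega>))"
    "(LINT \<omega>|M1. F (X1 \<omega>)) = (LINT \<omega>|M2. F (X2 \<omega>))"
    using R1.symmetric_sym_law[OF F sym] R2.symmetric_sym_law[OF F sym] by simp_all
qed

section \<open>Weyl integration\<close>

lemma normal_density_split: "nd s y = nd s 0 * exp (- (y\<^sup>2 / (2 * s\<^sup>2)))"
  by (simp add: normal_density_def)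

text \<open>By the choice of \<open>std_dev\<close> the exponent is minus half the trace of the
  square, so the weight is a function of the spectrum and can be divided out of a spectral
  statistic.\<close>

lemma gauss_weight_eigv:
  "gauss_weight (sq n) std_dev x = (\<Prod>e\<in>sq n. nd (std_dev e) 0) * exp (- ((\<Sum>i<n. (eigv n x i)\<^sup>2) / 2))"
proof -
  define q where "q a b = (if a = b then (x (a, a))\<^sup>2 / 2 else (x (a, b))\<^sup>2)" for a b :: nat
  have m: "(cmod (ment a b x))\<^sup>2 = q a b + q b a" for a b
    by (auto simp: ment_def q_def cmod_power2)
  have e: "(x e)\<^sup>2 / (2 * (std_dev e)\<^sup>2) = q (fst e) (snd e)" for e
    by (cases e) (auto simp: std_dev_def q_def power_divide real_sqrt_divide)
  have s1: "(\<Sum>a<n. \<Sum>b<n. q b a) = (\<Sum>a<n. \<Sum>b<n. q a b)" by (rule sum.swap)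
  have s2: "(\<Sum>e\<in>sq n. q (fst e) (snd e)) = (\<Sum>a<n. \<Sum>b<n. q a b)"
    unfolding sum.cartesian_product split_def ..
  have "(\<Sum>i<n. (eigv n x i)\<^sup>2) = 2 * (\<Sum>e\<in>sq n. q (fst e) (snd e))"
    unfolding sum_eigv_squares m sum.distrib s1 s2 by simp
  then have s3: "(\<Sum>e\<in>sq n. - q (fst e) (snd e)) = - ((\<Sum>i<n. (eigv n x i)\<^sup>2) / 2)"
    by (simp add: sum_negf)
  have "gauss_weight (sq n) std_dev x = (\<Prod>e\<in>sq n. nd (std_dev e) 0 * exp (- q (fst e) (snd e)))"
    unfolding gauss_weight_def
    by (rule prod.cong[OF refl], subst normal_density_split, simp only: e)
  also have "\<dots> = (\<Prod>e\<in>sq n. nd (std_dev e) 0) * exp (\<Sum>e\<in>sq n. - q (fst e) (snd e))"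
    unfolding prod.distrib by (subst exp_sum) simp_all
  finally show ?thesis unfolding s3 .
qed

lemma gauss_weight_unit:
  fixes n :: nat
  shows "gauss_weight {..<n} (\<lambda>_. 1) y = (\<Prod>i<n. nd 1 0) * exp (- ((\<Sum>i<n. (y i)\<^sup>2) / 2))"
proof -
  have "gauss_weight {..<n} (\<lambda>_. 1) y = (\<Prod>i<n. nd 1 0 * exp (- ((y i)\<^sup>2 / 2)))"
    unfolding gauss_weight_def
    by (rule prod.cong[OF refl], subst normal_density_split, simp)
  also have "\<dots> = (\<Prod>i<n. nd 1 0) * exp (\<Sum>i<n. - ((y i)\<^sup>2 / 2))"
    unfolding prod.distrib by (subst exp_sum) simp_all
  also have "(\<Sum>i<n. - ((y i)\<^sup>2 / 2)) = - ((\<Sum>i<n. (y i)\<^sup>2) / 2)"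
    by (simp only: sum_negf sum_divide_distrib)
  finally show ?thesis .
qed

lemma integral_gauss_weight:
  assumes "finite J" "\<And>e. e \<in> J \<Longrightarrow> 0 < s e"
  shows "(LINT x|Pi\<^sub>M J (\<lambda>_. lborel). gauss_weight J s x) = 1"
proof -
  interpret product_sigma_finite "\<lambda>_::'a. lborel :: real measure" by standard
  have "(LINT x|Pi\<^sub>M J (\<lambda>_. lborel). gauss_weight J s x) = (\<Prod>e\<in>J. LINT y|lborel. nd (s e) y)"
    unfolding gauss_weight_def
    by (rule product_integral_prod[OF assms(1)]) (rule integrable_normal_density, rule assms(2))
  also have "\<dots> = (\<Prod>e\<in>J. 1)"
    by (rule prod.cong[OF refl]) (rule integral_normal_density, rule assms(2))
  finally show ?thesis by simp
qed

lemma loop_equations_scale: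
  assumes "loop_equations n m" shows "loop_equations n (\<lambda>ks. a * m ks)"
  using assms unfolding loop_equations_def split_def
  by (simp add: distrib_left sum_distrib_left mult.left_commute flip: sum_list_const_mult)

lemma finite_measure_integrable_one:
  assumes "integrable M (\<lambda>y. 1 :: real)" shows "finite_measure M"
proof -
  have "integrable M (indicat_real (space M))"
    by (rule Bochner_Integration.integrable_bound[OF assms]) (simp_all add: indicator_def)
  then have "emeasure M (space M \<inter> space M) < \<infinity>"
    unfolding integrable_indicator_iff by (rule conjunct2)
  then have "emeasure M (space M) \<noteq> \<infinity>" by simp
  then show ?thesis by (rule finite_measureI)
qed

lemma random_vector_density:
  assumes fin: "finite J" and s: "\<And>e. e \<in> J \<Longrightarrow> 0 < s e"
    and G: "G \<in> borel_measurable (Pi\<^sub>M J (\<lambda>_. lborel))" "\<And>x. 0 \<le> G x"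
    and bd: "0 \<le> D" "\<And>x. G x \<le> D * (\<Prod>e\<in>J. exp (k * \<bar>x e\<bar>))"
    and X: "X \<in> measurable (Pi\<^sub>M J (\<lambda>_. lborel)) (Pi\<^sub>M {..<n} (\<lambda>_. borel))"
    and Xb: "0 \<le> C" "\<And>x i. i < n \<Longrightarrow> \<bar>X x i\<bar> \<le> C * (\<Sum>e\<in>J. \<bar>x e\<bar>)"
  shows "random_vector (density (Pi\<^sub>M J (\<lambda>_. lborel)) (\<lambda>x. ennreal (G x * gauss_weight J s x))) X n"
proof -
  let ?N = "Pi\<^sub>M J (\<lambda>_. lborel :: real measure)"
  let ?g = "\<lambda>x. G x * gauss_weight J s x"
  let ?M = "density ?N (\<lambda>x. ennreal (?g x))"
  have gm: "?g \<in> borel_measurable ?N" by (rule borel_measurable_times[OF G(1) gauss_weight_measurable])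
  have g0: "AE x in ?N. 0 \<le> ?g x" by (intro AE_I2 mult_nonneg_nonneg G(2) gauss_weight_nonneg)
  have hm: "(\<lambda>x. \<Prod>i<n. exp (c * \<bar>X x i\<bar>)) \<in> borel_measurable ?N" for c
  proof (rule borel_measurable_prod)
    fix i assume "i \<in> {..<n}"
    then have "(\<lambda>y. y i) \<in> measurable (Pi\<^sub>M {..<n} (\<lambda>_. borel)) (borel :: real measure)"
      by (rule measurable_component_singleton)
    from measurable_compose[OF X this] show "(\<lambda>x. exp (c * \<bar>X x i\<bar>)) \<in> borel_measurable ?N" by measurable
  qed
  have int: "integrable ?M (\<lambda>x. \<Prod>i<n. exp (c * \<bar>X x i\<bar>))" for c
  proof -
    \<comment> \<open>Each of the \<open>n\<close> factors has its exponent bounded by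
      \<open>\<bar>c\<bar> * C\<close> times the sum of the absolute values of the
      coordinates.\<close>
    define m where "m = real n * (\<bar>c\<bar> * C)"
    have hb: "(\<Prod>i<n. exp (c * \<bar>X x i\<bar>)) \<le> (\<Prod>e\<in>J. exp (m * \<bar>x e\<bar>))" for x
    proof -
      have t: "c * \<bar>X x i\<bar> \<le> \<bar>c\<bar> * (C * (\<Sum>e\<in>J. \<bar>x e\<bar>))" if "i < n" for i
      proof -
        have "c * \<bar>X x i\<bar> \<le> \<bar>c\<bar> * \<bar>X x i\<bar>" by (rule mult_right_mono) simp_all
        also have "\<dots> \<le> \<bar>c\<bar> * (C * (\<Sum>e\<in>J. \<bar>x e\<bar>))" by (rule mult_left_mono[OF Xb(2)[OF that]]) simp
        finally show ?thesis .
      qed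
      have "(\<Sum>i<n. c * \<bar>X x i\<bar>) \<le> (\<Sum>i<n. \<bar>c\<bar> * (C * (\<Sum>e\<in>J. \<bar>x e\<bar>)))"
        by (rule sum_mono) (rule t, simp)
      also have "\<dots> = (\<Sum>e\<in>J. m * \<bar>x e\<bar>)" by (simp add: m_def sum_distrib_left mult.assoc)
      finally have "exp (\<Sum>i<n. c * \<bar>X x i\<bar>) \<le> exp (\<Sum>e\<in>J. m * \<bar>x e\<bar>)" by simp
      then show ?thesis by (simp only: exp_sum[OF finite_lessThan] exp_sum[OF fin])
    qed
    have "integrable ?N (\<lambda>x. ?g x * (\<Prod>i<n. exp (c * \<bar>X x i\<bar>)))"
    proof (rule Bochner_Integration.integrable_bound)
      show "integrable ?N (\<lambda>x. D * ((\<Prod>e\<in>J. exp ((k + m) * \<bar>x e\<bar>)) * gauss_weight J s x))"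
        by (rule integrable_mult_right, rule integrable_exp_gauss[OF fin s])
      show "(\<lambda>x. ?g x * (\<Prod>i<n. exp (c * \<bar>X x i\<bar>))) \<in> borel_measurable ?N"
        by (rule borel_measurable_times[OF gm hm])
      show "AE x in ?N. norm (?g x * (\<Prod>i<n. exp (c * \<bar>X x i\<bar>))) \<le>
          norm (D * ((\<Prod>e\<in>J. exp ((k + m) * \<bar>x e\<bar>)) * gauss_weight J s x))"
      proof (rule AE_I2)
        fix x
        have p: "0 \<le> (\<Prod>e\<in>J. exp (k * \<bar>x e\<bar>))" "0 \<le> (\<Prod>i<n. exp (c * \<bar>X x i\<bar>))"
          by (rule prod_nonneg, simp)+
        have "G x * (\<Prod>i<n. exp (c * \<bar>X x i\<bar>)) \<le> (D * (\<Prod>e\<in>J. exp (k * \<bar>x e\<bar>))) * (\<Prod>e\<in>J. exp (m * \<bar>x e\<bar>))"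
          by (rule mult_mono[OF bd(2) hb mult_nonneg_nonneg[OF bd(1) p(1)] p(2)])
        also have "\<dots> = D * (\<Prod>e\<in>J. exp ((k + m) * \<bar>x e\<bar>))"
          by (simp only: distrib_right exp_add prod.distrib mult.assoc)
        finally have le: "G x * (\<Prod>i<n. exp (c * \<bar>X x i\<bar>)) \<le> D * (\<Prod>e\<in>J. exp ((k + m) * \<bar>x e\<bar>))" .
        have "norm (?g x * (\<Prod>i<n. exp (c * \<bar>X x i\<bar>))) = G x * (\<Prod>i<n. exp (c * \<bar>X x i\<bar>)) * gauss_weight J s x"
          using G(2)[of x] p(2) gauss_weight_nonneg[of J s x] by (simp add: abs_mult)
        also have "\<dots> \<le> D * (\<Prod>e\<in>J. exp ((k + m) * \<bar>x e\<bar>)) * gauss_weight J s x"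
          by (rule mult_right_mono[OF le gauss_weight_nonneg])
        also have "\<dots> \<le> norm (D * ((\<Prod>e\<in>J. exp ((k + m) * \<bar>x e\<bar>)) * gauss_weight J s x))"
          unfolding real_norm_def mult.assoc by (rule abs_ge_self)
        finally show "norm (?g x * (\<Prod>i<n. exp (c * \<bar>X x i\<bar>))) \<le>
          norm (D * ((\<Prod>e\<in>J. exp ((k + m) * \<bar>x e\<bar>)) * gauss_weight J s x))" .
      qed
    qed
    then show ?thesis by (subst integrable_density[OF hm gm g0]) simp
  qed
  have "integrable ?M (\<lambda>x. 1 :: real)" using int[of 0] by simp
  then have fm: "finite_measure ?M" by (rule finite_measure_integrable_one)
  show ?thesis
  proof (rule random_vector.intro[OF fm random_vector_axioms.intro])
    show "X \<in> measurable ?M (Pi\<^sub>M {..<n} (\<lambda>_. borel))" using X by simp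
    show "integrable ?M (\<lambda>x. \<Prod>i<n. exp (c * \<bar>X x i\<bar>))" for c by (rule int)
  qed
qed

lemma ident_measurable_PiM_lborel: "(\<lambda>y. y) \<in> measurable (Pi\<^sub>M J (\<lambda>_. lborel)) (Pi\<^sub>M J (\<lambda>_. borel :: real measure))"
proof (rule measurable_ident_sets)
  show "sets (Pi\<^sub>M J (\<lambda>_. lborel)) = sets (Pi\<^sub>M J (\<lambda>_. borel :: real measure))"
    by (rule sets_PiM_cong) simp_all
qed

lemma vsq_of_real: "vsq n y = of_real (\<Prod>q\<in>pairs n. (y (fst q) - y (snd q))\<^sup>2)"
  by (simp add: vsq_def)

text \<open>The two Gaussian laws are compared on \<open>F\<close> divided by the Gaussian weight,
  which is again symmetric because the weight depends on the sum of squares only. Divergent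
  integrals are covered as well: by \<open>symmetric_transfer\<close> the default values
  correspond.\<close>

theorem weyl_integration:
  assumes nz: "\<not> (AE y in Pi\<^sub>M {..<n} (\<lambda>_. lborel). vsq n y = 0)"
  obtains \<kappa> :: real where "\<kappa> > 0"
    and "\<And>F :: (nat \<Rightarrow> real) \<Rightarrow> complex. F \<in> borel_measurable (Pi\<^sub>M {..<n} (\<lambda>_. borel)) \<Longrightarrow>
      (\<And>js y. js \<in> tuples n {} n \<Longrightarrow> y \<in> space (Pi\<^sub>M {..<n} (\<lambda>_. borel)) \<Longrightarrow> F (\<lambda>i\<in>{..<n}. y (js ! i)) = F y) \<Longrightarrow>
      (LINT x|coords_space n. F (eigv n x)) = of_real \<kappa> * (LINT y|Pi\<^sub>M {..<n} (\<lambda>_. lborel). vsq n y * F y)"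
proof -
  let ?N1 = "coords_space n" and ?N2 = "Pi\<^sub>M {..<n} (\<lambda>_. lborel :: real measure)"
  let ?B = "Pi\<^sub>M {..<n} (\<lambda>_. borel :: real measure)"
  let ?g1 = "gauss_weight (sq n) std_dev" and ?g2 = "gauss_weight {..<n} (\<lambda>_. 1)"
  define r where "r y = (\<Prod>q\<in>pairs n. (y (fst q) - y (snd q))\<^sup>2)" for y :: "nat \<Rightarrow> real"
  have vr: "vsq n y = of_real (r y)" for y unfolding r_def by (rule vsq_of_real)
  have r0: "0 \<le> r y" for y unfolding r_def by (intro prod_nonneg) simp
  have rm: "r \<in> borel_measurable ?N2"
  proof -
    have "(\<lambda>y. Re (vsq n y)) \<in> borel_measurable ?N2"
      using poly_fun_measurable[OF poly_fun_vsq] by measurable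
    then show ?thesis by (simp add: vr)
  qed
  have g2m: "?g2 \<in> borel_measurable ?N2" by (rule gauss_weight_measurable)
  have g1m: "?g1 \<in> borel_measurable ?N1" by (rule gauss_weight_measurable)
  define K1 where "K1 = (\<Prod>e\<in>sq n. nd (std_dev e) 0)"
  define K2 where "K2 = (\<Prod>i<n. nd 1 0)"
  have K: "0 < K1" "0 < K2" unfolding K1_def K2_def by (rule prod_pos, simp add: normal_density_pos std_dev_pos)+
  have g2pos: "0 < ?g2 y" for y unfolding gauss_weight_unit K2_def[symmetric] using K by simp
  have int2: "integrable ?N2 (\<lambda>y. r y * ?g2 y)"
  proof -
    have "integrable ?N2 (\<lambda>y. vsq n y * of_real (?g2 y))"
      by (rule poly_fun_integrable[OF finite_lessThan _ poly_fun_vsq]) simp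
    then have "integrable ?N2 (\<lambda>y. Re (vsq n y * of_real (?g2 y)))" by (rule integrable_Re)
    then show ?thesis by (simp add: vr)
  qed
  define m2 where "m2 = (LINT y|?N2. r y * ?g2 y)"
  have nn2: "AE y in ?N2. 0 \<le> r y * ?g2 y" by (intro AE_I2 mult_nonneg_nonneg r0 gauss_weight_nonneg)
  \<comment> \<open>The Gaussian weight is positive, so a vanishing integral would make the
    Vandermonde factor zero almost everywhere, against \<open>nz\<close>.\<close>
  have "m2 \<noteq> 0"
  proof
    assume "m2 = 0"
    then have "AE y in ?N2. r y * ?g2 y = 0"
      using integral_nonneg_eq_0_iff_AE[OF int2 nn2] unfolding m2_def by blast
    then have "AE y in ?N2. vsq n y = 0"
    proof (rule AE_mp, intro AE_I2 impI)
      fix y assume "r y * ?g2 y = 0"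
      then show "vsq n y = 0" using g2pos[of y] by (simp add: vr)
    qed
    then show False using nz by contradiction
  qed
  moreover have "0 \<le> m2" unfolding m2_def by (rule integral_nonneg_AE[OF nn2])
  ultimately have m2: "0 < m2" by simp
  \<comment> \<open>Gives the second law the mass \<open>1\<close> of the first; the loop equations
    determine the moments only up to this factor.\<close>
  define c where "c = 1 / m2"
  have c: "0 < c" "c * m2 = 1" using m2 by (simp_all add: c_def)
  define M1 where "M1 = density ?N1 (\<lambda>x. ennreal (1 * ?g1 x))"
  define M2 where "M2 = density ?N2 (\<lambda>y. ennreal (c * r y * ?g2 y))"
  have rv1: "random_vector M1 (eigv n) n"
    unfolding M1_def
  proof (rule random_vector_density[where D=1 and k=0 and C=2])
    show "\<bar>eigv n x i\<bar> \<le> 2 * (\<Sum>e\<in>sq n. \<bar>x e\<bar>)" if "i < n" for x i by (rule eigv_bound[OF that])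
    show "eigv n \<in> measurable ?N1 ?B" by (rule eigv_measurable)
  qed (simp_all add: std_dev_pos)
  obtain D k where Dk: "0 \<le> D" "\<forall>y. norm (vsq n y) \<le> D * (\<Prod>e<n. exp (k * \<bar>y e\<bar>))"
    using poly_fun_bound[OF finite_lessThan poly_fun_vsq[of n]] by blast
  have rv2: "random_vector M2 (\<lambda>y. y) n"
    unfolding M2_def
  proof (rule random_vector_density[where D="c * D" and k=k and C=1])
    show "(\<lambda>y. c * r y) \<in> borel_measurable ?N2" using rm by measurable
    show "(\<lambda>y. y) \<in> measurable ?N2 ?B" by (rule ident_measurable_PiM_lborel)
    show "c * r y \<le> c * D * (\<Prod>e<n. exp (k * \<bar>y e\<bar>))" for y
    proof -
      have "r y \<le> D * (\<Prod>e<n. exp (k * \<bar>y e\<bar>))" using spec[OF Dk(2), of y] r0[of y] by (simp add: vr)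
      then show ?thesis using c(1) by (simp add: mult.assoc)
    qed
    show "\<bar>y i\<bar> \<le> 1 * (\<Sum>e<n. \<bar>y e\<bar>)" if "i < n" for y :: "nat \<Rightarrow> real" and i
      using member_le_sum[of i "{..<n}" "\<lambda>e. \<bar>y e\<bar>"] that by simp
    show "0 \<le> c * r y" for y using c(1) r0[of y] by simp
    show "0 \<le> c * D" using c(1) Dk(1) by simp
  qed simp_all
  have int_M1: "(LINT x|M1. f x) = (LINT x|?N1. f x * of_real (?g1 x))" if "f \<in> borel_measurable ?N1" for f :: "_ \<Rightarrow> complex"
    unfolding M1_def mult_1
    by (subst integral_density[OF that g1m AE_I2[OF gauss_weight_nonneg]])
      (simp only: scaleR_conv_of_real mult.commute)
  have cr0: "AE y in ?N2. 0 \<le> c * r y * ?g2 y"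
    by (intro AE_I2 mult_nonneg_nonneg r0 gauss_weight_nonneg less_imp_le[OF c(1)])
  have crm: "(\<lambda>y. c * r y * ?g2 y) \<in> borel_measurable ?N2" using rm g2m by measurable
  have int_M2: "(LINT y|M2. f y) = of_real c * (LINT y|?N2. f y * vsq n y * of_real (?g2 y))" if "f \<in> borel_measurable ?N2" for f :: "_ \<Rightarrow> complex"
  proof -
    have "(LINT y|M2. f y) = (LINT y|?N2. (c * r y * ?g2 y) *\<^sub>R f y)"
      unfolding M2_def by (rule integral_density[OF that crm cr0])
    also have "\<dots> = (LINT y|?N2. of_real c * (f y * vsq n y * of_real (?g2 y)))"
      by (simp add: scaleR_conv_of_real vr mult_ac)
    finally show ?thesis by simp
  qed
  have eq: "(LINT x|M1. psums n ks (eigv n x)) = (LINT y|M2. psums n ks y)" for ks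
  proof -
    have "(LINT x|M1. psums n ks (eigv n x)) = gint (sq n) std_dev (mtrs n ks)"
      unfolding mtrs_eq_psums[symmetric] by (rule int_M1[OF poly_fun_measurable[OF poly_fun_mtrs]])
    also have "\<dots> = of_real c * gint {..<n} (\<lambda>_. 1) (\<lambda>y. psums n ks y * vsq n y)"
    proof (rule loop_equations_unique[OF loop_equations_matrix loop_equations_scale[OF loop_equations_eigenvalues]])
      have "gint (sq n) std_dev (mtrs n []) = of_real (LINT x|?N1. ?g1 x)"
        by (simp add: mtrs_def integral_complex_of_real)
      also have "\<dots> = 1" by (subst integral_gauss_weight) (simp_all add: std_dev_pos)
      also have "1 = complex_of_real (c * m2)" by (simp only: c(2) of_real_1)
      also have "\<dots> = of_real c * gint {..<n} (\<lambda>_. 1) (\<lambda>y. psums n [] y * vsq n y)"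
        unfolding m2_def of_real_mult integral_complex_of_real[symmetric] by (simp add: vr)
      finally show "gint (sq n) std_dev (mtrs n []) = of_real c * gint {..<n} (\<lambda>_. 1) (\<lambda>y. psums n [] y * vsq n y)" .
    qed
    also have "\<dots> = (LINT y|M2. psums n ks y)"
      by (rule int_M2[OF poly_fun_measurable[OF poly_fun_psums], symmetric])
    finally show ?thesis .
  qed
  \<comment> \<open>The normalisation \<open>c\<close> times the ratio of the constants in front of
    the two Gaussian exponentials. Its value drops out later, since the partition function contains
    it too.\<close>
  define \<kappa> where "\<kappa> = c * K2 / K1"
  show thesis
  proof (rule that[of \<kappa>])
    show "\<kappa> > 0" unfolding \<kappa>_def using c(1) K by simp
    fix F :: "(nat \<Rightarrow> real) \<Rightarrow> complex"
    assume Fm: "F \<in> borel_measurable ?B"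
      and sym: "\<And>js y. js \<in> tuples n {} n \<Longrightarrow> y \<in> space ?B \<Longrightarrow> F (\<lambda>i\<in>{..<n}. y (js ! i)) = F y"
    \<comment> \<open>The Gaussian exponential is removed in advance; both
      \<open>gauss_weight_eigv\<close> and \<open>gauss_weight_unit\<close> restore it with the same
      exponent.\<close>
    define G where "G y = F y * of_real (exp ((\<Sum>i<n. (y i)\<^sup>2) / 2))" for y
    have sm: "(\<lambda>y. \<Sum>i<n. (y i)\<^sup>2 :: real) \<in> borel_measurable ?B"
      by (rule borel_measurable_sum, rule borel_measurable_power, rule measurable_component_singleton)
    have Gm: "G \<in> borel_measurable ?B" unfolding G_def[abs_def] using Fm sm by measurable
    have Gs: "G (\<lambda>i\<in>{..<n}. y (js ! i)) = G y" if "js \<in> tuples n {} n" "y \<in> space ?B" for js y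
    proof -
      have "(\<Sum>i<n. ((\<lambda>i\<in>{..<n}. y (js ! i)) i)\<^sup>2) = (\<Sum>i<n. (y (js ! i))\<^sup>2)" by (rule sum.cong) simp_all
      also have "\<dots> = (\<Sum>i<n. (y i)\<^sup>2)" by (rule sum.reindex_bij_betw[OF tuples_full[OF that(1)]])
      finally show ?thesis unfolding G_def sym[OF that] by simp
    qed
    have "(LINT x|M1. G (eigv n x)) = (LINT y|M2. G y)"
      by (rule symmetric_transfer(2)[OF rv1 rv2 eq Gm Gs])
    also have "(LINT x|M1. G (eigv n x)) = (LINT x|?N1. G (eigv n x) * of_real (?g1 x))"
      by (rule int_M1[OF measurable_compose[OF eigv_measurable Gm]])
    also have "\<dots> = (LINT x|?N1. of_real K1 * F (eigv n x))"
      unfolding G_def gauss_weight_eigv K1_def[symmetric] by (simp add: exp_minus field_simps)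
    also have "\<dots> = of_real K1 * (LINT x|?N1. F (eigv n x))" by simp
    also have "(LINT y|M2. G y) = of_real c * (LINT y|?N2. G y * vsq n y * of_real (?g2 y))"
      by (rule int_M2[OF measurable_compose[OF ident_measurable_PiM_lborel Gm]])
    also have "(LINT y|?N2. G y * vsq n y * of_real (?g2 y)) = (LINT y|?N2. of_real K2 * (vsq n y * F y))"
      unfolding G_def gauss_weight_unit K2_def[symmetric] by (simp add: exp_minus field_simps)
    also have "\<dots> = of_real K2 * (LINT y|?N2. vsq n y * F y)" by simp
    finally show "(LINT x|?N1. F (eigv n x)) = of_real \<kappa> * (LINT y|?N2. vsq n y * F y)"
      unfolding \<kappa>_def using K by (simp add: field_simps)
  qed
qed

section \<open>Cumulants of the eigenvalue density\<close>

lemma set_det_transpose: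
  assumes "finite S" shows "set_det (\<lambda>i j. f j i) S = set_det f S"
proof -
  have "set_det (\<lambda>i j. f j i) S = (\<Sum>\<pi> | \<pi> permutes S. of_int (sign (inv_into UNIV \<pi>)) * (\<Prod>i\<in>S. f (inv_into UNIV \<pi> i) i))"
    unfolding set_det_def by (rule sum_permutations_inverse)
  also have "\<dots> = (\<Sum>\<pi> | \<pi> permutes S. of_int (sign \<pi>) * (\<Prod>i\<in>S. f i (\<pi> i)))"
  proof (rule sum.cong[OF refl])
    fix \<pi> assume "\<pi> \<in> {\<pi>. \<pi> permutes S}"
    then have \<pi>: "\<pi> permutes S" by simp
    have "(\<Prod>i\<in>S. f (inv_into UNIV \<pi> i) i) = (\<Prod>i\<in>S. f (inv_into UNIV \<pi> (\<pi> i)) (\<pi> i))"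
      using prod.permute[OF \<pi>, of "\<lambda>i. f (inv_into UNIV \<pi> i) i"] by (simp add: o_def)
    also have "\<dots> = (\<Prod>i\<in>S. f i (\<pi> i))" by (simp only: permutes_inverses(2)[OF \<pi>])
    finally show "of_int (sign (inv_into UNIV \<pi>)) * (\<Prod>i\<in>S. f (inv_into UNIV \<pi> i) i) = of_int (sign \<pi>) * (\<Prod>i\<in>S. f i (\<pi> i))"
      using sign_inverse[OF permutes_imp_permutation[OF assms \<pi>]] by simp
  qed
  finally show ?thesis unfolding set_det_def .
qed

lemma vsq_eq_vandermonde: "vsq n x = (\<Prod>i<n. \<Prod>k<i. of_real (x i) - of_real (x k))\<^sup>2"
  by (simp add: vsq_def pairs_def prod.Sigma split_def prod_power_distrib)

context orthogonal_polys
begin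

definition joint_weight :: "nat \<Rightarrow> (nat \<Rightarrow> real) \<Rightarrow> complex" where
  "joint_weight n x = weight_prod n x * vsq n x"

text \<open>The integral of \<open>joint_weight\<close>, as the determinantal average without any
  points shows.\<close>

definition joint_mass :: "nat \<Rightarrow> complex" where
  "joint_mass n = fact n * (\<Prod>a<n. h a)"

lemma joint_mass_nonzero: "joint_mass n \<noteq> 0"
  by (simp add: joint_mass_def h_nz)

definition resolvent_moment :: "nat \<Rightarrow> (nat \<Rightarrow> complex) \<Rightarrow> nat set \<Rightarrow> complex" where
  "resolvent_moment n \<zeta> T = (LINT x|Pi\<^sub>M {..<n} (\<lambda>_. lborel). joint_weight n x * (\<Prod>j\<in>T. resolvent_sum n x (\<zeta> j))) / joint_mass n"

context
  fixes l n :: nat and \<zeta> :: "nat \<Rightarrow> complex"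
  assumes inj: "inj_on \<zeta> {..<l}" and off: "\<And>j. j < l \<Longrightarrow> \<zeta> j \<notin> complex_of_real ` I"
begin

lemma has_bochner_integral_set_det:
  assumes U: "U \<subseteq> {..<l}"
  shows "has_bochner_integral (Pi\<^sub>M {..<n} (\<lambda>_. lborel))
     (\<lambda>x. joint_weight n x * set_det (\<lambda>i j. (if i = j then resolvent_sum n x (\<zeta> i) else 0) + cauchy_off \<zeta> i j) U)
     (joint_mass n * set_det (\<lambda>i j. cauchy_off \<zeta> i j + cd_cauchy n (\<zeta> i) (\<zeta> j)) U)"
proof -
  have finU: "finite U" by (rule finite_subset[OF U]) simp
  obtain g where g: "bij_betw g {..<card U} U"
    using ex_bij_betw_nat_finite[OF finU] unfolding atLeast0LessThan by auto
  have ginj: "g i = g j \<longleftrightarrow> i = j" if "i \<in> {..<card U}" "j \<in> {..<card U}" for i j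
    by (rule inj_on_eq_iff[OF bij_betw_imp_inj_on[OF g] that])
  have "inj_on \<zeta> (g ` {..<card U})"
    using inj_on_subset[OF inj U] bij_betw_imp_surj_on[OF g] by simp
  then have zinj: "inj_on (\<zeta> \<circ> g) {..<card U}" by (rule comp_inj_on[OF bij_betw_imp_inj_on[OF g]])
  have zoff: "(\<zeta> \<circ> g) j \<notin> complex_of_real ` I" if "j < card U" for j
  proof -
    have "g j \<in> U" using bij_betwE[OF g] that by simp
    then have "g j < l" using U by auto
    then show ?thesis unfolding o_def by (rule off)
  qed
  have co: "cauchy_off (\<zeta> \<circ> g) i j = cauchy_off \<zeta> (g i) (g j)" if "i \<in> {..<card U}" "j \<in> {..<card U}" for i j
    by (simp add: cauchy_off_def ginj[OF that])
  have d1: "set_det (\<lambda>i j. (if i = j then resolvent_sum n x ((\<zeta> \<circ> g) i) else 0) + cauchy_off (\<zeta> \<circ> g) i j) {..<card U}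
     = set_det (\<lambda>i j. (if i = j then resolvent_sum n x (\<zeta> i) else 0) + cauchy_off \<zeta> i j) U" for x
  proof -
    have "set_det (\<lambda>i j. (if i = j then resolvent_sum n x ((\<zeta> \<circ> g) i) else 0) + cauchy_off (\<zeta> \<circ> g) i j) {..<card U}
      = set_det (\<lambda>i j. (if g i = g j then resolvent_sum n x (\<zeta> (g i)) else 0) + cauchy_off \<zeta> (g i) (g j)) {..<card U}"
      by (rule set_det_cong) (simp only: co ginj comp_apply)
    also have "\<dots> = set_det (\<lambda>i j. (if i = j then resolvent_sum n x (\<zeta> i) else 0) + cauchy_off \<zeta> i j) U"
      by (rule set_det_reindex[OF g finite_lessThan])
    finally show ?thesis .
  qed
  have d2: "set_det (\<lambda>i j. cauchy_off (\<zeta> \<circ> g) i j + cd_cauchy n ((\<zeta> \<circ> g) i) ((\<zeta> \<circ> g) j)) {..<card U}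
     = set_det (\<lambda>i j. cauchy_off \<zeta> i j + cd_cauchy n (\<zeta> i) (\<zeta> j)) U"
  proof -
    have "set_det (\<lambda>i j. cauchy_off (\<zeta> \<circ> g) i j + cd_cauchy n ((\<zeta> \<circ> g) i) ((\<zeta> \<circ> g) j)) {..<card U}
      = set_det (\<lambda>i j. cauchy_off \<zeta> (g i) (g j) + cd_cauchy n (\<zeta> (g i)) (\<zeta> (g j))) {..<card U}"
      by (rule set_det_cong) (simp only: co comp_apply)
    also have "\<dots> = set_det (\<lambda>i j. cauchy_off \<zeta> i j + cd_cauchy n (\<zeta> i) (\<zeta> j)) U"
      by (rule set_det_reindex[OF g finite_lessThan])
    finally show ?thesis .
  qed
  from has_bochner_integral_resolvent_det[OF zinj zoff, of n] show ?thesis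
    unfolding d1 d2 vsq_eq_vandermonde[symmetric] joint_weight_def[symmetric] joint_mass_def[symmetric] .
qed

lemma joint_set_det_expand:
  assumes U: "U \<subseteq> {..<l}"
  shows "joint_weight n x * set_det (\<lambda>i j. (if i = j then resolvent_sum n x (\<zeta> i) else 0) + cauchy_off \<zeta> i j) U =
    (\<Sum>T\<in>Pow U. joint_weight n x * (\<Prod>j\<in>T. resolvent_sum n x (\<zeta> j)) * set_det (cauchy_off \<zeta>) (U - T))"
proof -
  have finU: "finite U" by (rule finite_subset[OF U]) simp
  show ?thesis unfolding set_det_diag_add[OF finU] sum_distrib_left mult.assoc ..
qed

text \<open>Integrability is at hand for the determinants only. In their expansion over subsets the
  full product occurs with the factor \<open>1\<close>, the empty minor, and all other terms are
  integrable by induction on the number of points.\<close>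

lemma integrable_joint_resolvents:
  assumes "U \<subseteq> {..<l}"
  shows "integrable (Pi\<^sub>M {..<n} (\<lambda>_. lborel)) (\<lambda>x. joint_weight n x * (\<Prod>j\<in>U. resolvent_sum n x (\<zeta> j)))"
  using assms
proof (induction "card U" arbitrary: U rule: less_induct)
  case less
  have finU: "finite U" by (rule finite_subset[OF less.prems]) simp
  let ?d = "\<lambda>x. joint_weight n x * set_det (\<lambda>i j. (if i = j then resolvent_sum n x (\<zeta> i) else 0) + cauchy_off \<zeta> i j) U"
  let ?s = "\<lambda>x. \<Sum>T\<in>Pow U - {U}. joint_weight n x * (\<Prod>j\<in>T. resolvent_sum n x (\<zeta> j)) * set_det (cauchy_off \<zeta>) (U - T)"
  have e: "joint_weight n x * (\<Prod>j\<in>U. resolvent_sum n x (\<zeta> j)) = ?d x - ?s x" for x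
  proof -
    have "?d x = joint_weight n x * (\<Prod>j\<in>U. resolvent_sum n x (\<zeta> j)) * set_det (cauchy_off \<zeta>) (U - U) + ?s x"
      unfolding joint_set_det_expand[OF less.prems] by (rule sum.remove) (simp_all add: finU)
    then show ?thesis by simp
  qed
  have "integrable (Pi\<^sub>M {..<n} (\<lambda>_. lborel)) (\<lambda>x. ?d x - ?s x)"
  proof (rule Bochner_Integration.integrable_diff)
    show "integrable (Pi\<^sub>M {..<n} (\<lambda>_. lborel)) ?d"
      by (rule integrable.intros[OF has_bochner_integral_set_det[OF less.prems]])
    show "integrable (Pi\<^sub>M {..<n} (\<lambda>_. lborel)) ?s"
    proof (rule Bochner_Integration.integrable_sum, rule integrable_mult_left)
      fix T assume T: "T \<in> Pow U - {U}"
      then have "card T < card U" by (intro psubset_card_mono[OF finU]) auto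
      then show "integrable (Pi\<^sub>M {..<n} (\<lambda>_. lborel)) (\<lambda>x. joint_weight n x * (\<Prod>j\<in>T. resolvent_sum n x (\<zeta> j)))"
        using T less.prems by (intro less.hyps) auto
    qed
  qed
  then show ?case unfolding e .
qed

text \<open>The averaged expansion over subsets: the generating function of the averaged minors is
  that of the moments times that of the Cauchy minors.\<close>

lemma set_det_resolvent_moments:
  assumes U: "U \<subseteq> {..<l}"
  shows "set_det (\<lambda>i j. cauchy_off \<zeta> i j + cd_cauchy n (\<zeta> i) (\<zeta> j)) U =
    (\<Sum>T\<in>Pow U. resolvent_moment n \<zeta> T * set_det (cauchy_off \<zeta>) (U - T))"
proof -
  let ?L = "Pi\<^sub>M {..<n} (\<lambda>_. lborel :: real measure)"
  have "joint_mass n * set_det (\<lambda>i j. cauchy_off \<zeta> i j + cd_cauchy n (\<zeta> i) (\<zeta> j)) U =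
     (LINT x|?L. (\<Sum>T\<in>Pow U. joint_weight n x * (\<Prod>j\<in>T. resolvent_sum n x (\<zeta> j)) * set_det (cauchy_off \<zeta>) (U - T)))"
    using has_bochner_integral_integral_eq[OF has_bochner_integral_set_det[OF U]]
    unfolding joint_set_det_expand[OF U] by simp
  also have "\<dots> = (\<Sum>T\<in>Pow U. LINT x|?L. joint_weight n x * (\<Prod>j\<in>T. resolvent_sum n x (\<zeta> j)) * set_det (cauchy_off \<zeta>) (U - T))"
  proof (rule Bochner_Integration.integral_sum)
    fix T assume "T \<in> Pow U"
    then have "T \<subseteq> {..<l}" using U by auto
    then show "integrable ?L (\<lambda>x. joint_weight n x * (\<Prod>j\<in>T. resolvent_sum n x (\<zeta> j)) * set_det (cauchy_off \<zeta>) (U - T))"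
      by (intro integrable_mult_left integrable_joint_resolvents)
  qed
  also have "\<dots> = (\<Sum>T\<in>Pow U. joint_mass n * (resolvent_moment n \<zeta> T * set_det (cauchy_off \<zeta>) (U - T)))"
    by (rule sum.cong[OF refl]) (simp add: resolvent_moment_def joint_mass_nonzero)
  finally show ?thesis using joint_mass_nonzero by (simp add: sum_distrib_left[symmetric])
qed

lemma resolvent_moment_empty: "resolvent_moment n \<zeta> {} = 1"
  using set_det_resolvent_moments[of "{}"] by simp

text \<open>The moments are a quotient of two generating functions of minors, so the logarithm is a
  difference of two cycle sums. Transposing leaves the minors unchanged and gives the edge from
  \<open>i\<close> to \<open>\<sigma> i\<close> the kernel with first argument
  \<open>\<zeta> (\<sigma> i)\<close>, as it occurs in the traces of products.\<close>

theorem set_cumulant_resolvents: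
  assumes "0 < l"
  shows "set_cumulant (resolvent_moment n \<zeta>) {..<l} =
    cycle_det (\<lambda>i j. cauchy_off \<zeta> j i + cd_cauchy n (\<zeta> j) (\<zeta> i)) {..<l} - cycle_det (\<lambda>i j. cauchy_off \<zeta> j i) {..<l}"
proof (rule set_cumulant_eqI[where s=0])
  let ?D = "\<lambda>U. set_det (\<lambda>i j. cauchy_off \<zeta> j i + cd_cauchy n (\<zeta> j) (\<zeta> i)) U"
  let ?Z = "\<lambda>U. set_det (\<lambda>i j. cauchy_off \<zeta> j i) U"
  fix U :: "nat set" assume s: "0 \<in> U" and U: "U \<subseteq> {..<l}"
  have finU: "finite U" by (rule finite_subset[OF U]) simp
  show "resolvent_moment n \<zeta> U = (\<Sum>A | 0 \<in> A \<and> A \<subseteq> U.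
     (cycle_det (\<lambda>i j. cauchy_off \<zeta> j i + cd_cauchy n (\<zeta> j) (\<zeta> i)) A - cycle_det (\<lambda>i j. cauchy_off \<zeta> j i) A) * resolvent_moment n \<zeta> (U - A))"
  proof (rule quotient_recursion[where D = ?D and D0 = ?Z, OF finU s])
    fix V assume "V \<subseteq> U"
    then have V: "V \<subseteq> {..<l}" and fin: "finite V" using U finU by (auto intro: finite_subset)
    have "?D V = set_det (\<lambda>i j. cauchy_off \<zeta> i j + cd_cauchy n (\<zeta> i) (\<zeta> j)) V"
      by (rule set_det_transpose[OF fin])
    also have "\<dots> = (\<Sum>T\<in>Pow V. resolvent_moment n \<zeta> T * ?Z (V - T))"
      unfolding set_det_resolvent_moments[OF V]
      by (rule sum.cong[OF refl], subst set_det_transpose) (use fin in simp_all)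
    finally show "?D V = (\<Sum>T\<in>Pow V. resolvent_moment n \<zeta> T * ?Z (V - T))" .
  next
    fix V assume V: "0 \<in> V" "V \<subseteq> U"
    have fin: "finite V" by (rule finite_subset[OF V(2) finU])
    show "?D V = (\<Sum>A | 0 \<in> A \<and> A \<subseteq> V. cycle_det (\<lambda>i j. cauchy_off \<zeta> j i + cd_cauchy n (\<zeta> j) (\<zeta> i)) A * ?D (V - A))"
      by (rule set_det_cycle_expansion[OF fin V(1)])
    show "?Z V = (\<Sum>A | 0 \<in> A \<and> A \<subseteq> V. cycle_det (\<lambda>i j. cauchy_off \<zeta> j i) A * ?Z (V - A))"
      by (rule set_det_cycle_expansion[OF fin V(1)])
  qed simp
qed (use assms resolvent_moment_empty in simp_all)

end

text \<open>Otherwise the integral of \<open>joint_weight\<close> would be \<open>0\<close>, whereas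
  it is \<open>joint_mass\<close>, a product of nonzero factors.\<close>

lemma vsq_not_AE_zero: "\<not> (AE y in Pi\<^sub>M {..<n} (\<lambda>_. lborel). vsq n y = 0)"
proof
  assume "AE y in Pi\<^sub>M {..<n} (\<lambda>_. lborel). vsq n y = 0"
  then have "AE y in Pi\<^sub>M {..<n} (\<lambda>_. lborel). joint_weight n y = 0"
    by (rule AE_mp) (simp add: joint_weight_def)
  then have "(LINT y|Pi\<^sub>M {..<n} (\<lambda>_. lborel). joint_weight n y) = 0" by (rule integral_eq_zero_AE)
  then show False
    using resolvent_moment_empty[of "\<lambda>_. 0" 0 n] by (simp add: resolvent_moment_def)
qed

end

section \<open>The Riemann-Hilbert matrix\<close>

lemma mat_inv_eqI:
  assumes A: "A \<in> carrier_mat n n" and B: "B \<in> carrier_mat n n" and AB: "A * B = 1\<^sub>m n" and BA: "B * A = 1\<^sub>m n"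
  shows "mat_inv A = B"
proof -
  have "A \<in> Units (ring_mat TYPE(complex) n ())"
    unfolding Units_def using A B AB BA by (auto simp: ring_mat_simps)
  then have "mat_inverse A \<noteq> None" using mat_inverse(1)[OF A, of "()"] by blast
  then obtain M where M: "mat_inverse A = Some M" by blast
  have M': "M \<in> carrier_mat n n" "M * A = 1\<^sub>m n" using mat_inverse(2)[OF A M] by auto
  have "M = M * (A * B)" using AB M' by simp
  also have "\<dots> = M * A * B" using assoc_mult_mat[OF M'(1) A B] by simp
  also have "\<dots> = B" using M'(2) B by simp
  finally show ?thesis by (simp add: mat_inv_def M)
qed

section \<open>Two by two matrices and products of rank one matrices\<close>

abbreviation mat2 :: "complex \<Rightarrow> complex \<Rightarrow> complex \<Rightarrow> complex \<Rightarrow> complex mat" where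
  "mat2 a b c d \<equiv> mat_of_rows_list 2 [[a, b], [c, d]]"

lemma mat2_index:
  "dim_row (mat2 a b c d) = 2" "dim_col (mat2 a b c d) = 2"
  "mat2 a b c d $$ (0, 0) = a" "mat2 a b c d $$ (0, Suc 0) = b" "mat2 a b c d $$ (Suc 0, 0) = c" "mat2 a b c d $$ (Suc 0, Suc 0) = d"
  by (simp_all add: mat_of_rows_list_def)

lemma mat2_carrier: "mat2 a b c d \<in> carrier_mat 2 2"
  by (rule carrier_matI) (simp_all only: mat2_index)

lemma mat2_eqI:
  assumes "A \<in> carrier_mat 2 2" "A $$ (0, 0) = a" "A $$ (0, Suc 0) = b" "A $$ (Suc 0, 0) = c" "A $$ (Suc 0, Suc 0) = d"
  shows "A = mat2 a b c d"
proof (rule eq_matI)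
  fix i j assume "i < dim_row (mat2 a b c d)" "j < dim_col (mat2 a b c d)"
  then have "i = 0 \<or> i = Suc 0" "j = 0 \<or> j = Suc 0" by (auto simp: mat2_index)
  then show "A $$ (i, j) = mat2 a b c d $$ (i, j)" using assms by (auto simp: mat2_index)
qed (use assms(1) in \<open>simp_all add: mat2_index\<close>)

lemma mult_carrier_2_index:
  assumes "A \<in> carrier_mat 2 2" "B \<in> carrier_mat 2 2" "i < 2" "j < 2"
  shows "(A * B) $$ (i, j) = A $$ (i, 0) * B $$ (0, j) + A $$ (i, Suc 0) * B $$ (Suc 0, j)"
  using assms by (simp add: scalar_prod_def numeral_2_eq_2)

lemma mat2_mult: "mat2 a b c d * mat2 a' b' c' d' = mat2 (a * a' + b * c') (a * b' + b * d') (c * a' + d * c') (c * b' + d * d')"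
proof -
  have "Suc 0 < 2" by simp
  note mult = mult_carrier_2_index[OF mat2_carrier mat2_carrier]
  show ?thesis
    by (rule mat2_eqI[OF mult_carrier_mat[OF mat2_carrier mat2_carrier]])
      (simp_all only: mult[OF pos2 pos2] mult[OF pos2 \<open>Suc 0 < 2\<close>] mult[OF \<open>Suc 0 < 2\<close> pos2]
        mult[OF \<open>Suc 0 < 2\<close> \<open>Suc 0 < 2\<close>] mat2_index)
qed

lemma mat2_one: "1\<^sub>m 2 = mat2 1 0 0 1"
  by (rule mat2_eqI) simp_all

lemma mat_inv_mat2:
  assumes "a * d - b * c = 1" shows "mat_inv (mat2 a b c d) = mat2 d (- b) (- c) a"
proof (rule mat_inv_eqI[OF mat2_carrier mat2_carrier])
  have "a * d + b * - c = 1" "d * a + - b * c = 1" "c * - b + d * a = 1" "- c * b + a * d = 1" "a * - b + b * a = 0" "c * d + d * - c = 0"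
    "d * b + - b * d = 0" "- c * a + a * c = 0"
    using assms by (simp_all add: algebra_simps)
  then show "mat2 a b c d * mat2 d (- b) (- c) a = 1\<^sub>m 2" "mat2 d (- b) (- c) a * mat2 a b c d = 1\<^sub>m 2"
    unfolding mat2_mult mat2_one by (simp_all only:)
qed

text \<open>The matrix \<open>R\<close> has rank one. In a product of such matrices only the
  bilinear pairings \<open>dot2\<close> of neighbouring factors survive.\<close>

definition outer2 :: "(nat \<Rightarrow> complex) \<Rightarrow> (nat \<Rightarrow> complex) \<Rightarrow> complex mat" where
  "outer2 y r = Matrix.mat 2 2 (\<lambda>(i, j). y i * r j)"

definition dot2 :: "(nat \<Rightarrow> complex) \<Rightarrow> (nat \<Rightarrow> complex) \<Rightarrow> complex" where
  "dot2 r y = r 0 * y 0 + r (Suc 0) * y (Suc 0)"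

lemma outer2_carrier: "outer2 y r \<in> carrier_mat 2 2"
  by (simp add: outer2_def)

lemma mat_prod_list_outer2:
  "mat_prod_list 2 (map (\<lambda>k. outer2 (y k) (r k)) [a..<a + Suc m]) =
    Matrix.mat 2 2 (\<lambda>(i, j). (\<Prod>k<m. dot2 (r (a + k)) (y (Suc (a + k)))) * (y a i * r (a + m) j))"
proof (induction m arbitrary: a)
  case 0
  have "mat_prod_list 2 (map (\<lambda>k. outer2 (y k) (r k)) [a..<a + Suc 0]) = outer2 (y a) (r a)"
    using right_mult_one_mat[OF outer2_carrier[of "y a" "r a"]] by (simp add: mat_prod_list_def)
  then show ?case by (simp add: outer2_def)
next
  case (Suc m)
  let ?P = "\<Prod>k<m. dot2 (r (Suc a + k)) (y (Suc (Suc a + k)))"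
  let ?M = "Matrix.mat 2 2 (\<lambda>(i, j). ?P * (y (Suc a) i * r (Suc a + m) j))"
  have u: "[a..<a + Suc (Suc m)] = a # [Suc a..<Suc a + Suc m]"
    using upt_conv_Cons[of a "a + Suc (Suc m)"] by simp
  have "mat_prod_list 2 (map (\<lambda>k. outer2 (y k) (r k)) [a..<a + Suc (Suc m)]) =
      outer2 (y a) (r a) * mat_prod_list 2 (map (\<lambda>k. outer2 (y k) (r k)) [Suc a..<Suc a + Suc m])"
    unfolding u list.map mat_prod_list_def foldr_Cons o_def ..
  also have "\<dots> = outer2 (y a) (r a) * ?M" unfolding Suc.IH ..
  also have "\<dots> = Matrix.mat 2 2 (\<lambda>(i, j). (\<Prod>k<Suc m. dot2 (r (a + k)) (y (Suc (a + k)))) * (y a i * r (a + Suc m) j))"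
  proof (rule eq_matI)
    fix i j assume "i < dim_row (Matrix.mat 2 2 (\<lambda>(i, j). (\<Prod>k<Suc m. dot2 (r (a + k)) (y (Suc (a + k)))) * (y a i * r (a + Suc m) j)))"
      "j < dim_col (Matrix.mat 2 2 (\<lambda>(i, j). (\<Prod>k<Suc m. dot2 (r (a + k)) (y (Suc (a + k)))) * (y a i * r (a + Suc m) j)))"
    then have ij: "i < 2" "j < 2" by simp_all
    have M: "?M \<in> carrier_mat 2 2" by simp
    have "(outer2 (y a) (r a) * ?M) $$ (i, j) =
       y a i * r a 0 * (?P * (y (Suc a) 0 * r (Suc a + m) j)) + y a i * r a (Suc 0) * (?P * (y (Suc a) (Suc 0) * r (Suc a + m) j))"
      unfolding mult_carrier_2_index[OF outer2_carrier M ij] using ij by (simp add: outer2_def)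
    also have "\<dots> = (dot2 (r a) (y (Suc a)) * ?P) * (y a i * r (Suc a + m) j)"
      by (simp only: dot2_def) (simp add: algebra_simps)
    also have "dot2 (r a) (y (Suc a)) * ?P = (\<Prod>k<Suc m. dot2 (r (a + k)) (y (Suc (a + k))))"
      unfolding prod.lessThan_Suc_shift by simp
    finally show "(outer2 (y a) (r a) * ?M) $$ (i, j) =
        Matrix.mat 2 2 (\<lambda>(i, j). (\<Prod>k<Suc m. dot2 (r (a + k)) (y (Suc (a + k)))) * (y a i * r (a + Suc m) j)) $$ (i, j)"
      using ij by simp
  qed (simp_all add: outer2_def)
  finally show ?case .
qed

text \<open>The trace pairs the last row with the first column and so closes the cycle, hence the
  index modulo \<open>l\<close>.\<close>

lemma mat_trace_prod_outer2:
  assumes "0 < l"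
  shows "mat_trace (mat_prod_list 2 (map (\<lambda>k. outer2 (y k) (r k)) [0..<l])) = (\<Prod>k<l. dot2 (r k) (y (Suc k mod l)))"
proof -
  obtain m where l: "l = Suc m" using assms by (cases l) auto
  have "mat_trace (mat_prod_list 2 (map (\<lambda>k. outer2 (y k) (r k)) [0..<l])) = (\<Prod>k<m. dot2 (r k) (y (Suc k))) * dot2 (r m) (y 0)"
    using mat_prod_list_outer2[of y r 0 m] unfolding l
    by (simp add: mat_trace_def numeral_2_eq_2 dot2_def algebra_simps)
  also have "(\<Prod>k<m. dot2 (r k) (y (Suc k))) = (\<Prod>k<m. dot2 (r k) (y (Suc k mod l)))"
    by (rule prod.cong[OF refl]) (simp add: l)
  finally show ?thesis by (simp add: l)
qed

section \<open>The kernel in terms of the Riemann-Hilbert matrix\<close>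

context orthogonal_polys
begin

text \<open>By \<open>dot_rh\<close> this is the first row of the inverse of \<open>Ymat\<close> at
  \<open>z\<close> paired with the first column of \<open>Ymat\<close> at \<open>u\<close>.\<close>

definition rh_kernel :: "nat \<Rightarrow> complex \<Rightarrow> complex \<Rightarrow> complex" where
  "rh_kernel n u z = (poly (p n) u * second_kind (n - 1) z - poly (p (n - 1)) u * second_kind n z) / h (n - 1)"

text \<open>On the diagonal this yields the determinant \<open>1\<close> of \<open>Ymat\<close>; off
  the diagonal, division by \<open>u - z\<close> gives the entries of the averaged
  determinant.\<close>

lemma rh_kernel_eq:
  assumes "1 \<le> n" "z \<notin> complex_of_real ` I"
  shows "rh_kernel n u z = (u - z) * cd_cauchy n u z + 1"
proof -
  obtain m where "n = Suc m" using assms(1) by (cases n) auto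
  then show ?thesis
    using second_kind_christoffel_darboux[OF assms(2), of u m] by (simp add: rh_kernel_def cd_cauchy_def)
qed

text \<open>For fixed \<open>z\<close> both sides of \<open>rh_kernel_eq\<close> are polynomials in
  \<open>u\<close>, and their derivatives at \<open>u = z\<close> are compared.\<close>

lemma cd_cauchy_diag:
  assumes "1 \<le> n" "z \<notin> complex_of_real ` I"
  shows "cd_cauchy n z z =
    (poly (pderiv (p n)) z * second_kind (n - 1) z - poly (pderiv (p (n - 1))) z * second_kind n z) / h (n - 1)"
proof -
  define C where "C = (\<Sum>a<n. Polynomial.smult (second_kind a z / h a) (p a))"
  have C: "poly C u = cd_cauchy n u z" for u
    unfolding C_def cd_cauchy_def poly_sum by (simp add: mult.commute)
  define q1 where "q1 = second_kind (n - 1) z / h (n - 1)"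
  define q2 where "q2 = second_kind n z / h (n - 1)"
  have "[:- z, 1:] * C + 1 = Polynomial.smult q1 (p n) - Polynomial.smult q2 (p (n - 1))"
  proof (rule poly_eq_poly_eq_iff[THEN iffD1], rule ext)
    fix u
    have "poly ([:- z, 1:] * C + 1) u = (u - z) * cd_cauchy n u z + 1" by (simp add: C left_diff_distrib)
    also have "\<dots> = rh_kernel n u z" by (rule rh_kernel_eq[OF assms, symmetric])
    also have "\<dots> = poly (Polynomial.smult q1 (p n) - Polynomial.smult q2 (p (n - 1))) u"
      by (simp add: rh_kernel_def q1_def q2_def diff_divide_distrib mult.commute)
    finally show "poly ([:- z, 1:] * C + 1) u = poly (Polynomial.smult q1 (p n) - Polynomial.smult q2 (p (n - 1))) u" .
  qed
  then have "poly (pderiv ([:- z, 1:] * C + 1)) z = poly (pderiv (Polynomial.smult q1 (p n) - Polynomial.smult q2 (p (n - 1)))) z"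
    by (rule arg_cong)
  then have "poly C z = q1 * poly (pderiv (p n)) z - q2 * poly (pderiv (p (n - 1))) z"
    by (simp add: pderiv_add pderiv_diff pderiv_mult pderiv_smult pderiv_pCons)
  then show ?thesis unfolding C by (simp add: q1_def q2_def diff_divide_distrib mult.commute)
qed

context
  fixes V :: "real \<Rightarrow> real"
  assumes w_eq: "w = (\<lambda>x. indicator I x * exp (V x))"
begin

lemma cauchy_transform_eq:
  "(LINT x:I|lborel. poly (p a) (of_real x) * of_real (exp (V x)) / (of_real x - z)) = - second_kind a z"
proof -
  have "indicator I x *\<^sub>R (poly (p a) (of_real x) * of_real (exp (V x)) / (of_real x - z)) =
      - (poly (p a) (of_real x) * of_real (w x) / (z - of_real x))" for x
  proof -
    have "- (c / (z - of_real x)) = c / (of_real x - z)" for c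
      by (metis minus_diff_eq minus_divide_right)
    then show ?thesis by (cases "x \<in> I") (simp_all add: w_eq)
  qed
  then show ?thesis unfolding set_lebesgue_integral_def second_kind_def by simp
qed

text \<open>\<open>rh_col\<close> is the first column of \<open>Ymat\<close> and
  \<open>rh_row\<close> the first row of its inverse. In their pairing the two factors
  \<open>2 * of_real pi * \<i>\<close> cancel.\<close>

definition rh_col :: "nat \<Rightarrow> complex \<Rightarrow> nat \<Rightarrow> complex" where
  "rh_col n z i = (if i = 0 then poly (p n) z else - (2 * of_real pi * \<i>) / h (n - 1) * poly (p (n - 1)) z)"

definition rh_row :: "nat \<Rightarrow> complex \<Rightarrow> nat \<Rightarrow> complex" where
  "rh_row n z i = (if i = 0 then second_kind (n - 1) z / h (n - 1) else second_kind n z / (2 * of_real pi * \<i>))"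

lemma rh_entries:
  "rh_row n z 0 = second_kind (n - 1) z / h (n - 1)" "rh_row n z (Suc 0) = second_kind n z / (2 * of_real pi * \<i>)"
  "rh_col n z 0 = poly (p n) z" "rh_col n z (Suc 0) = - (2 * of_real pi * \<i>) / h (n - 1) * poly (p (n - 1)) z"
  by (simp_all add: rh_row_def rh_col_def)

lemma two_pi_i_cancel: "q / (2 * of_real pi * \<i>) * (- (2 * of_real pi * \<i>) / k * r) = - (r * q / k)" for q k r :: complex
proof -
  have cancel: "q / c * (- c / k * r) = - (r * q / k)" if "c \<noteq> 0" for c :: complex
    using that by (cases "k = 0") (simp_all add: field_simps)
  show ?thesis by (rule cancel) simp
qed

lemma dot_rh: "dot2 (rh_row n z) (rh_col n u) = rh_kernel n u z"
  unfolding dot2_def rh_entries two_pi_i_cancel rh_kernel_def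
  by (simp add: diff_divide_distrib mult.commute)

lemma Ymat_eq: "Ymat n I V p h z = mat2 (rh_col n z 0) (- rh_row n z (Suc 0)) (rh_col n z (Suc 0)) (rh_row n z 0)"
  unfolding Ymat_def cauchy_transform_eq by (simp add: rh_col_def rh_row_def)

context
  fixes n :: nat and z :: complex
  assumes n: "1 \<le> n" and z: "z \<notin> complex_of_real ` I"
begin

lemma mat_inv_Ymat:
  "mat_inv (Ymat n I V p h z) = mat2 (rh_row n z 0) (rh_row n z (Suc 0)) (- rh_col n z (Suc 0)) (rh_col n z 0)"
proof -
  have "rh_col n z 0 * rh_row n z 0 - - rh_row n z (Suc 0) * rh_col n z (Suc 0) = 1"
    using dot_rh[of n z z] rh_kernel_eq[OF n z, of z] by (simp add: dot2_def mult.commute)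
  from mat_inv_mat2[OF this] show ?thesis unfolding Ymat_eq minus_minus .
qed

text \<open>The middle matrix projects onto the first coordinate, which leaves the first column of
  \<open>Ymat\<close> times the first row of its inverse.\<close>

lemma Rmat_eq: "Rmat n I V p h z = outer2 (rh_col n z) (rh_row n z)"
proof -
  have "outer2 (rh_col n z) (rh_row n z) = mat2 (rh_col n z 0 * rh_row n z 0) (rh_col n z 0 * rh_row n z (Suc 0))
     (rh_col n z (Suc 0) * rh_row n z 0) (rh_col n z (Suc 0) * rh_row n z (Suc 0))"
    by (rule mat2_eqI[OF outer2_carrier]) (simp_all add: outer2_def)
  then show ?thesis unfolding Rmat_def mat_inv_Ymat unfolding Ymat_eq mat2_mult by simp
qed

text \<open>This entry involves the derivative of the first column only. The column is polynomial,
  so no Cauchy transform is differentiated.\<close>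

lemma log_deriv_Ymat: "(mat_inv (Ymat n I V p h z) * mat_deriv (Ymat n I V p h) z) $$ (0, 0) = cd_cauchy n z z"
proof -
  let ?D = "mat_deriv (Ymat n I V p h) z"
  have D: "?D \<in> carrier_mat 2 2" by (simp add: mat_deriv_def Ymat_eq mat2_index)
  have i: "?D $$ (i, 0) = deriv (\<lambda>w. Ymat n I V p h w $$ (i, 0)) z" if "i < 2" for i
    using that by (simp add: mat_deriv_def Ymat_eq mat2_index)
  have dp: "deriv (\<lambda>w. poly q w) z = poly (pderiv q) z" for q :: "complex poly"
    by (rule DERIV_imp_deriv[OF poly_DERIV])
  have d0: "?D $$ (0, 0) = poly (pderiv (p n)) z"
    using i[of 0] by (simp add: Ymat_eq mat2_index rh_col_def dp)
  have d1: "?D $$ (Suc 0, 0) = - (2 * of_real pi * \<i>) / h (n - 1) * poly (pderiv (p (n - 1))) z"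
  proof -
    have "(\<lambda>w. Ymat n I V p h w $$ (Suc 0, 0)) = (\<lambda>w. poly (Polynomial.smult (- (2 * of_real pi * \<i>) / h (n - 1)) (p (n - 1))) w)"
      by (rule ext) (simp add: Ymat_eq mat2_index rh_col_def)
    then have "?D $$ (Suc 0, 0) = deriv (\<lambda>w. poly (Polynomial.smult (- (2 * of_real pi * \<i>) / h (n - 1)) (p (n - 1))) w) z"
      using i[of "Suc 0"] by simp
    also have "\<dots> = poly (pderiv (Polynomial.smult (- (2 * of_real pi * \<i>) / h (n - 1)) (p (n - 1)))) z" by (rule dp)
    finally show ?thesis unfolding pderiv_smult poly_smult .
  qed
  show ?thesis
    unfolding mat_inv_Ymat mult_carrier_2_index[OF mat2_carrier D pos2 pos2] mat2_index d0 d1 cd_cauchy_diag[OF n z]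
      rh_entries(1,2) two_pi_i_cancel
    by (simp add: diff_divide_distrib mult.commute)
qed

end

end

end

section \<open>From matrices to eigenvalues\<close>

lemma inj_on_herm_of_coords: "inj_on (herm_of_coords n) (space (coords_space n))"
proof (rule inj_onI)
  fix x y assume x: "x \<in> space (coords_space n)" and y: "y \<in> space (coords_space n)" and e: "herm_of_coords n x = herm_of_coords n y"
  have m: "ment a b x = ment a b y" if "a < n" "b < n" for a b
    using arg_cong[OF e, of "\<lambda>X. X $$ (a, b)"] by (simp only: herm_of_coords_index[OF that])
  show "x = y"
  proof (rule PiE_ext)
    show "x \<in> Pi\<^sub>E (sq n) (\<lambda>_. UNIV)" "y \<in> Pi\<^sub>E (sq n) (\<lambda>_. UNIV)" using x y by (simp_all add: space_PiM)
    fix e assume "e \<in> sq n"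
    then obtain a b where ab: "e = (a, b)" "a < n" "b < n" by auto
    show "x e = y e"
    proof (cases "a \<le> b")
      case True
      then show ?thesis using arg_cong[OF m[OF ab(2,3)], of Re] by (auto simp: ab(1) ment_def split: if_splits)
    next
      case False
      then show ?thesis using arg_cong[OF m[OF ab(3,2)], of Im] by (auto simp: ab(1) ment_def split: if_splits)
    qed
  qed
qed

lemma herm_of_coords_in_hermitian_mats: "herm_of_coords n x \<in> hermitian_mats n I \<longleftrightarrow> (\<forall>i<n. eigv n x i \<in> I)"
  by (simp add: hermitian_mats_def mat_adjoint_herm_of_coords spectrum_herm_of_coords)

lemma eigv_component_measurable: "i < n \<Longrightarrow> (\<lambda>x. eigv n x i) \<in> borel_measurable (coords_space n)"
  by (rule measurable_compose[OF eigv_measurable measurable_component_singleton]) simp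

text \<open>Membership is a condition on the measurable eigenvalues, and the embedding transports
  measurable sets of coordinates to measurable sets of matrices.\<close>

lemma hermitian_mats_sets:
  assumes "closed I"
  shows "hermitian_mats n I \<inter> space (herm_lebesgue n) \<in> sets (herm_lebesgue n)"
proof -
  have "{x \<in> space (coords_space n). \<forall>i\<in>{..<n}. eigv n x i \<in> I} \<in> sets (coords_space n)"
  proof (rule sets.sets_Collect_finite_All)
    fix i assume "i \<in> {..<n}"
    then have "i < n" by simp
    from measurable_sets[OF eigv_component_measurable[OF this] borel_closed[OF assms]]
    show "{x \<in> space (coords_space n). eigv n x i \<in> I} \<in> sets (coords_space n)"
      by (simp add: vimage_def Int_def conj_commute)
  qed simp
  from in_sets_embed_measure[OF this, of "herm_of_coords n"]
  have "herm_of_coords n ` {x \<in> space (coords_space n). \<forall>i\<in>{..<n}. eigv n x i \<in> I} \<in> sets (herm_lebesgue n)"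
    by (simp add: herm_lebesgue_def)
  also have "herm_of_coords n ` {x \<in> space (coords_space n). \<forall>i\<in>{..<n}. eigv n x i \<in> I} = hermitian_mats n I \<inter> space (herm_lebesgue n)"
  proof -
    have "hermitian_mats n I \<inter> herm_of_coords n ` S = herm_of_coords n ` {x \<in> S. herm_of_coords n x \<in> hermitian_mats n I}" for S
      by blast
    then show ?thesis
      by (simp only: herm_lebesgue_def space_embed_measure herm_of_coords_in_hermitian_mats) auto
  qed
  finally show ?thesis .
qed

lemma herm_lebesgue_on_measurable:
  fixes G :: "complex mat \<Rightarrow> 'b::real_normed_vector"
  assumes "closed I"
    and "(\<lambda>x. indicator (hermitian_mats n I) (herm_of_coords n x) *\<^sub>R G (herm_of_coords n x)) \<in> borel_measurable (coords_space n)"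
  shows "G \<in> borel_measurable (herm_lebesgue_on n I)"
  unfolding herm_lebesgue_on_def borel_measurable_restrict_space_iff[OF hermitian_mats_sets[OF assms(1)]]
  unfolding herm_lebesgue_def by (rule measurable_embed_measure1) (rule assms(2))

lemma herm_lebesgue_on_integral:
  fixes G :: "complex mat \<Rightarrow> 'b::{banach, second_countable_topology}"
  assumes "closed I"
    and m: "(\<lambda>x. indicator (hermitian_mats n I) (herm_of_coords n x) *\<^sub>R G (herm_of_coords n x)) \<in> borel_measurable (coords_space n)"
  shows "(LINT X|herm_lebesgue_on n I. G X) =
    (LINT x|coords_space n. indicator (hermitian_mats n I) (herm_of_coords n x) *\<^sub>R G (herm_of_coords n x))"
proof -
  let ?G = "\<lambda>X. indicator (hermitian_mats n I) X *\<^sub>R G X"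
  have "(LINT X|herm_lebesgue_on n I. G X) = (LINT X|herm_lebesgue n. ?G X)"
    unfolding herm_lebesgue_on_def by (rule integral_restrict_space[OF hermitian_mats_sets[OF assms(1)]])
  also have "\<dots> = (LINT X|distr (coords_space n) (herm_lebesgue n) (herm_of_coords n). ?G X)"
    using arg_cong[OF embed_measure_eq_distr'[OF inj_on_herm_of_coords], of "\<lambda>M. integral\<^sup>L M ?G"]
    unfolding herm_lebesgue_def .
  also have "\<dots> = (LINT x|coords_space n. ?G (herm_of_coords n x))"
  proof (rule integral_distr)
    show "herm_of_coords n \<in> measurable (coords_space n) (herm_lebesgue n)"
      unfolding herm_lebesgue_def by (rule measurable_embed_measure2'[OF inj_on_herm_of_coords])
    show "?G \<in> borel_measurable (herm_lebesgue n)"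
      unfolding herm_lebesgue_def by (rule measurable_embed_measure1) (rule m)
  qed
  finally show ?thesis .
qed

lemma indicator_hermitian_mats: "indicator (hermitian_mats n I) (herm_of_coords n x) = (\<Prod>i<n. indicator I (eigv n x i) :: real)"
proof (cases "\<forall>i<n. eigv n x i \<in> I")
  case True
  then show ?thesis by (simp add: indicator_def herm_of_coords_in_hermitian_mats)
next
  case False
  then have "(\<Prod>i<n. indicator I (eigv n x i) :: real) = 0" by (auto simp: indicator_def)
  with False show ?thesis by (simp only: indicator_def herm_of_coords_in_hermitian_mats) simp
qed

lemma indicator_exp_tr:
  "indicator (hermitian_mats n I) (herm_of_coords n x) * exp_tr V (herm_of_coords n x) = (\<Prod>i<n. indicator I (eigv n x i) * exp (V (eigv n x i)))"
proof -
  have "Re (mat_trace (herm_fun V (herm_of_coords n x))) = (\<Sum>i<n. V (eigv n x i))"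
    unfolding mat_trace_herm_fun by simp
  then have "exp_tr V (herm_of_coords n x) = (\<Prod>i<n. exp (V (eigv n x i)))"
    unfolding exp_tr_def by (simp add: exp_sum)
  then show ?thesis by (simp only: indicator_hermitian_mats prod.distrib)
qed

section \<open>Symmetric statistics of the eigenvalues\<close>

context orthogonal_polys
begin

text \<open>The weight is integrable, being the case of the polynomial \<open>1\<close>, and
  integrable functions are measurable.\<close>

lemma w_measurable: "w \<in> borel_measurable borel"
proof -
  have "integrable lborel (\<lambda>x. complex_of_real (w x))" using integrable_poly[of 1] by simp
  from measurable_compose[OF borel_measurable_integrable[OF this] borel_measurable_Re] show ?thesis by simp
qed

lemma component_measurable: "i < n \<Longrightarrow> (\<lambda>y. y i) \<in> borel_measurable (Pi\<^sub>M {..<n} (\<lambda>_. borel :: real measure))"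
  by (rule measurable_component_singleton) simp

lemma weight_prod_measurable: "weight_prod n \<in> borel_measurable (Pi\<^sub>M {..<n} (\<lambda>_. borel))"
  unfolding weight_prod_def[abs_def]
proof (rule borel_measurable_prod)
  fix i assume "i \<in> {..<n}"
  then have "i < n" by simp
  from measurable_compose[OF component_measurable[OF this] w_measurable]
  show "(\<lambda>y. complex_of_real (w (y i))) \<in> borel_measurable (Pi\<^sub>M {..<n} (\<lambda>_. borel))" by measurable
qed

lemma resolvent_sum_measurable: "(\<lambda>y. resolvent_sum n y z) \<in> borel_measurable (Pi\<^sub>M {..<n} (\<lambda>_. borel))"
  unfolding resolvent_sum_def
proof (rule borel_measurable_sum)
  fix i assume "i \<in> {..<n}"
  then have "i < n" by simp
  from component_measurable[OF this]
  show "(\<lambda>y. 1 / (z - complex_of_real (y i))) \<in> borel_measurable (Pi\<^sub>M {..<n} (\<lambda>_. borel))" by measurable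
qed

text \<open>The density and the resolvents without the Vandermonde factor, which Weyl's formula
  supplies.\<close>

definition eig_stat :: "nat \<Rightarrow> complex list \<Rightarrow> (nat \<Rightarrow> real) \<Rightarrow> complex" where
  "eig_stat n zs y = weight_prod n y * (\<Prod>z\<leftarrow>zs. resolvent_sum n y z)"

lemma prod_resolvent_measurable: "(\<lambda>y. \<Prod>z\<leftarrow>zs. resolvent_sum n y z) \<in> borel_measurable (Pi\<^sub>M {..<n} (\<lambda>_. borel))"
proof (induction zs)
  case (Cons z zs)
  show ?case unfolding list.map prod_list.Cons by (rule borel_measurable_times[OF resolvent_sum_measurable Cons.IH])
qed simp

lemma eig_stat_measurable: "eig_stat n zs \<in> borel_measurable (Pi\<^sub>M {..<n} (\<lambda>_. borel))"
  unfolding eig_stat_def[abs_def] by (rule borel_measurable_times[OF weight_prod_measurable prod_resolvent_measurable])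

lemma eig_stat_symmetric:
  assumes "js \<in> tuples n {} n" shows "eig_stat n zs (\<lambda>i\<in>{..<n}. y (js ! i)) = eig_stat n zs y"
proof -
  have "weight_prod n (\<lambda>i\<in>{..<n}. y (js ! i)) = (\<Prod>i<n. of_real (w (y (js ! i))))"
    unfolding weight_prod_def by (rule prod.cong) simp_all
  also have "\<dots> = weight_prod n y"
    unfolding weight_prod_def by (rule prod.reindex_bij_betw[OF tuples_full[OF assms]])
  finally have 1: "weight_prod n (\<lambda>i\<in>{..<n}. y (js ! i)) = weight_prod n y" .
  have 2: "resolvent_sum n (\<lambda>i\<in>{..<n}. y (js ! i)) z = resolvent_sum n y z" for z
  proof -
    have "resolvent_sum n (\<lambda>i\<in>{..<n}. y (js ! i)) z = (\<Sum>i<n. 1 / (z - of_real (y (js ! i))))"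
      unfolding resolvent_sum_def by (rule sum.cong) simp_all
    also have "\<dots> = resolvent_sum n y z"
      unfolding resolvent_sum_def by (rule sum.reindex_bij_betw[OF tuples_full[OF assms]])
    finally show ?thesis .
  qed
  show ?thesis unfolding eig_stat_def 1 2 ..
qed

context
  fixes V :: "real \<Rightarrow> real"
  assumes w_eq: "w = (\<lambda>x. indicator I x * exp (V x))"
begin

text \<open>Weyl's formula is applied to the numerator and, with an empty list of points, to
  \<open>partition_const\<close>; the constant \<open>\<kappa>\<close> cancels in the
  quotient.\<close>

lemma cumulant_eq:
  assumes zs: "\<And>z. z \<in> set zs \<Longrightarrow> z \<notin> complex_of_real ` I"
  shows "cumulant n I V zs = (LINT y|Pi\<^sub>M {..<n} (\<lambda>_. lborel). joint_weight n y * (\<Prod>z\<leftarrow>zs. resolvent_sum n y z)) / joint_mass n"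
proof -
  let ?H = "herm_of_coords n" and ?C = "coords_space n" and ?L = "Pi\<^sub>M {..<n} (\<lambda>_. lborel :: real measure)"
  let ?A = "hermitian_mats n I" and ?pc = "partition_const n I V"
  let ?F = "\<lambda>X. \<Prod>z\<leftarrow>zs. mat_trace (mat_inv (z \<cdot>\<^sub>m 1\<^sub>m n - X))"
  have ie: "complex_of_real (indicator ?A (?H x) * exp_tr V (?H x)) = weight_prod n (eigv n x)" for x
    unfolding indicator_exp_tr weight_prod_def unfolding w_eq by simp
  obtain \<kappa> :: real where \<kappa>: "0 < \<kappa>"
    and weyl: "\<And>us. (LINT x|?C. eig_stat n us (eigv n x)) = of_real \<kappa> * (LINT y|?L. vsq n y * eig_stat n us y)"
  proof (rule weyl_integration[OF vsq_not_AE_zero[of n]])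
    fix \<kappa> :: real
    assume 0: "0 < \<kappa>" and 1: "\<And>F :: (nat \<Rightarrow> real) \<Rightarrow> complex. F \<in> borel_measurable (Pi\<^sub>M {..<n} (\<lambda>_. borel)) \<Longrightarrow>
      (\<And>js y. js \<in> tuples n {} n \<Longrightarrow> y \<in> space (Pi\<^sub>M {..<n} (\<lambda>_. borel)) \<Longrightarrow> F (\<lambda>i\<in>{..<n}. y (js ! i)) = F y) \<Longrightarrow>
      (LINT x|?C. F (eigv n x)) = of_real \<kappa> * (LINT y|?L. vsq n y * F y)"
    show thesis by (rule that[OF 0]) (rule 1[OF eig_stat_measurable eig_stat_symmetric])
  qed
  have em: "(\<lambda>x. eig_stat n us (eigv n x)) \<in> borel_measurable ?C" for us
    by (rule measurable_compose[OF eigv_measurable eig_stat_measurable])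
  have js: "(LINT y|?L. vsq n y * eig_stat n us y) = (LINT y|?L. joint_weight n y * (\<Prod>z\<leftarrow>us. resolvent_sum n y z))" for us
    by (simp only: joint_weight_def eig_stat_def mult_ac)
  have wm: "(\<lambda>x. indicator ?A (?H x) *\<^sub>R exp_tr V (?H x)) \<in> borel_measurable ?C"
  proof -
    have "(\<lambda>x. Re (eig_stat n [] (eigv n x))) \<in> borel_measurable ?C" by (rule measurable_compose[OF em borel_measurable_Re])
    moreover have "Re (eig_stat n [] (eigv n x)) = indicator ?A (?H x) *\<^sub>R exp_tr V (?H x)" for x
      unfolding eig_stat_def ie[symmetric] by simp
    ultimately show ?thesis by simp
  qed
  have pc: "of_real ?pc = of_real \<kappa> * joint_mass n"
  proof -
    have "complex_of_real ?pc = (LINT x|?C. complex_of_real (indicator ?A (?H x) *\<^sub>R exp_tr V (?H x)))"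
      unfolding partition_const_def herm_lebesgue_on_integral[OF closed_I wm] by (rule integral_complex_of_real[symmetric])
    also have "\<dots> = (LINT x|?C. eig_stat n [] (eigv n x))"
      unfolding real_scaleR_def ie eig_stat_def by simp
    also have "\<dots> = of_real \<kappa> * (LINT y|?L. joint_weight n y)" unfolding weyl js by simp
    also have "(LINT y|?L. joint_weight n y) = joint_mass n"
      using resolvent_moment_empty[of "\<lambda>_. 0" 0 n] by (simp add: resolvent_moment_def joint_mass_nonzero)
    finally show ?thesis .
  qed
  then have "complex_of_real ?pc \<noteq> 0" using \<kappa> joint_mass_nonzero[of n] by simp
  then have pc0: "?pc \<noteq> 0" by simp
  have pcn: "0 \<le> ?pc" unfolding partition_const_def by (rule integral_nonneg_AE) (simp add: exp_tr_def)
  \<comment> \<open>The resolvent trace is expressed by the eigenvalues only if the points avoid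
    them; the indicator confines the identity to spectra inside \<open>I\<close>.\<close>
  have Fe: "indicator ?A (?H x) *\<^sub>R ?F (?H x) = indicator ?A (?H x) *\<^sub>R (\<Prod>z\<leftarrow>zs. resolvent_sum n (eigv n x) z)" for x
  proof (cases "?H x \<in> ?A")
    case True
    then have e: "eigv n x i \<in> I" if "i < n" for i using that unfolding herm_of_coords_in_hermitian_mats by simp
    have "mat_trace (mat_inv (z \<cdot>\<^sub>m 1\<^sub>m n - ?H x)) = resolvent_sum n (eigv n x) z" if "z \<in> set zs" for z
      unfolding resolvent_sum_def using zs[OF that] e by (intro mat_trace_resolvent_eigv) auto
    then have "?F (?H x) = (\<Prod>z\<leftarrow>zs. resolvent_sum n (eigv n x) z)"
      by (intro arg_cong[where f=prod_list] map_cong) simp_all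
    then show ?thesis by simp
  qed simp
  have Fm: "(\<lambda>x. indicator ?A (?H x) *\<^sub>R ?F (?H x)) \<in> borel_measurable ?C"
    unfolding Fe unfolding indicator_hermitian_mats
  proof (rule borel_measurable_scaleR)
    show "(\<lambda>x. \<Prod>i<n. indicator I (eigv n x i) :: real) \<in> borel_measurable ?C"
    proof (rule borel_measurable_prod)
      fix i assume "i \<in> {..<n}"
      then have "i < n" by simp
      from measurable_compose[OF eigv_component_measurable[OF this] borel_measurable_indicator[OF borel_closed[OF closed_I]]]
      show "(\<lambda>x. indicator I (eigv n x i) :: real) \<in> borel_measurable ?C" .
    qed
    show "(\<lambda>x. \<Prod>z\<leftarrow>zs. resolvent_sum n (eigv n x) z) \<in> borel_measurable ?C"
      by (rule measurable_compose[OF eigv_measurable prod_resolvent_measurable])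
  qed
  have expm: "exp_tr V \<in> borel_measurable (herm_lebesgue_on n I)"
    by (rule herm_lebesgue_on_measurable[OF closed_I wm])
  have "cumulant n I V zs = (LINT X|herm_lebesgue_on n I. (exp_tr V X / ?pc) *\<^sub>R ?F X)"
    unfolding cumulant_def matrix_measure_def
  proof (rule integral_density)
    show "?F \<in> borel_measurable (herm_lebesgue_on n I)" by (rule herm_lebesgue_on_measurable[OF closed_I Fm])
    show "(\<lambda>X. exp_tr V X / ?pc) \<in> borel_measurable (herm_lebesgue_on n I)" using expm by measurable
    show "AE X in herm_lebesgue_on n I. 0 \<le> exp_tr V X / ?pc" using pcn by (simp add: exp_tr_def)
  qed
  also have "\<dots> = (LINT x|?C. (1 / of_real ?pc) * eig_stat n zs (eigv n x))"
  proof -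
    have p: "indicator ?A (?H x) *\<^sub>R ((exp_tr V (?H x) / ?pc) *\<^sub>R ?F (?H x)) = (1 / of_real ?pc) * eig_stat n zs (eigv n x)" for x
    proof -
      have "indicator ?A (?H x) *\<^sub>R ((exp_tr V (?H x) / ?pc) *\<^sub>R ?F (?H x)) = (exp_tr V (?H x) / ?pc) *\<^sub>R (indicator ?A (?H x) *\<^sub>R ?F (?H x))"
        by (simp only: scaleR_scaleR mult.commute)
      also have "\<dots> = (exp_tr V (?H x) / ?pc) *\<^sub>R (indicator ?A (?H x) *\<^sub>R (\<Prod>z\<leftarrow>zs. resolvent_sum n (eigv n x) z))"
        unfolding Fe ..
      also have "\<dots> = (1 / of_real ?pc) * (complex_of_real (indicator ?A (?H x) * exp_tr V (?H x)) * (\<Prod>z\<leftarrow>zs. resolvent_sum n (eigv n x) z))"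
        by (simp add: scaleR_conv_of_real)
      finally show ?thesis unfolding ie eig_stat_def .
    qed
    have "(\<lambda>x. indicator ?A (?H x) *\<^sub>R ((exp_tr V (?H x) / ?pc) *\<^sub>R ?F (?H x))) \<in> borel_measurable ?C"
      unfolding p by (rule borel_measurable_times[OF _ em]) simp
    from herm_lebesgue_on_integral[OF closed_I this] show ?thesis unfolding p .
  qed
  also have "\<dots> = (1 / of_real ?pc) * (LINT x|?C. eig_stat n zs (eigv n x))" by simp
  also have "\<dots> = (LINT y|?L. joint_weight n y * (\<Prod>z\<leftarrow>zs. resolvent_sum n y z)) / joint_mass n"
    unfolding weyl js pc using \<kappa> by simp
  finally show ?thesis .
qed

end

end

section \<open>Connected cumulants\<close>

lemma prod_list_nths:
  fixes f :: "'a \<Rightarrow> 'b::comm_monoid_mult"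
  shows "(\<Prod>x\<leftarrow>nths xs A. f x) = (\<Prod>j | j < length xs \<and> j \<in> A. f (xs ! j))"
proof (induction xs rule: rev_induct)
  case (snoc x xs)
  have c: "(\<Prod>j | j < length xs \<and> j \<in> A. f ((xs @ [x]) ! j)) = (\<Prod>j | j < length xs \<and> j \<in> A. f (xs ! j))"
    by (rule prod.cong) (auto simp: nth_append)
  show ?case
  proof (cases "length xs \<in> A")
    case True
    have "{j. j < length (xs @ [x]) \<and> j \<in> A} = insert (length xs) {j. j < length xs \<and> j \<in> A}"
      using True by (auto simp: less_Suc_eq)
    then have "(\<Prod>j | j < length (xs @ [x]) \<and> j \<in> A. f ((xs @ [x]) ! j)) = f x * (\<Prod>j | j < length xs \<and> j \<in> A. f (xs ! j))"
      by (simp add: c)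
    then show ?thesis using True snoc by (simp add: nths_append mult.commute)
  next
    case False
    then have "{j. j < length (xs @ [x]) \<and> j \<in> A} = {j. j < length xs \<and> j \<in> A}"
      by (auto simp: less_Suc_eq)
    then show ?thesis using False snoc c by (simp add: nths_append)
  qed
qed simp

lemma set_cumulant_cong:
  assumes "\<And>A. A \<subseteq> S \<Longrightarrow> M A = M' A" shows "set_cumulant M S = set_cumulant M' S"
  unfolding set_cumulant_def
proof (rule sum.cong[OF refl])
  fix P assume "P \<in> {P. partition_on S P}"
  then have "A \<subseteq> S" if "A \<in> P" for A using that by (auto simp: partition_on_def)
  then have "(\<Prod>A\<in>P. M A) = (\<Prod>A\<in>P. M' A)" by (intro prod.cong refl assms)
  then show "(- 1) ^ (card P - 1) * fact (card P - 1) * (\<Prod>A\<in>P. M A) = (- 1) ^ (card P - 1) * fact (card P - 1) * (\<Prod>A\<in>P. M' A)"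
    by simp
qed

lemma full_cycles_eq_set_cycles: "full_cycles l = set_cycles {..<l}"
  by (simp add: full_cycles_def set_cycles_def)

section \<open>Cycles on one and on two points\<close>

lemma set_cycles_nonempty: "cycle_of_list [0..<l] \<in> set_cycles {..<l}"
  unfolding set_cycles_def by (rule imageI) (simp add: atLeast0LessThan)

lemma set_cycles_one: "set_cycles {..<1::nat} = {id}"
proof -
  have "\<sigma> = id" if "\<sigma> \<in> set_cycles {..<1::nat}" for \<sigma>
  proof (rule ext)
    fix i
    have p: "\<sigma> permutes {..<1}" by (rule set_cycles_permutes[OF that])
    show "\<sigma> i = id i"
    proof (cases "i = 0")
      case True
      then show ?thesis using permutes_in_image[OF p, of 0] by simp
    next
      case False
      then show ?thesis using permutes_not_in[OF p, of i] by simp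
    qed
  qed
  note eq = this
  show ?thesis
  proof
    show "set_cycles {..<1::nat} \<subseteq> {id}"
    proof
      fix \<sigma> :: "nat \<Rightarrow> nat" assume "\<sigma> \<in> set_cycles {..<1}"
      then have "\<sigma> = id" by (rule eq)
      then show "\<sigma> \<in> {id}" by simp
    qed
    show "{id} \<subseteq> set_cycles {..<1::nat}"
      using set_cycles_nonempty[of 1] eq[OF set_cycles_nonempty[of 1]] by simp
  qed
qed

lemma set_cycles_two: obtains \<sigma> where "set_cycles {..<2::nat} = {\<sigma>}" "\<sigma> 0 = 1"
proof -
  define \<sigma>0 where "\<sigma>0 = cycle_of_list [0..<2]"
  have v: "\<sigma> 0 = 1 \<and> \<sigma> 1 = 0 \<and> (\<forall>i\<ge>2. \<sigma> i = i)" if "\<sigma> \<in> set_cycles {..<2::nat}" for \<sigma>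
  proof -
    have p: "\<sigma> permutes {..<2}" by (rule set_cycles_permutes[OF that])
    have "\<sigma> 0 < 2" "\<sigma> 1 < 2" using permutes_in_image[OF p, of 0] permutes_in_image[OF p, of 1] by simp_all
    moreover have "\<sigma> 0 \<noteq> 0" by (rule set_cycles_no_fixpoint[OF that]) simp_all
    moreover have "\<sigma> 1 \<noteq> 1" by (rule set_cycles_no_fixpoint[OF that]) simp_all
    ultimately have "\<sigma> 0 = 1" "\<sigma> 1 = 0" by linarith+
    moreover have "\<forall>i\<ge>2. \<sigma> i = i" using permutes_not_in[OF p] by simp
    ultimately show ?thesis by (intro conjI)
  qed
  have 0: "\<sigma>0 \<in> set_cycles {..<2}" unfolding \<sigma>0_def by (rule set_cycles_nonempty)
  have "\<sigma> = \<sigma>0" if "\<sigma> \<in> set_cycles {..<2::nat}" for \<sigma>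
  proof (rule ext)
    fix i :: nat
    have "i = 0 \<or> i = 1 \<or> 2 \<le> i" by linarith
    then show "\<sigma> i = \<sigma>0 i"
    proof (elim disjE)
      assume "2 \<le> i"
      then show ?thesis using v[OF that] v[OF 0] by simp
    qed (use v[OF that] v[OF 0] in simp_all)
  qed
  note eq = this
  have "set_cycles {..<2} = {\<sigma>0}"
  proof
    show "set_cycles {..<2} \<subseteq> {\<sigma>0}"
    proof
      fix \<sigma> :: "nat \<Rightarrow> nat" assume "\<sigma> \<in> set_cycles {..<2}"
      then have "\<sigma> = \<sigma>0" by (rule eq)
      then show "\<sigma> \<in> {\<sigma>0}" by simp
    qed
    show "{\<sigma>0} \<subseteq> set_cycles {..<2}" using 0 by simp
  qed
  then show thesis by (rule that) (use v[OF 0] in simp)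
qed

section \<open>Cycles as sequences of positions\<close>

lemma cycle_seq_nth: "k < l \<Longrightarrow> cycle_seq l \<sigma> ! k = (\<sigma> ^^ k) 0"
  by (simp add: cycle_seq_def)

lemma cycle_seq_bij:
  assumes "\<sigma> \<in> set_cycles {..<l}" "0 < l" shows "bij_betw (\<lambda>k. cycle_seq l \<sigma> ! k) {..<l} {..<l}"
proof -
  have "bij_betw (\<lambda>k. (\<sigma> ^^ k) 0) {..<l} {..<l}"
    using funpow_set_cycles_image(1)[OF assms(1), of 0] assms(2) by simp
  then show ?thesis by (subst bij_betw_cong[of _ _ "\<lambda>k. (\<sigma> ^^ k) 0"]) (simp_all add: cycle_seq_nth)
qed

lemma cycle_seq_next:
  assumes "\<sigma> \<in> set_cycles {..<l}" "k < l" shows "cycle_seq l \<sigma> ! (Suc k mod l) = \<sigma> (cycle_seq l \<sigma> ! k)"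
proof (cases "Suc k = l")
  case True
  have "(\<sigma> ^^ l) 0 = 0" using funpow_set_cycles_image(2)[OF assms(1), of 0] assms(2) by simp
  then show ?thesis using True assms(2) by (auto simp: cycle_seq_nth)
next
  case False
  then show ?thesis using assms(2) by (simp add: cycle_seq_nth)
qed

section \<open>Connected cumulants as cycle sums\<close>

context orthogonal_polys
begin

context
  fixes V :: "real \<Rightarrow> real" and n :: nat and zs :: "complex list"
  assumes w_eq: "w = (\<lambda>x. indicator I x * exp (V x))" and n: "1 \<le> n"
    and off: "set zs \<inter> complex_of_real ` I = {}" and dist: "distinct zs"
begin

abbreviation (input) "cyc_f \<equiv> (\<lambda>i j. cauchy_off ((!) zs) j i + cd_cauchy n (zs ! j) (zs ! i))"
abbreviation (input) "cyc_0 \<equiv> (\<lambda>i j. cauchy_off ((!) zs) j i)"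

lemma off_nth: "j < length zs \<Longrightarrow> zs ! j \<notin> complex_of_real ` I"
  using off nth_mem[of j zs] by blast

text \<open>The sublists in \<open>connected_cumulant\<close> are indexed by sets of positions, so
  it is a \<open>set_cumulant\<close>, and \<open>cumulant_eq\<close> identifies its set function
  with the resolvent moments.\<close>

lemma connected_cumulant_cycle_det:
  assumes "zs \<noteq> []"
  shows "connected_cumulant n I V zs = cycle_det cyc_f {..<length zs} - cycle_det cyc_0 {..<length zs}"
proof -
  have inj: "inj_on ((!) zs) {..<length zs}" using dist by (auto simp: inj_on_def nth_eq_iff_index_eq)
  have "connected_cumulant n I V zs = set_cumulant (\<lambda>A. cumulant n I V (nths zs A)) {..<length zs}"
    unfolding connected_cumulant_def set_cumulant_def ..
  also have "\<dots> = set_cumulant (resolvent_moment n ((!) zs)) {..<length zs}"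
  proof (rule set_cumulant_cong)
    fix A assume "A \<subseteq> {..<length zs}"
    then have A: "{j. j < length zs \<and> j \<in> A} = A" by auto
    have "z \<notin> complex_of_real ` I" if "z \<in> set (nths zs A)" for z
      using that off set_nths_subset[of zs A] by blast
    then show "cumulant n I V (nths zs A) = resolvent_moment n ((!) zs) A"
      unfolding resolvent_moment_def by (subst cumulant_eq[OF w_eq]) (simp_all add: prod_list_nths A)
  qed
  also have "\<dots> = cycle_det cyc_f {..<length zs} - cycle_det cyc_0 {..<length zs}"
    by (rule set_cumulant_resolvents[OF inj off_nth]) (use assms in simp_all)
  finally show ?thesis .
qed

text \<open>Along the cycle the row of each factor meets the column of the next one, which sits at
  the image under \<open>\<sigma>\<close>. The product over the steps is then reindexed by the
  positions visited.\<close>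

lemma trace_prod_Rmat:
  assumes \<sigma>: "\<sigma> \<in> set_cycles {..<length zs}" and l: "0 < length zs"
  shows "mat_trace (mat_prod_list 2 (map (\<lambda>k. Rmat n I V p h (zs ! (cycle_seq (length zs) \<sigma> ! k))) [0..<length zs])) =
    (\<Prod>j<length zs. rh_kernel n (zs ! (\<sigma> j)) (zs ! j))"
proof -
  let ?l = "length zs" and ?i = "\<lambda>k. cycle_seq (length zs) \<sigma> ! k"
  have bij: "bij_betw ?i {..<?l} {..<?l}" by (rule cycle_seq_bij[OF \<sigma> l])
  have m: "map (\<lambda>k. Rmat n I V p h (zs ! ?i k)) [0..<?l] = map (\<lambda>k. outer2 (rh_col n (zs ! ?i k)) (rh_row n (zs ! ?i k))) [0..<?l]"
  proof (rule map_cong[OF refl])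
    fix k assume "k \<in> set [0..<?l]"
    then have "?i k < ?l" using bij_betwE[OF bij] by simp
    then show "Rmat n I V p h (zs ! ?i k) = outer2 (rh_col n (zs ! ?i k)) (rh_row n (zs ! ?i k))"
      by (intro Rmat_eq[OF w_eq n] off_nth)
  qed
  have "mat_trace (mat_prod_list 2 (map (\<lambda>k. Rmat n I V p h (zs ! ?i k)) [0..<?l])) =
     (\<Prod>k<?l. dot2 (rh_row n (zs ! ?i k)) (rh_col n (zs ! ?i (Suc k mod ?l))))"
    unfolding m by (rule mat_trace_prod_outer2[OF l, where y="\<lambda>k. rh_col n (zs ! ?i k)" and r="\<lambda>k. rh_row n (zs ! ?i k)"])
  also have "\<dots> = (\<Prod>k<?l. rh_kernel n (zs ! \<sigma> (?i k)) (zs ! ?i k))"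
    by (rule prod.cong[OF refl]) (simp add: dot_rh[OF w_eq] cycle_seq_next[OF \<sigma>])
  also have "\<dots> = (\<Prod>j<?l. rh_kernel n (zs ! \<sigma> j) (zs ! j))"
    by (rule prod.reindex_bij_betw[OF bij, of "\<lambda>j. rh_kernel n (zs ! \<sigma> j) (zs ! j)"])
  finally show ?thesis .
qed

text \<open>The differences in the traversal of the cycle and those in the cycle expansion have
  opposite orientation, one sign for each step.\<close>

lemma cycle_denominator:
  assumes \<sigma>: "\<sigma> \<in> set_cycles {..<length zs}" and l: "0 < length zs"
  shows "(\<Prod>k<length zs. zs ! (cycle_seq (length zs) \<sigma> ! k) - zs ! (cycle_seq (length zs) \<sigma> ! (Suc k mod length zs))) =
    (-1) ^ length zs * (\<Prod>j<length zs. zs ! (\<sigma> j) - zs ! j)"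
proof -
  let ?l = "length zs" and ?i = "\<lambda>k. cycle_seq (length zs) \<sigma> ! k"
  have "(\<Prod>k<?l. zs ! ?i k - zs ! ?i (Suc k mod ?l)) = (\<Prod>k<?l. zs ! ?i k - zs ! \<sigma> (?i k))"
    by (rule prod.cong[OF refl]) (simp add: cycle_seq_next[OF \<sigma>])
  also have "\<dots> = (\<Prod>j<?l. zs ! j - zs ! \<sigma> j)"
    by (rule prod.reindex_bij_betw[OF cycle_seq_bij[OF \<sigma> l], of "\<lambda>j. zs ! j - zs ! \<sigma> j"])
  also have "\<dots> = (\<Prod>j<?l. - 1 * (zs ! \<sigma> j - zs ! j))" by simp
  also have "\<dots> = (-1) ^ ?l * (\<Prod>j<?l. zs ! \<sigma> j - zs ! j)" unfolding prod.distrib by simp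
  finally show ?thesis .
qed

context
  assumes l2: "2 \<le> length zs"
begin

lemma nth_cycle_neq:
  assumes "\<sigma> \<in> set_cycles {..<length zs}" "j < length zs"
  shows "\<sigma> j \<noteq> j" "\<sigma> j < length zs" "zs ! \<sigma> j \<noteq> zs ! j"
proof -
  show 1: "\<sigma> j \<noteq> j" by (rule set_cycles_no_fixpoint[OF assms(1)]) (use assms(2) l2 in simp_all)
  show 2: "\<sigma> j < length zs" using permutes_in_image[OF set_cycles_permutes[OF assms(1)], of j] assms(2) by simp
  show "zs ! \<sigma> j \<noteq> zs ! j" using nth_eq_iff_index_eq[OF dist 2 assms(2)] 1 by simp
qed

text \<open>The sign of the cycle and the reversal of all differences combine to the overall minus
  sign of the formula.\<close>

lemma sign_cycle: "(-1) ^ (length zs - 1) * (x / q) = - (x / ((-1) ^ length zs * q))" for x q :: complex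
proof -
  obtain m where "length zs = Suc m" using l2 by (cases "length zs") auto
  then show ?thesis by (cases "even m") simp_all
qed

lemma cycle_det_cyc_f:
  "cycle_det cyc_f {..<length zs} = - (\<Sum>\<sigma>\<in>full_cycles (length zs). let i = cycle_seq (length zs) \<sigma> in
     mat_trace (mat_prod_list 2 (map (\<lambda>k. Rmat n I V p h (zs ! (i ! k))) [0..<length zs])) /
     (\<Prod>k<length zs. zs ! (i ! k) - zs ! (i ! (Suc k mod length zs))))"
  unfolding cycle_det_def full_cycles_eq_set_cycles sum_distrib_left sum_negf[symmetric] card_lessThan Let_def
proof (rule sum.cong[OF refl])
  fix \<sigma> assume \<sigma>: "\<sigma> \<in> set_cycles {..<length zs}"
  have l: "0 < length zs" using l2 by linarith
  have f: "cauchy_off ((!) zs) (\<sigma> j) j + cd_cauchy n (zs ! \<sigma> j) (zs ! j) = rh_kernel n (zs ! \<sigma> j) (zs ! j) / (zs ! \<sigma> j - zs ! j)"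
    if "j < length zs" for j
    using nth_cycle_neq[OF \<sigma> that]
    by (simp add: cauchy_off_def rh_kernel_eq[OF n off_nth[OF that]] add_divide_distrib)
  have "(\<Prod>j<length zs. cauchy_off ((!) zs) (\<sigma> j) j + cd_cauchy n (zs ! \<sigma> j) (zs ! j)) =
     (\<Prod>j<length zs. rh_kernel n (zs ! \<sigma> j) (zs ! j)) / (\<Prod>j<length zs. zs ! \<sigma> j - zs ! j)"
    unfolding prod_dividef[symmetric] by (rule prod.cong[OF refl]) (simp add: f)
  then show "(- 1) ^ (length zs - 1) * (\<Prod>j<length zs. cauchy_off ((!) zs) (\<sigma> j) j + cd_cauchy n (zs ! \<sigma> j) (zs ! j)) =
     - (mat_trace (mat_prod_list 2 (map (\<lambda>k. Rmat n I V p h (zs ! (cycle_seq (length zs) \<sigma> ! k))) [0..<length zs])) /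
     (\<Prod>k<length zs. zs ! (cycle_seq (length zs) \<sigma> ! k) - zs ! (cycle_seq (length zs) \<sigma> ! (Suc k mod length zs))))"
    unfolding trace_prod_Rmat[OF \<sigma> l] cycle_denominator[OF \<sigma> l] by (simp only: sign_cycle)
qed

lemma prod_cyc_0:
  assumes "\<sigma> \<in> set_cycles {..<length zs}"
  shows "(\<Prod>j<length zs. cauchy_off ((!) zs) (\<sigma> j) j) = (\<Prod>j<length zs. 1 / (zs ! \<sigma> j - zs ! j))"
  by (rule prod.cong[OF refl]) (use nth_cycle_neq[OF assms] in \<open>simp add: cauchy_off_def\<close>)

end

end

end

theorem theorem1p5:
  fixes N :: nat and I :: "real set" and V :: "real \<Rightarrow> real"
    and P :: "nat \<Rightarrow> complex poly" and h :: "nat \<Rightarrow> complex"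
  assumes "N \<ge> 1"
    and "closed I" and "is_interval I" and "interior I \<noteq> {}"
    and "admissible_potential N I V"
    and "monic_orthogonal_polys I V P h"
  shows
    "(\<forall>z. z \<notin> complex_of_real ` I \<longrightarrow>
        connected_cumulant N I V [z] =
          (mat_inv (Ymat N I V P h z) * mat_deriv (Ymat N I V P h) z) $$ (0, 0)) \<and>
     (\<forall>z1 z2. z1 \<notin> complex_of_real ` I \<and> z2 \<notin> complex_of_real ` I \<and> z1 \<noteq> z2 \<longrightarrow>
        connected_cumulant N I V [z1, z2] =
          (mat_trace (Rmat N I V P h z1 * Rmat N I V P h z2) - 1) / (z1 - z2)\<^sup>2) \<and>
     (\<forall>l zs. l \<ge> 3 \<and> length zs = l \<and> distinct zs \<and> set zs \<inter> complex_of_real ` I = {} \<longrightarrow>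
        connected_cumulant N I V zs =
          - (\<Sum>\<sigma>\<in>full_cycles l. let i = cycle_seq l \<sigma> in
               mat_trace (mat_prod_list 2 (map (\<lambda>k. Rmat N I V P h (zs ! (i ! k))) [0..<l]))
               / (\<Prod>k<l. zs ! (i ! k) - zs ! (i ! (Suc k mod l)))))"
proof -
  \<comment> \<open>The indicator moves the restriction to \<open>I\<close> into the weight, as the
    locale expects it.\<close>
  define w where "w = (\<lambda>x. indicator I x * exp (V x) :: real)"
  have e: "indicator I x *\<^sub>R (poly (P l) (of_real x) * poly (P m) (of_real x) * of_real (exp (V x))) =
      poly (P l) (of_real x) * poly (P m) (of_real x) * complex_of_real (w x)" for l m x
    by (cases "x \<in> I") (simp_all add: w_def)
  have mon: "degree (P l) = l" "lead_coeff (P l) = 1" "h l \<noteq> 0" for l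
    using assms(6) unfolding monic_orthogonal_polys_def by blast+
  have orth: "integrable lborel (\<lambda>x. poly (P l) (of_real x) * poly (P m) (of_real x) * of_real (w x))"
    "(LINT x|lborel. poly (P l) (of_real x) * poly (P m) (of_real x) * of_real (w x)) = (if l = m then h l else 0)" for l m
    using assms(6) unfolding monic_orthogonal_polys_def Let_def set_integrable_def set_lebesgue_integral_def e by blast+
  interpret orthogonal_polys w I P h
  proof (rule orthogonal_polys.intro)
    show "w x = 0" if "x \<notin> I" for x using that by (simp add: w_def)
  qed (rule mon orth assms(2))+
  show ?thesis
  proof (intro conjI allI impI)
    fix z assume z: "z \<notin> complex_of_real ` I"
    \<comment> \<open>The only cycle on one point is the identity, and the Cauchy matrix has a zero
      diagonal, so just the kernel at \<open>z\<close> remains.\<close>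
    have "connected_cumulant N I V [z] = cd_cauchy N z z"
      using connected_cumulant_cycle_det[OF w_def assms(1), of "[z]"] z
      by (simp add: cycle_det_def set_cycles_one[simplified] cauchy_off_def)
    then show "connected_cumulant N I V [z] = (mat_inv (Ymat N I V P h z) * mat_deriv (Ymat N I V P h) z) $$ (0, 0)"
      using log_deriv_Ymat[OF w_def assms(1) z] by simp
  next
    fix z1 z2 assume z: "z1 \<notin> complex_of_real ` I \<and> z2 \<notin> complex_of_real ` I \<and> z1 \<noteq> z2"
    then have o: "set [z1, z2] \<inter> complex_of_real ` I = {}" "distinct [z1, z2]" "2 \<le> length [z1, z2]" "[z1, z2] \<noteq> []" by auto
    obtain \<sigma> where \<sigma>: "set_cycles {..<2::nat} = {\<sigma>}" "\<sigma> 0 = 1" by (rule set_cycles_two)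
    have \<sigma>1: "\<sigma> \<in> set_cycles {..<length [z1, z2]}" using \<sigma>(1) by (simp add: numeral_2_eq_2)
    have s: "cycle_seq 2 \<sigma> = [0, 1]" using \<sigma>(2) by (simp add: cycle_seq_def upt_rec)
    have "\<sigma> 1 = 0" using cycle_seq_next[of \<sigma> 2 1] \<sigma>(1) s by simp
    let ?T = "mat_trace (Rmat N I V P h z1 * Rmat N I V P h z2)"
    have R: "Rmat N I V P h z2 \<in> carrier_mat 2 2"
      using Rmat_eq[OF w_def assms(1), of z2] z outer2_carrier by simp
    have "cycle_det (\<lambda>i j. cauchy_off ((!) [z1, z2]) j i + cd_cauchy N ([z1, z2] ! j) ([z1, z2] ! i)) {..<length [z1, z2]} = - (?T / ((z1 - z2) * (z2 - z1)))"
      unfolding cycle_det_cyc_f[OF w_def assms(1) o(1-3)] full_cycles_eq_set_cycles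
      using \<sigma>(1) s right_mult_one_mat[OF R]
      by (simp add: numeral_2_eq_2 mat_prod_list_def)
    \<comment> \<open>On two points the cycle of the Cauchy matrix does not vanish; subtracting it
      produces the \<open>- 1\<close>.\<close>
    moreover have "cycle_det (\<lambda>i j. cauchy_off ((!) [z1, z2]) j i) {..<length [z1, z2]} = - (1 / ((z1 - z2) * (z2 - z1)))"
      unfolding cycle_det_def using \<sigma> \<open>\<sigma> 1 = 0\<close> z by (simp add: numeral_2_eq_2 cauchy_off_def)
    ultimately have "connected_cumulant N I V [z1, z2] = - (?T / ((z1 - z2) * (z2 - z1))) - - (1 / ((z1 - z2) * (z2 - z1)))"
      using connected_cumulant_cycle_det[OF w_def assms(1) o(1,2,4)] by simp
    also have "\<dots> = (?T - 1) / - ((z1 - z2) * (z2 - z1))"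
      by (simp add: diff_divide_distrib)
    also have "- ((z1 - z2) * (z2 - z1)) = (z1 - z2)\<^sup>2" by (simp add: power2_eq_square algebra_simps)
    finally show "connected_cumulant N I V [z1, z2] = (?T - 1) / (z1 - z2)\<^sup>2" .
  next
    fix l and zs :: "complex list"
    assume "l \<ge> 3 \<and> length zs = l \<and> distinct zs \<and> set zs \<inter> complex_of_real ` I = {}"
    then have l: "3 \<le> length zs" "2 \<le> length zs" "zs \<noteq> []" "l = length zs" and d: "distinct zs" and o: "set zs \<inter> complex_of_real ` I = {}" by auto
    have inj: "inj_on ((!) zs) {..<length zs}" using d by (auto simp: inj_on_def nth_eq_iff_index_eq)
    have "(\<Sum>\<sigma>\<in>set_cycles {..<length zs}. \<Prod>j<length zs. cauchy_off ((!) zs) (\<sigma> j) j) =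
        (\<Sum>\<sigma>\<in>set_cycles {..<length zs}. \<Prod>j<length zs. 1 / (zs ! \<sigma> j - zs ! j))"
      by (rule sum.cong[OF refl]) (rule prod_cyc_0[OF w_def assms(1) o d l(2)])
    also have "\<dots> = 0" by (rule sum_set_cycles_cauchy_eq_0[OF finite_lessThan _ inj]) (use l in simp)
    finally have "cycle_det (\<lambda>i j. cauchy_off ((!) zs) j i) {..<length zs} = 0" by (simp add: cycle_det_def)
    then show "connected_cumulant N I V zs = - (\<Sum>\<sigma>\<in>full_cycles l. let i = cycle_seq l \<sigma> in
               mat_trace (mat_prod_list 2 (map (\<lambda>k. Rmat N I V P h (zs ! (i ! k))) [0..<l]))
               / (\<Prod>k<l. zs ! (i ! k) - zs ! (i ! (Suc k mod l))))"
      unfolding l(4) connected_cumulant_cycle_det[OF w_def assms(1) o d l(3)] cycle_det_cyc_f[OF w_def assms(1) o d l(2)] by simp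
  qed
qed

end
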